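(* Let $d \geq 2$ be an integer and let $s \in (0, \frac{d}{2})$ be real. Let $$c_{BE}(s) := \inf_{f \in \dot{H}^s(\mathbb{R}^d) \setminus (\mathcal{M} \cup \{0\})} \frac{\|(-\Delta)^{s/2} f\|_{L^2(\mathbb{R}^d)}^2 - S_{d,s} \|f\|_{L^{2^*}(\mathbb{R}^d)}^2}{\operatorname{dist}(f, \mathcal{M})^2}$$ be the optimal (i.e. largest possible) constant in the Bianchi--Egnell stability inequality for the fractional Sobolev inequality, where $2^*$, $S_{d,s}$, $\mathcal{M}$ and $\operatorname{dist}$ are as defined in the context. Then $$c_{BE}(s) < \frac{4s}{d+2s+2}.$$
   Context: Let $d$ be a positive integer and $0 < s < \frac{d}{2}$. All functions are real-valued. The critical Sobolev exponent is $2^* = \frac{2d}{d-2s}$. $\dot{H}^s(\mathbb{R}^d)$ is the homogeneous Sobolev space, i.e. the completion of $C_c^\infty(\mathbb{R}^d)$ with respect to the norm $\|(-\Delta)^{s/2} f\|_{L^2(\mathbb{R}^d)}$, realized as a space of functions in $L^{2^*}(\mathbb{R}^d)$ via the Sobolev embedding. Here $(-\Delta)^{s/2}$ is the Fourier multiplier operator with symbol $|\xi|^s$, where the Fourier transform is normalized so that $-\Delta$ has symbol $|\xi|^2$. The constant $S_{d,s}$ is $$S_{d,s} = 2^{2s} \pi^s \frac{\Gamma(\frac{d+2s}{2})}{\Gamma(\frac{d-2s}{2})} \left( \frac{\Gamma(\frac{d}{2})}{\Gamma(d)} \right)^{\frac{2s}{d}},$$ which is the best constant in the (fractional) Sobolev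 inequality $\|(-\Delta)^{s/2} f\|_{L^2(\mathbb{R}^d)}^2 \geq S_{d,s} \|f\|_{L^{2^*}(\mathbb{R}^d)}^2$ for all $f \in \dot{H}^s(\mathbb{R}^d)$. The $(d+2)$-dimensional manifold $\mathcal{M} \subset \dot{H}^s(\mathbb{R}^d)$ of Talenti bubbles (the nonzero functions achieving equality in the Sobolev inequality) is $$\mathcal{M} := \left\{ x \mapsto c\,(a + |x-b|^2)^{-\frac{d-2s}{2}} \, : \, a > 0, \ b \in \mathbb{R}^d, \ c \in \mathbb{R} \setminus \{0\} \right\}.$$ The distance to $\mathcal{M}$ is taken in $\dot{H}^s(\mathbb{R}^d)$: $$\operatorname{dist}(f, \mathcal{M}) := \inf_{g \in \mathcal{M}} \|(-\Delta)^{s/2}(f-g)\|_{L^2(\mathbb{R}^d)}.$$ *)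

theory Defs
  imports "HOL-Analysis.Analysis"
begin

text \<open>
  Elements of Lebesgue and Sobolev spaces are represented by actual (Borel measurable) functions
  on \<open>real ^ 'n\<close>; equality of elements of these spaces is equality almost everywhere.
\<close>

definition Lp_norm :: "real \<Rightarrow> (real ^ 'n \<Rightarrow> 'b::real_normed_vector) \<Rightarrow> real" where
  "Lp_norm p f = (LINT x|lborel. norm (f x) powr p) powr (1 / p)"

definition Lp_space :: "real \<Rightarrow> (real ^ 'n \<Rightarrow> real) set" where
  "Lp_space p = {f \<in> borel_measurable lborel. integrable lborel (\<lambda>x. norm (f x) powr p)}"

fun C_k :: "nat \<Rightarrow> (real ^ 'n \<Rightarrow> real) \<Rightarrow> bool" where
  "C_k 0 f \<longleftrightarrow> continuous_on UNIV f"
| "C_k (Suc k) f \<longleftrightarrow>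
     f differentiable_on UNIV \<and> (\<forall>v. C_k k (\<lambda>x. frechet_derivative f (at x) v))"

definition test_functions :: "(real ^ 'n \<Rightarrow> real) set" where
  "test_functions = {f. (\<forall>k. C_k k f) \<and> compact (closure (support_on UNIV f))}"

text \<open>
  The unitary normalisation of the Fourier transform with phase \<open>x \<bullet> \<xi>\<close>,
  so that \<open>- \<Delta>\<close> has symbol \<open>norm \<xi> ^ 2\<close>.
\<close>

definition fourier :: "(real ^ 'n \<Rightarrow> complex) \<Rightarrow> real ^ 'n \<Rightarrow> complex" where
  "fourier f \<xi> = of_real ((2 * pi) powr (- real CARD('n) / 2)) *
     (LINT x|lborel. cis (- (x \<bullet> \<xi>)) * f x)"

definition inverse_fourier :: "(real ^ 'n \<Rightarrow> complex) \<Rightarrow> real ^ 'n \<Rightarrow> complex" where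
  "inverse_fourier g x = of_real ((2 * pi) powr (- real CARD('n) / 2)) *
     (LINT \<xi>|lborel. cis (x \<bullet> \<xi>) * g \<xi>)"

text \<open>
  The operator \<open>(- \<Delta>)\<close> to the power \<open>s / 2\<close>. It is only applied to test functions, for which
  both integrals converge absolutely when \<open>s > 0\<close>.
\<close>

definition frac_laplacian_half :: "real \<Rightarrow> (real ^ 'n \<Rightarrow> real) \<Rightarrow> real ^ 'n \<Rightarrow> complex" where
  "frac_laplacian_half s \<phi> =
     inverse_fourier (\<lambda>\<xi>. of_real (norm \<xi> powr s) * fourier (\<lambda>x. of_real (\<phi> x)) \<xi>)"

definition test_norm :: "real \<Rightarrow> (real ^ 'n \<Rightarrow> real) \<Rightarrow> real" where
  "test_norm s \<phi> = Lp_norm 2 (frac_laplacian_half s \<phi>)"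

definition crit_exp :: "real \<Rightarrow> real \<Rightarrow> real" where
  "crit_exp d s = 2 * d / (d - 2 * s)"

text \<open>
  A function belongs to the homogeneous Sobolev space iff it is the limit in the critical
  Lebesgue space of a sequence of test functions that is Cauchy for \<open>test_norm s\<close>: this is the
  completion of the test functions, embedded by the Sobolev inequality. As in any completion,
  the norm is the limit of the norms along such a sequence; by the Sobolev inequality
  it does not depend on the sequence.
\<close>

definition Hs_approx :: "real \<Rightarrow> (nat \<Rightarrow> real ^ 'n \<Rightarrow> real) \<Rightarrow> (real ^ 'n \<Rightarrow> real) \<Rightarrow> bool" where
  "Hs_approx s \<phi> f \<longleftrightarrow>
     (\<forall>n. \<phi> n \<in> test_functions) \<and>
     (\<forall>e>0. \<exists>N. \<forall>m\<ge>N. \<forall>n\<ge>N. test_norm s (\<lambda>x. \<phi> m x - \<phi> n x) < e) \<and>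
     f \<in> Lp_space (crit_exp (real CARD('n)) s) \<and>
     (\<lambda>n. Lp_norm (crit_exp (real CARD('n)) s) (\<lambda>x. \<phi> n x - f x)) \<longlonglongrightarrow> 0"

definition Hs :: "real \<Rightarrow> (real ^ 'n \<Rightarrow> real) set" where
  "Hs s = {f. \<exists>\<phi>. Hs_approx s \<phi> f}"

definition Hs_norm :: "real \<Rightarrow> (real ^ 'n \<Rightarrow> real) \<Rightarrow> real" where
  "Hs_norm s f = (THE L. \<exists>\<phi>. Hs_approx s \<phi> f \<and> (\<lambda>n. test_norm s (\<phi> n)) \<longlonglongrightarrow> L)"

definition Sobolev_const :: "real \<Rightarrow> real \<Rightarrow> real" where
  "Sobolev_const d s =
     2 powr (2 * s) * pi powr s * (Gamma ((d + 2 * s) / 2) / Gamma ((d - 2 * s) / 2)) *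
     (Gamma (d / 2) / Gamma d) powr (2 * s / d)"

definition bubbles :: "real \<Rightarrow> (real ^ 'n \<Rightarrow> real) set" where
  "bubbles s = {\<lambda>x. c * (a + (norm (x - b))\<^sup>2) powr (- (real CARD('n) - 2 * s) / 2) | a b c.
     a > 0 \<and> c \<noteq> 0}"

definition dist_bubbles :: "real \<Rightarrow> (real ^ 'n \<Rightarrow> real) \<Rightarrow> real" where
  "dist_bubbles s f = (INF g\<in>bubbles s. Hs_norm s (\<lambda>x. f x - g x))"

text \<open>
  The elements of the Sobolev space that are neither bubbles nor zero; since these elements are
  classes of functions, being a bubble or zero has to be read almost everywhere.
\<close>

definition BE_admissible :: "real \<Rightarrow> (real ^ 'n \<Rightarrow> real) set" where
  "BE_admissible s = {f \<in> Hs s. \<not> (\<exists>g \<in> bubbles s \<union> {\<lambda>x. 0}. AE x in lborel. f x = g x)}"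

definition BE_quotient :: "real \<Rightarrow> (real ^ 'n \<Rightarrow> real) \<Rightarrow> real" where
  "BE_quotient s f =
     ((Hs_norm s f)\<^sup>2 -
       Sobolev_const (real CARD('n)) s * (Lp_norm (crit_exp (real CARD('n)) s) f)\<^sup>2)
     / (dist_bubbles s f)\<^sup>2"

text \<open>
  The infimum is taken in the extended reals: on \<open>real\<close>, \<open>Inf\<close> is unspecified for sets that are
  not known to be bounded below. The type argument carries the dimension \<open>CARD('n)\<close>.
\<close>

definition c_BE :: "'n::finite itself \<Rightarrow> real \<Rightarrow> ereal" where
  "c_BE _ s = (INF f \<in> (BE_admissible s :: (real ^ 'n \<Rightarrow> real) set). ereal (BE_quotient s f))"

end

theory Submission
  imports Defs "HOL-Probability.Probability" "HOL-Real_Asymp.Real_Asymp"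
begin

text \<open>
  Perturb the standard bubble \<open>U = (1 + |x|\<^sup>2) powr - (d - 2 * s) / 2\<close> to \<open>f = U * (1 + \<epsilon> * Y)\<close>, where \<open>Y\<close> is
  the pullback of a zonal spherical harmonic of degree 2 under stereographic projection. To second
  order in \<open>\<epsilon>\<close> the quotient is \<open>4 * s / (d + 2 * s + 2)\<close>, the value given by the spectral gap of the
  linearized problem, and the third-order term is a negative multiple of the integral of \<open>Y ^ 3\<close>
  over the sphere, which is positive for \<open>d \<ge> 2\<close>; hence the inequality is strict for small \<open>\<epsilon>\<close>.
  The distance to the bubbles is bounded below by projecting: the squared distance of \<open>f\<close> to the
  multiples of a bubble \<open>h\<close> is the squared norm of \<open>f\<close> minus the squared inner product with the
  normalized \<open>h\<close>, and for small \<open>\<epsilon>\<close> this inner product is largest at \<open>h = U\<close>. All inner products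
  become integrals in physical space because the Fourier transforms of bubbles are Bessel-type
  integrals, whose recurrence and reflection formulas give the Euler-Lagrange equations.
\<close>

section \<open>Gaussian and Gamma integrals\<close>

text \<open>\<open>Hs_norm\<close> is a definite description over all approximating sequences of
  test functions, so its value has to be shown unique before any inner product can be computed.
  Uniqueness comes from closability: a sequence of test functions that is Cauchy for
  \<open>test_norm\<close> and null in the critical Lebesgue space is null for
  \<open>test_norm\<close>. Explicit functions enter the space through \<open>Hs_pair\<close>, a
  relation closed under limits, so bubbles are reached from test functions in two stages, each by
  dominated convergence: a cutoff is removed under a Gaussian, then the Gaussian itself. The
  projection bound must hold for all bubbles at once, with parameters in a noncompact set, and it is
  attained at \<open>U\<close>, where nothing may be lost. Moving a bubble away from
  \<open>U\<close> lowers its interaction with \<open>U\<close> in proportion to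
  \<open>cosh_dist a b - 1\<close>, up to a fixed fraction far away. The perturbation changes the
  interaction by at most a constant times \<epsilon> times the same quantity, because
  \<open>Y\<close> is orthogonal to the spherical harmonics of degree 0 and 1. Hence a small
  \<epsilon> works uniformly.\<close>

lemma has_bochner_integral_lborel_affine:
  fixes f :: "'a::euclidean_space \<Rightarrow> 'b::{banach, second_countable_topology}"
  assumes f: "has_bochner_integral lborel f I" and c: "c \<noteq> 0"
  shows "has_bochner_integral lborel (\<lambda>x. f (t + c *\<^sub>R x)) (I /\<^sub>R \<bar>c\<bar> ^ DIM('a))"
proof -
  have [measurable]: "f \<in> borel_measurable borel"
    using f by (auto simp: has_bochner_integral_iff dest: borel_measurable_integrable)
  have i: "integrable lborel f" and I: "integral\<^sup>L lborel f = I"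
    using f by (auto simp: has_bochner_integral_iff)
  have "integrable (density (distr lborel borel (\<lambda>x::'a. t + c *\<^sub>R x)) (\<lambda>_. ennreal (\<bar>c\<bar>^DIM('a)))) f"
    using i lborel_affine[OF c, of t] by simp
  then have "integrable lborel (\<lambda>x. \<bar>c\<bar> ^ DIM('a) *\<^sub>R f (t + c *\<^sub>R x))"
    using c by (subst (asm) integrable_density) (auto simp: integrable_distr_eq)
  from integrable_scaleR_right[OF this, of "1 / \<bar>c\<bar> ^ DIM('a)"]
  have 1: "integrable lborel (\<lambda>x. f (t + c *\<^sub>R x))" using c by simp
  have "I = integral\<^sup>L (density (distr lborel borel (\<lambda>x::'a. t + c *\<^sub>R x)) (\<lambda>_. ennreal (\<bar>c\<bar>^DIM('a)))) f"
    using I lborel_affine[OF c, of t] by simp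
  also have "\<dots> = \<bar>c\<bar>^DIM('a) *\<^sub>R (\<integral>x. f (t + c *\<^sub>R x) \<partial>lborel)"
    using c by (subst integral_density) (auto simp: integral_distr)
  finally show ?thesis using 1 c by (simp add: has_bochner_integral_iff)
qed

lemma integrable_lborel_affine_iff:
  fixes f :: "'a::euclidean_space \<Rightarrow> 'b::{banach, second_countable_topology}"
  assumes c: "c \<noteq> 0"
  shows "integrable lborel (\<lambda>x. f (t + c *\<^sub>R x)) \<longleftrightarrow> integrable lborel f"
proof
  assume "integrable lborel f"
  then show "integrable lborel (\<lambda>x. f (t + c *\<^sub>R x))"
    using has_bochner_integral_lborel_affine[OF has_bochner_integral_integrable c]
    by (auto simp: has_bochner_integral_iff)
next
  assume "integrable lborel (\<lambda>x. f (t + c *\<^sub>R x))"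
  then have "integrable lborel (\<lambda>x. f (t + c *\<^sub>R (- (1/c) *\<^sub>R t + (1/c) *\<^sub>R x)))"
    using has_bochner_integral_lborel_affine[OF has_bochner_integral_integrable, of "\<lambda>x. f (t + c *\<^sub>R x)" "1/c" "- (1/c) *\<^sub>R t"] c
    by (auto simp: has_bochner_integral_iff)
  moreover have "t + c *\<^sub>R (- (1/c) *\<^sub>R t + (1/c) *\<^sub>R x) = x" for x
    using c by (simp add: scaleR_add_right scaleR_diff_right)
  ultimately show "integrable lborel f" by simp
qed

lemma integral_lborel_affine:
  fixes f :: "'a::euclidean_space \<Rightarrow> 'b::{banach, second_countable_topology}"
  assumes c: "c \<noteq> 0"
  shows "(\<integral>x. f (t + c *\<^sub>R x) \<partial>lborel) = (\<integral>x. f x \<partial>lborel) /\<^sub>R \<bar>c\<bar> ^ DIM('a)"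
proof (cases "integrable lborel f")
  case True
  then show ?thesis
    using has_bochner_integral_lborel_affine[OF has_bochner_integral_integrable c]
    by (auto simp: has_bochner_integral_iff)
next
  case False
  then show ?thesis using integrable_lborel_affine_iff[OF c, of f t]
    by (simp add: not_integrable_integral_eq)
qed

lemma integral_lborel_translation:
  fixes f :: "'a::euclidean_space \<Rightarrow> 'b::{banach, second_countable_topology}"
  shows "(\<integral>x. f (x + t) \<partial>lborel) = (\<integral>x. f x \<partial>lborel)"
    "(\<integral>x. f (x - t) \<partial>lborel) = (\<integral>x. f x \<partial>lborel)"
  using integral_lborel_affine[of 1 f t] integral_lborel_affine[of 1 f "-t"]
  by (simp_all add: add.commute)

lemma integrable_lborel_translation:
  fixes f :: "'a::euclidean_space \<Rightarrow> 'b::{banach, second_countable_topology}"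
  shows "integrable lborel (\<lambda>x. f (x + t)) \<longleftrightarrow> integrable lborel f"
    "integrable lborel (\<lambda>x. f (x - t)) \<longleftrightarrow> integrable lborel f"
  using integrable_lborel_affine_iff[of 1 f t] integrable_lborel_affine_iff[of 1 f "-t"]
  by (simp_all add: add.commute)

lemma borel_measurable_cis [measurable]: "cis \<in> borel_measurable borel"
  by (intro borel_measurable_continuous_onI continuous_on_cis continuous_on_id)

text \<open>Rescaling by \<open>sqrt (2 * \<tau>)\<close> turns the Gaussian into the standard
  normal density, so the formula is the characteristic function of the normal distribution.\<close>

lemma gaussian_fourier_real:
  fixes y :: real
  assumes "\<tau> > 0"
  shows "has_bochner_integral lborel (\<lambda>x. cis (x * y) * of_real (exp (- \<tau> * x\<^sup>2)))
     (of_real (sqrt (pi / \<tau>) * exp (- y\<^sup>2 / (4 * \<tau>))))"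
proof -
  define r where "r = sqrt (2 * \<tau>)"
  have r: "r > 0" "r\<^sup>2 = 2 * \<tau>" using assms by (auto simp: r_def)
  let ?f = "\<lambda>x. cis (x * (y / r)) * of_real (std_normal_density x)"
  have i: "integrable lborel ?f"
    by (rule Bochner_Integration.integrable_bound[OF integrable_normal_moment[of 1 0 0]])
       (auto simp: norm_mult)
  have "char std_normal_distribution (y / r) = integral\<^sup>L lborel ?f"
    unfolding char_def
    by (subst integral_density) (auto simp: cis_conv_exp mult_ac scaleR_conv_of_real)
  then have "has_bochner_integral lborel ?f (of_real (exp (- (y/r)\<^sup>2 / 2)))"
    using i by (simp add: has_bochner_integral_iff char_std_normal_distribution)
  from has_bochner_integral_lborel_affine[OF this less_imp_neq[OF r(1), symmetric], of 0]
  have "has_bochner_integral lborel (\<lambda>x. ?f (r * x)) (of_real (exp (- (y/r)\<^sup>2 / 2) / r))"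
    using r(1) by (simp only: add_0_left real_scaleR_def DIM_real power_one_right abs_of_pos
      scaleR_conv_of_real of_real_mult[symmetric] divide_inverse mult.commute)
  from has_bochner_integral_mult_right[OF this, of "of_real (sqrt (2 * pi))"]
  have *: "has_bochner_integral lborel (\<lambda>x. of_real (sqrt (2 * pi)) * ?f (r * x))
     (of_real (sqrt (2*pi)) * of_real (exp (- (y/r)\<^sup>2 / 2) / r))" by auto
  have "sqrt (2 * pi) / r = sqrt (pi / \<tau>)"
    using r by (simp add: r_def real_sqrt_mult real_sqrt_divide)
  then have "sqrt (2*pi) * (exp (- (y/r)\<^sup>2 / 2) / r) = sqrt (pi / \<tau>) * exp (- y\<^sup>2 / (4 * \<tau>))"
    using r by (simp add: power_divide times_divide_eq_right[symmetric] times_divide_eq_left[symmetric] del: times_divide_eq_right times_divide_eq_left) (simp add: field_simps)?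
  moreover have "of_real (sqrt (2 * pi)) * ?f (r * x) = cis (x * y) * of_real (exp (- \<tau> * x\<^sup>2))" for x
  proof -
    have "sqrt (2 * pi) * std_normal_density (r * x) = exp (- \<tau> * x\<^sup>2)"
      using r by (simp add: std_normal_density_def power_mult_distrib)
    then show ?thesis using r by (simp flip: of_real_mult add: mult.left_commute)
  qed
  ultimately show ?thesis using * unfolding of_real_mult[symmetric] by (simp only:)
qed

text \<open>Phase and Gaussian both factor over the coordinates, so the integral is a product over
  \<open>Basis\<close> of one-dimensional ones.\<close>

lemma gaussian_fourier:
  fixes y :: "'a::euclidean_space"
  assumes t: "\<tau> > 0"
  shows "has_bochner_integral lborel (\<lambda>x::'a. cis (x \<bullet> y) * of_real (exp (- \<tau> * (norm x)\<^sup>2)))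
     (of_real ((pi / \<tau>) powr (DIM('a) / 2) * exp (- (norm y)\<^sup>2 / (4 * \<tau>))))"
proof -
  let ?f = "\<lambda>b x. cis (x * (y \<bullet> b)) * complex_of_real (exp (- \<tau> * x\<^sup>2))"
  let ?g = "\<lambda>x::'a. cis (x \<bullet> y) * complex_of_real (exp (- \<tau> * (norm x)\<^sup>2))"
  interpret product_sigma_finite "\<lambda>b::'a. lborel :: real measure"
    by standard
  have 1: "integrable lborel (?f b)" and 2: "integral\<^sup>L lborel (?f b) = of_real (sqrt (pi / \<tau>) * exp (- (y \<bullet> b)\<^sup>2 / (4 * \<tau>)))" for b
    using gaussian_fourier_real[OF t, of "y \<bullet> b"] by (simp_all add: has_bochner_integral_iff)
  have cis_sum: "cis (sum h A) = (\<Prod>b\<in>A. cis (h b))" for h :: "'a \<Rightarrow> real" and A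
    by (induction A rule: infinite_finite_induct) (simp_all flip: cis_mult)
  have n2: "(norm x)\<^sup>2 = (\<Sum>b\<in>Basis. (x \<bullet> b)\<^sup>2)" for x :: 'a
    unfolding power2_norm_eq_inner by (subst euclidean_inner) (simp add: power2_eq_square)
  have g: "?g x = (\<Prod>b\<in>Basis. ?f b (x \<bullet> b))" for x
  proof -
    have "exp (- \<tau> * (norm x)\<^sup>2) = (\<Prod>b\<in>Basis. exp (- \<tau> * (x \<bullet> b)\<^sup>2))"
      unfolding n2 sum_distrib_left by (simp add: exp_sum)
    moreover have "cis (x \<bullet> y) = (\<Prod>b\<in>Basis. cis ((x \<bullet> b) * (y \<bullet> b)))"
      unfolding cis_sum[symmetric] by (subst euclidean_inner) simp
    ultimately show ?thesis by (simp add: prod.distrib)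
  qed
  have eq: "?g (\<Sum>b\<in>Basis. h b *\<^sub>R b) = (\<Prod>b\<in>Basis. ?f b (h b))" for h
    unfolding g by (intro prod.cong) auto
  have [measurable]: "?g \<in> borel_measurable borel" by measurable
  have "integrable lborel ?g"
    by (subst lborel_eq, subst integrable_distr_eq)
       (simp_all only: eq, simp_all add: product_integrable_prod[OF finite_Basis 1, simplified])
  moreover have "integral\<^sup>L lborel ?g = (\<Prod>b\<in>Basis. of_real (sqrt (pi / \<tau>) * exp (- (y \<bullet> b)\<^sup>2 / (4 * \<tau>))))"
    by (subst lborel_eq, subst integral_distr)
       (simp_all only: eq 2 product_integral_prod[OF finite_Basis 1], simp_all)
  moreover have "(\<Prod>b\<in>Basis. sqrt (pi / \<tau>) * exp (- (y \<bullet> b)\<^sup>2 / (4 * \<tau>)))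
     = (pi / \<tau>) powr (DIM('a) / 2) * exp (- (norm y)\<^sup>2 / (4 * \<tau>))"
    using t by (simp add: prod.distrib n2 sum_divide_distrib exp_sum powr_half_sqrt[symmetric] powr_power
        flip: sum_negf)
  ultimately show ?thesis unfolding has_bochner_integral_iff by (simp only: of_real_prod[symmetric] simp_thms)
qed

lemma gaussian_integral:
  assumes t: "\<tau> > 0"
  shows "has_bochner_integral lborel (\<lambda>x::'a::euclidean_space. exp (- \<tau> * (norm x)\<^sup>2)) ((pi / \<tau>) powr (DIM('a) / 2))"
  using has_bochner_integral_Re[OF gaussian_fourier[OF t, of "0::'a"]] by simp

lemma nn_integral_gaussian:
  assumes t: "\<tau> > 0"
  shows "(\<integral>\<^sup>+x. ennreal (exp (- \<tau> * (norm (x::'a::euclidean_space))\<^sup>2)) \<partial>lborel) = ennreal ((pi / \<tau>) powr (DIM('a) / 2))"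
  using gaussian_integral[OF t, where 'a='a]
  by (subst nn_integral_eq_integral) (auto simp: has_bochner_integral_iff)

text \<open>Euler's integral read as a superposition: \<open>y powr - g\<close> is a mixture of
  exponentials \<open>exp (- t * y)\<close>. With \<open>y\<close> quadratic in x, bubble powers
  become mixtures of Gaussians; the nonnegative integral lets Tonelli be used before integrability
  is known.\<close>

lemma nn_integral_Gamma_scaled:
  assumes g: "g > 0" and y: "y > (0::real)"
  shows "(\<integral>\<^sup>+t. ennreal (indicator {0<..} t * t powr (g - 1) * exp (- t * y)) \<partial>lborel)
    = ennreal (Gamma g * y powr - g)"
proof -
  let ?f = "\<lambda>t::real. ennreal (indicator {0..} t * t powr (g - 1) / exp t)"
  have "ennreal (Gamma g) = ennreal y * (\<integral>\<^sup>+t. ?f (y * t) \<partial>lborel)"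
    using nn_integral_real_affine[of ?f y 0] y Gamma_conv_nn_integral_real[OF g] by simp
  also have "(\<integral>\<^sup>+t. ?f (y * t) \<partial>lborel) = (\<integral>\<^sup>+t. ennreal (y powr (g - 1)) * ennreal (indicator {0<..} t * t powr (g - 1) * exp (- t * y)) \<partial>lborel)"
  proof (rule nn_integral_cong)
    fix t :: real
    show "?f (y * t) = ennreal (y powr (g - 1)) * ennreal (indicator {0<..} t * t powr (g - 1) * exp (- t * y))"
      using y by (subst ennreal_mult[symmetric])
        (auto simp: indicator_def powr_mult exp_minus field_simps zero_le_mult_iff)
  qed
  also have "\<dots> = ennreal (y powr (g - 1)) * (\<integral>\<^sup>+t. ennreal (indicator {0<..} t * t powr (g - 1) * exp (- t * y)) \<partial>lborel)"
    (is "_ = _ * ?I") by (rule nn_integral_cmult) auto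
  finally have "ennreal (Gamma g) = ennreal (y powr g) * ?I"
    using y by (simp add: mult.assoc[symmetric] powr_diff flip: ennreal_mult)
  then have "ennreal (y powr - g) * ennreal (Gamma g) = ?I"
    using y by (simp add: mult.assoc[symmetric] powr_minus flip: ennreal_mult)
  then show ?thesis using g y by (simp add: mult.commute Gamma_real_pos less_imp_le flip: ennreal_mult)
qed

lemma Gamma_scaled_integral:
  assumes g: "g > 0" and y: "y > (0::real)"
  shows "has_bochner_integral lborel (\<lambda>t. indicator {0<..} t * t powr (g - 1) * exp (- t * y)) (Gamma g * y powr - g)"
  using nn_integral_Gamma_scaled[OF assms] g
  by (intro has_bochner_integral_nn_integral) (auto simp: Gamma_real_pos less_imp_le)

text \<open>The power is a mixture of Gaussians in x. After Tonelli the Gaussian integral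
  contributes \<open>t powr - (d / 2)\<close>, with d the dimension, which lowers the index of the
  remaining Gamma integral from \<open>g\<close> to \<open>g - d / 2\<close>.\<close>

lemma inverse_power_integral:
  assumes g: "g > real DIM('a) / 2" and P: "P > 0" and Q: "Q > (0::real)"
  shows "has_bochner_integral lborel (\<lambda>x::'a::euclidean_space. (Q + P * (norm x)\<^sup>2) powr - g)
    (pi powr (real DIM('a) / 2) * Gamma (g - real DIM('a) / 2) / Gamma g * P powr - (real DIM('a) / 2) * Q powr (real DIM('a) / 2 - g))"
    (is "has_bochner_integral _ ?f ?I")
proof (rule has_bochner_integral_nn_integral)
  have g0: "g > 0" "Gamma g > 0" "g - real DIM('a) / 2 > 0" "Gamma (g - real DIM('a) / 2) > 0"
    using g by (auto intro!: Gamma_real_pos less_le_trans[OF _ less_imp_le[OF g]])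
  let ?h = "\<lambda>x::'a. \<lambda>t::real. indicator {0<..} t * t powr (g - 1) * exp (- t * (Q + P * (norm x)\<^sup>2))"
  have "ennreal (Gamma g) * (\<integral>\<^sup>+x. ennreal (?f x) \<partial>lborel) = (\<integral>\<^sup>+x. ennreal (Gamma g) * ennreal (?f x) \<partial>lborel)"
    by (rule nn_integral_cmult[symmetric]) auto
  also have "\<dots> = (\<integral>\<^sup>+x. (\<integral>\<^sup>+t. ennreal (?h x t) \<partial>lborel) \<partial>lborel)"
    using P Q g0 by (intro nn_integral_cong, subst nn_integral_Gamma_scaled)
      (auto simp: ennreal_mult less_imp_le add_pos_nonneg)
  also have "\<dots> = (\<integral>\<^sup>+t. (\<integral>\<^sup>+x. ennreal (?h x t) \<partial>lborel) \<partial>lborel)"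
    by (rule lborel_pair.Fubini'[symmetric]) measurable
  also have "\<dots> = (\<integral>\<^sup>+t. ennreal ((pi / P) powr (real DIM('a) / 2)) * ennreal (indicator {0<..} t * t powr (g - real DIM('a) / 2 - 1) * exp (- t * Q)) \<partial>lborel)"
  proof (rule nn_integral_cong)
    fix t :: real
    show "(\<integral>\<^sup>+(x::'a). ennreal (?h x t) \<partial>lborel) = ennreal ((pi / P) powr (real DIM('a) / 2)) * ennreal (indicator {0<..} t * t powr (g - real DIM('a) / 2 - 1) * exp (- t * Q))"
    proof (cases "t > 0")
      case True
      have "(\<integral>\<^sup>+(x::'a). ennreal (?h x t) \<partial>lborel) = (\<integral>\<^sup>+(x::'a). ennreal (t powr (g - 1) * exp (- t * Q)) * ennreal (exp (- (t * P) * (norm x)\<^sup>2)) \<partial>lborel)"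
        using True by (intro nn_integral_cong, subst ennreal_mult[symmetric])
          (auto simp: algebra_simps exp_add[symmetric])
      also have "\<dots> = ennreal (t powr (g - 1) * exp (- t * Q)) * ennreal ((pi / (t * P)) powr (real DIM('a) / 2))"
        using True P nn_integral_gaussian[of "t * P", where 'a='a] by (subst nn_integral_cmult) auto
      also have "\<dots> = ennreal ((t powr (g - 1) * exp (- t * Q)) * ((pi / (t * P)) powr (real DIM('a) / 2)))"
        by (simp add: ennreal_mult)
      also have "(t powr (g - 1) * exp (- t * Q)) * ((pi / (t * P)) powr (real DIM('a) / 2))
         = (pi / P) powr (real DIM('a) / 2) * (t powr (g - real DIM('a) / 2 - 1) * exp (- t * Q))"
      proof -
        have "(pi / (t * P)) powr (real DIM('a) / 2) = (pi / P) powr (real DIM('a) / 2) * t powr (- (real DIM('a) / 2))"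
          using True P by (simp add: powr_divide powr_mult powr_minus field_simps)
        moreover have "t powr (g - real DIM('a) / 2 - 1) = t powr (g - 1) * t powr (- (real DIM('a) / 2))"
          using True by (simp add: powr_add[symmetric] algebra_simps)
        ultimately show ?thesis by simp
      qed
      finally show ?thesis using True by (simp add: ennreal_mult)
    qed simp
  qed
  also have "\<dots> = ennreal ((pi / P) powr (real DIM('a) / 2)) * ennreal (Gamma (g - real DIM('a) / 2) * Q powr - (g - real DIM('a) / 2))"
    using g0 Q nn_integral_Gamma_scaled[of "g - real DIM('a) / 2" Q] by (subst nn_integral_cmult) auto
  also have "\<dots> = ennreal ((pi / P) powr (real DIM('a) / 2) * (Gamma (g - real DIM('a) / 2) * Q powr - (g - real DIM('a) / 2)))"
    using g0 by (simp add: ennreal_mult)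
  also have "(pi / P) powr (real DIM('a) / 2) * (Gamma (g - real DIM('a) / 2) * Q powr - (g - real DIM('a) / 2)) = Gamma g * ?I"
  proof -
    have "(pi / P) powr (real DIM('a) / 2) = pi powr (real DIM('a) / 2) * P powr - (real DIM('a) / 2)"
      using P by (simp add: powr_divide powr_minus_divide)
    moreover have "a * e * (b * f) = c * (a * b / c * e * f)" if "c > 0" for a b c e f :: real
      using that by simp
    ultimately show ?thesis by (simp only: g0 minus_diff_eq)
  qed
  finally have "ennreal (1 / Gamma g) * (ennreal (Gamma g) * (\<integral>\<^sup>+x. ennreal (?f x) \<partial>lborel)) = ennreal (1 / Gamma g) * ennreal (Gamma g * ?I)"
    by simp
  then show "(\<integral>\<^sup>+x. ennreal (?f x) \<partial>lborel) = ennreal ?I"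
    using g0 by (simp add: mult.assoc[symmetric] ennreal_mult[symmetric])
  show "0 \<le> ?I" using g0 by (intro mult_nonneg_nonneg divide_nonneg_nonneg) auto
qed auto

text \<open>Here the singular power \<open>norm x powr (- 2 * q)\<close> is written as a mixture of
  Gaussians; only finiteness is at stake.\<close>

lemma integrable_riesz_gaussian:
  assumes q: "0 < q" "q < real DIM('a) / 2"
  shows "integrable lborel (\<lambda>x::'a::euclidean_space. norm x powr (- 2 * q) * exp (- (norm x)\<^sup>2))"
proof (subst integrable_iff_bounded, intro conjI)
  let ?h = "\<lambda>x::'a. \<lambda>t::real. indicator {0<..} t * t powr (q - 1) * exp (- t * (norm x)\<^sup>2) * exp (- (norm x)\<^sup>2)"
  have Gq: "Gamma q > 0" using q by (simp add: Gamma_real_pos)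
  have "ennreal (Gamma q) * (\<integral>\<^sup>+(x::'a). ennreal (norm (norm x powr (- 2 * q) * exp (- (norm x)\<^sup>2))) \<partial>lborel)
     = (\<integral>\<^sup>+(x::'a). ennreal (Gamma q) * ennreal (norm (norm x powr (- 2 * q) * exp (- (norm x)\<^sup>2))) \<partial>lborel)"
    by (rule nn_integral_cmult[symmetric]) auto
  also have "\<dots> = (\<integral>\<^sup>+x. (\<integral>\<^sup>+t. ennreal (?h x t) \<partial>lborel) \<partial>lborel)"
  proof (intro nn_integral_cong_AE eventually_mono[OF AE_lborel_singleton[of 0]])
    fix x :: 'a assume x: "x \<noteq> 0"
    have "(\<integral>\<^sup>+t. ennreal (?h x t) \<partial>lborel) = (\<integral>\<^sup>+t. ennreal (indicator {0<..} t * t powr (q - 1) * exp (- t * (norm x)\<^sup>2)) * ennreal (exp (- (norm x)\<^sup>2)) \<partial>lborel)"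
      by (intro nn_integral_cong) (simp add: ennreal_mult)
    also have "\<dots> = ennreal (Gamma q * (norm x)\<^sup>2 powr - q) * ennreal (exp (- (norm x)\<^sup>2))"
      using x q nn_integral_Gamma_scaled[of q "(norm x)\<^sup>2"] by (subst nn_integral_multc) (auto simp del: mult_minus_left)
    also have "(norm x)\<^sup>2 powr - q = norm x powr (- 2 * q)"
      using x by (simp add: powr_powr flip: powr_numeral)
    finally show "ennreal (Gamma q) * ennreal (norm (norm x powr (- 2 * q) * exp (- (norm x)\<^sup>2))) = (\<integral>\<^sup>+t. ennreal (?h x t) \<partial>lborel)"
      using Gq by (simp add: ennreal_mult mult_ac)
  qed
  also have "\<dots> = (\<integral>\<^sup>+t. (\<integral>\<^sup>+x. ennreal (?h x t) \<partial>lborel) \<partial>lborel)"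
    by (rule lborel_pair.Fubini'[symmetric]) measurable
  also have "\<dots> = (\<integral>\<^sup>+t. ennreal (indicator {0<..} t * t powr (q - 1) * (pi / (t + 1)) powr (real DIM('a) / 2)) \<partial>lborel)"
  proof (rule nn_integral_cong)
    fix t :: real
    show "(\<integral>\<^sup>+(x::'a). ennreal (?h x t) \<partial>lborel) = ennreal (indicator {0<..} t * t powr (q - 1) * (pi / (t + 1)) powr (real DIM('a) / 2))"
    proof (cases "t > 0")
      case True
      have "(\<integral>\<^sup>+(x::'a). ennreal (?h x t) \<partial>lborel) = (\<integral>\<^sup>+(x::'a). ennreal (t powr (q - 1)) * ennreal (exp (- (t + 1) * (norm x)\<^sup>2)) \<partial>lborel)"
        using True by (intro nn_integral_cong, subst ennreal_mult[symmetric])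
          (auto simp: algebra_simps exp_add[symmetric])
      also have "\<dots> = ennreal (t powr (q - 1)) * ennreal ((pi / (t + 1)) powr (real DIM('a) / 2))"
        using True nn_integral_gaussian[of "t + 1", where 'a='a] by (subst nn_integral_cmult) auto
      finally show ?thesis using True by (simp add: ennreal_mult)
    qed simp
  qed
  \<comment> \<open>Near \<open>t = 0\<close> the integrand behaves like
    \<open>t powr (q - 1)\<close>, at infinity like \<open>t powr (q - d / 2 - 1)\<close> with d the
    dimension; the two bounds on \<open>q\<close> make each half integrable.\<close>
  also have "\<dots> \<le> (\<integral>\<^sup>+t. ennreal (pi powr (real DIM('a) / 2)) * ennreal (indicator {0<..1} t * t powr (q - 1) + indicator {1..} t * t powr (q - real DIM('a) / 2 - 1)) \<partial>lborel)"
  proof (rule nn_integral_mono, subst ennreal_mult[symmetric])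
    fix t :: real
    have "t powr (q - 1) * (pi / (t + 1)) powr (real DIM('a) / 2) \<le> pi powr (real DIM('a) / 2) * t powr (q - 1)" if "t > 0"
      using that powr_mono2[of "real DIM('a) / 2" "pi / (t + 1)" pi] by (simp add: field_simps mult_left_mono)
    moreover have "t powr (q - 1) * (pi / (t + 1)) powr (real DIM('a) / 2) \<le> pi powr (real DIM('a) / 2) * t powr (q - real DIM('a) / 2 - 1)" if "t \<ge> 1"
    proof -
      have "(pi / (t + 1)) powr (real DIM('a) / 2) \<le> (pi / t) powr (real DIM('a) / 2)"
        using that by (intro powr_mono2) (auto simp: field_simps)
      also have "\<dots> = pi powr (real DIM('a) / 2) * t powr - (real DIM('a) / 2)"
        using that by (simp add: powr_divide powr_minus field_simps)
      finally have "t powr (q - 1) * (pi / (t + 1)) powr (real DIM('a) / 2) \<le> t powr (q - 1) * (pi powr (real DIM('a) / 2) * t powr - (real DIM('a) / 2))"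
        by (intro mult_left_mono) auto
      moreover have "t powr (q - real DIM('a) / 2 - 1) = t powr (q - 1) * t powr (- (real DIM('a) / 2))"
        using that by (simp add: powr_add[symmetric] algebra_simps)
      ultimately show ?thesis by (simp add: mult_ac)
    qed
    ultimately show "ennreal (indicator {0<..} t * t powr (q - 1) * (pi / (t + 1)) powr (real DIM('a) / 2))
       \<le> ennreal (pi powr (real DIM('a) / 2) * (indicator {0<..1} t * t powr (q - 1) + indicator {1..} t * t powr (q - real DIM('a) / 2 - 1)))"
      by (intro ennreal_leI) (auto simp: indicator_def algebra_simps add_increasing)
  qed auto
  also have "\<dots> < \<infinity>"
  proof -
    have "set_integrable lborel {0<..1} (\<lambda>t. t powr (q - 1))"
      using integrable_Beta[of q 1] q unfolding set_integrable_def
      by (rule_tac Bochner_Integration.integrable_bound)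
         (auto split: split_indicator intro!: eventually_mono[OF AE_lborel_singleton[of 1]])
    moreover have "set_integrable lborel {1..} (\<lambda>t. t powr (q - real DIM('a) / 2 - 1))"
    proof -
      have "((\<lambda>t. t powr (q - real DIM('a) / 2 - 1)) has_integral - (1 powr (q - real DIM('a) / 2 - 1 + 1)) / (q - real DIM('a) / 2 - 1 + 1)) {1..}"
        using q by (intro has_integral_powr_to_inf) auto
      then have "(\<lambda>t. t powr (q - real DIM('a) / 2 - 1)) absolutely_integrable_on {1..}"
        by (intro nonnegative_absolutely_integrable_1) (auto simp: integrable_on_def)
      then show ?thesis
        unfolding set_integrable_def by (subst (asm) integrable_completion) auto
    qed
    ultimately have "integrable lborel (\<lambda>t. indicator {0<..1} t * t powr (q - 1) + indicator {1..} t * t powr (q - real DIM('a) / 2 - 1))"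
      unfolding set_integrable_def by (intro Bochner_Integration.integrable_add) auto
    then have "integrable lborel (\<lambda>t. pi powr (real DIM('a) / 2) * (indicator {0<..1} t * t powr (q - 1) + indicator {1..} t * t powr (q - real DIM('a) / 2 - 1)))"
      by simp
    then have "(\<integral>\<^sup>+t. ennreal (norm (pi powr (real DIM('a) / 2) * (indicator {0<..1} t * t powr (q - 1) + indicator {1..} t * t powr (q - real DIM('a) / 2 - 1)))) \<partial>lborel) < \<infinity>"
      unfolding integrable_iff_bounded by blast
    then show ?thesis
    proof (rule order.strict_trans1[rotated], intro nn_integral_mono, goal_cases)
      case (1 t)
      show ?case by (subst ennreal_mult[symmetric]) (auto intro!: ennreal_leI)
    qed
  qed
  finally show "(\<integral>\<^sup>+(x::'a). ennreal (norm (norm x powr (- 2 * q) * exp (- (norm x)\<^sup>2))) \<partial>lborel) < \<infinity>"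
    using Gq by (auto simp: ennreal_mult_less_top)
qed measurable

lemma integrable_inverse_power:
  assumes "g > real DIM('a) / 2"
  shows "integrable lborel (\<lambda>x::'a::euclidean_space. (1 + (norm x)\<^sup>2) powr - g)"
  using inverse_power_integral[OF assms, of 1 1] by (simp add: has_bochner_integral_iff)

text \<open>In the unit ball \<open>exp (1 - (norm x)\<^sup>2)\<close> is at least 1, so the
  Gaussian case dominates; outside, the singular factor is at most 1.\<close>

lemma integrable_riesz_inverse_power:
  assumes q: "0 < q" "q < real DIM('a) / 2" and r: "r > real DIM('a) / 2"
  shows "integrable lborel (\<lambda>x::'a::euclidean_space. norm x powr (- 2 * q) * (1 + (norm x)\<^sup>2) powr - r)"
proof (rule Bochner_Integration.integrable_bound)
  show "integrable lborel (\<lambda>x::'a. exp 1 * (norm x powr (- 2 * q) * exp (- (norm x)\<^sup>2)) + (1 + (norm x)\<^sup>2) powr - r)"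
    using q r by (intro Bochner_Integration.integrable_add integrable_mult_right integrable_riesz_gaussian integrable_inverse_power) auto
  show "AE x::'a in lborel. norm (norm x powr (- 2 * q) * (1 + (norm x)\<^sup>2) powr - r)
     \<le> norm (exp 1 * (norm x powr (- 2 * q) * exp (- (norm x)\<^sup>2)) + (1 + (norm x)\<^sup>2) powr - r)"
  proof (rule AE_I2)
    fix x :: 'a
    show "norm (norm x powr (- 2 * q) * (1 + (norm x)\<^sup>2) powr - r)
     \<le> norm (exp 1 * (norm x powr (- 2 * q) * exp (- (norm x)\<^sup>2)) + (1 + (norm x)\<^sup>2) powr - r)"
    proof (cases "norm x \<le> 1")
      case True
      have "(1 + (norm x)\<^sup>2) powr - r \<le> 1"
        using r powr_mono[of "- r" 0 "1 + (norm x)\<^sup>2"]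
        by (auto simp: add_pos_nonneg split: if_splits)
      also have "1 \<le> exp (1 + - (norm x)\<^sup>2)"
        using True by (simp add: power_le_one)
      finally have "norm x powr (- 2 * q) * (1 + (norm x)\<^sup>2) powr - r \<le> norm x powr (- 2 * q) * (exp 1 * exp (- (norm x)\<^sup>2))"
        unfolding exp_add by (intro mult_left_mono) auto
      then show ?thesis by (simp add: mult_ac add_increasing2)
    next
      case False
      then have "norm x powr (- 2 * q) \<le> norm x powr 0"
        using q by (intro powr_mono) auto
      also have "norm x powr 0 = 1" using False by auto
      finally have "norm x powr (- 2 * q) * (1 + (norm x)\<^sup>2) powr - r \<le> 1 * (1 + (norm x)\<^sup>2) powr - r"
        using False by (intro mult_right_mono) auto
      then show ?thesis by (simp add: add_increasing)
    qed
  qed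
qed measurable

section \<open>Square-integrable functions: Cauchy-Schwarz and triangle inequalities\<close>

lemma borel_measurable_cnj [measurable]: "cnj \<in> borel_measurable borel"
  by (intro borel_measurable_continuous_onI continuous_on_cnj continuous_on_id)

definition square_integrable :: "('a::euclidean_space \<Rightarrow> complex) \<Rightarrow> bool" where
  "square_integrable F \<longleftrightarrow> F \<in> borel_measurable borel \<and> integrable lborel (\<lambda>x. (cmod (F x))\<^sup>2)"

definition l2norm :: "('a::euclidean_space \<Rightarrow> complex) \<Rightarrow> real" where
  "l2norm F = sqrt (\<integral>x. (cmod (F x))\<^sup>2 \<partial>lborel)"

lemma l2norm_nonneg [simp]: "l2norm F \<ge> 0"
  by (simp add: l2norm_def)

lemma l2norm_squared: "(l2norm F)\<^sup>2 = (\<integral>x. (cmod (F x))\<^sup>2 \<partial>lborel)"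
  by (simp add: l2norm_def)

lemma square_integrable_measurable [measurable_dest]:
  "square_integrable F \<Longrightarrow> F \<in> borel_measurable borel"
  by (simp add: square_integrable_def)

lemma square_integrable_norm_product:
  assumes "square_integrable F" "square_integrable G"
  shows "integrable lborel (\<lambda>x. cmod (F x) * cmod (G x))"
proof (rule Bochner_Integration.integrable_bound)
  show "integrable lborel (\<lambda>x. (cmod (F x))\<^sup>2 + (cmod (G x))\<^sup>2)"
    using assms by (auto simp: square_integrable_def)
  show "AE x in lborel. norm (cmod (F x) * cmod (G x)) \<le> norm ((cmod (F x))\<^sup>2 + (cmod (G x))\<^sup>2)"
  proof (rule AE_I2)
    fix x
    have "2 * (cmod (F x) * cmod (G x)) \<le> (cmod (F x))\<^sup>2 + (cmod (G x))\<^sup>2"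
      using sum_squares_bound[of "cmod (F x)" "cmod (G x)"] by (simp add: mult_ac)
    moreover have "0 \<le> cmod (F x) * cmod (G x)" by simp
    ultimately have "cmod (F x) * cmod (G x) \<le> (cmod (F x))\<^sup>2 + (cmod (G x))\<^sup>2" by linarith
    then show "norm (cmod (F x) * cmod (G x)) \<le> norm ((cmod (F x))\<^sup>2 + (cmod (G x))\<^sup>2)"
      by (simp add: abs_mult)
  qed
qed (use assms in measurable)

lemma Cauchy_Schwarz_norm_product:
  assumes "square_integrable F" "square_integrable G"
  shows "(\<integral>x. cmod (F x) * cmod (G x) \<partial>lborel) \<le> l2norm F * l2norm G"
proof -
  note [measurable] = assms[THEN square_integrable_measurable]
  let ?I = "\<integral>x. cmod (F x) * cmod (G x) \<partial>lborel"
  have "ennreal (?I\<^sup>2) = (\<integral>\<^sup>+x. ennreal (cmod (F x)) * ennreal (cmod (G x)) \<partial>lborel)\<^sup>2"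
    using nn_integral_eq_integral[OF square_integrable_norm_product[OF assms]]
    by (simp add: ennreal_power ennreal_mult Bochner_Integration.integral_nonneg)
  also have "\<dots> \<le> (\<integral>\<^sup>+x. ennreal (cmod (F x))^2 \<partial>lborel) * (\<integral>\<^sup>+x. ennreal (cmod (G x))^2 \<partial>lborel)"
    by (rule Cauchy_Schwarz_nn_integral) measurable
  also have "\<dots> = ennreal ((l2norm F)\<^sup>2) * ennreal ((l2norm G)\<^sup>2)"
    using assms unfolding l2norm_squared square_integrable_def
    by (simp add: ennreal_power nn_integral_eq_integral)
  also have "\<dots> = ennreal ((l2norm F * l2norm G)\<^sup>2)"
    by (simp add: ennreal_mult power_mult_distrib)
  finally have "?I\<^sup>2 \<le> (l2norm F * l2norm G)\<^sup>2" by (simp add: ennreal_le_iff)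
  then show ?thesis by (rule power2_le_imp_le) simp
qed

lemma square_integrable_product:
  assumes "square_integrable F" "square_integrable G"
  shows "integrable lborel (\<lambda>x. F x * cnj (G x))"
  by (rule Bochner_Integration.integrable_bound[OF square_integrable_norm_product[OF assms]])
     (use assms[THEN square_integrable_measurable] in \<open>auto simp: norm_mult\<close>)

lemma Cauchy_Schwarz_l2norm:
  assumes "square_integrable F" "square_integrable G"
  shows "cmod (\<integral>x. F x * cnj (G x) \<partial>lborel) \<le> l2norm F * l2norm G"
proof -
  have "cmod (\<integral>x. F x * cnj (G x) \<partial>lborel) \<le> (\<integral>x. cmod (F x) * cmod (G x) \<partial>lborel)"
    using integral_norm_bound[of lborel "\<lambda>x. F x * cnj (G x)"] by (simp add: norm_mult)
  with Cauchy_Schwarz_norm_product[OF assms] show ?thesis by linarith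
qed

lemma square_integrable_cmult:
  assumes "square_integrable F" shows "square_integrable (\<lambda>x. c * F x)"
  using assms by (auto simp: square_integrable_def norm_mult power_mult_distrib)

lemma l2norm_cmult: "l2norm (\<lambda>x. c * F x) = cmod c * l2norm F"
  by (simp add: l2norm_def norm_mult power_mult_distrib real_sqrt_mult)

lemma square_integrable_add:
  assumes "square_integrable F" "square_integrable G"
  shows "square_integrable (\<lambda>x. F x + G x)"
  unfolding square_integrable_def
proof (rule conjI, goal_cases)
  note [measurable] = assms[THEN square_integrable_measurable]
  case 1
  show ?case by measurable
next
  note [measurable] = assms[THEN square_integrable_measurable]
  case 2
  show ?case
  proof (rule Bochner_Integration.integrable_bound)
  show "integrable lborel (\<lambda>x. (cmod (F x))\<^sup>2 + (cmod (G x))\<^sup>2 + 2 * (cmod (F x) * cmod (G x)))"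
    using assms square_integrable_norm_product[OF assms] by (auto simp: square_integrable_def)
  show "AE x in lborel. norm ((cmod (F x + G x))\<^sup>2)
      \<le> norm ((cmod (F x))\<^sup>2 + (cmod (G x))\<^sup>2 + 2 * (cmod (F x) * cmod (G x)))"
  proof (rule AE_I2)
    fix x
    have "(cmod (F x + G x))\<^sup>2 \<le> (cmod (F x) + cmod (G x))\<^sup>2"
      by (intro power_mono norm_triangle_ineq) auto
    then show "norm ((cmod (F x + G x))\<^sup>2) \<le> norm ((cmod (F x))\<^sup>2 + (cmod (G x))\<^sup>2 + 2 * (cmod (F x) * cmod (G x)))"
      by (simp add: power2_sum mult.assoc)
  qed
  qed measurable
qed

lemma l2norm_triangle:
  assumes "square_integrable F" "square_integrable G"
  shows "l2norm (\<lambda>x. F x + G x) \<le> l2norm F + l2norm G"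
proof (rule power2_le_imp_le)
  have i: "integrable lborel (\<lambda>x. (cmod (F x))\<^sup>2)" "integrable lborel (\<lambda>x. (cmod (G x))\<^sup>2)"
    "integrable lborel (\<lambda>x. (cmod (F x + G x))\<^sup>2)"
    using assms square_integrable_add[OF assms] by (auto simp: square_integrable_def)
  note p = square_integrable_norm_product[OF assms]
  have "(l2norm (\<lambda>x. F x + G x))\<^sup>2 \<le> (\<integral>x. (cmod (F x))\<^sup>2 + (cmod (G x))\<^sup>2 + 2 * (cmod (F x) * cmod (G x)) \<partial>lborel)"
    unfolding l2norm_squared
  proof (intro integral_mono)
    fix x
    have "(cmod (F x + G x))\<^sup>2 \<le> (cmod (F x) + cmod (G x))\<^sup>2"
      by (intro power_mono norm_triangle_ineq) auto
    then show "(cmod (F x + G x))\<^sup>2 \<le> (cmod (F x))\<^sup>2 + (cmod (G x))\<^sup>2 + 2 * (cmod (F x) * cmod (G x))"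
      by (simp add: power2_sum mult.assoc)
  qed (use i p in auto)
  also have "\<dots> = (l2norm F)\<^sup>2 + (l2norm G)\<^sup>2 + 2 * (\<integral>x. cmod (F x) * cmod (G x) \<partial>lborel)"
    using i p by (simp add: l2norm_squared)
  also have "\<dots> \<le> (l2norm F + l2norm G)\<^sup>2"
    using Cauchy_Schwarz_norm_product[OF assms] by (simp add: power2_sum)
  finally show "(l2norm (\<lambda>x. F x + G x))\<^sup>2 \<le> (l2norm F + l2norm G)\<^sup>2" .
qed simp

lemma square_integrable_diff:
  assumes "square_integrable F" "square_integrable G"
  shows "square_integrable (\<lambda>x. F x - G x)"
  using square_integrable_add[OF assms(1) square_integrable_cmult[OF assms(2), of "-1"]] by simp

lemma l2norm_triangle_diff:
  assumes "square_integrable F" "square_integrable G"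
  shows "\<bar>l2norm F - l2norm G\<bar> \<le> l2norm (\<lambda>x. F x - G x)"
proof -
  have "l2norm F \<le> l2norm (\<lambda>x. F x - G x) + l2norm G"
    using l2norm_triangle[OF square_integrable_diff[OF assms] assms(2)] by simp
  moreover have "l2norm G \<le> l2norm (\<lambda>x. G x - F x) + l2norm F"
    using l2norm_triangle[OF square_integrable_diff[OF assms(2,1)] assms(1)] by simp
  moreover have "l2norm (\<lambda>x. G x - F x) = l2norm (\<lambda>x. F x - G x)"
    by (simp add: l2norm_def norm_minus_commute)
  ultimately show ?thesis by linarith
qed

section \<open>Exchange of integrals and the Plancherel identity\<close>

lemma integrable_product_lborel:
  fixes f :: "'a::euclidean_space \<Rightarrow> complex" and g :: "'b::euclidean_space \<Rightarrow> complex"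
  assumes f: "integrable lborel f" and g: "integrable lborel g"
  shows "integrable (lborel \<Otimes>\<^sub>M lborel) (\<lambda>(x, y). f x * g y)"
proof (rule lborel_pair.Fubini_integrable)
  have [measurable]: "f \<in> borel_measurable borel" "g \<in> borel_measurable borel"
    using f g by (auto dest: borel_measurable_integrable)
  show "(\<lambda>(x, y). f x * g y) \<in> borel_measurable (lborel \<Otimes>\<^sub>M lborel)" by measurable
  show "integrable lborel (\<lambda>x. \<integral>y. norm (case (x, y) of (x, y) \<Rightarrow> f x * g y) \<partial>lborel)"
    using f g by (simp add: norm_mult)
  show "AE x in lborel. integrable lborel (\<lambda>y. case (x, y) of (x, y) \<Rightarrow> f x * g y)"
    using g by simp
qed

text \<open>The product \<open>f x * g y\<close> dominates up to the factor \<open>C\<close>. With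
  \<open>k x y = cis (x \<bullet> y)\<close> this is the multiplication formula that moves a Fourier
  transform from one factor to the other.\<close>

lemma Fubini_bounded_kernel:
  fixes f :: "'a::euclidean_space \<Rightarrow> complex" and g :: "'b::euclidean_space \<Rightarrow> complex"
  assumes f: "integrable lborel f" and g: "integrable lborel g"
    and k [measurable]: "case_prod k \<in> borel_measurable (borel \<Otimes>\<^sub>M borel)"
    and b: "\<And>x y. cmod (k x y) \<le> C"
  shows "(\<integral>x. f x * (\<integral>y. k x y * g y \<partial>lborel) \<partial>lborel) = (\<integral>y. g y * (\<integral>x. k x y * f x \<partial>lborel) \<partial>lborel)"
proof -
  have [measurable]: "f \<in> borel_measurable borel" "g \<in> borel_measurable borel"
    using f g by (auto dest: borel_measurable_integrable)
  have "integrable (lborel \<Otimes>\<^sub>M lborel) (\<lambda>(x, y). k x y * (f x * g y))"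
  proof (rule Bochner_Integration.integrable_bound)
    show "integrable (lborel \<Otimes>\<^sub>M lborel) (\<lambda>z. of_real C * (case z of (x, y) \<Rightarrow> f x * g y))"
      by (intro integrable_mult_right integrable_product_lborel f g)
    have "C \<ge> 0" using b[of undefined undefined] norm_ge_zero order_trans by blast
    then show "AE z in lborel \<Otimes>\<^sub>M lborel. norm (case z of (x, y) \<Rightarrow> k x y * (f x * g y)) \<le> norm (of_real C * (case z of (x, y) \<Rightarrow> f x * g y))"
      using b by (intro AE_I2) (simp add: norm_mult mult_right_mono split: prod.split)
  qed measurable
  from lborel_pair.Fubini_integral[OF this]
  have "(\<integral>y. (\<integral>x. k x y * (f x * g y) \<partial>lborel) \<partial>lborel) = (\<integral>x. (\<integral>y. k x y * (f x * g y) \<partial>lborel) \<partial>lborel)" .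
  moreover have "(\<integral>x. k x y * (f x * g y) \<partial>lborel) = g y * (\<integral>x. k x y * f x \<partial>lborel)" for y
    by (simp add: integral_mult_right_zero[symmetric] mult_ac del: integral_mult_right_zero)
  moreover have "(\<integral>y. k x y * (f x * g y) \<partial>lborel) = f x * (\<integral>y. k x y * g y \<partial>lborel)" for x
    by (simp add: integral_mult_right_zero[symmetric] mult_ac del: integral_mult_right_zero)
  ultimately show ?thesis by simp
qed

lemma integrable_cis_mult:
  fixes g :: "'a::euclidean_space \<Rightarrow> complex"
  assumes "integrable lborel g" and [measurable]: "h \<in> borel_measurable borel"
  shows "integrable lborel (\<lambda>x. cis (h x) * g x)"
  by (rule Bochner_Integration.integrable_bound[OF assms(1)])
     (use assms(1)[THEN borel_measurable_integrable] in \<open>auto simp: norm_mult\<close>)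

lemma norm_integral_cis_le:
  fixes g :: "'a::euclidean_space \<Rightarrow> complex"
  shows "cmod (\<integral>x. cis (h x) * g x \<partial>lborel) \<le> (\<integral>x. cmod (g x) \<partial>lborel)"
  using integral_norm_bound[of lborel "\<lambda>x. cis (h x) * g x"] by (simp add: norm_mult)

lemma continuous_fourier_integral:
  fixes g :: "'a::euclidean_space \<Rightarrow> complex"
  assumes g: "integrable lborel g"
  shows "continuous_on UNIV (\<lambda>y. \<integral>x. cis (x \<bullet> y) * g x \<partial>lborel)"
proof (rule continuous_at_imp_continuous_on, rule ballI)
  fix y :: 'a
  have [measurable]: "g \<in> borel_measurable borel" using g by auto
  show "isCont (\<lambda>y. \<integral>x. cis (x \<bullet> y) * g x \<partial>lborel) y"
    unfolding continuous_at_sequentially comp_def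
  proof (intro allI impI)
    fix X assume X: "X \<longlonglongrightarrow> y"
    show "(\<lambda>n. \<integral>x. cis (x \<bullet> X n) * g x \<partial>lborel) \<longlonglongrightarrow> (\<integral>x. cis (x \<bullet> y) * g x \<partial>lborel)"
    proof (rule integral_dominated_convergence[where w="\<lambda>x. norm (g x)"])
      show "AE x in lborel. (\<lambda>n. cis (x \<bullet> X n) * g x) \<longlonglongrightarrow> cis (x \<bullet> y) * g x"
        by (intro AE_I2 tendsto_intros X isCont_tendsto_compose[OF continuous_on_interior[OF continuous_on_cis[OF continuous_on_id]]])
    qed (use g in \<open>auto simp: norm_mult\<close>)
  qed
qed

lemma gaussian_tendsto_1:
  fixes x :: "'a::euclidean_space"
  shows "(\<lambda>n. exp (- (1 / real (Suc n)) * (norm x)\<^sup>2)) \<longlonglongrightarrow> 1"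
proof -
  have "(\<lambda>n. 1 / real (Suc n)) \<longlonglongrightarrow> 0"
    using LIMSEQ_inverse_real_of_nat by (simp add: inverse_eq_divide)
  then have "(\<lambda>n. exp (- (1 / real (Suc n)) * (norm x)\<^sup>2)) \<longlonglongrightarrow> exp (- 0 * (norm x)\<^sup>2)"
    by (intro tendsto_intros)
  then show ?thesis by simp
qed

lemma sqrt_inverse_tendsto_0: "(\<lambda>n. sqrt (1 / real (Suc n))) \<longlonglongrightarrow> 0"
proof -
  have "(\<lambda>n. 1 / real (Suc n)) \<longlonglongrightarrow> 0"
    using LIMSEQ_inverse_real_of_nat by (simp add: inverse_eq_divide)
  from tendsto_real_sqrt[OF this] show ?thesis by simp
qed

text \<open>The Gaussian factor makes the triple integral absolutely convergent; it is removed by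
  monotone convergence on one side and, being an approximate identity, by dominated convergence
  on the other.\<close>

lemma plancherel_integral:
  fixes g :: "'a::euclidean_space \<Rightarrow> complex"
  assumes g: "integrable lborel g" and cont: "continuous_on UNIV g" and bdd: "\<And>x. cmod (g x) \<le> B"
  defines "G \<equiv> \<lambda>x. \<integral>y. cis (x \<bullet> y) * g y \<partial>lborel"
  shows "has_bochner_integral lborel (\<lambda>x. (cmod (G x))\<^sup>2) ((2 * pi) ^ DIM('a) * (\<integral>x. (cmod (g x))\<^sup>2 \<partial>lborel))"
proof -
  let ?d = "real DIM('a)"
  define I where "I = (\<integral>x. cmod (g x) \<partial>lborel)"
  have B0: "B \<ge> 0" using bdd[of 0] norm_ge_zero order_trans by blast
  have [measurable]: "g \<in> borel_measurable borel" using g by auto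
  have contG: "continuous_on UNIV G"
    using continuous_fourier_integral[OF g] unfolding G_def by (simp add: inner_commute)
  then have [measurable]: "G \<in> borel_measurable borel" by (rule borel_measurable_continuous_onI)
  have Gb: "cmod (G x) \<le> I" for x unfolding G_def I_def by (rule norm_integral_cis_le)
  have I0: "I \<ge> 0" unfolding I_def by simp
  define e where "e n = 1 / real (Suc n)" for n
  have e: "e n > 0" for n by (simp add: e_def)
  define E where "E n x = exp (- e n * (norm x)\<^sup>2)" for n and x :: 'a
  have [measurable]: "E n \<in> borel_measurable borel" for n unfolding E_def by measurable
  have iE: "integrable lborel (E n)" for n
    using gaussian_integral[OF e[of n], where 'a='a] unfolding E_def by (simp add: has_bochner_integral_iff)
  have iEG: "integrable lborel (\<lambda>x. E n x *\<^sub>R cnj (G x))" for n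
  proof (rule Bochner_Integration.integrable_bound)
    show "integrable lborel (\<lambda>x. I * E n x)" using iE by simp
    show "AE x in lborel. norm (E n x *\<^sub>R cnj (G x)) \<le> norm (I * E n x)"
      using Gb I0 by (auto simp: E_def abs_mult mult.commute mult_right_mono)
  qed measurable
  have iEG2: "integrable lborel (\<lambda>x. E n x * (cmod (G x))\<^sup>2)" for n
  proof (rule Bochner_Integration.integrable_bound)
    show "integrable lborel (\<lambda>x. I\<^sup>2 * E n x)" using iE by simp
    show "AE x in lborel. norm (E n x * (cmod (G x))\<^sup>2) \<le> norm (I\<^sup>2 * E n x)"
      using Gb I0 by (auto simp: E_def abs_mult mult.commute intro!: mult_right_mono power_mono)
  qed measurable
  \<comment> \<open>\<open>cnj g\<close> smoothed at width \<open>sqrt (e n)\<close>. The width sits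
    in the argument of \<open>g\<close> and not in the kernel, so that dominated convergence with a
    fixed Gaussian gives the limit.\<close>
  define R where "R n \<xi> = of_real (pi powr (?d / 2)) * (\<integral>k. cnj (g (\<xi> + sqrt (e n) *\<^sub>R k)) * of_real (exp (- (norm k)\<^sup>2 / 4)) \<partial>lborel)" for n \<xi>
  have R: "(\<integral>x. cis (x \<bullet> \<xi>) * (E n x *\<^sub>R cnj (G x)) \<partial>lborel) = R n \<xi>" for n \<xi>
  proof -
    have cG: "cnj (G x) = (\<integral>y. cis (- (x \<bullet> y)) * cnj (g y) \<partial>lborel)" for x
      unfolding G_def Bochner_Integration.integral_cnj[symmetric] by (simp add: cis_cnj)
    have "(\<integral>x. cis (x \<bullet> \<xi>) * (E n x *\<^sub>R cnj (G x)) \<partial>lborel)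
       = (\<integral>x. (cis (x \<bullet> \<xi>) * of_real (E n x)) * (\<integral>y. cis (- (x \<bullet> y)) * cnj (g y) \<partial>lborel) \<partial>lborel)"
      by (simp add: cG scaleR_conv_of_real mult_ac)
    also have "\<dots> = (\<integral>y. cnj (g y) * (\<integral>x. cis (- (x \<bullet> y)) * (cis (x \<bullet> \<xi>) * of_real (E n x)) \<partial>lborel) \<partial>lborel)"
    proof (rule Fubini_bounded_kernel[where C=1])
      show "integrable lborel (\<lambda>x. cis (x \<bullet> \<xi>) * complex_of_real (E n x))"
        using iE by (intro integrable_cis_mult) auto
    qed (use g in auto)
    also have "\<dots> = (\<integral>y. cnj (g y) * of_real ((pi / e n) powr (?d / 2) * exp (- (norm (\<xi> - y))\<^sup>2 / (4 * e n))) \<partial>lborel)"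
    proof (rule Bochner_Integration.integral_cong)
      fix y
      have "(\<integral>x. cis (- (x \<bullet> y)) * (cis (x \<bullet> \<xi>) * of_real (E n x)) \<partial>lborel) = (\<integral>x. cis (x \<bullet> (\<xi> - y)) * of_real (E n x) \<partial>lborel)"
        by (intro Bochner_Integration.integral_cong) (auto simp: cis_mult inner_diff_right mult.assoc[symmetric])
      also have "\<dots> = of_real ((pi / e n) powr (?d / 2) * exp (- (norm (\<xi> - y))\<^sup>2 / (4 * e n)))"
        using gaussian_fourier[OF e[of n], of "\<xi> - y"] unfolding E_def by (simp add: has_bochner_integral_iff)
      finally show "cnj (g y) * (\<integral>x. cis (- (x \<bullet> y)) * (cis (x \<bullet> \<xi>) * of_real (E n x)) \<partial>lborel) = cnj (g y) * of_real ((pi / e n) powr (?d / 2) * exp (- (norm (\<xi> - y))\<^sup>2 / (4 * e n)))"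
        by simp
    qed simp
    also have "\<dots> = (sqrt (e n) ^ DIM('a)) *\<^sub>R (\<integral>k. cnj (g (\<xi> + sqrt (e n) *\<^sub>R k)) * of_real ((pi / e n) powr (?d / 2) * exp (- (norm (\<xi> - (\<xi> + sqrt (e n) *\<^sub>R k)))\<^sup>2 / (4 * e n))) \<partial>lborel)"
      using e[of n] by (subst integral_lborel_affine[of "sqrt (e n)"]) auto
    also have "\<dots> = (sqrt (e n) ^ DIM('a)) *\<^sub>R (\<integral>k. of_real ((pi / e n) powr (?d / 2)) * (cnj (g (\<xi> + sqrt (e n) *\<^sub>R k)) * of_real (exp (- (norm k)\<^sup>2 / 4))) \<partial>lborel)"
      using e[of n] by (simp add: power_mult_distrib mult_ac)
    also have "\<dots> = R n \<xi>"
    proof -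
      have "sqrt (e n) ^ DIM('a) * (pi / e n) powr (?d / 2) = pi powr (?d / 2)"
        using e[of n] by (simp add: powr_divide powr_half_sqrt[symmetric] powr_power)
      then have *: "of_real (sqrt (e n) ^ DIM('a)) * (of_real ((pi / e n) powr (?d / 2)) * z) = of_real (pi powr (?d / 2)) * z" for z :: complex
        by (metis mult.assoc of_real_mult)
      show ?thesis
        unfolding R_def scaleR_conv_of_real integral_mult_right_zero * ..
    qed
    finally show ?thesis .
  qed
  have EG2: "of_real (\<integral>x. E n x * (cmod (G x))\<^sup>2 \<partial>lborel) = (\<integral>\<xi>. g \<xi> * R n \<xi> \<partial>lborel)" for n
  proof -
    have "complex_of_real (E n x * (cmod (G x))\<^sup>2) = (E n x *\<^sub>R cnj (G x)) * G x" for x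
      unfolding of_real_mult complex_norm_square by (simp add: scaleR_conv_of_real)
    then have "of_real (\<integral>x. E n x * (cmod (G x))\<^sup>2 \<partial>lborel) = (\<integral>x. (E n x *\<^sub>R cnj (G x)) * G x \<partial>lborel)"
      unfolding integral_complex_of_real[symmetric] by (simp only:)
    also have "\<dots> = (\<integral>x. (E n x *\<^sub>R cnj (G x)) * (\<integral>y. cis (x \<bullet> y) * g y \<partial>lborel) \<partial>lborel)"
      by (simp only: G_def)
    also have "\<dots> = (\<integral>y. g y * (\<integral>x. cis (x \<bullet> y) * (E n x *\<^sub>R cnj (G x)) \<partial>lborel) \<partial>lborel)"
      by (rule Fubini_bounded_kernel[where C=1]) (use g iEG in auto)
    finally show ?thesis unfolding R .
  qed
  \<comment> \<open>This mass and the prefactor \<open>pi powr (?d / 2)\<close> of \<open>R\<close>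
    multiply to \<open>(2 * pi) ^ DIM('a)\<close>.\<close>
  have iK: "has_bochner_integral lborel (\<lambda>k::'a. exp (- (norm k)\<^sup>2 / 4)) ((4 * pi) powr (?d / 2))"
    using gaussian_integral[of "1/4", where 'a='a] by (simp add: mult.commute)
  have R_lim: "(\<lambda>n. R n \<xi>) \<longlonglongrightarrow> of_real ((2 * pi) ^ DIM('a)) * cnj (g \<xi>)" for \<xi>
  proof -
    have "(\<lambda>n. \<integral>k. cnj (g (\<xi> + sqrt (e n) *\<^sub>R k)) * of_real (exp (- (norm k)\<^sup>2 / 4)) \<partial>lborel)
       \<longlonglongrightarrow> (\<integral>k. cnj (g \<xi>) * of_real (exp (- (norm (k::'a))\<^sup>2 / 4)) \<partial>lborel)"
    proof (rule integral_dominated_convergence[where w="\<lambda>k. B * exp (- (norm k)\<^sup>2 / 4)"])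
      show "integrable lborel (\<lambda>k::'a. B * exp (- (norm k)\<^sup>2 / 4))"
        using iK by (simp add: has_bochner_integral_iff)
      show "AE k in lborel. (\<lambda>n. cnj (g (\<xi> + sqrt (e n) *\<^sub>R k)) * of_real (exp (- (norm k)\<^sup>2 / 4))) \<longlonglongrightarrow> cnj (g \<xi>) * of_real (exp (- (norm (k::'a))\<^sup>2 / 4))"
      proof (intro AE_I2 tendsto_intros)
        fix k :: 'a
        have "(\<lambda>n. \<xi> + sqrt (e n) *\<^sub>R k) \<longlonglongrightarrow> \<xi> + 0 *\<^sub>R k"
          unfolding e_def by (intro tendsto_intros sqrt_inverse_tendsto_0)
        then show "(\<lambda>n. g (\<xi> + sqrt (e n) *\<^sub>R k)) \<longlonglongrightarrow> g \<xi>"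
          using continuous_on_tendsto_compose[OF cont] by simp
      qed
      show "AE k in lborel. norm (cnj (g (\<xi> + sqrt (e n) *\<^sub>R k)) * of_real (exp (- (norm k)\<^sup>2 / 4))) \<le> B * exp (- (norm (k::'a))\<^sup>2 / 4)" for n
        using bdd by (auto simp: norm_mult intro!: mult_right_mono)
    qed measurable
    also have "(\<integral>k. cnj (g \<xi>) * of_real (exp (- (norm (k::'a))\<^sup>2 / 4)) \<partial>lborel) = cnj (g \<xi>) * of_real ((4 * pi) powr (?d / 2))"
      unfolding integral_mult_right_zero integral_complex_of_real using iK by (simp add: has_bochner_integral_iff)
    finally have "(\<lambda>n. R n \<xi>) \<longlonglongrightarrow> of_real (pi powr (?d / 2)) * (cnj (g \<xi>) * of_real ((4 * pi) powr (?d / 2)))"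
      unfolding R_def by (intro tendsto_intros)
    moreover have "pi powr (?d / 2) * (4 * pi) powr (?d / 2) = (2 * pi) ^ DIM('a)"
    proof -
      have "pi * (4 * pi) = (2 * pi) powr 2" by (simp add: power2_eq_square)
      then have "pi powr (?d / 2) * (4 * pi) powr (?d / 2) = ((2 * pi) powr 2) powr (?d / 2)"
        by (simp only: powr_mult[symmetric])
      also have "\<dots> = (2 * pi) powr ?d" by (subst powr_powr) simp
      finally show ?thesis by (simp add: powr_realpow)
    qed
    moreover have "complex_of_real a * (z * complex_of_real b) = complex_of_real (a * b) * z" for a b z by simp
    ultimately show ?thesis by (simp only:)
  qed
  have Rb: "cmod (R n \<xi>) \<le> pi powr (?d / 2) * (B * (4 * pi) powr (?d / 2))" for n \<xi>
  proof -
    have "cmod (\<integral>k. cnj (g (\<xi> + sqrt (e n) *\<^sub>R k)) * of_real (exp (- (norm k)\<^sup>2 / 4)) \<partial>lborel) \<le> (\<integral>k. B * exp (- (norm (k::'a))\<^sup>2 / 4) \<partial>lborel)"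
    proof (rule Bochner_Integration.integral_norm_bound_integral)
      show i: "integrable lborel (\<lambda>k::'a. B * exp (- (norm k)\<^sup>2 / 4))"
        using iK by (simp add: has_bochner_integral_iff)
      show "cmod (cnj (g (\<xi> + sqrt (e n) *\<^sub>R k)) * of_real (exp (- (norm k)\<^sup>2 / 4))) \<le> B * exp (- (norm (k::'a))\<^sup>2 / 4)" for k
        using bdd by (simp add: norm_mult mult_right_mono)
      then have *: "AE k in lborel. norm (cnj (g (\<xi> + sqrt (e n) *\<^sub>R k)) * of_real (exp (- (norm k)\<^sup>2 / 4))) \<le> norm (B * exp (- (norm (k::'a))\<^sup>2 / 4))"
        using B0 by (intro AE_I2) (simp add: abs_mult)
      show "integrable lborel (\<lambda>k::'a. cnj (g (\<xi> + sqrt (e n) *\<^sub>R k)) * of_real (exp (- (norm k)\<^sup>2 / 4)))"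
        by (rule Bochner_Integration.integrable_bound[OF i _ *]) measurable
    qed
    also have "\<dots> = B * (4 * pi) powr (?d / 2)" using iK by (simp add: has_bochner_integral_iff)
    finally show ?thesis unfolding R_def by (simp add: norm_mult mult_left_mono)
  qed
  have [measurable]: "R n \<in> borel_measurable borel" for n unfolding R_def by measurable
  have "(\<lambda>n. \<integral>\<xi>. g \<xi> * R n \<xi> \<partial>lborel) \<longlonglongrightarrow> (\<integral>\<xi>. g \<xi> * (of_real ((2 * pi) ^ DIM('a)) * cnj (g \<xi>)) \<partial>lborel)"
  proof (rule integral_dominated_convergence[where w="\<lambda>\<xi>. cmod (g \<xi>) * (pi powr (?d / 2) * (B * (4 * pi) powr (?d / 2)))"])
    show "AE \<xi> in lborel. (\<lambda>n. g \<xi> * R n \<xi>) \<longlonglongrightarrow> g \<xi> * (of_real ((2 * pi) ^ DIM('a)) * cnj (g \<xi>))"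
      by (intro AE_I2 tendsto_mult_left R_lim)
    show "AE \<xi> in lborel. norm (g \<xi> * R n \<xi>) \<le> cmod (g \<xi>) * (pi powr (?d / 2) * (B * (4 * pi) powr (?d / 2)))" for n
      using Rb by (auto simp: norm_mult intro!: mult_left_mono)
  qed (use g in auto)
  also have "(\<integral>\<xi>. g \<xi> * (of_real ((2 * pi) ^ DIM('a)) * cnj (g \<xi>)) \<partial>lborel) = of_real ((2 * pi) ^ DIM('a) * (\<integral>x. (cmod (g x))\<^sup>2 \<partial>lborel))"
  proof -
    have "z * (complex_of_real c * cnj z) = complex_of_real (c * (cmod z)\<^sup>2)" for z c
      unfolding of_real_mult complex_norm_square by (rule mult.left_commute)
    then show ?thesis by (simp only: integral_complex_of_real integral_mult_right_zero)
  qed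
  finally have lim: "(\<lambda>n. \<integral>x. E n x * (cmod (G x))\<^sup>2 \<partial>lborel) \<longlonglongrightarrow> (2 * pi) ^ DIM('a) * (\<integral>x. (cmod (g x))\<^sup>2 \<partial>lborel)"
    unfolding EG2[symmetric] tendsto_of_real_iff .
  have mono: "incseq (\<lambda>n. E n x * (cmod (G x))\<^sup>2)" for x
  proof (intro incseq_SucI mult_right_mono)
    fix n
    have "e (Suc n) \<le> e n" unfolding e_def by (simp add: field_simps)
    then show "E n x \<le> E (Suc n) x" unfolding E_def by (simp add: mult_right_mono)
  qed simp
  have ptw: "(\<lambda>n. E n x * (cmod (G x))\<^sup>2) \<longlonglongrightarrow> (cmod (G x))\<^sup>2" for x
    using tendsto_mult_right[OF gaussian_tendsto_1[of x], of "(cmod (G x))\<^sup>2"] unfolding E_def e_def by simp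
  show ?thesis
  proof (rule has_bochner_integral_monotone_convergence[OF iEG2 _ _ lim])
    show "AE x in lborel. mono (\<lambda>n. E n x * (cmod (G x))\<^sup>2)" by (intro AE_I2 mono)
    show "AE x in lborel. (\<lambda>n. E n x * (cmod (G x))\<^sup>2) \<longlonglongrightarrow> (cmod (G x))\<^sup>2" by (intro AE_I2 ptw)
  qed measurable
qed

section \<open>Test functions and their Fourier transforms\<close>

text \<open>Direction first, so that \<open>dirderiv v ^^ k\<close> is the derivative of order
  \<open>k\<close> along \<open>v\<close>.\<close>

definition dirderiv :: "'a::real_normed_vector \<Rightarrow> ('a \<Rightarrow> real) \<Rightarrow> 'a \<Rightarrow> real" where
  "dirderiv v f x = frechet_derivative f (at x) v"

lemma test_function_differentiable: "\<phi> \<in> test_functions \<Longrightarrow> \<phi> differentiable (at x)"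
  unfolding test_functions_def using C_k.simps(2)[of 0 \<phi>] by (auto simp: differentiable_on_def)

lemma test_function_continuous: "\<phi> \<in> test_functions \<Longrightarrow> continuous_on UNIV \<phi>"
  unfolding test_functions_def using C_k.simps(1)[of \<phi>] by auto

lemma test_function_measurable [measurable_dest]: "\<phi> \<in> test_functions \<Longrightarrow> \<phi> \<in> borel_measurable borel"
  by (intro borel_measurable_continuous_onI test_function_continuous)

lemma test_function_support:
  assumes "\<phi> \<in> test_functions"
  obtains R where "R > 0" "\<And>x. norm x > R \<Longrightarrow> \<phi> x = 0"
proof -
  have "bounded (support_on UNIV \<phi>)"
    using assms compact_imp_bounded[THEN bounded_subset, of _ "support_on UNIV \<phi>"] closure_subset unfolding test_functions_def by blast
  then obtain B where "\<forall>x\<in>support_on UNIV \<phi>. norm x \<le> B" by (auto simp: bounded_iff)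
  then have "\<And>x. norm x > max B 1 \<Longrightarrow> \<phi> x = 0" by (force simp: support_on_def)
  then show ?thesis using that[of "max B 1"] by simp
qed

lemma test_function_bounded:
  assumes "\<phi> \<in> test_functions"
  obtains B where "B > 0" "\<And>x. \<bar>\<phi> x\<bar> \<le> B"
proof -
  obtain R where R: "R > 0" "\<And>x. norm x > R \<Longrightarrow> \<phi> x = 0" using test_function_support[OF assms] by blast
  have "compact (\<phi> ` cball 0 R)"
    by (rule compact_continuous_image[OF continuous_on_subset[OF test_function_continuous[OF assms]] compact_cball]) simp
  from compact_imp_bounded[OF this] obtain B where B: "\<forall>y\<in>\<phi> ` cball 0 R. norm y \<le> B"
    unfolding bounded_iff by blast
  have "\<bar>\<phi> x\<bar> \<le> max B 1" for x
  proof (cases "norm x \<le> R")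
    case True
    then have "norm (\<phi> x) \<le> B" using B by (simp add: image_iff)
    then show ?thesis by simp
  next
    case False
    then show ?thesis using R(2)[of x] by simp
  qed
  then show ?thesis using that[of "max B 1"] by simp
qed

lemma integrable_indicator_cball: "integrable lborel (\<lambda>x::'a::euclidean_space. c * indicator (cball 0 R) x :: real)"
  by (intro integrable_mult_right integrable_real_indicator) (use emeasure_bounded_finite[OF bounded_cball] in auto)

lemma test_function_integrable:
  assumes "\<phi> \<in> test_functions"
  shows "integrable lborel \<phi>"
proof -
  note [measurable] = test_function_measurable[OF assms]
  obtain R where R: "R > 0" "\<And>x. norm x > R \<Longrightarrow> \<phi> x = 0" using test_function_support[OF assms] by blast
  obtain B where B: "B > 0" "\<And>x. \<bar>\<phi> x\<bar> \<le> B" using test_function_bounded[OF assms] by blast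
  show ?thesis
    by (rule Bochner_Integration.integrable_bound[OF integrable_indicator_cball[of B R]])
       (use R B in \<open>auto simp: indicator_def not_le abs_of_pos\<close>)
qed

text \<open>Where a function vanishes on an open set so does its derivative, hence the closed
  support cannot grow.\<close>

lemma dirderiv_test_function:
  fixes \<phi> :: "real ^ 'n \<Rightarrow> real"
  assumes "\<phi> \<in> test_functions"
  shows "dirderiv v \<phi> \<in> test_functions"
proof -
  have "C_k k (dirderiv v \<phi>)" for k
    using assms C_k.simps(2)[of k \<phi>] unfolding test_functions_def dirderiv_def by blast
  moreover have "support_on UNIV (dirderiv v \<phi>) \<subseteq> closure (support_on UNIV \<phi>)"
  proof
    fix x assume x: "x \<in> support_on UNIV (dirderiv v \<phi>)"
    show "x \<in> closure (support_on UNIV \<phi>)"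
    proof (rule ccontr)
      assume nx: "x \<notin> closure (support_on UNIV \<phi>)"
      have "((\<lambda>_. 0::real) has_derivative (\<lambda>_. 0)) (at x)" by simp
      then have "(\<phi> has_derivative (\<lambda>_. 0)) (at x)"
      proof (rule has_derivative_transform_within_open)
        show "open (- closure (support_on UNIV \<phi>))" by auto
        show "0 = \<phi> y" if "y \<in> - closure (support_on UNIV \<phi>)" for y
          using that closure_subset[of "support_on UNIV \<phi>"] by (auto simp: support_on_def)
      qed (use nx in auto)
      then have "dirderiv v \<phi> x = 0" unfolding dirderiv_def by (simp add: frechet_derivative_at[symmetric])
      then show False using x by (simp add: support_on_def)
    qed
  qed
  then have "bounded (support_on UNIV (dirderiv v \<phi>))"
    using assms compact_imp_bounded bounded_subset unfolding test_functions_def by blast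
  ultimately show ?thesis unfolding test_functions_def by (simp add: compact_closure)
qed

lemma dirderiv_power_test_function:
  fixes \<phi> :: "real ^ 'n \<Rightarrow> real"
  assumes "\<phi> \<in> test_functions"
  shows "(dirderiv v ^^ k) \<phi> \<in> test_functions"
  using assms by (induction k) (auto intro: dirderiv_test_function)

lemma test_function_add:
  fixes \<phi> \<psi> :: "real ^ 'n \<Rightarrow> real"
  assumes "\<phi> \<in> test_functions" "\<psi> \<in> test_functions"
  shows "(\<lambda>x. a * \<phi> x + b * \<psi> x) \<in> test_functions"
proof -
  have C: "C_k k f \<Longrightarrow> C_k k g \<Longrightarrow> C_k k (\<lambda>x. a * f x + b * g x)" for k and f g :: "real ^ 'n \<Rightarrow> real"
  proof (induction k arbitrary: f g)
    case (Suc k)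
    have d: "f differentiable (at x)" "g differentiable (at x)" for x
      using Suc.prems by (auto simp: differentiable_on_def)
    have "frechet_derivative (\<lambda>x. a * f x + b * g x) (at x) = (\<lambda>v. a * frechet_derivative f (at x) v + b * frechet_derivative g (at x) v)" for x
      by (rule frechet_derivative_at[symmetric])
         (intro has_derivative_add has_derivative_mult_right d[unfolded frechet_derivative_works])
    then show ?case using Suc d by (auto simp: differentiable_on_def)
  qed (auto intro!: continuous_intros)
  have "support_on UNIV (\<lambda>x. a * \<phi> x + b * \<psi> x) \<subseteq> closure (support_on UNIV \<phi>) \<union> closure (support_on UNIV \<psi>)"
  proof
    fix x assume "x \<in> support_on UNIV (\<lambda>x. a * \<phi> x + b * \<psi> x)"
    then have "\<phi> x \<noteq> 0 \<or> \<psi> x \<noteq> 0" by (auto simp: support_on_def)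
    then have "x \<in> support_on UNIV \<phi> \<union> support_on UNIV \<psi>" by (auto simp: support_on_def)
    then show "x \<in> closure (support_on UNIV \<phi>) \<union> closure (support_on UNIV \<psi>)"
      using closure_subset by blast
  qed
  moreover have "bounded (closure (support_on UNIV \<phi>) \<union> closure (support_on UNIV \<psi>))"
    using assms unfolding test_functions_def by (simp add: compact_imp_bounded)
  ultimately have "bounded (support_on UNIV (\<lambda>x. a * \<phi> x + b * \<psi> x))"
    by (rule bounded_subset[rotated])
  then show ?thesis using C assms unfolding test_functions_def by (simp add: compact_closure)
qed

lemma test_function_diff:
  fixes \<phi> \<psi> :: "real ^ 'n \<Rightarrow> real"
  assumes "\<phi> \<in> test_functions" "\<psi> \<in> test_functions"
  shows "(\<lambda>x. \<phi> x - \<psi> x) \<in> test_functions"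
  using test_function_add[OF assms, of 1 "-1"] by simp

lemma has_derivative_along_line:
  fixes \<phi> :: "real ^ 'n \<Rightarrow> real"
  assumes "\<phi> \<in> test_functions"
  shows "((\<lambda>t. \<phi> (x + t *\<^sub>R v)) has_real_derivative dirderiv v \<phi> (x + t *\<^sub>R v)) (at t)"
proof -
  have d: "(\<phi> has_derivative frechet_derivative \<phi> (at (x + t *\<^sub>R v))) (at (x + t *\<^sub>R v))"
    using test_function_differentiable[OF assms] frechet_derivative_works by blast
  have "((\<lambda>t. x + t *\<^sub>R v) has_derivative (\<lambda>h. h *\<^sub>R v)) (at t)"
    by (auto intro!: derivative_eq_intros)
  from has_derivative_compose[OF this, of \<phi>] d
  have "((\<lambda>t. \<phi> (x + t *\<^sub>R v)) has_derivative (\<lambda>h. frechet_derivative \<phi> (at (x + t *\<^sub>R v)) (h *\<^sub>R v))) (at t)"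
    by simp
  moreover have "frechet_derivative \<phi> (at (x + t *\<^sub>R v)) (h *\<^sub>R v) = h * dirderiv v \<phi> (x + t *\<^sub>R v)" for h
    using linear_scale[OF linear_frechet_derivative[OF test_function_differentiable[OF assms]]]
    by (simp add: dirderiv_def)
  ultimately show ?thesis by (simp add: has_field_derivative_def mult.commute[of _ "dirderiv _ _ _"])
qed

text \<open>Integration by parts, obtained by differentiating the translation invariance of the integral.\<close>

lemma fourier_integral_dirderiv:
  fixes \<phi> :: "real ^ 'n \<Rightarrow> real"
  assumes t: "\<phi> \<in> test_functions"
  shows "(\<integral>x. cis (- (x \<bullet> \<xi>)) * of_real (dirderiv v \<phi> x) \<partial>lborel) = \<i> * of_real (v \<bullet> \<xi>) * (\<integral>x. cis (- (x \<bullet> \<xi>)) * of_real (\<phi> x) \<partial>lborel)"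
proof -
  note [measurable] = test_function_measurable[OF t] test_function_measurable[OF dirderiv_test_function[OF t]]
  obtain R where R: "R > 0" "\<And>x. norm x > R \<Longrightarrow> \<phi> x = 0" using test_function_support[OF t] by blast
  obtain B where B: "B > 0" "\<And>x. \<bar>dirderiv v \<phi> x\<bar> \<le> B" using test_function_bounded[OF dirderiv_test_function[OF t]] by blast
  define h where "h n = 1 / real (Suc n)" for n
  have h: "h n > 0" "h n \<le> 1" for n by (auto simp: h_def)
  have hlim: "h \<longlonglongrightarrow> 0" unfolding h_def using LIMSEQ_inverse_real_of_nat by (simp add: inverse_eq_divide)
  have hlim': "filterlim h (at 0) sequentially"
    using hlim h by (auto simp: filterlim_at intro!: always_eventually) (metis less_irrefl)
  let ?J = "\<integral>x. cis (- (x \<bullet> \<xi>)) * of_real (\<phi> x) \<partial>lborel"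
  have i1: "integrable lborel (\<lambda>x. cis (- (x \<bullet> \<xi>)) * complex_of_real (\<phi> x))"
    using test_function_integrable[OF t] by (intro integrable_cis_mult) auto
  have i2: "integrable lborel (\<lambda>x. cis (- (x \<bullet> \<xi>)) * complex_of_real (\<phi> (x + w)))" for w
    using test_function_integrable[OF t] integrable_lborel_translation(1)[of \<phi> w] by (intro integrable_cis_mult) auto
  have "(\<lambda>n. \<integral>x. cis (- (x \<bullet> \<xi>)) * of_real ((\<phi> (x + h n *\<^sub>R v) - \<phi> x) / h n) \<partial>lborel) \<longlonglongrightarrow> (\<integral>x. cis (- (x \<bullet> \<xi>)) * of_real (dirderiv v \<phi> x) \<partial>lborel)"
  proof (rule integral_dominated_convergence[where w="\<lambda>x. B * indicator (cball 0 (R + norm v)) x"])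
    show "AE x in lborel. (\<lambda>n. cis (- (x \<bullet> \<xi>)) * of_real ((\<phi> (x + h n *\<^sub>R v) - \<phi> x) / h n)) \<longlonglongrightarrow> cis (- (x \<bullet> \<xi>)) * of_real (dirderiv v \<phi> x)"
    proof (intro AE_I2 tendsto_mult_left tendsto_of_real)
      fix x
      have "((\<lambda>k. (\<phi> (x + (0 + k) *\<^sub>R v) - \<phi> (x + 0 *\<^sub>R v)) / k) \<longlongrightarrow> dirderiv v \<phi> (x + 0 *\<^sub>R v)) (at 0)"
        using has_derivative_along_line[OF t, of x v 0] unfolding DERIV_def .
      from filterlim_compose[OF this hlim']
      show "(\<lambda>n. (\<phi> (x + h n *\<^sub>R v) - \<phi> x) / h n) \<longlonglongrightarrow> dirderiv v \<phi> x" by simp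
    qed
    show "AE x in lborel. norm (cis (- (x \<bullet> \<xi>)) * of_real ((\<phi> (x + h n *\<^sub>R v) - \<phi> x) / h n)) \<le> B * indicator (cball 0 (R + norm v)) x" for n
    proof (rule AE_I2)
      fix x
      have "\<bar>\<phi> (x + h n *\<^sub>R v) - \<phi> x\<bar> \<le> h n * B"
      proof -
        obtain z where "\<phi> (x + h n *\<^sub>R v) - \<phi> (x + 0 *\<^sub>R v) = (h n - 0) * dirderiv v \<phi> (x + z *\<^sub>R v)"
          using MVT2[of 0 "h n" "\<lambda>t. \<phi> (x + t *\<^sub>R v)" "\<lambda>t. dirderiv v \<phi> (x + t *\<^sub>R v)"] h has_derivative_along_line[OF t] by blast
        then show ?thesis using B(2)[of "x + z *\<^sub>R v"] h(1)[of n] by (simp add: abs_mult)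
      qed
      \<comment> \<open>Only steps \<open>h n \<le> 1\<close> occur, so all translates vanish
        outside the ball of radius \<open>R + norm v\<close>, which gives a common dominating
        function.\<close>
      moreover have "\<phi> (x + h n *\<^sub>R v) - \<phi> x = 0" if "norm x > R + norm v"
      proof -
        have "norm (h n *\<^sub>R v) \<le> norm v" using h[of n] by (simp add: mult_left_le_one_le)
        moreover have "norm x \<le> norm (x + h n *\<^sub>R v) + norm (h n *\<^sub>R v)" using norm_triangle_ineq4[of "x + h n *\<^sub>R v" "h n *\<^sub>R v"] by simp
        ultimately have "norm (x + h n *\<^sub>R v) > R" "norm x > R" using that norm_ge_zero[of v] by linarith+
        then show ?thesis using R by simp
      qed
      ultimately show "norm (cis (- (x \<bullet> \<xi>)) * of_real ((\<phi> (x + h n *\<^sub>R v) - \<phi> x) / h n)) \<le> B * indicator (cball 0 (R + norm v)) x"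
        using h[of n] B(1) by (auto simp: norm_mult indicator_def not_le field_simps simp del: of_real_divide of_real_diff)
    qed
  qed (use integrable_indicator_cball in auto)
  moreover have "(\<integral>x. cis (- (x \<bullet> \<xi>)) * of_real ((\<phi> (x + h n *\<^sub>R v) - \<phi> x) / h n) \<partial>lborel) = (cis (h n * (v \<bullet> \<xi>)) - 1) / of_real (h n) * ?J" for n
  proof -
    have "(\<integral>x. cis (- (x \<bullet> \<xi>)) * of_real (\<phi> (x + h n *\<^sub>R v)) \<partial>lborel)
      = (\<integral>x. cis (- ((x - h n *\<^sub>R v) \<bullet> \<xi>)) * of_real (\<phi> ((x - h n *\<^sub>R v) + h n *\<^sub>R v)) \<partial>lborel)"
      by (rule integral_lborel_translation(2)[symmetric])
    also have "\<dots> = (\<integral>x. cis (h n * (v \<bullet> \<xi>)) * (cis (- (x \<bullet> \<xi>)) * of_real (\<phi> x)) \<partial>lborel)"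
      by (intro Bochner_Integration.integral_cong) (auto simp: cis_mult mult.assoc[symmetric] inner_diff_left)
    finally have *: "(\<integral>x. cis (- (x \<bullet> \<xi>)) * of_real (\<phi> (x + h n *\<^sub>R v)) \<partial>lborel) = cis (h n * (v \<bullet> \<xi>)) * ?J" by simp
    have "(\<integral>x. cis (- (x \<bullet> \<xi>)) * of_real ((\<phi> (x + h n *\<^sub>R v) - \<phi> x) / h n) \<partial>lborel)
       = (\<integral>x. (cis (- (x \<bullet> \<xi>)) * of_real (\<phi> (x + h n *\<^sub>R v)) - cis (- (x \<bullet> \<xi>)) * of_real (\<phi> x)) / of_real (h n) \<partial>lborel)"
      by (intro Bochner_Integration.integral_cong) (auto simp: algebra_simps diff_divide_distrib)
    also have "\<dots> = (cis (h n * (v \<bullet> \<xi>)) * ?J - ?J) / of_real (h n)"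
      using i1 i2 * by simp
    finally show ?thesis by (simp add: algebra_simps diff_divide_distrib)
  qed
  moreover have "(\<lambda>n. (cis (h n * (v \<bullet> \<xi>)) - 1) / of_real (h n) * ?J) \<longlonglongrightarrow> \<i> * of_real (v \<bullet> \<xi>) * ?J"
  proof (rule tendsto_mult_right)
    have "((\<lambda>z. exp (\<i> * (z * of_real (v \<bullet> \<xi>)))) has_field_derivative (\<i> * of_real (v \<bullet> \<xi>))) (at 0)"
      by (auto intro!: derivative_eq_intros)
    then have 1: "((\<lambda>z. (exp (\<i> * ((0 + z) * of_real (v \<bullet> \<xi>))) - exp (\<i> * (0 * of_real (v \<bullet> \<xi>)))) / z) \<longlongrightarrow> \<i> * of_real (v \<bullet> \<xi>)) (at 0)"
      unfolding DERIV_def .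
    have "filterlim (\<lambda>n. complex_of_real (h n)) (at 0) sequentially"
      using tendsto_of_real[OF hlim, where 'a=complex] h by (auto simp: filterlim_at intro!: always_eventually) (metis less_irrefl)
    from filterlim_compose[OF 1 this]
    show "(\<lambda>n. (cis (h n * (v \<bullet> \<xi>)) - 1) / of_real (h n)) \<longlonglongrightarrow> \<i> * of_real (v \<bullet> \<xi>)"
      unfolding cis_conv_exp of_real_mult by simp
  qed
  ultimately have lims: "(\<lambda>n. (cis (h n * (v \<bullet> \<xi>)) - 1) / of_real (h n) * ?J) \<longlonglongrightarrow> (\<integral>x. cis (- (x \<bullet> \<xi>)) * of_real (dirderiv v \<phi> x) \<partial>lborel)"
    "(\<lambda>n. (cis (h n * (v \<bullet> \<xi>)) - 1) / of_real (h n) * ?J) \<longlonglongrightarrow> \<i> * of_real (v \<bullet> \<xi>) * ?J"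
    by (simp_all only:)
  show ?thesis by (rule LIMSEQ_unique[OF lims])
qed

section \<open>Decay of the Fourier transforms of test functions\<close>

abbreviation fourier_const :: "'n::finite itself \<Rightarrow> real" where
  "fourier_const _ \<equiv> (2 * pi) powr (- real CARD('n) / 2)"

lemma fourier_const_square: "(fourier_const TYPE('n::finite))\<^sup>2 * (2 * pi) ^ CARD('n) = 1"
proof -
  have "(fourier_const TYPE('n))\<^sup>2 = (2 * pi) powr (- real CARD('n))"
    by (simp add: power2_eq_square powr_add[symmetric])
  moreover have "(2 * pi) powr (- real CARD('n)) = 1 / (2 * pi) ^ CARD('n)"
    unfolding powr_minus_divide by (subst powr_realpow) auto
  ultimately show ?thesis by simp
qed

lemma fourier_integral_dirderiv_power:
  fixes \<phi> :: "real ^ 'n \<Rightarrow> real"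
  assumes "\<phi> \<in> test_functions"
  shows "(\<integral>x. cis (- (x \<bullet> \<xi>)) * of_real ((dirderiv v ^^ k) \<phi> x) \<partial>lborel) = (\<i> * of_real (v \<bullet> \<xi>)) ^ k * (\<integral>x. cis (- (x \<bullet> \<xi>)) * of_real (\<phi> x) \<partial>lborel)"
  by (induction k) (simp_all add: fourier_integral_dirderiv dirderiv_power_test_function[OF assms] mult.assoc)

lemma fourier_test_function_bound:
  fixes \<phi> :: "real ^ 'n \<Rightarrow> real"
  assumes "\<phi> \<in> test_functions"
  shows "\<bar>v \<bullet> \<xi>\<bar> ^ k * cmod (fourier (\<lambda>x. of_real (\<phi> x)) \<xi>) \<le> fourier_const TYPE('n) * (\<integral>x. \<bar>(dirderiv v ^^ k) \<phi> x\<bar> \<partial>lborel)"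
proof -
  have "\<bar>v \<bullet> \<xi>\<bar> ^ k * cmod (\<integral>x. cis (- (x \<bullet> \<xi>)) * of_real (\<phi> x) \<partial>lborel) = cmod (\<integral>x. cis (- (x \<bullet> \<xi>)) * of_real ((dirderiv v ^^ k) \<phi> x) \<partial>lborel)"
    unfolding fourier_integral_dirderiv_power[OF assms] by (simp add: norm_mult norm_power)
  also have "\<dots> \<le> (\<integral>x. \<bar>(dirderiv v ^^ k) \<phi> x\<bar> \<partial>lborel)"
    using norm_integral_cis_le[of "\<lambda>x. - (x \<bullet> \<xi>)" "\<lambda>x. of_real ((dirderiv v ^^ k) \<phi> x)"] by simp
  finally show ?thesis
    unfolding fourier_def norm_mult by (simp add: mult.left_commute mult_left_mono)
qed

text \<open>\<open>norm \<xi>\<close> is at most the dimension times its largest coordinate. The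
  maximum is then replaced by the sum, because each
  \<open>\<bar>b \<bullet> \<xi>\<bar> ^ (2 * N)\<close> is what integration by parts along
  \<open>b\<close> controls.\<close>

lemma one_plus_square_power_le:
  fixes \<xi> :: "'a::euclidean_space"
  shows "(1 + (norm \<xi>)\<^sup>2) ^ N \<le> 2 ^ N * (1 + real DIM('a) ^ (2 * N) * (\<Sum>b\<in>Basis. \<bar>b \<bullet> \<xi>\<bar> ^ (2 * N)))"
proof -
  define M where "M = Max ((\<lambda>b. \<bar>b \<bullet> \<xi>\<bar>) ` (Basis :: 'a set))"
  have Mb: "\<bar>b \<bullet> \<xi>\<bar> \<le> M" if "b \<in> Basis" for b unfolding M_def using that by (intro Max_ge) auto
  have "M \<in> (\<lambda>b. \<bar>b \<bullet> \<xi>\<bar>) ` (Basis :: 'a set)" unfolding M_def by (intro Max_in) auto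
  then obtain b0 where b0: "b0 \<in> Basis" "M = \<bar>b0 \<bullet> \<xi>\<bar>" by auto
  have "norm \<xi> \<le> (\<Sum>b\<in>Basis. \<bar>\<xi> \<bullet> b\<bar>)" by (rule norm_le_l1)
  also have "\<dots> \<le> (\<Sum>b\<in>(Basis::'a set). M)" by (intro sum_mono) (use Mb in \<open>simp add: inner_commute\<close>)
  finally have "norm \<xi> \<le> real DIM('a) * M" by simp
  then have "norm \<xi> ^ (2 * N) \<le> (real DIM('a) * M) ^ (2 * N)" by (intro power_mono) auto
  also have "\<dots> = real DIM('a) ^ (2 * N) * \<bar>b0 \<bullet> \<xi>\<bar> ^ (2 * N)" using b0 by (simp add: power_mult_distrib)
  also have "\<dots> \<le> real DIM('a) ^ (2 * N) * (\<Sum>b\<in>Basis. \<bar>b \<bullet> \<xi>\<bar> ^ (2 * N))"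
    using b0 by (intro mult_left_mono member_le_sum) auto
  finally have 1: "(norm \<xi>)^ (2 * N) \<le> real DIM('a) ^ (2 * N) * (\<Sum>b\<in>Basis. \<bar>b \<bullet> \<xi>\<bar> ^ (2 * N))" .
  have "(1 + (norm \<xi>)\<^sup>2) ^ N \<le> (2 * max 1 ((norm \<xi>)\<^sup>2)) ^ N" by (intro power_mono) auto
  also have "\<dots> = 2 ^ N * max 1 ((norm \<xi>)\<^sup>2) ^ N" by (simp add: power_mult_distrib)
  also have "max 1 ((norm \<xi>)\<^sup>2) ^ N \<le> 1 + (norm \<xi>) ^ (2 * N)"
    by (auto simp: max_def power_mult)
  finally have "(1 + (norm \<xi>)\<^sup>2) ^ N \<le> 2 ^ N * (1 + (norm \<xi>) ^ (2 * N))" by simp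
  also have "\<dots> \<le> 2 ^ N * (1 + real DIM('a) ^ (2 * N) * (\<Sum>b\<in>Basis. \<bar>b \<bullet> \<xi>\<bar> ^ (2 * N)))"
    using 1 by (intro mult_left_mono) auto
  finally show ?thesis .
qed

text \<open>The constant stays explicit in the integrals of derivatives, because
  \<open>damped_cutoff_fourier_decay\<close> needs one bound for a whole family of
  functions.\<close>

lemma fourier_test_function_decay:
  fixes \<phi> :: "real ^ 'n \<Rightarrow> real"
  assumes t: "\<phi> \<in> test_functions"
  shows "(1 + (norm \<xi>)\<^sup>2) ^ N * cmod (fourier (\<lambda>x. of_real (\<phi> x)) \<xi>)
    \<le> 2 ^ N * real CARD('n) ^ (2 * N) * fourier_const TYPE('n) *
       ((\<integral>x. \<bar>\<phi> x\<bar> \<partial>lborel) + (\<Sum>b\<in>Basis. \<integral>x. \<bar>(dirderiv b ^^ (2 * N)) \<phi> x\<bar> \<partial>lborel))"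
proof -
  let ?f = "cmod (fourier (\<lambda>x. of_real (\<phi> x)) \<xi>)" and ?c = "fourier_const TYPE('n)" and ?D = "real CARD('n) ^ (2 * N)"
  have D1: "1 \<le> ?D" by (simp add: one_le_power Suc_leI)
  have "(1 + (norm \<xi>)\<^sup>2) ^ N * ?f \<le> 2 ^ N * (1 + ?D * (\<Sum>b\<in>Basis. \<bar>b \<bullet> \<xi>\<bar> ^ (2 * N))) * ?f"
    using one_plus_square_power_le[of \<xi> N] by (intro mult_right_mono) auto
  also have "\<dots> = 2 ^ N * (?f + ?D * (\<Sum>b\<in>Basis. \<bar>b \<bullet> \<xi>\<bar> ^ (2 * N) * ?f))"
    by (simp only: sum_distrib_right[symmetric]) (simp add: algebra_simps)
  also have "\<dots> \<le> 2 ^ N * (?D * (?c * (\<integral>x. \<bar>\<phi> x\<bar> \<partial>lborel)) + ?D * (\<Sum>b\<in>Basis. ?c * (\<integral>x. \<bar>(dirderiv b ^^ (2 * N)) \<phi> x\<bar> \<partial>lborel)))"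
  proof (intro mult_left_mono add_mono sum_mono fourier_test_function_bound[OF t])
    have "?f \<le> ?c * (\<integral>x. \<bar>\<phi> x\<bar> \<partial>lborel)" using fourier_test_function_bound[OF t, of 0 \<xi> 0] by simp
    also have "\<dots> \<le> ?D * (?c * (\<integral>x. \<bar>\<phi> x\<bar> \<partial>lborel))"
      using mult_right_mono[OF D1, of "?c * (\<integral>x. \<bar>\<phi> x\<bar> \<partial>lborel)"] by simp
    finally show "?f \<le> ?D * (?c * (\<integral>x. \<bar>\<phi> x\<bar> \<partial>lborel))" .
  qed auto
  also have "\<dots> = 2 ^ N * ?D * ?c * ((\<integral>x. \<bar>\<phi> x\<bar> \<partial>lborel) + (\<Sum>b\<in>Basis. \<integral>x. \<bar>(dirderiv b ^^ (2 * N)) \<phi> x\<bar> \<partial>lborel))"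
    by (simp only: sum_distrib_left[symmetric]) (simp add: algebra_simps)
  finally show ?thesis .
qed

lemma fourier_test_function_decay_ex:
  fixes \<phi> :: "real ^ 'n \<Rightarrow> real"
  assumes t: "\<phi> \<in> test_functions"
  shows "\<exists>C>0. \<forall>\<xi>. cmod (fourier (\<lambda>x. of_real (\<phi> x)) \<xi>) \<le> C / (1 + (norm \<xi>)\<^sup>2) ^ N"
proof -
  define C where "C = 2 ^ N * real CARD('n) ^ (2 * N) * fourier_const TYPE('n) *
       ((\<integral>x. \<bar>\<phi> x\<bar> \<partial>lborel) + (\<Sum>b\<in>Basis. \<integral>x. \<bar>(dirderiv b ^^ (2 * N)) \<phi> x\<bar> \<partial>lborel))"
  have "cmod (fourier (\<lambda>x. of_real (\<phi> x)) \<xi>) \<le> max C 1 / (1 + (norm \<xi>)\<^sup>2) ^ N" for \<xi>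
  proof -
    have "(1 + (norm \<xi>)\<^sup>2) ^ N > 0" by (intro zero_less_power add_pos_nonneg) auto
    then show ?thesis
      using fourier_test_function_decay[OF t, of \<xi> N] unfolding C_def[symmetric] by (simp add: field_simps)
  qed
  then show ?thesis by (intro exI[of _ "max C 1"]) auto
qed

lemma continuous_fourier_test_function:
  fixes \<phi> :: "real ^ 'n \<Rightarrow> real"
  assumes t: "\<phi> \<in> test_functions"
  shows "continuous_on UNIV (fourier (\<lambda>x. of_real (\<phi> x)))"
proof -
  have "continuous_on UNIV ((\<lambda>y. \<integral>x. cis (x \<bullet> y) * complex_of_real (\<phi> x) \<partial>lborel) \<circ> uminus)"
    using test_function_integrable[OF t]
    by (intro continuous_on_compose continuous_on_subset[OF continuous_fourier_integral] continuous_intros) auto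
  then show ?thesis unfolding fourier_def by (intro continuous_intros) (simp add: o_def)
qed

lemma norm_powr_le: "t \<ge> 0 \<Longrightarrow> norm \<xi> powr t \<le> (1 + (norm \<xi>)\<^sup>2) powr (t / 2)"
proof -
  assume t: "t \<ge> 0"
  have "norm \<xi> powr t = ((norm \<xi>)\<^sup>2) powr (t / 2)"
    by (cases "norm \<xi> = 0") (simp_all add: powr_powr flip: powr_numeral)
  also have "\<dots> \<le> (1 + (norm \<xi>)\<^sup>2) powr (t / 2)" using t by (intro powr_mono2) auto
  finally show ?thesis .
qed

lemma continuous_norm_powr: "t > 0 \<Longrightarrow> continuous_on UNIV (\<lambda>\<xi>::'a::real_normed_vector. complex_of_real (norm \<xi> powr t))"
  by (intro continuous_on_of_real continuous_on_powr' continuous_intros) auto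

text \<open>Test functions decay to order \<open>2 * CARD('n)\<close> in
  \<open>1 + (norm \<xi>)\<^sup>2\<close>; half of this pays for the weight.\<close>

lemma weighted_fourier_decay:
  fixes \<phi> :: "real ^ 'n \<Rightarrow> real"
  assumes t: "\<phi> \<in> test_functions" and u: "0 \<le> u" "u < real CARD('n)"
  shows "\<exists>C>0. \<forall>\<xi>. cmod (of_real (norm \<xi> powr u) * fourier (\<lambda>x. of_real (\<phi> x)) \<xi>) \<le> C / (1 + (norm \<xi>)\<^sup>2) ^ CARD('n)"
proof -
  let ?N = "CARD('n)"
  obtain C where C: "C > 0" "\<And>\<xi>. cmod (fourier (\<lambda>x. of_real (\<phi> x)) \<xi>) \<le> C / (1 + (norm \<xi>)\<^sup>2) ^ (2 * ?N)"
    using fourier_test_function_decay_ex[OF t] by blast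
  have "cmod (of_real (norm \<xi> powr u) * fourier (\<lambda>x. of_real (\<phi> x)) \<xi>) \<le> C / (1 + (norm \<xi>)\<^sup>2) ^ ?N" for \<xi>
  proof -
    let ?y = "1 + (norm \<xi>)\<^sup>2"
    have y: "?y \<ge> 1" by simp
    have "norm \<xi> powr u \<le> ?y powr (u / 2)" using u by (intro norm_powr_le) auto
    also have "\<dots> \<le> ?y powr (real ?N)" using u y by (intro powr_mono) auto
    also have "\<dots> = ?y ^ ?N" using y by (intro powr_realpow) linarith
    finally have "cmod (of_real (norm \<xi> powr u) * fourier (\<lambda>x. of_real (\<phi> x)) \<xi>) \<le> ?y ^ ?N * (C / ?y ^ (2 * ?N))"
      unfolding norm_mult using C by (intro mult_mono) auto
    also have "\<dots> = C / ?y ^ ?N" using y by (simp add: mult_2 power_add)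
    finally show ?thesis .
  qed
  then show ?thesis using C by blast
qed

lemma integrable_inverse_nat_power:
  assumes "N > DIM('a) div 2"
  shows "integrable lborel (\<lambda>x::'a::euclidean_space. C / (1 + (norm x)\<^sup>2) ^ N)"
proof -
  have "integrable lborel (\<lambda>x::'a. C * (1 + (norm x)\<^sup>2) powr - real N)"
    using assms by (intro integrable_mult_right integrable_inverse_power) linarith
  moreover have "C * (1 + (norm x)\<^sup>2) powr - real N = C / (1 + (norm x)\<^sup>2) ^ N" for x :: 'a
    by (simp add: powr_minus_divide powr_realpow add_pos_nonneg)
  ultimately show ?thesis by simp
qed

text \<open>\<open>frac_laplacian_half\<close> is the inverse transform of this function, so
  Plancherel turns \<open>test_norm\<close> into its \<open>l2norm\<close>
  (\<open>test_norm_eq\<close>).\<close>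

definition weighted_fourier :: "real \<Rightarrow> (real ^ 'n \<Rightarrow> real) \<Rightarrow> real ^ 'n \<Rightarrow> complex" where
  "weighted_fourier s \<phi> \<xi> = of_real (norm \<xi> powr s) * fourier (\<lambda>x. of_real (\<phi> x)) \<xi>"

lemma
  fixes \<phi> :: "real ^ 'n \<Rightarrow> real"
  assumes t: "\<phi> \<in> test_functions" and s: "0 < s" "s < real CARD('n)"
  shows weighted_fourier_continuous: "continuous_on UNIV (weighted_fourier s \<phi>)"
    and weighted_fourier_bounded: "\<exists>B>0. \<forall>\<xi>. cmod (weighted_fourier s \<phi> \<xi>) \<le> B"
    and weighted_fourier_integrable: "integrable lborel (weighted_fourier s \<phi>)"
    and weighted_fourier_square_integrable: "square_integrable (weighted_fourier s \<phi>)"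
proof -
  let ?N = "CARD('n)"
  obtain C where C: "C > 0" "\<And>\<xi>. cmod (weighted_fourier s \<phi> \<xi>) \<le> C / (1 + (norm \<xi>)\<^sup>2) ^ ?N"
    using weighted_fourier_decay[OF t, of s] s unfolding weighted_fourier_def by auto
  show c: "continuous_on UNIV (weighted_fourier s \<phi>)"
    unfolding weighted_fourier_def by (intro continuous_on_mult continuous_norm_powr s continuous_fourier_test_function t)
  then have [measurable]: "weighted_fourier s \<phi> \<in> borel_measurable borel" by (rule borel_measurable_continuous_onI)
  have B: "cmod (weighted_fourier s \<phi> \<xi>) \<le> C" for \<xi>
  proof -
    have "C / (1 + (norm \<xi>)\<^sup>2) ^ ?N \<le> C / 1" using C by (intro divide_left_mono) (auto intro!: one_le_power zero_less_power add_pos_nonneg)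
    then show ?thesis using C(2)[of \<xi>] by simp
  qed
  then show "\<exists>B>0. \<forall>\<xi>. cmod (weighted_fourier s \<phi> \<xi>) \<le> B" using C by blast
  have iC: "integrable lborel (\<lambda>\<xi>::real^'n. C / (1 + (norm \<xi>)\<^sup>2) ^ ?N)"
    by (rule integrable_inverse_nat_power) (simp add: div_less_dividend)
  have C2: "AE \<xi> in lborel. norm (weighted_fourier s \<phi> \<xi>) \<le> norm (C / (1 + (norm \<xi>)\<^sup>2) ^ ?N)"
    using C by (intro AE_I2) (simp add: order_trans[OF _ abs_ge_self])
  show i: "integrable lborel (weighted_fourier s \<phi>)"
    by (rule Bochner_Integration.integrable_bound[OF iC _ C2]) measurable
  have C3: "AE \<xi> in lborel. norm ((cmod (weighted_fourier s \<phi> \<xi>))\<^sup>2) \<le> norm (C * cmod (weighted_fourier s \<phi> \<xi>))"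
    using B C(1) by (intro AE_I2) (simp add: abs_mult power2_eq_square mult_right_mono)
  have "integrable lborel (\<lambda>\<xi>. C * cmod (weighted_fourier s \<phi> \<xi>))" using i by simp
  then have "integrable lborel (\<lambda>\<xi>. (cmod (weighted_fourier s \<phi> \<xi>))\<^sup>2)"
    by (rule Bochner_Integration.integrable_bound[OF _ _ C3]) measurable
  then show "square_integrable (weighted_fourier s \<phi>)" unfolding square_integrable_def by simp
qed

lemma test_norm_eq:
  fixes \<phi> :: "real ^ 'n \<Rightarrow> real"
  assumes t: "\<phi> \<in> test_functions" and s: "0 < s" "s < real CARD('n)"
  shows "test_norm s \<phi> = l2norm (weighted_fourier s \<phi>)"
proof -
  let ?g = "weighted_fourier s \<phi>"
  let ?G = "\<lambda>x. \<integral>y. cis (x \<bullet> y) * ?g y \<partial>lborel"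
  obtain B where B: "\<And>\<xi>. cmod (?g \<xi>) \<le> B" using weighted_fourier_bounded[OF t s] by blast
  have P: "(\<integral>x. (cmod (?G x))\<^sup>2 \<partial>lborel) = (2 * pi) ^ CARD('n) * (\<integral>x. (cmod (?g x))\<^sup>2 \<partial>lborel)"
    using plancherel_integral[OF weighted_fourier_integrable[OF t s] weighted_fourier_continuous[OF t s] B]
    by (simp add: has_bochner_integral_iff)
  have f: "frac_laplacian_half s \<phi> x = of_real (fourier_const TYPE('n)) * ?G x" for x
    unfolding frac_laplacian_half_def inverse_fourier_def weighted_fourier_def ..
  have "(\<integral>x. norm (frac_laplacian_half s \<phi> x) powr 2 \<partial>lborel) = (\<integral>x. (fourier_const TYPE('n))\<^sup>2 * (cmod (?G x))\<^sup>2 \<partial>lborel)"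
    unfolding f by (intro Bochner_Integration.integral_cong) (auto simp: norm_mult power_mult_distrib powr_mult)
  also have "\<dots> = ((fourier_const TYPE('n))\<^sup>2 * (2 * pi) ^ CARD('n)) * (\<integral>x. (cmod (?g x))\<^sup>2 \<partial>lborel)"
    using P by simp
  also have "\<dots> = (\<integral>x. (cmod (?g x))\<^sup>2 \<partial>lborel)" unfolding fourier_const_square by simp
  finally show ?thesis
    unfolding test_norm_def Lp_norm_def l2norm_def by (simp add: powr_half_sqrt)
qed

lemma fourier_diff_test:
  fixes \<phi> \<psi> :: "real ^ 'n \<Rightarrow> real"
  assumes "\<phi> \<in> test_functions" "\<psi> \<in> test_functions"
  shows "fourier (\<lambda>x. of_real (a * \<phi> x + b * \<psi> x)) \<xi> = of_real a * fourier (\<lambda>x. of_real (\<phi> x)) \<xi> + of_real b * fourier (\<lambda>x. of_real (\<psi> x)) \<xi>"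
proof -
  have i: "integrable lborel (\<lambda>x. cis (- (x \<bullet> \<xi>)) * complex_of_real (\<phi> x))" "integrable lborel (\<lambda>x. cis (- (x \<bullet> \<xi>)) * complex_of_real (\<psi> x))"
    using assms[THEN test_function_integrable] by (auto intro!: integrable_cis_mult)
  have "(\<integral>x. cis (- (x \<bullet> \<xi>)) * of_real (a * \<phi> x + b * \<psi> x) \<partial>lborel) = (\<integral>x. of_real a * (cis (- (x \<bullet> \<xi>)) * of_real (\<phi> x)) + of_real b * (cis (- (x \<bullet> \<xi>)) * of_real (\<psi> x)) \<partial>lborel)"
    by (intro Bochner_Integration.integral_cong) (auto simp: algebra_simps)
  also have "\<dots> = of_real a * (\<integral>x. cis (- (x \<bullet> \<xi>)) * of_real (\<phi> x) \<partial>lborel) + of_real b * (\<integral>x. cis (- (x \<bullet> \<xi>)) * of_real (\<psi> x) \<partial>lborel)"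
    using i by simp
  finally show ?thesis unfolding fourier_def by (simp only: distrib_left mult.left_commute)
qed

lemma weighted_fourier_lincomb:
  fixes \<phi> \<psi> :: "real ^ 'n \<Rightarrow> real"
  assumes "\<phi> \<in> test_functions" "\<psi> \<in> test_functions"
  shows "weighted_fourier s (\<lambda>x. a * \<phi> x + b * \<psi> x) = (\<lambda>\<xi>. of_real a * weighted_fourier s \<phi> \<xi> + of_real b * weighted_fourier s \<psi> \<xi>)"
  unfolding weighted_fourier_def fourier_diff_test[OF assms] by (simp add: fun_eq_iff distrib_left mult.left_commute)

lemma weighted_fourier_diff:
  fixes \<phi> \<psi> :: "real ^ 'n \<Rightarrow> real"
  assumes "\<phi> \<in> test_functions" "\<psi> \<in> test_functions"
  shows "weighted_fourier s (\<lambda>x. \<phi> x - \<psi> x) = (\<lambda>\<xi>. weighted_fourier s \<phi> \<xi> - weighted_fourier s \<psi> \<xi>)"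
  using weighted_fourier_lincomb[OF assms, of s 1 "-1"] by simp

section \<open>Closability of the Sobolev norm\<close>

text \<open>Lets decay survive a shift: in \<open>mollify_approximates\<close> the loss
  \<open>1 + (norm y)\<^sup>2\<close> is absorbed by a moment of the Gaussian kernel.\<close>

lemma Peetre_inequality:
  fixes x y :: "'a::real_inner"
  shows "1 + (norm x)\<^sup>2 \<le> 2 * (1 + (norm (x - y))\<^sup>2) * (1 + (norm y)\<^sup>2)"
proof -
  have "norm x \<le> norm (x - y) + norm y" using norm_triangle_ineq[of "x - y" y] by simp
  then have "(norm x)\<^sup>2 \<le> (norm (x - y) + norm y)\<^sup>2" by (intro power_mono) auto
  also have "\<dots> \<le> 2 * (norm (x - y))\<^sup>2 + 2 * (norm y)\<^sup>2"
    using sum_squares_bound[of "norm (x - y)" "norm y"] by (simp add: power2_sum)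
  finally have 1: "(norm x)\<^sup>2 \<le> 2 * (norm (x - y))\<^sup>2 + 2 * (norm y)\<^sup>2" .
  have "2 * (1 + (norm (x - y))\<^sup>2) * (1 + (norm y)\<^sup>2) = 2 + 2 * (norm (x - y))\<^sup>2 + 2 * (norm y)\<^sup>2 + 2 * ((norm (x - y))\<^sup>2 * (norm y)\<^sup>2)"
    by (simp add: algebra_simps)
  moreover have "0 \<le> (norm (x - y))\<^sup>2 * (norm y)\<^sup>2" by simp
  ultimately show ?thesis using 1 by linarith
qed

section \<open>Gaussian mollification in frequency space\<close>

definition gauss_kernel :: "'a::euclidean_space \<Rightarrow> real" where
  "gauss_kernel k = (4 * pi) powr (- real DIM('a) / 2) * exp (- (norm k)\<^sup>2 / 4)"

lemma gauss_kernel_nonneg [simp]: "gauss_kernel k \<ge> 0"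
  by (simp add: gauss_kernel_def)

lemma gauss_kernel_measurable [measurable]: "gauss_kernel \<in> borel_measurable borel"
  unfolding gauss_kernel_def by measurable

text \<open>\<open>gauss_kernel\<close> is the heat kernel at time 1, so the instance
  \<open>\<tau> = 1 / 4\<close> of the Gaussian formula gives a transform free of constants.\<close>

lemma gauss_kernel_fourier:
  fixes y :: "'a::euclidean_space"
  shows "has_bochner_integral lborel (\<lambda>k. cis (k \<bullet> y) * of_real (gauss_kernel k)) (of_real (exp (- (norm y)\<^sup>2)))"
proof -
  let ?c = "(4 * pi) powr (- real DIM('a) / 2)"
  have "has_bochner_integral lborel (\<lambda>k::'a. of_real ?c * (cis (k \<bullet> y) * of_real (exp (- (1/4) * (norm k)\<^sup>2))))
     (of_real ?c * of_real ((pi / (1/4)) powr (real DIM('a) / 2) * exp (- (norm y)\<^sup>2 / (4 * (1/4)))))"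
    by (intro has_bochner_integral_mult_right gaussian_fourier) simp
  moreover have "?c * ((pi / (1/4)) powr (real DIM('a) / 2) * exp (- (norm y)\<^sup>2 / (4 * (1/4)))) = exp (- (norm y)\<^sup>2)"
    by (simp add: mult.assoc[symmetric] powr_add[symmetric] mult.commute[of pi])
  moreover have "of_real ?c * (cis (k \<bullet> y) * of_real (exp (- (1/4) * (norm k)\<^sup>2))) = cis (k \<bullet> y) * of_real (gauss_kernel k)" for k :: 'a
    unfolding gauss_kernel_def by simp
  ultimately show ?thesis by (simp only: of_real_mult[symmetric])
qed

lemma gauss_kernel_integral: "has_bochner_integral lborel (gauss_kernel :: 'a::euclidean_space \<Rightarrow> real) 1"
  using has_bochner_integral_Re[OF gauss_kernel_fourier[of "0::'a"]] by simp

text \<open>By \<open>(1 + t / N) ^ N \<le> exp t\<close> with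
  \<open>t = (norm k)\<^sup>2 / 8\<close> the polynomial costs half of the exponent
  \<open>(norm k)\<^sup>2 / 4\<close>; the other half stays integrable.\<close>

lemma gauss_kernel_moment:
  assumes N: "N > 0"
  shows "integrable lborel (\<lambda>k::'a::euclidean_space. (1 + (norm k)\<^sup>2) ^ N * gauss_kernel k)"
proof -
  let ?c = "(4 * pi) powr (- real DIM('a) / 2)"
  have i: "integrable lborel (\<lambda>k::'a. (8 * real N) ^ N * (?c * exp (- (1/8) * (norm k)\<^sup>2)))"
    using gaussian_integral[of "1/8", where 'a='a] by (intro integrable_mult_right) (auto simp: has_bochner_integral_iff)
  have "(1 + (norm k)\<^sup>2) ^ N * gauss_kernel k \<le> (8 * real N) ^ N * (?c * exp (- (1/8) * (norm k)\<^sup>2))" for k :: 'a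
  proof -
    have "1 + (norm k)\<^sup>2 \<le> (8 * real N) * (1 + ((norm k)\<^sup>2 / 8) / real N)"
      using N by (simp add: field_simps)
    then have "(1 + (norm k)\<^sup>2) ^ N \<le> ((8 * real N) * (1 + ((norm k)\<^sup>2 / 8) / real N)) ^ N"
      by (intro power_mono) auto
    also have "\<dots> = (8 * real N) ^ N * (1 + ((norm k)\<^sup>2 / 8) / real N) ^ N" by (rule power_mult_distrib)
    also have "\<dots> \<le> (8 * real N) ^ N * exp ((norm k)\<^sup>2 / 8)"
      using N by (intro mult_left_mono exp_ge_one_plus_x_over_n_power_n)
        (auto intro: order_trans[of _ 0])
    finally have "(1 + (norm k)\<^sup>2) ^ N * gauss_kernel k \<le> ((8 * real N) ^ N * exp ((norm k)\<^sup>2 / 8)) * gauss_kernel k"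
      by (intro mult_right_mono) auto
    also have "\<dots> = (8 * real N) ^ N * (?c * (exp ((norm k)\<^sup>2 / 8) * exp (- (norm k)\<^sup>2 / 4)))"
      unfolding gauss_kernel_def by simp
    also have "exp ((norm k)\<^sup>2 / 8) * exp (- (norm k)\<^sup>2 / 4) = exp (- (1/8) * (norm k)\<^sup>2)"
      unfolding exp_add[symmetric] by (simp add: field_simps)
    finally show ?thesis .
  qed
  then have b: "AE k in lborel. norm ((1 + (norm k)\<^sup>2) ^ N * gauss_kernel k) \<le> norm ((8 * real N) ^ N * (?c * exp (- (1/8) * (norm (k::'a))\<^sup>2)))"
    by (intro AE_I2) (simp add: abs_mult)
  show ?thesis
    by (rule Bochner_Integration.integrable_bound[OF i _ b]) measurable
qed

text \<open>Convolution with the heat kernel at time \<open>e\<close>, rescaled so that the kernel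
  is fixed and the width \<open>sqrt e\<close> enters the argument of \<open>q\<close>.\<close>

definition mollify :: "real \<Rightarrow> ('a::euclidean_space \<Rightarrow> complex) \<Rightarrow> 'a \<Rightarrow> complex" where
  "mollify e q \<xi> = (\<integral>k. of_real (gauss_kernel k) * q (\<xi> - sqrt e *\<^sub>R k) \<partial>lborel)"

lemma mollify_measurable [measurable]:
  assumes [measurable]: "q \<in> borel_measurable borel"
  shows "mollify e q \<in> borel_measurable borel"
  unfolding mollify_def by measurable

lemma mollify_product_integrable:
  fixes q :: "'a::euclidean_space \<Rightarrow> complex"
  assumes q: "integrable lborel q"
  shows "integrable (lborel \<Otimes>\<^sub>M lborel) (\<lambda>(k, \<xi>). of_real (gauss_kernel k) * q (\<xi> - sqrt e *\<^sub>R k))"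
proof (rule lborel_pair.Fubini_integrable)
  have [measurable]: "q \<in> borel_measurable borel" using q by auto
  show "(\<lambda>(k, \<xi>). of_real (gauss_kernel k) * q (\<xi> - sqrt e *\<^sub>R k)) \<in> borel_measurable (lborel \<Otimes>\<^sub>M lborel)"
    by measurable
  have "(\<integral>\<xi>. cmod (q (\<xi> - sqrt e *\<^sub>R k)) \<partial>lborel) = (\<integral>\<xi>. cmod (q \<xi>) \<partial>lborel)" for k
    by (rule integral_lborel_translation(2))
  then show "integrable lborel (\<lambda>k. \<integral>\<xi>. norm (case (k, \<xi>) of (k, \<xi>) \<Rightarrow> of_real (gauss_kernel k) * q (\<xi> - sqrt e *\<^sub>R k)) \<partial>lborel)"
    using gauss_kernel_integral[where 'a='a] by (simp add: norm_mult has_bochner_integral_iff)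
  show "AE k in lborel. integrable lborel (\<lambda>\<xi>. case (k, \<xi>) of (k, \<xi>) \<Rightarrow> of_real (gauss_kernel k) * q (\<xi> - sqrt e *\<^sub>R k))"
    using q integrable_lborel_translation(2)[of q] by simp
qed

lemma mollify_integrable:
  assumes q: "integrable lborel q"
  shows "integrable lborel (mollify e q)"
  using lborel_pair.integrable_snd[OF mollify_product_integrable[OF q]] unfolding mollify_def .

text \<open>Convolution in frequency is multiplication by a Gaussian in space. This Gaussian is the
  weight against which a null sequence in the critical Lebesgue space can be tested
  (\<open>gaussian_weighted_null\<close>).\<close>

lemma fourier_mollify:
  fixes q :: "'a::euclidean_space \<Rightarrow> complex"
  assumes q: "integrable lborel q" and e: "e \<ge> 0"
  shows "(\<integral>\<xi>. cis (x \<bullet> \<xi>) * mollify e q \<xi> \<partial>lborel) = of_real (exp (- e * (norm x)\<^sup>2)) * (\<integral>\<xi>. cis (x \<bullet> \<xi>) * q \<xi> \<partial>lborel)"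
proof -
  have [measurable]: "q \<in> borel_measurable borel" using q by auto
  let ?f = "\<lambda>k \<xi>. cis (x \<bullet> \<xi>) * (of_real (gauss_kernel k) * q (\<xi> - sqrt e *\<^sub>R k))"
  let ?Q = "\<integral>\<xi>. cis (x \<bullet> \<xi>) * q \<xi> \<partial>lborel"
  have b: "AE z in lborel \<Otimes>\<^sub>M lborel. norm (case z of (k, \<xi>) \<Rightarrow> ?f k \<xi>) \<le> norm (case z of (k, \<xi>) \<Rightarrow> of_real (gauss_kernel k) * q (\<xi> - sqrt e *\<^sub>R k))"
    by (intro AE_I2) (simp add: norm_mult split: prod.split)
  have i: "integrable (lborel \<Otimes>\<^sub>M lborel) (\<lambda>(k, \<xi>). ?f k \<xi>)"
    by (rule Bochner_Integration.integrable_bound[OF mollify_product_integrable[OF q, of e] _ b]) measurable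
  have "(\<integral>\<xi>. cis (x \<bullet> \<xi>) * mollify e q \<xi> \<partial>lborel) = (\<integral>\<xi>. (\<integral>k. ?f k \<xi> \<partial>lborel) \<partial>lborel)"
    unfolding mollify_def by simp
  also have "\<dots> = (\<integral>k. (\<integral>\<xi>. ?f k \<xi> \<partial>lborel) \<partial>lborel)"
    by (rule lborel_pair.Fubini_integral[OF i])
  also have "\<dots> = (\<integral>k. (cis (k \<bullet> (sqrt e *\<^sub>R x)) * of_real (gauss_kernel k)) * ?Q \<partial>lborel)"
  proof (intro Bochner_Integration.integral_cong refl)
    fix k
    have "(\<integral>\<xi>. ?f k \<xi> \<partial>lborel) = of_real (gauss_kernel k) * (\<integral>\<xi>. cis (x \<bullet> \<xi>) * q (\<xi> - sqrt e *\<^sub>R k) \<partial>lborel)"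
      by (simp add: mult.left_commute)
    also have "(\<integral>\<xi>. cis (x \<bullet> \<xi>) * q (\<xi> - sqrt e *\<^sub>R k) \<partial>lborel) = (\<integral>\<xi>. cis (x \<bullet> (\<xi> + sqrt e *\<^sub>R k)) * q ((\<xi> + sqrt e *\<^sub>R k) - sqrt e *\<^sub>R k) \<partial>lborel)"
      by (rule integral_lborel_translation(1)[symmetric])
    also have "\<dots> = (\<integral>\<xi>. cis (k \<bullet> (sqrt e *\<^sub>R x)) * (cis (x \<bullet> \<xi>) * q \<xi>) \<partial>lborel)"
      by (intro Bochner_Integration.integral_cong refl)
         (simp add: inner_add_right cis_mult[symmetric] inner_commute[of k] mult_ac)
    also have "\<dots> = cis (k \<bullet> (sqrt e *\<^sub>R x)) * ?Q" by simp
    finally show "(\<integral>\<xi>. ?f k \<xi> \<partial>lborel) = (cis (k \<bullet> (sqrt e *\<^sub>R x)) * of_real (gauss_kernel k)) * ?Q" by simp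
  qed
  also have "\<dots> = of_real (exp (- (norm (sqrt e *\<^sub>R x))\<^sup>2)) * ?Q"
    using gauss_kernel_fourier[of "sqrt e *\<^sub>R x"] by (simp add: has_bochner_integral_iff)
  also have "(norm (sqrt e *\<^sub>R x))\<^sup>2 = e * (norm x)\<^sup>2" using e by (simp add: power_mult_distrib)
  finally show ?thesis by simp
qed

text \<open>As \<theta> is real, conjugating its transform flips the phase; the multiplication
  formula then puts the transform on the mollified \<open>q\<close>.\<close>

lemma pairing_mollify:
  fixes q :: "real ^ 'n \<Rightarrow> complex"
  assumes q: "integrable lborel q" and \<theta>: "\<theta> \<in> test_functions" and e: "e \<ge> 0"
  shows "(\<integral>\<xi>. mollify e q \<xi> * cnj (fourier (\<lambda>x. of_real (\<theta> x)) \<xi>) \<partial>lborel)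
    = of_real (fourier_const TYPE('n)) * (\<integral>x. of_real (\<theta> x) * (of_real (exp (- e * (norm x)\<^sup>2)) * (\<integral>\<xi>. cis (x \<bullet> \<xi>) * q \<xi> \<partial>lborel)) \<partial>lborel)"
proof -
  have "cnj (fourier (\<lambda>x. of_real (\<theta> x)) \<xi>) = of_real (fourier_const TYPE('n)) * (\<integral>x. cis (x \<bullet> \<xi>) * of_real (\<theta> x) \<partial>lborel)" for \<xi>
    unfolding fourier_def by (simp add: Bochner_Integration.integral_cnj[symmetric] cis_cnj del: Bochner_Integration.integral_cnj)
  then have "(\<integral>\<xi>. mollify e q \<xi> * cnj (fourier (\<lambda>x. of_real (\<theta> x)) \<xi>) \<partial>lborel) = of_real (fourier_const TYPE('n)) * (\<integral>\<xi>. mollify e q \<xi> * (\<integral>x. cis (x \<bullet> \<xi>) * of_real (\<theta> x) \<partial>lborel) \<partial>lborel)"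
    by (simp only: integral_mult_right_zero[symmetric] mult.left_commute)
  also have "(\<integral>\<xi>. mollify e q \<xi> * (\<integral>x. cis (x \<bullet> \<xi>) * of_real (\<theta> x) \<partial>lborel) \<partial>lborel) = (\<integral>x. of_real (\<theta> x) * (\<integral>\<xi>. cis (x \<bullet> \<xi>) * mollify e q \<xi> \<partial>lborel) \<partial>lborel)"
    by (rule Fubini_bounded_kernel[where C=1]) (use mollify_integrable[OF q] test_function_integrable[OF \<theta>] in auto)
  finally show ?thesis unfolding fourier_mollify[OF q e] .
qed

text \<open>The factor \<open>norm \<xi> powr - s\<close> compensates the weight in the transforms
  \<open>weighted_fourier s (\<theta> m)\<close> with which \<open>V n\<close> is paired and of
  which only the \<open>l2norm\<close> is bounded. Its square is integrable at 0 because
  \<open>2 * s\<close> is below the dimension.\<close>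

lemma mollify_approximates:
  fixes q :: "real ^ 'n \<Rightarrow> complex"
  assumes s: "0 < s" "s < real CARD('n) / 2" and cont: "continuous_on UNIV q"
    and dec: "\<And>\<xi>. cmod (q \<xi>) \<le> C / (1 + (norm \<xi>)\<^sup>2) ^ CARD('n)"
  defines "V \<equiv> \<lambda>n \<xi>. (q \<xi> - mollify (1 / real (Suc n)) q \<xi>) * of_real (norm \<xi> powr - s)"
  shows "square_integrable (V n)" "(\<lambda>n. l2norm (V n)) \<longlonglongrightarrow> 0"
proof -
  let ?N = "CARD('n)"
  define e where "e n = 1 / real (Suc n)" for n
  have e: "0 < e n" "e n \<le> 1" for n by (auto simp: e_def)
  have [measurable]: "q \<in> borel_measurable borel" using cont by (rule borel_measurable_continuous_onI)
  have [measurable]: "V n \<in> borel_measurable borel" for n unfolding V_def by measurable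
  have pos: "(1 + (norm x)\<^sup>2) ^ ?N > 0" for x :: "real^'n" by (intro zero_less_power add_pos_nonneg) auto
  have ge1: "(1 + (norm x)\<^sup>2) ^ ?N \<ge> 1" for x :: "real^'n" by (intro one_le_power) auto
  have C0: "C \<ge> 0" using order_trans[OF norm_ge_zero dec[of 0]] by simp
  have qC: "cmod (q x) \<le> C" for x
    using dec[of x] divide_left_mono[OF ge1[of x] C0] pos[of x] by simp
  \<comment> \<open>The power of 2 and the moment are what \<open>Peetre_inequality\<close> costs
    when decay is moved from \<open>\<xi> - sqrt (e n) *\<^sub>R k\<close> to
    \<open>\<xi>\<close>.\<close>
  define K where "K = 2 ^ ?N * (\<integral>k. (1 + (norm (k::real^'n))\<^sup>2) ^ ?N * gauss_kernel k \<partial>lborel)"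
  have K0: "K \<ge> 0" unfolding K_def by (intro mult_nonneg_nonneg Bochner_Integration.integral_nonneg) auto
  have mb: "cmod (mollify (e n) q \<xi>) \<le> C * K / (1 + (norm \<xi>)\<^sup>2) ^ ?N" for n \<xi>
  proof -
    let ?w = "C * 2 ^ ?N / (1 + (norm \<xi>)\<^sup>2) ^ ?N"
    have "cmod (of_real (gauss_kernel k) * q (\<xi> - sqrt (e n) *\<^sub>R k)) \<le> ?w * ((1 + (norm k)\<^sup>2) ^ ?N * gauss_kernel k)" for k
    proof -
      have "norm (sqrt (e n) *\<^sub>R k) \<le> norm k" using e[of n] by (simp add: mult_left_le_one_le)
      then have "1 + (norm (sqrt (e n) *\<^sub>R k))\<^sup>2 \<le> 1 + (norm k)\<^sup>2" by (simp add: power_mono)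
      then have "1 + (norm \<xi>)\<^sup>2 \<le> 2 * (1 + (norm (\<xi> - sqrt (e n) *\<^sub>R k))\<^sup>2) * (1 + (norm k)\<^sup>2)"
        using Peetre_inequality[of \<xi> "sqrt (e n) *\<^sub>R k"] by (elim order_trans) (intro mult_left_mono, auto)
      then have "(1 + (norm \<xi>)\<^sup>2) ^ ?N \<le> (2 * (1 + (norm (\<xi> - sqrt (e n) *\<^sub>R k))\<^sup>2) * (1 + (norm k)\<^sup>2)) ^ ?N"
        by (intro power_mono) auto
      then have "1 / (1 + (norm (\<xi> - sqrt (e n) *\<^sub>R k))\<^sup>2) ^ ?N \<le> 2 ^ ?N * (1 + (norm k)\<^sup>2) ^ ?N / (1 + (norm \<xi>)\<^sup>2) ^ ?N"
      proof -
        have *: "1 / b \<le> t * c / X" if "X \<le> t * b * c" "b > 0" "X > 0" for X t b c :: real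
          using that by (simp add: field_simps)
        assume "(1 + (norm \<xi>)\<^sup>2) ^ ?N \<le> (2 * (1 + (norm (\<xi> - sqrt (e n) *\<^sub>R k))\<^sup>2) * (1 + (norm k)\<^sup>2)) ^ ?N"
        then show ?thesis unfolding power_mult_distrib by (intro * pos)
      qed
      then have "C * (1 / (1 + (norm (\<xi> - sqrt (e n) *\<^sub>R k))\<^sup>2) ^ ?N) \<le> C * (2 ^ ?N * (1 + (norm k)\<^sup>2) ^ ?N / (1 + (norm \<xi>)\<^sup>2) ^ ?N)"
        using C0 by (intro mult_left_mono)
      then have "cmod (q (\<xi> - sqrt (e n) *\<^sub>R k)) \<le> ?w * (1 + (norm k)\<^sup>2) ^ ?N"
        using dec[of "\<xi> - sqrt (e n) *\<^sub>R k"] by simp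
      from mult_left_mono[OF this gauss_kernel_nonneg[of k]] show ?thesis by (simp add: norm_mult mult_ac)
    qed
    then have "cmod (mollify (e n) q \<xi>) \<le> (\<integral>k. ?w * ((1 + (norm (k::real^'n))\<^sup>2) ^ ?N * gauss_kernel k) \<partial>lborel)"
    proof -
      assume b: "\<And>k. cmod (of_real (gauss_kernel k) * q (\<xi> - sqrt (e n) *\<^sub>R k)) \<le> ?w * ((1 + (norm k)\<^sup>2) ^ ?N * gauss_kernel k)"
      have i: "integrable lborel (\<lambda>k::real^'n. ?w * ((1 + (norm k)\<^sup>2) ^ ?N * gauss_kernel k))"
        by (intro integrable_mult_right gauss_kernel_moment) simp
      have b': "AE k in lborel. norm (of_real (gauss_kernel k) * q (\<xi> - sqrt (e n) *\<^sub>R k)) \<le> norm (?w * ((1 + (norm k)\<^sup>2) ^ ?N * gauss_kernel k))"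
        unfolding real_norm_def by (intro AE_I2 order_trans[OF b abs_ge_self])
      have i2: "integrable lborel (\<lambda>k. of_real (gauss_kernel k) * q (\<xi> - sqrt (e n) *\<^sub>R k))"
        by (rule Bochner_Integration.integrable_bound[OF i _ b']) measurable
      show ?thesis unfolding mollify_def
        using order_trans[OF integral_norm_bound integral_mono[OF integrable_norm[OF i2] i b]] .
    qed
    then show ?thesis unfolding K_def integral_mult_right_zero by simp
  qed
  define W where "W \<xi> = (C * (1 + K))\<^sup>2 * (norm \<xi> powr (- 2 * s) * (1 + (norm \<xi>)\<^sup>2) powr - (2 * real ?N))" for \<xi> :: "real^'n"
  have iW: "integrable lborel W" unfolding W_def
    using s by (intro integrable_mult_right integrable_riesz_inverse_power) auto
  have VW: "(cmod (V n \<xi>))\<^sup>2 \<le> W \<xi>" for n \<xi>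
  proof -
    let ?y = "1 + (norm \<xi>)\<^sup>2"
    have y: "?y > 0" by (simp add: add_pos_nonneg)
    have "cmod (q \<xi> - mollify (e n) q \<xi>) \<le> C / ?y ^ ?N + C * K / ?y ^ ?N"
      using norm_triangle_ineq4[of "q \<xi>" "mollify (e n) q \<xi>"] dec[of \<xi>] mb[of n \<xi>] by linarith
    also have "\<dots> = C * (1 + K) / ?y ^ ?N" by (simp add: algebra_simps add_divide_distrib)
    finally have "cmod (V n \<xi>) \<le> C * (1 + K) / ?y ^ ?N * norm \<xi> powr - s"
      unfolding V_def e_def[symmetric] norm_mult using C0 K0 y
      by (intro mult_mono) (auto intro!: divide_nonneg_nonneg mult_nonneg_nonneg)
    then have "(cmod (V n \<xi>))\<^sup>2 \<le> (C * (1 + K) / ?y ^ ?N * norm \<xi> powr - s)\<^sup>2" by (intro power_mono) auto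
    also have "\<dots> = (C * (1 + K))\<^sup>2 * ((norm \<xi> powr - s)\<^sup>2 * (1 / (?y ^ ?N)\<^sup>2))"
      by (simp add: power_mult_distrib power_divide)
    also have "(norm \<xi> powr - s)\<^sup>2 = norm \<xi> powr (- 2 * s)"
      by (simp add: power2_eq_square powr_add[symmetric])
    also have "1 / (?y ^ ?N)\<^sup>2 = ?y powr - (2 * real ?N)"
    proof -
      have "?y powr (2 * real ?N) = (?y ^ ?N)\<^sup>2"
        using y powr_realpow[of ?y "?N * 2"] by (simp add: power_mult mult.commute)
      then show ?thesis by (simp add: powr_minus_divide)
    qed
    finally show ?thesis unfolding W_def .
  qed
  have W0: "W \<xi> \<ge> 0" for \<xi> unfolding W_def by simp
  have b: "AE \<xi> in lborel. norm ((cmod (V n \<xi>))\<^sup>2) \<le> norm (W \<xi>)" for n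
    using VW W0 by (intro AE_I2) simp
  have i: "integrable lborel (\<lambda>\<xi>. (cmod (V n \<xi>))\<^sup>2)" for n
    by (rule Bochner_Integration.integrable_bound[OF iW _ b[of n]]) measurable
  then show "square_integrable (V n)" unfolding square_integrable_def by simp
  have ptw: "(\<lambda>n. mollify (e n) q \<xi>) \<longlonglongrightarrow> q \<xi>" for \<xi>
  proof -
    have "(\<lambda>n. mollify (e n) q \<xi>) \<longlonglongrightarrow> (\<integral>k. of_real (gauss_kernel (k::real^'n)) * q \<xi> \<partial>lborel)"
      unfolding mollify_def
    proof (rule integral_dominated_convergence[where w="\<lambda>k. C * gauss_kernel k"])
      show "integrable lborel (\<lambda>k::real^'n. C * gauss_kernel k)"
        using gauss_kernel_integral[where 'a="real^'n"] by (simp add: has_bochner_integral_iff)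
      show "AE k in lborel. (\<lambda>n. of_real (gauss_kernel k) * q (\<xi> - sqrt (e n) *\<^sub>R k)) \<longlonglongrightarrow> of_real (gauss_kernel k) * q \<xi>"
      proof (intro AE_I2 tendsto_mult_left)
        fix k
        have "(\<lambda>n. \<xi> - sqrt (e n) *\<^sub>R k) \<longlonglongrightarrow> \<xi> - 0 *\<^sub>R k"
          unfolding e_def by (intro tendsto_intros sqrt_inverse_tendsto_0)
        then show "(\<lambda>n. q (\<xi> - sqrt (e n) *\<^sub>R k)) \<longlonglongrightarrow> q \<xi>"
          using continuous_on_tendsto_compose[OF cont] by simp
      qed
      show "AE k in lborel. norm (of_real (gauss_kernel k) * q (\<xi> - sqrt (e n) *\<^sub>R k)) \<le> C * gauss_kernel k" for n
        using mult_right_mono[OF qC gauss_kernel_nonneg] by (intro AE_I2) (simp add: norm_mult mult.commute)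
    qed measurable
    also have "(\<integral>k. of_real (gauss_kernel (k::real^'n)) * q \<xi> \<partial>lborel) = q \<xi>"
      using gauss_kernel_integral[where 'a="real^'n"] by (simp add: has_bochner_integral_iff)
    finally show ?thesis .
  qed
  have "(\<lambda>n. \<integral>\<xi>. (cmod (V n \<xi>))\<^sup>2 \<partial>lborel) \<longlonglongrightarrow> (\<integral>\<xi>. (0::real) \<partial>(lborel :: (real^'n) measure))"
  proof (rule integral_dominated_convergence[where w=W])
    show "AE \<xi> in lborel. (\<lambda>n. (cmod (V n \<xi>))\<^sup>2) \<longlonglongrightarrow> 0"
    proof (rule AE_I2)
      fix \<xi>
      have "(\<lambda>n. (cmod ((q \<xi> - mollify (e n) q \<xi>) * of_real (norm \<xi> powr - s)))\<^sup>2) \<longlonglongrightarrow> (cmod ((q \<xi> - q \<xi>) * of_real (norm \<xi> powr - s)))\<^sup>2"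
        by (intro tendsto_intros ptw)
      then show "(\<lambda>n. (cmod (V n \<xi>))\<^sup>2) \<longlonglongrightarrow> 0" unfolding V_def e_def by simp
    qed
    show "AE \<xi> in lborel. norm ((cmod (V n \<xi>))\<^sup>2) \<le> W \<xi>" for n using VW by (intro AE_I2) simp
  qed (use iW in auto)
  from tendsto_real_sqrt[OF this] show "(\<lambda>n. l2norm (V n)) \<longlonglongrightarrow> 0" unfolding l2norm_def by simp
qed

section \<open>From null sequences in the critical Lebesgue space to weak convergence of the
  transforms\<close>

lemma test_function_powr_integrable:
  assumes "\<phi> \<in> test_functions" and p: "p > 0"
  shows "integrable lborel (\<lambda>x. \<bar>\<phi> x\<bar> powr p)"
proof -
  note [measurable] = test_function_measurable[OF assms(1)]
  obtain R where R: "R > 0" "\<And>x. norm x > R \<Longrightarrow> \<phi> x = 0" using test_function_support[OF assms(1)] by blast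
  obtain B where B: "B > 0" "\<And>x. \<bar>\<phi> x\<bar> \<le> B" using test_function_bounded[OF assms(1)] by blast
  have "\<bar>\<phi> x\<bar> powr p \<le> B powr p" for x using p B by (intro powr_mono2) auto
  then have b: "AE x in lborel. norm (\<bar>\<phi> x\<bar> powr p) \<le> norm (B powr p * indicator (cball 0 R) x)"
    using R(2) by (intro AE_I2) (auto simp: indicator_def not_le)
  show ?thesis
    by (rule Bochner_Integration.integrable_bound[OF integrable_indicator_cball _ b]) measurable
qed

text \<open>Split the values of \<open>\<theta> m\<close> at a height \<open>k\<close>: small values
  contribute at most \<open>k\<close> times the Gaussian mass, while large ones satisfy
  \<open>\<bar>y\<bar> \<le> k powr (1 - p) * \<bar>y\<bar> powr p\<close>.\<close>

lemma gaussian_weighted_null: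
  fixes \<theta> :: "nat \<Rightarrow> real ^ 'n \<Rightarrow> real"
  assumes t: "\<And>m. \<theta> m \<in> test_functions" and p: "p > 1" and e: "e > 0"
    and lim: "(\<lambda>m. \<integral>x. \<bar>\<theta> m x\<bar> powr p \<partial>lborel) \<longlonglongrightarrow> 0"
  shows "(\<lambda>m. \<integral>x. \<bar>\<theta> m x\<bar> * exp (- e * (norm x)\<^sup>2) \<partial>lborel) \<longlonglongrightarrow> 0"
proof (rule LIMSEQ_I)
  fix r :: real assume r: "r > 0"
  note [measurable] = test_function_measurable[OF t]
  define G where "G = (\<integral>x. exp (- e * (norm (x::real^'n))\<^sup>2) \<partial>lborel)"
  have iG: "integrable lborel (\<lambda>x::real^'n. exp (- e * (norm x)\<^sup>2))"
    using gaussian_integral[OF e, where 'a="real^'n"] by (simp add: has_bochner_integral_iff)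
  have G0: "G \<ge> 0" unfolding G_def by simp
  \<comment> \<open>Makes the small values contribute less than \<open>r / 2\<close>;
    \<open>G + 1\<close> keeps the denominator positive.\<close>
  define k where "k = r / (2 * (G + 1))"
  have k: "k > 0" using r G0 by (simp add: k_def)
  have kG: "k * G < r / 2"
  proof -
    have "k * G < k * (G + 1)" using k by simp
    also have "\<dots> = r / 2" using G0 by (simp add: k_def field_simps)
    finally show ?thesis .
  qed
  have ptw: "\<bar>y\<bar> * g \<le> k * g + k powr (1 - p) * \<bar>y\<bar> powr p" if "0 \<le> g" "g \<le> 1" for y g
  proof (cases "\<bar>y\<bar> \<le> k")
    case True
    then have "\<bar>y\<bar> * g \<le> k * g" using that by (intro mult_right_mono) auto
    then show ?thesis by (simp add: add_increasing2)
  next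
    case False
    then have "\<bar>y\<bar> powr (1 - p) \<le> k powr (1 - p)" using p k by (intro powr_mono2') auto
    then have "\<bar>y\<bar> powr (1 - p) * \<bar>y\<bar> powr p \<le> k powr (1 - p) * \<bar>y\<bar> powr p" by (intro mult_right_mono) auto
    moreover have "\<bar>y\<bar> powr (1 - p) * \<bar>y\<bar> powr p = \<bar>y\<bar>"
      using False k by (simp add: powr_add[symmetric])
    moreover have "\<bar>y\<bar> * g \<le> \<bar>y\<bar>" using that by (simp add: mult_left_le)
    moreover have "0 \<le> k * g" using k that by simp
    ultimately show ?thesis by linarith
  qed
  have le: "(\<integral>x. \<bar>\<theta> m x\<bar> * exp (- e * (norm x)\<^sup>2) \<partial>lborel) \<le> k * G + k powr (1 - p) * (\<integral>x. \<bar>\<theta> m x\<bar> powr p \<partial>lborel)" for m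
  proof -
    have i: "integrable lborel (\<lambda>x. \<bar>\<theta> m x\<bar> powr p)"
      using p by (intro test_function_powr_integrable t) auto
    have b: "AE x in lborel. norm (\<bar>\<theta> m x\<bar> * exp (- e * (norm x)\<^sup>2)) \<le> norm (\<theta> m x)"
      using e by (intro AE_I2) (simp add: abs_mult mult_left_le)
    have "(\<integral>x. \<bar>\<theta> m x\<bar> * exp (- e * (norm x)\<^sup>2) \<partial>lborel) \<le> (\<integral>x. k * exp (- e * (norm x)\<^sup>2) + k powr (1 - p) * \<bar>\<theta> m x\<bar> powr p \<partial>lborel)"
    proof (rule integral_mono)
      show "integrable lborel (\<lambda>x. \<bar>\<theta> m x\<bar> * exp (- e * (norm x)\<^sup>2))"
        by (rule Bochner_Integration.integrable_bound[OF test_function_integrable[OF t[of m]] _ b]) measurable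
      show "integrable lborel (\<lambda>x. k * exp (- e * (norm x)\<^sup>2) + k powr (1 - p) * \<bar>\<theta> m x\<bar> powr p)"
        using i iG by (intro Bochner_Integration.integrable_add integrable_mult_right)
      show "\<bar>\<theta> m x\<bar> * exp (- e * (norm x)\<^sup>2) \<le> k * exp (- e * (norm x)\<^sup>2) + k powr (1 - p) * \<bar>\<theta> m x\<bar> powr p" for x
        using e by (intro ptw) auto
    qed
    also have "\<dots> = k * G + k powr (1 - p) * (\<integral>x. \<bar>\<theta> m x\<bar> powr p \<partial>lborel)"
      using i iG unfolding G_def by (subst Bochner_Integration.integral_add) auto
    finally show ?thesis .
  qed
  have "(\<lambda>m. k powr (1 - p) * (\<integral>x. \<bar>\<theta> m x\<bar> powr p \<partial>lborel)) \<longlonglongrightarrow> k powr (1 - p) * 0"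
    by (intro tendsto_intros lim)
  then have "eventually (\<lambda>m. k powr (1 - p) * (\<integral>x. \<bar>\<theta> m x\<bar> powr p \<partial>lborel) < r / 2) sequentially"
    using r by (intro order_tendstoD(2)[where a="r/2"]) auto
  then obtain N where N: "\<And>m. m \<ge> N \<Longrightarrow> k powr (1 - p) * (\<integral>x. \<bar>\<theta> m x\<bar> powr p \<partial>lborel) < r / 2"
    unfolding eventually_sequentially by blast
  have "norm ((\<integral>x. \<bar>\<theta> m x\<bar> * exp (- e * (norm x)\<^sup>2) \<partial>lborel) - 0) < r" if "m \<ge> N" for m
  proof -
    have "0 \<le> (\<integral>x. \<bar>\<theta> m x\<bar> * exp (- e * (norm x)\<^sup>2) \<partial>lborel)" by simp
    then show ?thesis using le[of m] N[OF that] kG by simp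
  qed
  then show "\<exists>N. \<forall>m\<ge>N. norm ((\<integral>x. \<bar>\<theta> m x\<bar> * exp (- e * (norm x)\<^sup>2) \<partial>lborel) - 0) < r" by blast
qed

text \<open>The function \<open>(-\<Delta>)\<^sup>s\<phi>\<close> is only known to be bounded and continuous; mollifying its Fourier
  transform makes it decay fast enough to be tested against a null sequence in the critical
  Lebesgue space.\<close>

lemma weighted_fourier_weak_null:
  fixes \<theta> :: "nat \<Rightarrow> real ^ 'n \<Rightarrow> real"
  assumes s: "0 < s" "s < real CARD('n) / 2" and \<phi>: "\<phi> \<in> test_functions"
    and t: "\<And>m. \<theta> m \<in> test_functions" and p: "p > 1"
    and lim: "(\<lambda>m. \<integral>x. \<bar>\<theta> m x\<bar> powr p \<partial>lborel) \<longlonglongrightarrow> 0"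
    and K: "\<And>m. l2norm (weighted_fourier s (\<theta> m)) \<le> K"
  shows "(\<lambda>m. \<integral>\<xi>. weighted_fourier s \<phi> \<xi> * cnj (weighted_fourier s (\<theta> m) \<xi>) \<partial>lborel) \<longlonglongrightarrow> 0"
proof (rule LIMSEQ_I)
  fix r :: real assume r: "r > 0"
  let ?N = "CARD('n)"
  let ?F = "\<lambda>\<theta> \<xi>. fourier (\<lambda>x. complex_of_real (\<theta> x)) (\<xi> :: real^'n)"
  \<comment> \<open>\<open>q\<close> is the transform of \<open>(- \<Delta>)\<^sup>s \<phi>\<close>:
    both half-powers are put on the fixed function \<open>\<phi>\<close>.\<close>
  define q where "q \<xi> = of_real (norm \<xi> powr (2 * s)) * ?F \<phi> \<xi>" for \<xi>
  obtain C where C: "\<And>\<xi>. cmod (q \<xi>) \<le> C / (1 + (norm \<xi>)\<^sup>2) ^ ?N"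
    using weighted_fourier_decay[OF \<phi>, of "2 * s"] s unfolding q_def by auto
  have contq: "continuous_on UNIV q"
    unfolding q_def using s by (intro continuous_on_mult continuous_norm_powr continuous_fourier_test_function \<phi>) auto
  then have [measurable]: "q \<in> borel_measurable borel" by (rule borel_measurable_continuous_onI)
  have bq: "AE \<xi> in lborel. norm (q \<xi>) \<le> norm (C / (1 + (norm \<xi>)\<^sup>2) ^ ?N)"
    unfolding real_norm_def by (intro AE_I2 order_trans[OF C abs_ge_self])
  have iq: "integrable lborel q"
    by (rule Bochner_Integration.integrable_bound[OF integrable_inverse_nat_power _ bq]) auto
  define V where "V n \<xi> = (q \<xi> - mollify (1 / real (Suc n)) q \<xi>) * of_real (norm \<xi> powr - s)" for n \<xi>
  have V: "square_integrable (V n)" for n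
    using mollify_approximates(1)[OF s contq C] unfolding V_def .
  have Vlim: "(\<lambda>n. l2norm (V n)) \<longlonglongrightarrow> 0"
    using mollify_approximates(2)[OF s contq C] unfolding V_def .
  have K0: "K \<ge> 0" using K[of 0] l2norm_nonneg order_trans by blast
  have "(\<lambda>n. l2norm (V n) * K) \<longlonglongrightarrow> 0 * K" by (intro tendsto_intros Vlim)
  then have "eventually (\<lambda>n. l2norm (V n) * K < r / 2) sequentially"
    using r by (intro order_tendstoD(2)[where a="r/2"]) auto
  \<comment> \<open>The mollification is fixed here, before the sequence index: its error is below
    \<open>r / 2\<close> for every \<open>m\<close> by the bound \<open>K\<close>, and for this
    \<open>n\<close> the main part tends to 0.\<close>
  then obtain n where n: "l2norm (V n) * K < r / 2" unfolding eventually_sequentially by blast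
  define e where "e = 1 / real (Suc n)"
  have e: "e > 0" unfolding e_def by simp
  define Q where "Q x = (\<integral>\<xi>. cis (x \<bullet> \<xi>) * q \<xi> \<partial>lborel)" for x
  define I where "I = (\<integral>\<xi>. cmod (q \<xi>) \<partial>lborel)"
  have QI: "cmod (Q x) \<le> I" for x unfolding Q_def I_def by (rule norm_integral_cis_le)
  have I0: "I \<ge> 0" unfolding I_def by simp
  let ?c = "fourier_const TYPE('n)"
  have W: "square_integrable (weighted_fourier s (\<theta> m))" "square_integrable (weighted_fourier s \<phi>)" for m
    using s by (auto intro!: weighted_fourier_square_integrable t \<phi>)
  have ie: "integrable lborel (\<lambda>x. \<bar>\<theta> m x\<bar> * exp (- e * (norm x)\<^sup>2))" for m
  proof -
    note [measurable] = test_function_measurable[OF t]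
    have b: "AE x in lborel. norm (\<bar>\<theta> m x\<bar> * exp (- e * (norm x)\<^sup>2)) \<le> norm (\<theta> m x)"
      using e by (intro AE_I2) (simp add: abs_mult mult_left_le)
    show ?thesis by (rule Bochner_Integration.integrable_bound[OF test_function_integrable[OF t[of m]] _ b]) measurable
  qed
  have 1: "cmod (\<integral>\<xi>. mollify e q \<xi> * cnj (?F (\<theta> m) \<xi>) \<partial>lborel) \<le> ?c * I * (\<integral>x. \<bar>\<theta> m x\<bar> * exp (- e * (norm x)\<^sup>2) \<partial>lborel)" for m
  proof -
    have "cmod (\<integral>x. of_real (\<theta> m x) * (of_real (exp (- e * (norm x)\<^sup>2)) * Q x) \<partial>lborel) \<le> (\<integral>x. norm (of_real (\<theta> m x) * (of_real (exp (- e * (norm x)\<^sup>2)) * Q x)) \<partial>lborel)"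
      by (rule integral_norm_bound)
    also have "\<dots> \<le> (\<integral>x. I * (\<bar>\<theta> m x\<bar> * exp (- e * (norm x)\<^sup>2)) \<partial>lborel)"
    proof (rule integral_mono')
      show "integrable lborel (\<lambda>x. I * (\<bar>\<theta> m x\<bar> * exp (- e * (norm x)\<^sup>2)))" using ie by (rule integrable_mult_right)
      show "norm (of_real (\<theta> m x) * (of_real (exp (- e * (norm x)\<^sup>2)) * Q x)) \<le> I * (\<bar>\<theta> m x\<bar> * exp (- e * (norm x)\<^sup>2))" for x
        using mult_right_mono[OF QI, of "\<bar>\<theta> m x\<bar> * exp (- e * (norm x)\<^sup>2)" x] by (simp add: norm_mult mult_ac)
      show "0 \<le> I * (\<bar>\<theta> m x\<bar> * exp (- e * (norm x)\<^sup>2))" for x using I0 by simp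
    qed
    finally have "cmod (\<integral>x. of_real (\<theta> m x) * (of_real (exp (- e * (norm x)\<^sup>2)) * Q x) \<partial>lborel) \<le> I * (\<integral>x. \<bar>\<theta> m x\<bar> * exp (- e * (norm x)\<^sup>2) \<partial>lborel)" by simp
    then have "?c * cmod (\<integral>x. of_real (\<theta> m x) * (of_real (exp (- e * (norm x)\<^sup>2)) * Q x) \<partial>lborel) \<le> ?c * (I * (\<integral>x. \<bar>\<theta> m x\<bar> * exp (- e * (norm x)\<^sup>2) \<partial>lborel))"
      by (rule mult_left_mono) simp
    then show ?thesis
      unfolding pairing_mollify[OF iq t less_imp_le[OF e]] Q_def[symmetric] by (simp add: norm_mult mult.assoc)
  qed
  \<comment> \<open>Away from the origin the weight of \<open>\<theta> m\<close> is moved onto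
    \<open>\<phi>\<close>, completing \<open>q\<close>. In the error term the same weight is given
    back, so that Cauchy-Schwarz meets the bounded \<open>l2norm\<close>.\<close>
  have 2: "(\<integral>\<xi>. weighted_fourier s \<phi> \<xi> * cnj (weighted_fourier s (\<theta> m) \<xi>) \<partial>lborel)
     = (\<integral>\<xi>. mollify e q \<xi> * cnj (?F (\<theta> m) \<xi>) \<partial>lborel) + (\<integral>\<xi>. V n \<xi> * cnj (weighted_fourier s (\<theta> m) \<xi>) \<partial>lborel)" for m
  proof -
    have i1: "integrable lborel (\<lambda>\<xi>. weighted_fourier s \<phi> \<xi> * cnj (weighted_fourier s (\<theta> m) \<xi>))"
      by (rule square_integrable_product[OF W(2) W(1)])
    have i2: "integrable lborel (\<lambda>\<xi>. V n \<xi> * cnj (weighted_fourier s (\<theta> m) \<xi>))"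
      by (rule square_integrable_product[OF V W(1)])
    have "AE \<xi> in lborel. mollify e q \<xi> * cnj (?F (\<theta> m) \<xi>) = weighted_fourier s \<phi> \<xi> * cnj (weighted_fourier s (\<theta> m) \<xi>) - V n \<xi> * cnj (weighted_fourier s (\<theta> m) \<xi>)"
    proof (rule eventually_mono[OF AE_lborel_singleton[of 0]])
      fix \<xi> :: "real^'n" assume x: "\<xi> \<noteq> 0"
      have a: "norm \<xi> powr s * norm \<xi> powr s = norm \<xi> powr (2 * s)" by (simp add: powr_add[symmetric])
      have b: "norm \<xi> powr - s * norm \<xi> powr s = 1" using x by (simp add: powr_add[symmetric])
      have "weighted_fourier s \<phi> \<xi> * cnj (weighted_fourier s (\<theta> m) \<xi>) = of_real (norm \<xi> powr s * norm \<xi> powr s) * ?F \<phi> \<xi> * cnj (?F (\<theta> m) \<xi>)"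
        unfolding weighted_fourier_def by simp
      moreover have "V n \<xi> * cnj (weighted_fourier s (\<theta> m) \<xi>) = of_real (norm \<xi> powr - s * norm \<xi> powr s) * (q \<xi> - mollify e q \<xi>) * cnj (?F (\<theta> m) \<xi>)"
        unfolding weighted_fourier_def V_def e_def by simp
      ultimately show "mollify e q \<xi> * cnj (?F (\<theta> m) \<xi>) = weighted_fourier s \<phi> \<xi> * cnj (weighted_fourier s (\<theta> m) \<xi>) - V n \<xi> * cnj (weighted_fourier s (\<theta> m) \<xi>)"
        unfolding a b q_def by (simp add: algebra_simps)
    qed
    moreover have [measurable]: "?F (\<theta> m) \<in> borel_measurable borel" "weighted_fourier s (\<theta> m) \<in> borel_measurable borel" "weighted_fourier s \<phi> \<in> borel_measurable borel" "V n \<in> borel_measurable borel"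
      using W[THEN square_integrable_measurable] V[THEN square_integrable_measurable]
        borel_measurable_continuous_onI[OF continuous_fourier_test_function[OF t]] by auto
    ultimately have "(\<integral>\<xi>. mollify e q \<xi> * cnj (?F (\<theta> m) \<xi>) \<partial>lborel) = (\<integral>\<xi>. weighted_fourier s \<phi> \<xi> * cnj (weighted_fourier s (\<theta> m) \<xi>) - V n \<xi> * cnj (weighted_fourier s (\<theta> m) \<xi>) \<partial>lborel)"
      by (intro integral_cong_AE) measurable
    then show ?thesis using i1 i2 by simp
  qed
  have "(\<lambda>m. ?c * I * (\<integral>x. \<bar>\<theta> m x\<bar> * exp (- e * (norm x)\<^sup>2) \<partial>lborel)) \<longlonglongrightarrow> ?c * I * 0"
    by (intro tendsto_intros gaussian_weighted_null[OF t p e lim])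
  then have "eventually (\<lambda>m. ?c * I * (\<integral>x. \<bar>\<theta> m x\<bar> * exp (- e * (norm x)\<^sup>2) \<partial>lborel) < r / 2) sequentially"
    using r by (intro order_tendstoD(2)[where a="r/2"]) auto
  then obtain M where M: "\<And>m. m \<ge> M \<Longrightarrow> ?c * I * (\<integral>x. \<bar>\<theta> m x\<bar> * exp (- e * (norm x)\<^sup>2) \<partial>lborel) < r / 2"
    unfolding eventually_sequentially by blast
  have "norm ((\<integral>\<xi>. weighted_fourier s \<phi> \<xi> * cnj (weighted_fourier s (\<theta> m) \<xi>) \<partial>lborel) - 0) < r" if "m \<ge> M" for m
  proof -
    have "cmod (\<integral>\<xi>. V n \<xi> * cnj (weighted_fourier s (\<theta> m) \<xi>) \<partial>lborel) \<le> l2norm (V n) * l2norm (weighted_fourier s (\<theta> m))"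
      by (rule Cauchy_Schwarz_l2norm[OF V W(1)])
    also have "\<dots> \<le> l2norm (V n) * K" by (intro mult_left_mono K) simp
    finally have "cmod (\<integral>\<xi>. V n \<xi> * cnj (weighted_fourier s (\<theta> m) \<xi>) \<partial>lborel) < r / 2" using n by linarith
    moreover have "cmod (\<integral>\<xi>. mollify e q \<xi> * cnj (?F (\<theta> m) \<xi>) \<partial>lborel) < r / 2"
      using 1[of m] M[OF that] by linarith
    ultimately show ?thesis
      unfolding 2 using norm_triangle_ineq[of "\<integral>\<xi>. mollify e q \<xi> * cnj (?F (\<theta> m) \<xi>) \<partial>lborel" "\<integral>\<xi>. V n \<xi> * cnj (weighted_fourier s (\<theta> m) \<xi>) \<partial>lborel"]
      by simp
  qed
  then show "\<exists>M. \<forall>m\<ge>M. norm ((\<integral>\<xi>. weighted_fourier s \<phi> \<xi> * cnj (weighted_fourier s (\<theta> m) \<xi>) \<partial>lborel) - 0) < r" by blast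
qed

text \<open>A Cauchy sequence that tends weakly to 0 tends to 0 in norm: the squared norm of the
  n-th transform is its pairing with the difference of the n-th and m-th, small by the Cauchy
  property, plus its pairing with the m-th, which tends to 0 in m. This is what makes
  \<open>Hs_norm\<close> well defined.\<close>

lemma Sobolev_norm_closable:
  fixes \<theta> :: "nat \<Rightarrow> real ^ 'n \<Rightarrow> real"
  assumes s: "0 < s" "s < real CARD('n) / 2" and t: "\<And>m. \<theta> m \<in> test_functions" and p: "p > 1"
    and lim: "(\<lambda>m. \<integral>x. \<bar>\<theta> m x\<bar> powr p \<partial>lborel) \<longlonglongrightarrow> 0"
    and cauchy: "\<And>e. e > 0 \<Longrightarrow> \<exists>N. \<forall>m\<ge>N. \<forall>n\<ge>N. l2norm (\<lambda>\<xi>. weighted_fourier s (\<theta> m) \<xi> - weighted_fourier s (\<theta> n) \<xi>) < e"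
  shows "(\<lambda>m. l2norm (weighted_fourier s (\<theta> m))) \<longlonglongrightarrow> 0"
proof -
  let ?W = "\<lambda>m. weighted_fourier s (\<theta> m)"
  have W: "square_integrable (?W m)" for m using s by (intro weighted_fourier_square_integrable t) auto
  have Wd: "square_integrable (\<lambda>\<xi>. ?W m \<xi> - ?W n \<xi>)" for m n by (intro square_integrable_diff W)
  obtain N0 where N0: "\<And>m n. m \<ge> N0 \<Longrightarrow> n \<ge> N0 \<Longrightarrow> l2norm (\<lambda>\<xi>. ?W m \<xi> - ?W n \<xi>) < 1" using cauchy[of 1] by auto
  \<comment> \<open>The weak convergence is applied to the sequence shifted by \<open>N0\<close>,
    where the Cauchy property bounds all norms.\<close>
  define K where "K = l2norm (?W N0) + 1"
  have K: "l2norm (?W (m + N0)) \<le> K" for m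
    using l2norm_triangle_diff[OF W[of "m + N0"] W[of N0]] N0[of "m + N0" N0] unfolding K_def by simp
  have weak: "(\<lambda>m. \<integral>\<xi>. ?W n \<xi> * cnj (?W (m + N0) \<xi>) \<partial>lborel) \<longlonglongrightarrow> 0" for n
    by (rule weighted_fourier_weak_null[OF s t t p LIMSEQ_ignore_initial_segment[OF lim] K])
  show ?thesis
  proof (rule LIMSEQ_I)
    fix r :: real assume r: "r > 0"
    then obtain N where N: "\<And>m n. m \<ge> N \<Longrightarrow> n \<ge> N \<Longrightarrow> l2norm (\<lambda>\<xi>. ?W m \<xi> - ?W n \<xi>) < r / 2"
      using cauchy[of "r / 2"] by auto
    have "l2norm (?W n) < r" if n: "n \<ge> N" for n
    proof -
      have le: "(l2norm (?W n))\<^sup>2 \<le> l2norm (?W n) * (r / 2) + cmod (\<integral>\<xi>. ?W n \<xi> * cnj (?W m \<xi>) \<partial>lborel)" if m: "m \<ge> N" for m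
      proof -
        have "complex_of_real ((l2norm (?W n))\<^sup>2) = (\<integral>\<xi>. ?W n \<xi> * cnj (?W n \<xi>) \<partial>lborel)"
          unfolding l2norm_squared integral_complex_of_real[symmetric] complex_norm_square ..
        also have "\<dots> = (\<integral>\<xi>. ?W n \<xi> * cnj (?W n \<xi> - ?W m \<xi>) + ?W n \<xi> * cnj (?W m \<xi>) \<partial>lborel)"
          by (simp add: algebra_simps)
        also have "\<dots> = (\<integral>\<xi>. ?W n \<xi> * cnj (?W n \<xi> - ?W m \<xi>) \<partial>lborel) + (\<integral>\<xi>. ?W n \<xi> * cnj (?W m \<xi>) \<partial>lborel)"
          by (intro Bochner_Integration.integral_add square_integrable_product W Wd)
        finally have "(l2norm (?W n))\<^sup>2 = cmod ((\<integral>\<xi>. ?W n \<xi> * cnj (?W n \<xi> - ?W m \<xi>) \<partial>lborel) + (\<integral>\<xi>. ?W n \<xi> * cnj (?W m \<xi>) \<partial>lborel))"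
          by (metis norm_of_real abs_of_nonneg zero_le_power2)
        also have "\<dots> \<le> cmod (\<integral>\<xi>. ?W n \<xi> * cnj (?W n \<xi> - ?W m \<xi>) \<partial>lborel) + cmod (\<integral>\<xi>. ?W n \<xi> * cnj (?W m \<xi>) \<partial>lborel)"
          by (rule norm_triangle_ineq)
        also have "cmod (\<integral>\<xi>. ?W n \<xi> * cnj (?W n \<xi> - ?W m \<xi>) \<partial>lborel) \<le> l2norm (?W n) * l2norm (\<lambda>\<xi>. ?W n \<xi> - ?W m \<xi>)"
          by (rule Cauchy_Schwarz_l2norm[OF W Wd])
        also have "\<dots> \<le> l2norm (?W n) * (r / 2)"
          using N[OF n m] by (intro mult_left_mono) auto
        finally show ?thesis by simp
      qed
      have "(\<lambda>m. l2norm (?W n) * (r / 2) + cmod (\<integral>\<xi>. ?W n \<xi> * cnj (?W (m + N0) \<xi>) \<partial>lborel)) \<longlonglongrightarrow> l2norm (?W n) * (r / 2) + cmod 0"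
        by (intro tendsto_intros weak)
      moreover have "\<forall>m\<ge>N. (l2norm (?W n))\<^sup>2 \<le> l2norm (?W n) * (r / 2) + cmod (\<integral>\<xi>. ?W n \<xi> * cnj (?W (m + N0) \<xi>) \<partial>lborel)"
        using le by auto
      ultimately have "(l2norm (?W n))\<^sup>2 \<le> l2norm (?W n) * (r / 2)"
        using LIMSEQ_le_const by fastforce
      then have "l2norm (?W n) \<le> r / 2"
        using l2norm_nonneg[of "?W n"] r by (cases "l2norm (?W n) = 0") (auto simp: power2_eq_square)
      then show ?thesis using r by linarith
    qed
    then show "\<exists>N. \<forall>n\<ge>N. norm (l2norm (?W n) - 0) < r" by auto
  qed
qed

section \<open>Identifying the Sobolev norm\<close>

lemma crit_exp_gt_2:
  assumes "0 < s" "s < real CARD('n::finite) / 2"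
  shows "crit_exp (real CARD('n)) s > 2"
  using assms by (simp add: crit_exp_def field_simps)

text \<open>The factor \<open>2 powr p\<close> is harmless: the estimate serves to show that
  integrals of \<open>p\<close>-th powers are finite or tend to 0.\<close>

lemma abs_add_powr_le:
  fixes a b :: real
  assumes "p > 0"
  shows "\<bar>a + b\<bar> powr p \<le> 2 powr p * (\<bar>a\<bar> powr p + \<bar>b\<bar> powr p)"
proof -
  have "\<bar>a + b\<bar> powr p \<le> (2 * max \<bar>a\<bar> \<bar>b\<bar>) powr p" using assms by (intro powr_mono2) auto
  also have "\<dots> = 2 powr p * max \<bar>a\<bar> \<bar>b\<bar> powr p" by (simp add: powr_mult)
  also have "\<dots> \<le> 2 powr p * (\<bar>a\<bar> powr p + \<bar>b\<bar> powr p)" by (intro mult_left_mono) (auto simp: max_def)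
  finally show ?thesis .
qed

lemma
  fixes f g :: "'a::euclidean_space \<Rightarrow> real"
  assumes p: "p > 0" and f: "f \<in> borel_measurable borel" "integrable lborel (\<lambda>x. \<bar>f x\<bar> powr p)"
    and g: "g \<in> borel_measurable borel" "integrable lborel (\<lambda>x. \<bar>g x\<bar> powr p)"
  shows powr_integrable_add: "integrable lborel (\<lambda>x. \<bar>a * f x + b * g x\<bar> powr p)"
    and powr_integral_add_le: "(\<integral>x. \<bar>a * f x + b * g x\<bar> powr p \<partial>lborel) \<le> 2 powr p * (\<bar>a\<bar> powr p * (\<integral>x. \<bar>f x\<bar> powr p \<partial>lborel) + \<bar>b\<bar> powr p * (\<integral>x. \<bar>g x\<bar> powr p \<partial>lborel))"
proof -
  note [measurable] = f(1) g(1)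
  have i: "integrable lborel (\<lambda>x. 2 powr p * (\<bar>a\<bar> powr p * \<bar>f x\<bar> powr p + \<bar>b\<bar> powr p * \<bar>g x\<bar> powr p))"
    using f g by (intro integrable_mult_right Bochner_Integration.integrable_add)
  have le: "\<bar>a * f x + b * g x\<bar> powr p \<le> 2 powr p * (\<bar>a\<bar> powr p * \<bar>f x\<bar> powr p + \<bar>b\<bar> powr p * \<bar>g x\<bar> powr p)" for x
    using abs_add_powr_le[OF p, of "a * f x" "b * g x"] by (simp add: abs_mult powr_mult)
  have b: "AE x in lborel. norm (\<bar>a * f x + b * g x\<bar> powr p) \<le> norm (2 powr p * (\<bar>a\<bar> powr p * \<bar>f x\<bar> powr p + \<bar>b\<bar> powr p * \<bar>g x\<bar> powr p))"
    using le by (intro AE_I2) simp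
  show i2: "integrable lborel (\<lambda>x. \<bar>a * f x + b * g x\<bar> powr p)"
    by (rule Bochner_Integration.integrable_bound[OF i _ b]) measurable
  have "(\<integral>x. \<bar>a * f x + b * g x\<bar> powr p \<partial>lborel) \<le> (\<integral>x. 2 powr p * (\<bar>a\<bar> powr p * \<bar>f x\<bar> powr p + \<bar>b\<bar> powr p * \<bar>g x\<bar> powr p) \<partial>lborel)"
    by (rule integral_mono[OF i2 i le])
  also have "\<dots> = 2 powr p * (\<bar>a\<bar> powr p * (\<integral>x. \<bar>f x\<bar> powr p \<partial>lborel) + \<bar>b\<bar> powr p * (\<integral>x. \<bar>g x\<bar> powr p \<partial>lborel))"
    using f g by (simp add: Bochner_Integration.integral_add)
  finally show "(\<integral>x. \<bar>a * f x + b * g x\<bar> powr p \<partial>lborel) \<le> 2 powr p * (\<bar>a\<bar> powr p * (\<integral>x. \<bar>f x\<bar> powr p \<partial>lborel) + \<bar>b\<bar> powr p * (\<integral>x. \<bar>g x\<bar> powr p \<partial>lborel))" .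
qed

text \<open>\<open>F\<close> plays the role of \<open>norm \<xi> powr s\<close> times the Fourier transform of \<open>f\<close>.\<close>

definition Hs_pair :: "real \<Rightarrow> (real ^ 'n \<Rightarrow> real) \<Rightarrow> (real ^ 'n \<Rightarrow> complex) \<Rightarrow> bool" where
  "Hs_pair s f F \<longleftrightarrow> f \<in> borel_measurable borel \<and>
     integrable lborel (\<lambda>x. \<bar>f x\<bar> powr crit_exp (real CARD('n)) s) \<and> square_integrable F \<and>
     (\<forall>e>0. \<exists>\<phi>\<in>test_functions. (\<integral>x. \<bar>\<phi> x - f x\<bar> powr crit_exp (real CARD('n)) s \<partial>lborel) < e \<and>
        l2norm (\<lambda>\<xi>. weighted_fourier s \<phi> \<xi> - F \<xi>) < e)"

lemma Hs_pair_lincomb: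
  fixes f g :: "real ^ 'n \<Rightarrow> real"
  assumes s: "0 < s" "s < real CARD('n) / 2" and f: "Hs_pair s f F" and g: "Hs_pair s g G"
  shows "Hs_pair s (\<lambda>x. a * f x + b * g x) (\<lambda>\<xi>. of_real a * F \<xi> + of_real b * G \<xi>)"
  unfolding Hs_pair_def
proof (intro conjI allI impI)
  let ?p = "crit_exp (real CARD('n)) s"
  have p: "?p > 0" using crit_exp_gt_2[OF s] by simp
  note F = f[unfolded Hs_pair_def] and G = g[unfolded Hs_pair_def]
  have [measurable]: "f \<in> borel_measurable borel" "g \<in> borel_measurable borel" using F G by auto
  show "(\<lambda>x. a * f x + b * g x) \<in> borel_measurable borel" by measurable
  show "integrable lborel (\<lambda>x. \<bar>a * f x + b * g x\<bar> powr ?p)"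
    using F G p by (intro powr_integrable_add) auto
  show "square_integrable (\<lambda>\<xi>. of_real a * F \<xi> + of_real b * G \<xi>)"
    using F G by (intro square_integrable_add square_integrable_cmult) auto
  fix e :: real assume e: "e > 0"
  define M where "M = 1 + 2 powr ?p * (\<bar>a\<bar> powr ?p + \<bar>b\<bar> powr ?p) + \<bar>a\<bar> + \<bar>b\<bar>"
  have M1: "M > 2 powr ?p * (\<bar>a\<bar> powr ?p + \<bar>b\<bar> powr ?p)" "M > \<bar>a\<bar> + \<bar>b\<bar>" "M > 0"
  proof -
    have "0 \<le> 2 powr ?p * (\<bar>a\<bar> powr ?p + \<bar>b\<bar> powr ?p)" by simp
    then show "M > 2 powr ?p * (\<bar>a\<bar> powr ?p + \<bar>b\<bar> powr ?p)" "M > \<bar>a\<bar> + \<bar>b\<bar>" "M > 0"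
      unfolding M_def by linarith+
  qed
  define r where "r = e / M"
  have r: "r > 0" using e M1 by (simp add: r_def)
  have Mr: "M * r = e" using M1 by (simp add: r_def)
  from F r obtain \<phi> where \<phi>: "\<phi> \<in> test_functions" "(\<integral>x. \<bar>\<phi> x - f x\<bar> powr ?p \<partial>lborel) < r" "l2norm (\<lambda>\<xi>. weighted_fourier s \<phi> \<xi> - F \<xi>) < r" by blast
  from G r obtain \<psi> where \<psi>: "\<psi> \<in> test_functions" "(\<integral>x. \<bar>\<psi> x - g x\<bar> powr ?p \<partial>lborel) < r" "l2norm (\<lambda>\<xi>. weighted_fourier s \<psi> \<xi> - G \<xi>) < r" by blast
  note [measurable] = test_function_measurable[OF \<phi>(1)] test_function_measurable[OF \<psi>(1)]
  have i1: "integrable lborel (\<lambda>x. \<bar>\<phi> x - f x\<bar> powr ?p)"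
    using powr_integrable_add[OF p, of \<phi> f 1 "-1"] F p test_function_powr_integrable[OF \<phi>(1), of ?p] by simp
  have i2: "integrable lborel (\<lambda>x. \<bar>\<psi> x - g x\<bar> powr ?p)"
    using powr_integrable_add[OF p, of \<psi> g 1 "-1"] G p test_function_powr_integrable[OF \<psi>(1), of ?p] by simp
  let ?comb = "\<lambda>x. a * \<phi> x + b * \<psi> x"
  have "?comb \<in> test_functions" by (rule test_function_add[OF \<phi>(1) \<psi>(1)])
  moreover have "(\<integral>x. \<bar>?comb x - (a * f x + b * g x)\<bar> powr ?p \<partial>lborel) < e"
  proof -
    have "(\<integral>x. \<bar>?comb x - (a * f x + b * g x)\<bar> powr ?p \<partial>lborel) = (\<integral>x. \<bar>a * (\<phi> x - f x) + b * (\<psi> x - g x)\<bar> powr ?p \<partial>lborel)"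
      by (simp add: algebra_simps)
    also have "\<dots> \<le> 2 powr ?p * (\<bar>a\<bar> powr ?p * (\<integral>x. \<bar>\<phi> x - f x\<bar> powr ?p \<partial>lborel) + \<bar>b\<bar> powr ?p * (\<integral>x. \<bar>\<psi> x - g x\<bar> powr ?p \<partial>lborel))"
      by (rule powr_integral_add_le[OF p _ i1 _ i2]) measurable
    also have "\<dots> \<le> 2 powr ?p * (\<bar>a\<bar> powr ?p * r + \<bar>b\<bar> powr ?p * r)"
      using \<phi> \<psi> by (intro mult_left_mono add_mono) auto
    also have "\<dots> = 2 powr ?p * (\<bar>a\<bar> powr ?p + \<bar>b\<bar> powr ?p) * r" by (simp add: algebra_simps)
    also have "\<dots> < M * r" using M1 r by (intro mult_strict_right_mono) auto
    finally show ?thesis using Mr by simp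
  qed
  moreover have "l2norm (\<lambda>\<xi>. weighted_fourier s ?comb \<xi> - (of_real a * F \<xi> + of_real b * G \<xi>)) < e"
  proof -
    have W: "square_integrable (weighted_fourier s \<phi>)" "square_integrable (weighted_fourier s \<psi>)"
      using s by (auto intro!: weighted_fourier_square_integrable \<phi> \<psi>)
    have d: "square_integrable (\<lambda>\<xi>. weighted_fourier s \<phi> \<xi> - F \<xi>)" "square_integrable (\<lambda>\<xi>. weighted_fourier s \<psi> \<xi> - G \<xi>)"
      using W F G by (auto intro!: square_integrable_diff)
    have "l2norm (\<lambda>\<xi>. weighted_fourier s ?comb \<xi> - (of_real a * F \<xi> + of_real b * G \<xi>))
       = l2norm (\<lambda>\<xi>. of_real a * (weighted_fourier s \<phi> \<xi> - F \<xi>) + of_real b * (weighted_fourier s \<psi> \<xi> - G \<xi>))"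
      unfolding weighted_fourier_lincomb[OF \<phi>(1) \<psi>(1)] by (simp add: algebra_simps)
    also have "\<dots> \<le> \<bar>a\<bar> * l2norm (\<lambda>\<xi>. weighted_fourier s \<phi> \<xi> - F \<xi>) + \<bar>b\<bar> * l2norm (\<lambda>\<xi>. weighted_fourier s \<psi> \<xi> - G \<xi>)"
      using l2norm_triangle[OF square_integrable_cmult[OF d(1)] square_integrable_cmult[OF d(2)], of "of_real a" "of_real b"]
      by (simp add: l2norm_cmult)
    also have "\<dots> \<le> \<bar>a\<bar> * r + \<bar>b\<bar> * r" using \<phi> \<psi> by (intro add_mono mult_left_mono) auto
    also have "\<dots> = (\<bar>a\<bar> + \<bar>b\<bar>) * r" by (simp add: algebra_simps)
    also have "\<dots> < M * r" using M1 r by (intro mult_strict_right_mono) auto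
    finally show ?thesis using Mr by simp
  qed
  ultimately show "\<exists>\<phi>\<in>test_functions. (\<integral>x. \<bar>\<phi> x - (a * f x + b * g x)\<bar> powr ?p \<partial>lborel) < e \<and>
        l2norm (\<lambda>\<xi>. weighted_fourier s \<phi> \<xi> - (of_real a * F \<xi> + of_real b * G \<xi>)) < e"
    by (intro bexI[of _ ?comb] conjI)
qed

text \<open>Closedness of the relation allows approximation in stages: cutoffs are removed in
  \<open>Hs_pair_damped\<close>, the Gaussian in \<open>Hs_pair_bubble_power\<close>.\<close>

lemma Hs_pair_limit:
  fixes f :: "real ^ 'n \<Rightarrow> real"
  assumes s: "0 < s" "s < real CARD('n) / 2" and f: "f \<in> borel_measurable borel"
     "integrable lborel (\<lambda>x. \<bar>f x\<bar> powr crit_exp (real CARD('n)) s)" and F: "square_integrable F"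
    and g: "\<And>n::nat. Hs_pair s (g n) (G n)"
    and l1: "(\<lambda>n. \<integral>x. \<bar>g n x - f x\<bar> powr crit_exp (real CARD('n)) s \<partial>lborel) \<longlonglongrightarrow> 0"
    and l2: "(\<lambda>n. l2norm (\<lambda>\<xi>. G n \<xi> - F \<xi>)) \<longlonglongrightarrow> 0"
  shows "Hs_pair s f F"
  unfolding Hs_pair_def
proof (intro conjI allI impI f F)
  let ?p = "crit_exp (real CARD('n)) s"
  have p: "?p > 0" using crit_exp_gt_2[OF s] by simp
  fix e :: real assume e: "e > 0"
  define r where "r = e / (2 powr ?p * 4)"
  have r: "r > 0" "2 powr ?p * (r + r) < e" using e by (auto simp: r_def field_simps)
  have "eventually (\<lambda>n. (\<integral>x. \<bar>g n x - f x\<bar> powr ?p \<partial>lborel) < r) sequentially"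
    "eventually (\<lambda>n. l2norm (\<lambda>\<xi>. G n \<xi> - F \<xi>) < e / 2) sequentially"
    using e r order_tendstoD(2)[OF l1, of r] order_tendstoD(2)[OF l2, of "e/2"] by auto
  then have "eventually (\<lambda>n. (\<integral>x. \<bar>g n x - f x\<bar> powr ?p \<partial>lborel) < r \<and> l2norm (\<lambda>\<xi>. G n \<xi> - F \<xi>) < e / 2) sequentially"
    by eventually_elim simp
  then obtain n where n: "(\<integral>x. \<bar>g n x - f x\<bar> powr ?p \<partial>lborel) < r" "l2norm (\<lambda>\<xi>. G n \<xi> - F \<xi>) < e / 2"
    unfolding eventually_sequentially by blast
  note Gn = g[of n, unfolded Hs_pair_def]
  have "min r (e / 2) > 0" using r e by simp
  with Gn obtain \<phi> where \<phi>: "\<phi> \<in> test_functions" "(\<integral>x. \<bar>\<phi> x - g n x\<bar> powr ?p \<partial>lborel) < min r (e / 2)" "l2norm (\<lambda>\<xi>. weighted_fourier s \<phi> \<xi> - G n \<xi>) < min r (e / 2)"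
    by blast
  have [measurable]: "g n \<in> borel_measurable borel" "f \<in> borel_measurable borel" "\<phi> \<in> borel_measurable borel"
    using Gn f test_function_measurable[OF \<phi>(1)] by auto
  have i1: "integrable lborel (\<lambda>x. \<bar>\<phi> x - g n x\<bar> powr ?p)"
    using powr_integrable_add[OF p, of \<phi> "g n" 1 "-1"] Gn p test_function_powr_integrable[OF \<phi>(1), of ?p] by simp
  have i2: "integrable lborel (\<lambda>x. \<bar>g n x - f x\<bar> powr ?p)"
    using powr_integrable_add[OF p, of "g n" f 1 "-1"] Gn f by simp
  have "(\<integral>x. \<bar>\<phi> x - f x\<bar> powr ?p \<partial>lborel) \<le> 2 powr ?p * ((\<integral>x. \<bar>\<phi> x - g n x\<bar> powr ?p \<partial>lborel) + (\<integral>x. \<bar>g n x - f x\<bar> powr ?p \<partial>lborel))"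
    using powr_integral_add_le[OF p _ i1 _ i2, of 1 1] by simp
  also have "\<dots> \<le> 2 powr ?p * (r + r)" using \<phi> n by (intro mult_left_mono add_mono) auto
  finally have 1: "(\<integral>x. \<bar>\<phi> x - f x\<bar> powr ?p \<partial>lborel) < e" using r by simp
  have W: "square_integrable (weighted_fourier s \<phi>)" using s by (auto intro!: weighted_fourier_square_integrable \<phi>)
  have "l2norm (\<lambda>\<xi>. weighted_fourier s \<phi> \<xi> - F \<xi>) \<le> l2norm (\<lambda>\<xi>. weighted_fourier s \<phi> \<xi> - G n \<xi>) + l2norm (\<lambda>\<xi>. G n \<xi> - F \<xi>)"
    using l2norm_triangle[of "\<lambda>\<xi>. weighted_fourier s \<phi> \<xi> - G n \<xi>" "\<lambda>\<xi>. G n \<xi> - F \<xi>"] W Gn F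
    by (simp add: square_integrable_diff)
  then have "l2norm (\<lambda>\<xi>. weighted_fourier s \<phi> \<xi> - F \<xi>) < e" using n \<phi> by simp
  with 1 \<phi>(1) show "\<exists>\<phi>\<in>test_functions. (\<integral>x. \<bar>\<phi> x - f x\<bar> powr ?p \<partial>lborel) < e \<and> l2norm (\<lambda>\<xi>. weighted_fourier s \<phi> \<xi> - F \<xi>) < e"
    by blast
qed

text \<open>Two approximating sequences of \<open>f\<close> differ by a sequence that is Cauchy for
  \<open>test_norm\<close> and null in the critical Lebesgue space, so by
  \<open>Sobolev_norm_closable\<close> their norms have the same limit. The sequence provided by
  \<open>Hs_pair\<close> shows that this limit is \<open>l2norm F\<close>.\<close>

lemma
  fixes f :: "real ^ 'n \<Rightarrow> real"
  assumes s: "0 < s" "s < real CARD('n) / 2" and f: "Hs_pair s f F"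
  shows Hs_pair_norm: "Hs_norm s f = l2norm F" and Hs_pair_Hs: "f \<in> Hs s"
proof -
  let ?p = "crit_exp (real CARD('n)) s"
  have p: "?p > 2" using crit_exp_gt_2[OF s] .
  note F = f[unfolded Hs_pair_def]
  have [measurable]: "f \<in> borel_measurable borel" using F by auto
  have fLp: "f \<in> Lp_space ?p" using F unfolding Lp_space_def by simp
  have "\<forall>n. \<exists>\<phi>. \<phi> \<in> test_functions \<and> (\<integral>x. \<bar>\<phi> x - f x\<bar> powr ?p \<partial>lborel) < 1 / real (Suc n) \<and> l2norm (\<lambda>\<xi>. weighted_fourier s \<phi> \<xi> - F \<xi>) < 1 / real (Suc n)"
  proof
    fix n
    have "1 / real (Suc n) > 0" by simp
    with F have "\<exists>\<phi>\<in>test_functions. (\<integral>x. \<bar>\<phi> x - f x\<bar> powr ?p \<partial>lborel) < 1 / real (Suc n) \<and> l2norm (\<lambda>\<xi>. weighted_fourier s \<phi> \<xi> - F \<xi>) < 1 / real (Suc n)"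
      by (elim conjE) (erule allE, erule mp)
    then show "\<exists>\<phi>. \<phi> \<in> test_functions \<and> (\<integral>x. \<bar>\<phi> x - f x\<bar> powr ?p \<partial>lborel) < 1 / real (Suc n) \<and> l2norm (\<lambda>\<xi>. weighted_fourier s \<phi> \<xi> - F \<xi>) < 1 / real (Suc n)"
      unfolding Bex_def .
  qed
  then obtain \<phi> where *: "\<forall>n. \<phi> n \<in> test_functions \<and> (\<integral>x. \<bar>\<phi> n x - f x\<bar> powr ?p \<partial>lborel) < 1 / real (Suc n) \<and> l2norm (\<lambda>\<xi>. weighted_fourier s (\<phi> n) \<xi> - F \<xi>) < 1 / real (Suc n)"
    by (rule exE[OF choice])
  have \<phi>: "\<phi> n \<in> test_functions" "(\<integral>x. \<bar>\<phi> n x - f x\<bar> powr ?p \<partial>lborel) < 1 / real (Suc n)" "l2norm (\<lambda>\<xi>. weighted_fourier s (\<phi> n) \<xi> - F \<xi>) < 1 / real (Suc n)" for n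
    using *[THEN spec, of n] by (blast dest: conjunct1 conjunct2)+
  have s': "0 < s" "s < real CARD('n)" using s by auto
  note W = weighted_fourier_square_integrable[OF _ s']
  have h0: "(\<lambda>n. 1 / real (Suc n)) \<longlonglongrightarrow> 0"
    using LIMSEQ_inverse_real_of_nat by (simp add: inverse_eq_divide)
  have l1: "(\<lambda>n. \<integral>x. \<bar>\<phi> n x - f x\<bar> powr ?p \<partial>lborel) \<longlonglongrightarrow> 0"
    by (rule tendsto_sandwich[OF always_eventually always_eventually tendsto_const h0]) (simp, intro allI less_imp_le \<phi>(2))
  have l2: "(\<lambda>n. l2norm (\<lambda>\<xi>. weighted_fourier s (\<phi> n) \<xi> - F \<xi>)) \<longlonglongrightarrow> 0"
    by (rule tendsto_sandwich[OF always_eventually always_eventually tendsto_const h0]) (simp, intro allI less_imp_le \<phi>(3))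
  have powr0: "(\<lambda>n. a n powr c) \<longlonglongrightarrow> 0" if "a \<longlonglongrightarrow> 0" "\<And>n. a n \<ge> 0" "c > 0" for a :: "nat \<Rightarrow> real" and c :: real
    using tendsto_zero_powrI[OF that(1) tendsto_const[of c]] that by auto
  have approx: "Hs_approx s \<phi> f"
    unfolding Hs_approx_def
  proof (intro conjI allI impI \<phi>(1) fLp)
    show "(\<lambda>n. Lp_norm ?p (\<lambda>x. \<phi> n x - f x)) \<longlonglongrightarrow> 0"
      unfolding Lp_norm_def real_norm_def using p by (intro powr0 l1) auto
    fix e :: real assume e: "e > 0"
    then obtain N where N: "\<And>n. n \<ge> N \<Longrightarrow> l2norm (\<lambda>\<xi>. weighted_fourier s (\<phi> n) \<xi> - F \<xi>) < e / 2"
      using order_tendstoD(2)[OF l2, of "e / 2"] unfolding eventually_sequentially by auto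
    have "test_norm s (\<lambda>x. \<phi> m x - \<phi> n x) < e" if "m \<ge> N" "n \<ge> N" for m n
    proof -
      have "test_norm s (\<lambda>x. \<phi> m x - \<phi> n x) = l2norm (\<lambda>\<xi>. weighted_fourier s (\<phi> m) \<xi> - weighted_fourier s (\<phi> n) \<xi>)"
        unfolding test_norm_eq[OF test_function_diff[OF \<phi>(1) \<phi>(1)] s'] weighted_fourier_diff[OF \<phi>(1) \<phi>(1)] ..
      also have "\<dots> \<le> l2norm (\<lambda>\<xi>. weighted_fourier s (\<phi> m) \<xi> - F \<xi>) + l2norm (\<lambda>\<xi>. F \<xi> - weighted_fourier s (\<phi> n) \<xi>)"
        using l2norm_triangle[OF square_integrable_diff[OF W[OF \<phi>(1)[of m]]] square_integrable_diff[OF _ W[OF \<phi>(1)[of n]]], of F F] F by simp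
      also have "l2norm (\<lambda>\<xi>. F \<xi> - weighted_fourier s (\<phi> n) \<xi>) = l2norm (\<lambda>\<xi>. weighted_fourier s (\<phi> n) \<xi> - F \<xi>)"
        by (simp add: l2norm_def norm_minus_commute)
      finally show ?thesis using N[OF that(1)] N[OF that(2)] by simp
    qed
    then show "\<exists>N. \<forall>m\<ge>N. \<forall>n\<ge>N. test_norm s (\<lambda>x. \<phi> m x - \<phi> n x) < e" by blast
  qed
  then show "f \<in> Hs s" unfolding Hs_def by blast
  have norm_lim: "(\<lambda>n. test_norm s (\<psi> n)) \<longlonglongrightarrow> l2norm F" if \<psi>: "Hs_approx s \<psi> f" for \<psi>
  proof -
    have t\<psi>: "\<psi> n \<in> test_functions" for n using \<psi> unfolding Hs_approx_def by blast
    define \<theta> where "\<theta> n = (\<lambda>x. \<psi> n x - \<phi> n x)" for n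
    have t\<theta>: "\<theta> n \<in> test_functions" for n unfolding \<theta>_def by (intro test_function_diff t\<psi> \<phi>)
    note [measurable] = test_function_measurable[OF t\<psi>] test_function_measurable[OF \<phi>(1)]
    have W\<theta>: "weighted_fourier s (\<theta> n) = (\<lambda>\<xi>. weighted_fourier s (\<psi> n) \<xi> - weighted_fourier s (\<phi> n) \<xi>)" for n
      unfolding \<theta>_def by (rule weighted_fourier_diff[OF t\<psi> \<phi>(1)])
    have i\<psi>: "integrable lborel (\<lambda>x. \<bar>\<psi> n x - f x\<bar> powr ?p)" for n
      using powr_integrable_add[of ?p "\<psi> n" f 1 "-1"] F p test_function_powr_integrable[OF t\<psi>, of ?p] by simp
    have i\<phi>: "integrable lborel (\<lambda>x. \<bar>\<phi> n x - f x\<bar> powr ?p)" for n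
      using powr_integrable_add[of ?p "\<phi> n" f 1 "-1"] F p test_function_powr_integrable[OF \<phi>(1), of ?p] by simp
    have "(\<lambda>n. Lp_norm ?p (\<lambda>x. \<psi> n x - f x)) \<longlonglongrightarrow> 0" using \<psi> unfolding Hs_approx_def by blast
    from powr0[OF this, of ?p] have l\<psi>: "(\<lambda>n. \<integral>x. \<bar>\<psi> n x - f x\<bar> powr ?p \<partial>lborel) \<longlonglongrightarrow> 0"
      using p by (simp add: Lp_norm_def powr_powr)
    have l\<theta>: "(\<lambda>n. \<integral>x. \<bar>\<theta> n x\<bar> powr ?p \<partial>lborel) \<longlonglongrightarrow> 0"
    proof (rule tendsto_sandwich[OF _ _ tendsto_const])
      show "(\<lambda>n. 2 powr ?p * ((\<integral>x. \<bar>\<psi> n x - f x\<bar> powr ?p \<partial>lborel) + (\<integral>x. \<bar>\<phi> n x - f x\<bar> powr ?p \<partial>lborel))) \<longlonglongrightarrow> 0"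
        using tendsto_mult_left[OF tendsto_add[OF l\<psi> l1], of "2 powr ?p"] by simp
      show "\<forall>\<^sub>F n in sequentially. (\<integral>x. \<bar>\<theta> n x\<bar> powr ?p \<partial>lborel) \<le> 2 powr ?p * ((\<integral>x. \<bar>\<psi> n x - f x\<bar> powr ?p \<partial>lborel) + (\<integral>x. \<bar>\<phi> n x - f x\<bar> powr ?p \<partial>lborel))"
      proof (intro always_eventually allI)
        fix n
        show "(\<integral>x. \<bar>\<theta> n x\<bar> powr ?p \<partial>lborel) \<le> 2 powr ?p * ((\<integral>x. \<bar>\<psi> n x - f x\<bar> powr ?p \<partial>lborel) + (\<integral>x. \<bar>\<phi> n x - f x\<bar> powr ?p \<partial>lborel))"
          using p powr_integral_add_le[OF _ _ i\<psi>[of n] _ i\<phi>[of n], of 1 "-1"] unfolding \<theta>_def by simp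
      qed
    qed auto
    have cauchy: "\<exists>N. \<forall>m\<ge>N. \<forall>n\<ge>N. l2norm (\<lambda>\<xi>. weighted_fourier s (\<theta> m) \<xi> - weighted_fourier s (\<theta> n) \<xi>) < e" if e: "e > 0" for e
    proof -
      have c: "\<exists>N. \<forall>m\<ge>N. \<forall>n\<ge>N. l2norm (\<lambda>\<xi>. weighted_fourier s (\<zeta> m) \<xi> - weighted_fourier s (\<zeta> n) \<xi>) < e / 2" if "Hs_approx s \<zeta> f" for \<zeta>
      proof -
        have t: "\<zeta> n \<in> test_functions" for n using that unfolding Hs_approx_def by blast
        have "\<exists>N. \<forall>m\<ge>N. \<forall>n\<ge>N. test_norm s (\<lambda>x. \<zeta> m x - \<zeta> n x) < e / 2"
          using that half_gt_zero[OF e] unfolding Hs_approx_def by blast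
        then show ?thesis unfolding test_norm_eq[OF test_function_diff[OF t t] s'] weighted_fourier_diff[OF t t] .
      qed
      from c[OF \<psi>] obtain N1 where N1: "\<And>m n. m \<ge> N1 \<Longrightarrow> n \<ge> N1 \<Longrightarrow> l2norm (\<lambda>\<xi>. weighted_fourier s (\<psi> m) \<xi> - weighted_fourier s (\<psi> n) \<xi>) < e / 2" by blast
      from c[OF approx] obtain N2 where N2: "\<And>m n. m \<ge> N2 \<Longrightarrow> n \<ge> N2 \<Longrightarrow> l2norm (\<lambda>\<xi>. weighted_fourier s (\<phi> m) \<xi> - weighted_fourier s (\<phi> n) \<xi>) < e / 2" by blast
      have "l2norm (\<lambda>\<xi>. weighted_fourier s (\<theta> m) \<xi> - weighted_fourier s (\<theta> n) \<xi>) < e" if "m \<ge> max N1 N2" "n \<ge> max N1 N2" for m n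
      proof -
        have "l2norm (\<lambda>\<xi>. weighted_fourier s (\<theta> m) \<xi> - weighted_fourier s (\<theta> n) \<xi>)
           = l2norm (\<lambda>\<xi>. (weighted_fourier s (\<psi> m) \<xi> - weighted_fourier s (\<psi> n) \<xi>) + (weighted_fourier s (\<phi> n) \<xi> - weighted_fourier s (\<phi> m) \<xi>))"
          unfolding W\<theta> by (simp add: algebra_simps)
        also have "\<dots> \<le> l2norm (\<lambda>\<xi>. weighted_fourier s (\<psi> m) \<xi> - weighted_fourier s (\<psi> n) \<xi>) + l2norm (\<lambda>\<xi>. weighted_fourier s (\<phi> n) \<xi> - weighted_fourier s (\<phi> m) \<xi>)"
          by (intro l2norm_triangle square_integrable_diff W t\<psi> \<phi>)
        finally show ?thesis using N1[of m n] N2[of n m] that by simp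
      qed
      then show ?thesis by blast
    qed
    have l\<theta>2: "(\<lambda>n. l2norm (weighted_fourier s (\<theta> n))) \<longlonglongrightarrow> 0"
      by (rule Sobolev_norm_closable[OF s t\<theta> _ l\<theta> cauchy]) (use p in auto)
    have "(\<lambda>n. \<bar>l2norm (weighted_fourier s (\<psi> n)) - l2norm F\<bar>) \<longlonglongrightarrow> 0"
    proof (rule tendsto_sandwich[OF _ _ tendsto_const])
      show "(\<lambda>n. l2norm (weighted_fourier s (\<theta> n)) + l2norm (\<lambda>\<xi>. weighted_fourier s (\<phi> n) \<xi> - F \<xi>)) \<longlonglongrightarrow> 0"
        using tendsto_add[OF l\<theta>2 l2] by simp
      have "\<bar>l2norm (weighted_fourier s (\<psi> n)) - l2norm F\<bar> \<le> l2norm (weighted_fourier s (\<theta> n)) + l2norm (\<lambda>\<xi>. weighted_fourier s (\<phi> n) \<xi> - F \<xi>)" for n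
      proof -
        have "\<bar>l2norm (weighted_fourier s (\<psi> n)) - l2norm (weighted_fourier s (\<phi> n))\<bar> \<le> l2norm (weighted_fourier s (\<theta> n))"
          unfolding W\<theta> by (intro l2norm_triangle_diff W t\<psi> \<phi>)
        moreover have "\<bar>l2norm (weighted_fourier s (\<phi> n)) - l2norm F\<bar> \<le> l2norm (\<lambda>\<xi>. weighted_fourier s (\<phi> n) \<xi> - F \<xi>)"
          using F by (intro l2norm_triangle_diff W \<phi>) auto
        ultimately show ?thesis by linarith
      qed
      then show "\<forall>\<^sub>F n in sequentially. \<bar>l2norm (weighted_fourier s (\<psi> n)) - l2norm F\<bar> \<le> l2norm (weighted_fourier s (\<theta> n)) + l2norm (\<lambda>\<xi>. weighted_fourier s (\<phi> n) \<xi> - F \<xi>)" by simp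
    qed auto
    then have "(\<lambda>n. l2norm (weighted_fourier s (\<psi> n))) \<longlonglongrightarrow> l2norm F"
      by (metis LIM_zero_cancel tendsto_rabs_zero_cancel)
    then show ?thesis unfolding test_norm_eq[OF t\<psi> s'] .
  qed
  show "Hs_norm s f = l2norm F"
    unfolding Hs_norm_def
  proof (rule the_equality)
    show "\<exists>\<phi>. Hs_approx s \<phi> f \<and> (\<lambda>n. test_norm s (\<phi> n)) \<longlonglongrightarrow> l2norm F"
      using approx norm_lim by blast
    show "L = l2norm F" if "\<exists>\<phi>. Hs_approx s \<phi> f \<and> (\<lambda>n. test_norm s (\<phi> n)) \<longlonglongrightarrow> L" for L
      using that norm_lim LIMSEQ_unique by blast
  qed
qed

section \<open>Smooth cutoffs\<close>

text \<open>\<open>bump 0\<close> is the standard smooth function \<open>exp (- (1 / z))\<close>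
  extended by 0; the powers of \<open>1 / z\<close> make the family closed under differentiation up
  to linear combinations.\<close>

definition bump :: "nat \<Rightarrow> real \<Rightarrow> real" where
  "bump k z = (if z > 0 then (1 / z) ^ k * exp (- (1 / z)) else 0)"

lemma power_le_exp: "(y::real) \<ge> 0 \<Longrightarrow> y ^ k \<le> real k ^ k * exp y"
proof (cases "k = 0")
  case False
  assume y: "y \<ge> 0"
  have "y ^ k \<le> (real k * (1 + y / real k)) ^ k"
    using False y by (intro power_mono) (auto simp: field_simps)
  also have "\<dots> = real k ^ k * (1 + y / real k) ^ k" by (rule power_mult_distrib)
  also have "\<dots> \<le> real k ^ k * exp y"
    using False y by (intro mult_left_mono exp_ge_one_plus_x_over_n_power_n) auto
  finally show ?thesis .
qed simp

lemma bump_nonneg: "bump k z \<ge> 0"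
  by (simp add: bump_def)

lemma bump_le: "bump k z \<le> real k ^ k"
proof (cases "z > 0")
  case True
  then have "(1 / z) ^ k * exp (- (1 / z)) \<le> (real k ^ k * exp (1 / z)) * exp (- (1 / z))"
    by (intro mult_right_mono power_le_exp) auto
  then show ?thesis using True by (simp add: bump_def mult.assoc exp_minus)
qed (simp add: bump_def)

lemma bump_has_derivative: "(bump k has_real_derivative (bump (k + 2) z - real k * bump (k + 1) z)) (at z)"
proof -
  consider "z > 0" | "z < 0" | "z = 0" by linarith
  then show ?thesis
  proof cases
    case 1
    have "((\<lambda>y. y ^ k * exp (- y)) has_real_derivative (real k * (1 / z) ^ (k - 1) * exp (- (1 / z)) - (1 / z) ^ k * exp (- (1 / z)))) (at (1 / z))"
      by (auto intro!: derivative_eq_intros)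
    moreover have "((\<lambda>z. 1 / z) has_real_derivative - ((1 / z)\<^sup>2)) (at z)"
      using 1 by (auto intro!: derivative_eq_intros simp: power2_eq_square field_simps)
    ultimately have "((\<lambda>z. (1 / z) ^ k * exp (- (1 / z))) has_real_derivative
        (real k * (1 / z) ^ (k - 1) * exp (- (1 / z)) - (1 / z) ^ k * exp (- (1 / z))) * - ((1 / z)\<^sup>2)) (at z)"
      by (rule DERIV_chain2)
    moreover have "(real k * (1 / z) ^ (k - 1) * exp (- (1 / z)) - (1 / z) ^ k * exp (- (1 / z))) * - ((1 / z)\<^sup>2)
       = bump (k + 2) z - real k * bump (k + 1) z"
    proof -
      have "(real k * y ^ (k - 1) * E - y ^ k * E) * - (y\<^sup>2) = y ^ (k + 2) * E - real k * (y ^ (k + 1) * E)" for y E :: real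
        by (cases k) (simp_all add: algebra_simps power2_eq_square)
      then show ?thesis using 1 by (simp only: bump_def if_True)
    qed
    ultimately have "((\<lambda>z. (1 / z) ^ k * exp (- (1 / z))) has_real_derivative (bump (k + 2) z - real k * bump (k + 1) z)) (at z)"
      by (simp only:)
    then show ?thesis
      by (rule has_field_derivative_transform_within_open[where S="{0<..}"]) (use 1 in \<open>auto simp: bump_def\<close>)
  next
    case 2
    have "((\<lambda>z::real. 0) has_real_derivative 0) (at z)" by simp
    then have "(bump k has_real_derivative 0) (at z)"
      using 2 by (rule_tac has_field_derivative_transform_within_open[where S="{..<0}"]) (auto simp: bump_def)
    then show ?thesis using 2 by (simp add: bump_def)
  next
    case 3
    have le: "\<bar>(bump k (0 + h) - bump k 0) / h\<bar> \<le> \<bar>h\<bar> * real (k + 2) ^ (k + 2)" if "h \<noteq> 0" for h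
    proof (cases "h > 0")
      case True
      \<comment> \<open>The quotient supplies one power of \<open>1 / h\<close>; a second is put in
        and cancelled by the factor \<open>h\<close>. As \<open>bump (k + 2)\<close> is bounded, the
        quotient tends to 0.\<close>
      then have "(bump k (0 + h) - bump k 0) / h = h * bump (k + 2) h"
        by (simp add: bump_def field_simps power2_eq_square)
      then show ?thesis using True bump_le[of "k + 2" h] bump_nonneg[of "k + 2" h] by (simp add: abs_mult)
    next
      case False
      then have "(bump k (0 + h) - bump k 0) / h = 0" by (simp add: bump_def)
      then show ?thesis by (simp only: abs_zero) (intro mult_nonneg_nonneg, auto)
    qed
    have "((\<lambda>h. (bump k (0 + h) - bump k 0) / h) \<longlongrightarrow> 0) (at 0)"
    proof (rule Lim_null_comparison)
      show "((\<lambda>h::real. \<bar>h\<bar> * real (k + 2) ^ (k + 2)) \<longlongrightarrow> 0) (at 0)"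
        by (auto intro!: tendsto_eq_intros)
      show "\<forall>\<^sub>F h in at 0. norm ((bump k (0 + h) - bump k 0) / h) \<le> \<bar>h\<bar> * real (k + 2) ^ (k + 2)"
        unfolding real_norm_def eventually_at_filter using le by (intro always_eventually) blast
    qed
    then have "(bump k has_real_derivative 0) (at 0)" unfolding DERIV_def .
    then show ?thesis using 3 by (simp add: bump_def)
  qed
qed

text \<open>The first argument is the scale of the cutoff, in which all bounds are uniform.\<close>

inductive cutoff_algebra :: "real \<Rightarrow> real ^ 'n \<Rightarrow> (real \<Rightarrow> real ^ 'n \<Rightarrow> real) \<Rightarrow> bool" for a b where
  const: "cutoff_algebra a b (\<lambda>\<eta> x. c)"
| scale: "cutoff_algebra a b (\<lambda>\<eta> x. \<eta>)"
| linear: "cutoff_algebra a b (\<lambda>\<eta> x. (x - b) \<bullet> w)"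
| bump: "cutoff_algebra a b (\<lambda>\<eta> x. bump k (1 - \<eta> * (norm (x - b))\<^sup>2))"
| power: "cutoff_algebra a b (\<lambda>\<eta> x. (a + (norm (x - b))\<^sup>2) powr r)"
| add: "cutoff_algebra a b f \<Longrightarrow> cutoff_algebra a b g \<Longrightarrow> cutoff_algebra a b (\<lambda>\<eta> x. f \<eta> x + g \<eta> x)"
| mult: "cutoff_algebra a b f \<Longrightarrow> cutoff_algebra a b g \<Longrightarrow> cutoff_algebra a b (\<lambda>\<eta> x. f \<eta> x * g \<eta> x)"

lemma has_derivative_norm_square:
  fixes b :: "'a::real_inner"
  shows "((\<lambda>x. (norm (x - b))\<^sup>2) has_derivative (\<lambda>v. 2 * ((x - b) \<bullet> v))) (at x)"
  unfolding power2_norm_eq_inner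
  by (auto intro!: derivative_eq_intros simp: inner_commute)

text \<open>The generators are chosen for this: differentiating a \<open>bump\<close> of the
  rescaled square brings out the scale, a linear function and bumps of higher index; differentiating
  a power lowers its exponent and brings out a linear function.\<close>

lemma cutoff_algebra_derivative:
  assumes "cutoff_algebra a b g" and a: "a > 0"
  shows "\<exists>D. (\<forall>v. cutoff_algebra a b (D v)) \<and> (\<forall>\<eta> x. (g \<eta> has_derivative (\<lambda>v. D v \<eta> x)) (at x))"
  using assms(1)
proof induction
  case (const c)
  show ?case by (intro exI[of _ "\<lambda>v \<eta> x. 0"]) (auto intro: cutoff_algebra.const)
next
  case scale
  show ?case by (intro exI[of _ "\<lambda>v \<eta> x. 0"]) (auto intro: cutoff_algebra.const)
next
  case (linear w)
  show ?case
    by (intro exI[of _ "\<lambda>v \<eta> x. v \<bullet> w"]) (auto intro: cutoff_algebra.const intro!: derivative_eq_intros)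
next
  case (bump k)
  let ?D = "\<lambda>v \<eta> x. (bump (k + 2) (1 - \<eta> * (norm (x - b))\<^sup>2) + (- real k) * bump (k + 1) (1 - \<eta> * (norm (x - b))\<^sup>2)) * (\<eta> * ((- 2) * ((x - b) \<bullet> v)))"
  have "((\<lambda>x. bump k (1 - \<eta> * (norm (x - b))\<^sup>2)) has_derivative (\<lambda>v. ?D v \<eta> x)) (at x)" for \<eta> x
  proof -
    have "((\<lambda>x. 1 - \<eta> * (norm (x - b))\<^sup>2) has_derivative (\<lambda>v. 0 - \<eta> * (2 * ((x - b) \<bullet> v)))) (at x)"
      by (intro has_derivative_diff has_derivative_const has_derivative_mult_right has_derivative_norm_square)
    from has_derivative_compose[OF this bump_has_derivative[unfolded has_field_derivative_def]]
    show ?thesis by (simp add: algebra_simps)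
  qed
  then show ?case by (intro exI[of _ ?D] conjI allI) (intro cutoff_algebra.intros)
next
  case (power r)
  let ?D = "\<lambda>v \<eta> x. r * (a + (norm (x - b))\<^sup>2) powr (r - 1) * (2 * ((x - b) \<bullet> v))"
  have "((\<lambda>x. (a + (norm (x - b))\<^sup>2) powr r) has_derivative (\<lambda>v. ?D v \<eta> x)) (at x)" for \<eta> x
  proof -
    have p: "a + (norm (x - b))\<^sup>2 > 0" using a by (simp add: add_pos_nonneg)
    have 1: "((\<lambda>x. a + (norm (x - b))\<^sup>2) has_derivative (\<lambda>v. 0 + (2 * ((x - b) \<bullet> v)))) (at x)"
      by (intro has_derivative_add has_derivative_const has_derivative_norm_square)
    have "((\<lambda>z. z powr r) has_real_derivative r * (a + (norm (x - b))\<^sup>2) powr (r - 1)) (at (a + (norm (x - b))\<^sup>2))"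
      using p by (rule has_real_derivative_powr)
    from has_derivative_compose[OF 1 this[unfolded has_field_derivative_def]]
    show ?thesis by simp
  qed
  then show ?case by (intro exI[of _ ?D]) (auto intro!: cutoff_algebra.intros)
next
  case (add f g)
  then obtain D E where D: "\<And>v. cutoff_algebra a b (D v)" "\<And>\<eta> x. (f \<eta> has_derivative (\<lambda>v. D v \<eta> x)) (at x)"
    and E: "\<And>v. cutoff_algebra a b (E v)" "\<And>\<eta> x. (g \<eta> has_derivative (\<lambda>v. E v \<eta> x)) (at x)" by blast
  show ?case
    by (intro exI[of _ "\<lambda>v \<eta> x. D v \<eta> x + E v \<eta> x"] conjI allI cutoff_algebra.intros D E has_derivative_add)
next
  case (mult f g)
  then obtain D E where D: "\<And>v. cutoff_algebra a b (D v)" "\<And>\<eta> x. (f \<eta> has_derivative (\<lambda>v. D v \<eta> x)) (at x)"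
    and E: "\<And>v. cutoff_algebra a b (E v)" "\<And>\<eta> x. (g \<eta> has_derivative (\<lambda>v. E v \<eta> x)) (at x)" by blast
  show ?case
    by (intro exI[of _ "\<lambda>v \<eta> x. f \<eta> x * E v \<eta> x + D v \<eta> x * g \<eta> x"] conjI allI cutoff_algebra.intros D E mult.hyps has_derivative_mult)
qed

text \<open>Together with closure under derivatives this bounds every derivative of a member
  polynomially, with one bound for all scales in the unit interval.\<close>

lemma cutoff_algebra_bound:
  assumes "cutoff_algebra a b g" and a: "a > 0"
  shows "\<exists>C m. C \<ge> 0 \<and> (\<forall>\<eta> x. 0 \<le> \<eta> \<longrightarrow> \<eta> \<le> 1 \<longrightarrow> \<bar>g \<eta> x\<bar> \<le> C * (1 + (norm (x - b))\<^sup>2) ^ m)"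
  using assms(1)
proof induction
  case (const c)
  show ?case by (intro exI[of _ "\<bar>c\<bar>"] exI[of _ 0]) simp
next
  case scale
  show ?case by (intro exI[of _ 1] exI[of _ 0]) simp
next
  case (linear w)
  have "\<bar>(x - b) \<bullet> w\<bar> \<le> norm w * (1 + (norm (x - b))\<^sup>2)" for x
  proof -
    have "norm (x - b) \<le> 1 + (norm (x - b))\<^sup>2"
      using sum_squares_bound[of "norm (x - b)" 1] by (simp add: power2_eq_square) (smt (verit) zero_le_square)
    then have "norm (x - b) * norm w \<le> (1 + (norm (x - b))\<^sup>2) * norm w" by (intro mult_right_mono) auto
    then show ?thesis using Cauchy_Schwarz_ineq2[of "x - b" w] by (simp add: mult.commute)
  qed
  then show ?case by (intro exI[of _ "norm w"] exI[of _ 1]) simp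
next
  case (bump k)
  have "\<bar>bump k z\<bar> \<le> real k ^ k" for z using bump_le[of k z] bump_nonneg[of k z] by simp
  then show ?case by (intro exI[of _ "real k ^ k"] exI[of _ 0]) simp
next
  case (power r)
  define m where "m = nat \<lceil>\<bar>r\<bar>\<rceil>"
  have m: "\<bar>r\<bar> \<le> real m" unfolding m_def by linarith
  have "(a + (norm (x - b))\<^sup>2) powr r \<le> (max a (1 / a) powr \<bar>r\<bar>) * (1 + (norm (x - b))\<^sup>2) ^ m" for x
  proof -
    let ?t = "(norm (x - b))\<^sup>2"
    \<comment> \<open>The constant \<open>max a (1 / a)\<close> serves both signs of
      \<open>r\<close>: for \<open>r \<ge> 0\<close> it bounds \<open>a + ?t\<close> by a multiple
      of \<open>1 + ?t\<close>, for negative \<open>r\<close> it bounds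
      \<open>1 / a\<close>.\<close>
    have M1: "max a (1 / a) \<ge> 1"
    proof (cases "a \<ge> 1")
      case False
      then have "1 / a \<ge> 1" using a by (simp add: field_simps)
      then show ?thesis by (rule max.coboundedI2)
    qed (rule max.coboundedI1)
    have t1: "(1 + ?t) powr \<bar>r\<bar> \<le> (1 + ?t) ^ m"
    proof -
      have "(1 + ?t) powr \<bar>r\<bar> \<le> (1 + ?t) powr real m" using m by (intro powr_mono) auto
      also have "\<dots> = (1 + ?t) ^ m" by (rule powr_realpow) (simp add: add_pos_nonneg)
      finally show ?thesis .
    qed
    show ?thesis
    proof (cases "r \<ge> 0")
      case True
      have "a + ?t \<le> max a (1 / a) * (1 + ?t)"
        using M1 mult_right_mono[OF M1, of ?t] by (simp add: distrib_left add_mono)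
      then have "(a + ?t) powr r \<le> (max a (1 / a) * (1 + ?t)) powr r" using True a by (intro powr_mono2) auto
      also have "\<dots> = max a (1 / a) powr \<bar>r\<bar> * (1 + ?t) powr \<bar>r\<bar>" using True M1 by (simp add: powr_mult)
      also have "\<dots> \<le> max a (1 / a) powr \<bar>r\<bar> * (1 + ?t) ^ m" using t1 by (intro mult_left_mono) auto
      finally show ?thesis .
    next
      case False
      have "(a + ?t) powr r \<le> a powr r" using False a by (intro powr_mono2') auto
      also have "\<dots> = (1 / a) powr \<bar>r\<bar>" using False a by (simp add: powr_divide powr_minus_divide[symmetric])
      also have "\<dots> \<le> max a (1 / a) powr \<bar>r\<bar>" using a by (intro powr_mono2) auto
      also have "\<dots> \<le> max a (1 / a) powr \<bar>r\<bar> * (1 + ?t) ^ m"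
        using mult_left_mono[of 1 "(1 + ?t) ^ m" "max a (1 / a) powr \<bar>r\<bar>"] by (simp add: one_le_power)
      finally show ?thesis .
    qed
  qed
  then show ?case by (intro exI[of _ "max a (1 / a) powr \<bar>r\<bar>"] exI[of _ m]) simp
next
  case (add f g)
  then obtain C m D n where C: "C \<ge> 0" "\<And>\<eta> x. 0 \<le> \<eta> \<Longrightarrow> \<eta> \<le> 1 \<Longrightarrow> \<bar>f \<eta> x\<bar> \<le> C * (1 + (norm (x - b))\<^sup>2) ^ m"
    and D: "D \<ge> 0" "\<And>\<eta> x. 0 \<le> \<eta> \<Longrightarrow> \<eta> \<le> 1 \<Longrightarrow> \<bar>g \<eta> x\<bar> \<le> D * (1 + (norm (x - b))\<^sup>2) ^ n" by metis
  have "\<bar>f \<eta> x + g \<eta> x\<bar> \<le> (C + D) * (1 + (norm (x - b))\<^sup>2) ^ (m + n)" if "0 \<le> \<eta>" "\<eta> \<le> 1" for \<eta> x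
  proof -
    have "C * (1 + (norm (x - b))\<^sup>2) ^ m \<le> C * (1 + (norm (x - b))\<^sup>2) ^ (m + n)"
      "D * (1 + (norm (x - b))\<^sup>2) ^ n \<le> D * (1 + (norm (x - b))\<^sup>2) ^ (m + n)"
      using C D by (auto intro!: mult_left_mono power_increasing)
    then show ?thesis using C(2)[OF that, of x] D(2)[OF that, of x] by (simp add: distrib_right)
  qed
  then show ?case using C D by (intro exI[of _ "C + D"] exI[of _ "m + n"]) auto
next
  case (mult f g)
  then obtain C m D n where C: "C \<ge> 0" "\<And>\<eta> x. 0 \<le> \<eta> \<Longrightarrow> \<eta> \<le> 1 \<Longrightarrow> \<bar>f \<eta> x\<bar> \<le> C * (1 + (norm (x - b))\<^sup>2) ^ m"
    and D: "D \<ge> 0" "\<And>\<eta> x. 0 \<le> \<eta> \<Longrightarrow> \<eta> \<le> 1 \<Longrightarrow> \<bar>g \<eta> x\<bar> \<le> D * (1 + (norm (x - b))\<^sup>2) ^ n" by metis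
  have "\<bar>f \<eta> x * g \<eta> x\<bar> \<le> (C * D) * (1 + (norm (x - b))\<^sup>2) ^ (m + n)" if "0 \<le> \<eta>" "\<eta> \<le> 1" for \<eta> x
  proof -
    have "\<bar>f \<eta> x\<bar> * \<bar>g \<eta> x\<bar> \<le> (C * (1 + (norm (x - b))\<^sup>2) ^ m) * (D * (1 + (norm (x - b))\<^sup>2) ^ n)"
      using C D that by (intro mult_mono) auto
    then show ?thesis by (simp add: abs_mult power_add mult_ac)
  qed
  then show ?case using C D by (intro exI[of _ "C * D"] exI[of _ "m + n"]) auto
qed

section \<open>Gaussian-damped cutoff functions\<close>

lemma damped_derivative:
  fixes b :: "real ^ 'n"
  assumes "cutoff_algebra a b g" and a: "a > 0"
  shows "\<exists>D. (\<forall>v. cutoff_algebra a b (D v)) \<and>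
    (\<forall>\<eta> x. ((\<lambda>x. exp (- \<delta> * (norm (x - b))\<^sup>2) * g \<eta> x) has_derivative (\<lambda>v. exp (- \<delta> * (norm (x - b))\<^sup>2) * D v \<eta> x)) (at x))"
proof -
  obtain D where D: "\<And>v. cutoff_algebra a b (D v)" "\<And>\<eta> x. (g \<eta> has_derivative (\<lambda>v. D v \<eta> x)) (at x)"
    using cutoff_algebra_derivative[OF assms] by blast
  let ?D = "\<lambda>v \<eta> x. D v \<eta> x + (- 2 * \<delta>) * (((x - b) \<bullet> v) * g \<eta> x)"
  have "((\<lambda>x. exp (- \<delta> * (norm (x - b))\<^sup>2) * g \<eta> x) has_derivative (\<lambda>v. exp (- \<delta> * (norm (x - b))\<^sup>2) * ?D v \<eta> x)) (at x)" for \<eta> x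
  proof -
    have 1: "((\<lambda>x. exp (- \<delta> * (norm (x - b))\<^sup>2)) has_derivative (\<lambda>v. exp (- \<delta> * (norm (x - b))\<^sup>2) * (- \<delta> * (2 * ((x - b) \<bullet> v))))) (at x)"
      by (rule has_derivative_compose[OF _ DERIV_exp[unfolded has_field_derivative_def]])
         (intro has_derivative_mult_right has_derivative_norm_square)
    show ?thesis
      using has_derivative_mult[OF 1 D(2)[of \<eta> x]] by (simp add: algebra_simps)
  qed
  moreover have "cutoff_algebra a b (?D v)" for v
    by (intro cutoff_algebra.intros D(1) assms(1))
  ultimately show ?thesis by (intro exI[of _ ?D] conjI allI)
qed

lemma damped_C_k:
  assumes "cutoff_algebra a b g" and a: "a > 0"
  shows "C_k k (\<lambda>x. exp (- \<delta> * (norm (x - b))\<^sup>2) * g \<eta> x)"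
  using assms(1)
proof (induction k arbitrary: g)
  case 0
  obtain D where D: "\<And>\<eta> x. ((\<lambda>x. exp (- \<delta> * (norm (x - b))\<^sup>2) * g \<eta> x) has_derivative (\<lambda>v. exp (- \<delta> * (norm (x - b))\<^sup>2) * D v \<eta> x)) (at x)"
    using damped_derivative[OF 0 a, of \<delta>] by blast
  show ?case
    unfolding C_k.simps using has_derivative_continuous[OF D] by (intro continuous_at_imp_continuous_on ballI)
next
  case (Suc k)
  obtain D where D: "\<And>v. cutoff_algebra a b (D v)"
    "\<And>\<eta> x. ((\<lambda>x. exp (- \<delta> * (norm (x - b))\<^sup>2) * g \<eta> x) has_derivative (\<lambda>v. exp (- \<delta> * (norm (x - b))\<^sup>2) * D v \<eta> x)) (at x)"
    using damped_derivative[OF Suc.prems a, of \<delta>] by blast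
  have "frechet_derivative (\<lambda>x. exp (- \<delta> * (norm (x - b))\<^sup>2) * g \<eta> x) (at x) = (\<lambda>v. exp (- \<delta> * (norm (x - b))\<^sup>2) * D v \<eta> x)" for x
    using frechet_derivative_at[OF D(2)] by simp
  then show ?case
    using Suc.IH[OF D(1)] differentiableI[OF D(2)] unfolding C_k.simps differentiable_on_def by simp
qed

text \<open>The Gaussian reproduces itself under differentiation, so it stays in front while the
  rest remains in the algebra. One \<open>h\<close> serves all scales, which makes its bound
  uniform.\<close>

lemma damped_dirderiv_power:
  assumes "cutoff_algebra a b g" and a: "a > 0"
  shows "\<exists>h. cutoff_algebra a b h \<and> (\<forall>\<eta>. (dirderiv v ^^ k) (\<lambda>x. exp (- \<delta> * (norm (x - b))\<^sup>2) * g \<eta> x) = (\<lambda>x. exp (- \<delta> * (norm (x - b))\<^sup>2) * h \<eta> x))"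
proof (induction k)
  case 0
  show ?case using assms by auto
next
  case (Suc k)
  then obtain h where h: "cutoff_algebra a b h" "\<And>\<eta>. (dirderiv v ^^ k) (\<lambda>x. exp (- \<delta> * (norm (x - b))\<^sup>2) * g \<eta> x) = (\<lambda>x. exp (- \<delta> * (norm (x - b))\<^sup>2) * h \<eta> x)" by blast
  obtain D where D: "\<And>v. cutoff_algebra a b (D v)"
    "\<And>\<eta> x. ((\<lambda>x. exp (- \<delta> * (norm (x - b))\<^sup>2) * h \<eta> x) has_derivative (\<lambda>v. exp (- \<delta> * (norm (x - b))\<^sup>2) * D v \<eta> x)) (at x)"
    using damped_derivative[OF h(1) a, of \<delta>] by blast
  have "dirderiv v (\<lambda>x. exp (- \<delta> * (norm (x - b))\<^sup>2) * h \<eta> x) = (\<lambda>x. exp (- \<delta> * (norm (x - b))\<^sup>2) * D v \<eta> x)" for \<eta>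
    unfolding dirderiv_def using frechet_derivative_at[OF D(2)] by (auto simp: fun_eq_iff dest: fun_cong)
  then show ?case using h D(1) by (intro exI[of _ "D v"]) auto
qed

lemma gaussian_moment:
  fixes b :: "'a::euclidean_space"
  assumes d: "\<delta> > 0"
  shows "integrable lborel (\<lambda>x. (1 + (norm (x - b))\<^sup>2) ^ m * exp (- \<delta> * (norm (x - b))\<^sup>2))"
proof -
  \<comment> \<open>Chosen so that the kernel exponent
    \<open>(norm (c *\<^sub>R (x - b)))\<^sup>2 / 4\<close> equals
    \<open>\<delta> * (norm (x - b))\<^sup>2\<close>.\<close>
  define c where "c = 2 * sqrt \<delta>"
  have c: "c > 0" "c\<^sup>2 = 4 * \<delta>" using d by (auto simp: c_def power_mult_distrib)
  define M where "M = max 1 (1 / c\<^sup>2)"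
  have M: "M \<ge> 1" "M * c\<^sup>2 \<ge> 1"
  proof -
    show "M \<ge> 1" by (simp add: M_def)
    have "1 / c\<^sup>2 \<le> M" by (simp add: M_def)
    then have "1 / c\<^sup>2 * c\<^sup>2 \<le> M * c\<^sup>2" by (rule mult_right_mono) simp
    then show "M * c\<^sup>2 \<ge> 1" using c(1) by simp
  qed
  let ?K = "M ^ Suc m / (4 * pi) powr (- real DIM('a) / 2)"
  \<comment> \<open>\<open>Suc m\<close> because \<open>gauss_kernel_moment\<close> asks for a
    positive exponent, while \<open>m\<close> may be 0.\<close>
  have "integrable lborel (\<lambda>x. (\<lambda>k. (1 + (norm k)\<^sup>2) ^ Suc m * gauss_kernel k) ((- c) *\<^sub>R b + c *\<^sub>R x))"
    using c by (subst integrable_lborel_affine_iff) (auto intro!: gauss_kernel_moment simp del: power_Suc)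
  then have i: "integrable lborel (\<lambda>x. ?K * ((1 + (norm ((- c) *\<^sub>R b + c *\<^sub>R x))\<^sup>2) ^ Suc m * gauss_kernel ((- c) *\<^sub>R b + c *\<^sub>R x)))"
    by (intro integrable_mult_right)
  have le: "(1 + (norm (x - b))\<^sup>2) ^ m * exp (- \<delta> * (norm (x - b))\<^sup>2) \<le> ?K * ((1 + (norm ((- c) *\<^sub>R b + c *\<^sub>R x))\<^sup>2) ^ Suc m * gauss_kernel ((- c) *\<^sub>R b + c *\<^sub>R x))" for x
  proof -
    have "(- c) *\<^sub>R b + c *\<^sub>R x = c *\<^sub>R (x - b)" by (simp add: algebra_simps)
    then have n: "(norm ((- c) *\<^sub>R b + c *\<^sub>R x))\<^sup>2 = c\<^sup>2 * (norm (x - b))\<^sup>2" using c by (simp add: power_mult_distrib)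
    have "1 + (norm (x - b))\<^sup>2 \<le> M * (1 + c\<^sup>2 * (norm (x - b))\<^sup>2)"
      using M mult_right_mono[OF M(2), of "(norm (x - b))\<^sup>2"] by (simp add: distrib_left mult.assoc)
    then have "(1 + (norm (x - b))\<^sup>2) ^ Suc m \<le> (M * (1 + c\<^sup>2 * (norm (x - b))\<^sup>2)) ^ Suc m" by (intro power_mono) auto
    moreover have "(1 + (norm (x - b))\<^sup>2) ^ m \<le> (1 + (norm (x - b))\<^sup>2) ^ Suc m" by (intro power_increasing) auto
    ultimately have "(1 + (norm (x - b))\<^sup>2) ^ m \<le> M ^ Suc m * (1 + c\<^sup>2 * (norm (x - b))\<^sup>2) ^ Suc m"
      unfolding power_mult_distrib by linarith
    then have "(1 + (norm (x - b))\<^sup>2) ^ m * exp (- \<delta> * (norm (x - b))\<^sup>2) \<le> M ^ Suc m * (1 + c\<^sup>2 * (norm (x - b))\<^sup>2) ^ Suc m * exp (- \<delta> * (norm (x - b))\<^sup>2)"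
      by (intro mult_right_mono) auto
    also have "M ^ Suc m * (1 + c\<^sup>2 * (norm (x - b))\<^sup>2) ^ Suc m * exp (- \<delta> * (norm (x - b))\<^sup>2) = ?K * ((1 + (norm ((- c) *\<^sub>R b + c *\<^sub>R x))\<^sup>2) ^ Suc m * gauss_kernel ((- c) *\<^sub>R b + c *\<^sub>R x))"
    proof -
      have "exp (- \<delta> * (norm (x - b))\<^sup>2) = gauss_kernel ((- c) *\<^sub>R b + c *\<^sub>R x) / (4 * pi) powr (- real DIM('a) / 2)"
        unfolding gauss_kernel_def n c(2) by simp
      then show ?thesis unfolding n by (simp del: power_Suc)
    qed
    finally show ?thesis .
  qed
  have b: "AE x in lborel. norm ((1 + (norm (x - b))\<^sup>2) ^ m * exp (- \<delta> * (norm (x - b))\<^sup>2)) \<le> norm (?K * ((1 + (norm ((- c) *\<^sub>R b + c *\<^sub>R x))\<^sup>2) ^ Suc m * gauss_kernel ((- c) *\<^sub>R b + c *\<^sub>R x)))"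
    unfolding real_norm_def
    by (intro AE_I2, subst abs_of_nonneg, simp, rule order_trans[OF le abs_ge_self])
  show ?thesis by (rule Bochner_Integration.integrable_bound[OF i _ b]) measurable
qed

lemma damped_cutoff_test_function:
  fixes b :: "real ^ 'n"
  assumes g: "cutoff_algebra a b g" and a: "a > 0" and e: "\<eta> > 0"
  shows "(\<lambda>x. exp (- \<delta> * (norm (x - b))\<^sup>2) * (bump 0 (1 - \<eta> * (norm (x - b))\<^sup>2) * g \<eta> x)) \<in> test_functions"
    (is "?f \<in> _")
proof -
  have "C_k k ?f" for k
    using damped_C_k[OF cutoff_algebra.mult[OF cutoff_algebra.bump g] a] .
  moreover have "support_on UNIV ?f \<subseteq> cball b (sqrt (1 / \<eta>))"
  proof
    fix x assume "x \<in> support_on UNIV ?f"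
    then have "bump 0 (1 - \<eta> * (norm (x - b))\<^sup>2) \<noteq> 0" by (auto simp: support_on_def)
    then have "\<eta> * (norm (x - b))\<^sup>2 < 1" by (auto simp: bump_def split: if_splits)
    then have "(norm (x - b))\<^sup>2 \<le> 1 / \<eta>" using e by (simp add: field_simps)
    then have "norm (x - b) \<le> sqrt (1 / \<eta>)" by (rule real_le_rsqrt)
    then show "x \<in> cball b (sqrt (1 / \<eta>))" by (simp add: dist_norm norm_minus_commute)
  qed
  then have "bounded (support_on UNIV ?f)" using bounded_cball bounded_subset by blast
  ultimately show ?thesis unfolding test_functions_def by (simp add: compact_closure)
qed

text \<open>Each derivative is a Gaussian times a member of the cutoff algebra, hence its integral
  is bounded for all \<open>\<eta>\<close> at once. Inserted into
  \<open>fourier_test_function_decay\<close>, these bounds give the dominating function for removing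
  the cutoff.\<close>

lemma damped_cutoff_fourier_decay:
  fixes b :: "real ^ 'n"
  assumes g: "cutoff_algebra a b g" and a: "a > 0" and d: "\<delta> > 0"
  shows "\<exists>C\<ge>0. \<forall>\<eta> \<xi>. 0 < \<eta> \<longrightarrow> \<eta> \<le> 1 \<longrightarrow> (1 + (norm \<xi>)\<^sup>2) ^ N * cmod (fourier (\<lambda>x. of_real (exp (- \<delta> * (norm (x - b))\<^sup>2) * (bump 0 (1 - \<eta> * (norm (x - b))\<^sup>2) * g \<eta> x))) \<xi>) \<le> C"
proof -
  let ?f = "\<lambda>\<eta> x. exp (- \<delta> * (norm (x - b))\<^sup>2) * (bump 0 (1 - \<eta> * (norm (x - b))\<^sup>2) * g \<eta> x)"
  have alg: "cutoff_algebra a b (\<lambda>\<eta> x. bump 0 (1 - \<eta> * (norm (x - b))\<^sup>2) * g \<eta> x)"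
    by (intro cutoff_algebra.intros g)
  have "\<exists>C. \<forall>\<eta>. 0 < \<eta> \<longrightarrow> \<eta> \<le> 1 \<longrightarrow> (\<integral>x. \<bar>(dirderiv v ^^ k) (?f \<eta>) x\<bar> \<partial>lborel) \<le> C" for v k
  proof -
    obtain h where h: "cutoff_algebra a b h" "\<And>\<eta>. (dirderiv v ^^ k) (?f \<eta>) = (\<lambda>x. exp (- \<delta> * (norm (x - b))\<^sup>2) * h \<eta> x)"
      using damped_dirderiv_power[OF alg a, where v=v and k=k and \<delta>=\<delta>] by blast
    obtain C m where C: "C \<ge> 0" "\<And>\<eta> x. 0 \<le> \<eta> \<Longrightarrow> \<eta> \<le> 1 \<Longrightarrow> \<bar>h \<eta> x\<bar> \<le> C * (1 + (norm (x - b))\<^sup>2) ^ m"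
      using cutoff_algebra_bound[OF h(1) a] by blast
    have i: "integrable lborel (\<lambda>x. C * ((1 + (norm (x - b))\<^sup>2) ^ m * exp (- \<delta> * (norm (x - b))\<^sup>2)))"
      by (intro integrable_mult_right gaussian_moment d)
    have "(\<integral>x. \<bar>(dirderiv v ^^ k) (?f \<eta>) x\<bar> \<partial>lborel) \<le> (\<integral>x. C * ((1 + (norm (x - b))\<^sup>2) ^ m * exp (- \<delta> * (norm (x - b))\<^sup>2)) \<partial>lborel)" if "0 < \<eta>" "\<eta> \<le> 1" for \<eta>
    proof (rule integral_mono'[OF i])
      show "\<bar>(dirderiv v ^^ k) (?f \<eta>) x\<bar> \<le> C * ((1 + (norm (x - b))\<^sup>2) ^ m * exp (- \<delta> * (norm (x - b))\<^sup>2))" for x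
        unfolding h(2) using mult_right_mono[OF C(2)[of \<eta> x], of "exp (- \<delta> * (norm (x - b))\<^sup>2)"] that by (simp add: abs_mult mult_ac)
      show "0 \<le> C * ((1 + (norm (x - b))\<^sup>2) ^ m * exp (- \<delta> * (norm (x - b))\<^sup>2))" for x using C(1) by simp
    qed
    then show ?thesis by blast
  qed
  note ex = this
  \<comment> \<open>Names one bound per direction and order, so that the bounds can be summed over
    \<open>Basis\<close>.\<close>
  define B where "B v k = (SOME C. \<forall>\<eta>. 0 < \<eta> \<longrightarrow> \<eta> \<le> 1 \<longrightarrow> (\<integral>x. \<bar>(dirderiv v ^^ k) (?f \<eta>) x\<bar> \<partial>lborel) \<le> C)" for v k
  have B: "(\<integral>x. \<bar>(dirderiv v ^^ k) (?f \<eta>) x\<bar> \<partial>lborel) \<le> B v k" if "0 < \<eta>" "\<eta> \<le> 1" for v k \<eta>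
    using someI_ex[OF ex[where v=v and k=k]] that unfolding B_def by blast
  let ?K = "2 ^ N * real CARD('n) ^ (2 * N) * fourier_const TYPE('n)"
  define C where "C = ?K * (B 0 0 + (\<Sum>v\<in>Basis. B v (2 * N)))"
  have le: "(1 + (norm \<xi>)\<^sup>2) ^ N * cmod (fourier (\<lambda>x. of_real (?f \<eta> x)) \<xi>) \<le> C" if "0 < \<eta>" "\<eta> \<le> 1" for \<eta> \<xi>
  proof -
    have "(1 + (norm \<xi>)\<^sup>2) ^ N * cmod (fourier (\<lambda>x. of_real (?f \<eta> x)) \<xi>) \<le> ?K * ((\<integral>x. \<bar>?f \<eta> x\<bar> \<partial>lborel) + (\<Sum>b\<in>Basis. \<integral>x. \<bar>(dirderiv b ^^ (2 * N)) (?f \<eta>) x\<bar> \<partial>lborel))"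
      by (rule fourier_test_function_decay[OF damped_cutoff_test_function[OF g a that(1)]])
    also have "\<dots> \<le> C"
      unfolding C_def using B[OF that, of 0 0] B[OF that] by (intro mult_left_mono add_mono sum_mono) auto
    finally show ?thesis .
  qed
  have "(1 + (norm (0::real^'n))\<^sup>2) ^ N * cmod (fourier (\<lambda>x. of_real (?f 1 x)) 0) \<le> C" by (rule le) auto
  then have "C \<ge> 0" by (rule order_trans[rotated]) simp
  then show ?thesis using le by (intro exI[of _ C]) auto
qed

lemma Hs_pair_test_function:
  fixes \<phi> :: "real ^ 'n \<Rightarrow> real"
  assumes s: "0 < s" "s < real CARD('n) / 2" and t: "\<phi> \<in> test_functions"
  shows "Hs_pair s \<phi> (weighted_fourier s \<phi>)"
proof -
  have "crit_exp (real CARD('n)) s > 0" using crit_exp_gt_2[OF s] by simp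
  moreover have "l2norm (\<lambda>\<xi>. weighted_fourier s \<phi> \<xi> - weighted_fourier s \<phi> \<xi>) = 0" by (simp add: l2norm_def)
  moreover have "(\<integral>x. \<bar>\<phi> x - \<phi> x\<bar> powr crit_exp (real CARD('n)) s \<partial>lborel) = 0" by simp
  moreover have "square_integrable (weighted_fourier s \<phi>)" using s by (intro weighted_fourier_square_integrable t) auto
  ultimately show ?thesis
    unfolding Hs_pair_def
    by (intro conjI test_function_measurable test_function_powr_integrable t allI impI bexI[of _ \<phi>]) simp_all
qed

text \<open>The same trade as in \<open>weighted_fourier_decay\<close>, but for a given constant, so
  that bounds uniform in a parameter stay uniform.\<close>

lemma weighted_le_inverse_power:
  fixes \<xi> :: "real ^ 'n"
  assumes le: "(1 + (norm \<xi>)\<^sup>2) ^ (2 * CARD('n)) * cmod z \<le> C" and u: "0 \<le> u" "u < real CARD('n)" and C: "C \<ge> 0"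
  shows "cmod (of_real (norm \<xi> powr u) * z) \<le> C / (1 + (norm \<xi>)\<^sup>2) ^ CARD('n)"
proof -
  let ?N = "CARD('n)"
  let ?y = "1 + (norm \<xi>)\<^sup>2"
  have y: "?y \<ge> 1" by simp
  then have y0: "?y ^ (2 * ?N) > 0" by (intro zero_less_power) linarith
  have "norm \<xi> powr u \<le> ?y powr (u / 2)" using u by (intro norm_powr_le) auto
  also have "\<dots> \<le> ?y powr (real ?N)" using u y by (intro powr_mono) auto
  also have "\<dots> = ?y ^ ?N" using y by (intro powr_realpow) linarith
  finally have "cmod (of_real (norm \<xi> powr u) * z) \<le> ?y ^ ?N * (C / ?y ^ (2 * ?N))"
    unfolding norm_mult using le y0 by (intro mult_mono) (auto simp: field_simps)
  also have "\<dots> = C / ?y ^ ?N" using y by (simp add: mult_2 power_add)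
  finally show ?thesis .
qed

lemma fourier_tendsto:
  fixes f :: "nat \<Rightarrow> real ^ 'n \<Rightarrow> real"
  assumes f: "\<And>n. f n \<in> borel_measurable borel" "g \<in> borel_measurable borel" and w: "integrable lborel w"
    and le: "\<And>n x. \<bar>f n x\<bar> \<le> w x" and lim: "\<And>x. (\<lambda>n. f n x) \<longlonglongrightarrow> g x"
  shows "(\<lambda>n. fourier (\<lambda>x. of_real (f n x)) \<xi>) \<longlonglongrightarrow> fourier (\<lambda>x. of_real (g x)) \<xi>"
proof -
  note [measurable] = f
  have "(\<lambda>n. \<integral>x. cis (- (x \<bullet> \<xi>)) * of_real (f n x) \<partial>lborel) \<longlonglongrightarrow> (\<integral>x. cis (- (x \<bullet> \<xi>)) * of_real (g x) \<partial>lborel)"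
    by (rule integral_dominated_convergence[where w=w])
       (use w le lim in \<open>auto simp: norm_mult intro!: tendsto_intros AE_I2\<close>)
  then show ?thesis unfolding fourier_def by (intro tendsto_intros)
qed

text \<open>The cutoff scale tends to 0. In space the damped function itself dominates; in frequency
  the uniform decay of \<open>damped_cutoff_fourier_decay\<close> does, and it passes to the
  limit.\<close>

lemma Hs_pair_damped:
  fixes b :: "real ^ 'n"
  assumes s: "0 < s" "s < real CARD('n) / 2" and a: "a > 0" and d: "\<delta> > 0"
  shows "Hs_pair s (\<lambda>x. exp (- \<delta> * (norm (x - b))\<^sup>2) * (a + (norm (x - b))\<^sup>2) powr r)
     (weighted_fourier s (\<lambda>x. exp (- \<delta> * (norm (x - b))\<^sup>2) * (a + (norm (x - b))\<^sup>2) powr r))"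
    (is "Hs_pair s ?f _")
proof -
  let ?p = "crit_exp (real CARD('n)) s" and ?N = "CARD('n)"
  have p: "?p > 2" using crit_exp_gt_2[OF s] .
  define \<eta> where "\<eta> n = 1 / real (Suc n)" for n
  have \<eta>: "0 < \<eta> n" "\<eta> n \<le> 1" for n by (auto simp: \<eta>_def)
  have \<eta>lim: "\<eta> \<longlonglongrightarrow> 0" unfolding \<eta>_def using LIMSEQ_inverse_real_of_nat by (simp add: inverse_eq_divide)
  \<comment> \<open>\<open>exp 1\<close> normalises the cutoff, since
    \<open>bump 0 1 = exp (- 1)\<close>.\<close>
  let ?g = "\<lambda>(\<eta>::real) x. exp 1 * (a + (norm (x - b))\<^sup>2) powr r"
  have g: "cutoff_algebra a b ?g" by (intro cutoff_algebra.intros)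
  define \<phi> where "\<phi> n x = exp (- \<delta> * (norm (x - b))\<^sup>2) * (bump 0 (1 - \<eta> n * (norm (x - b))\<^sup>2) * ?g (\<eta> n) x)" for n x
  have t: "\<phi> n \<in> test_functions" for n
    unfolding \<phi>_def by (rule damped_cutoff_test_function[OF g a \<eta>(1)])
  note [measurable] = test_function_measurable[OF t]
  have cut: "0 \<le> bump 0 (1 - \<eta> n * (norm (x - b))\<^sup>2) * exp 1" "bump 0 (1 - \<eta> n * (norm (x - b))\<^sup>2) * exp 1 \<le> 1" for n x
  proof -
    let ?z = "1 - \<eta> n * (norm (x - b))\<^sup>2"
    show "0 \<le> bump 0 ?z * exp 1" by (simp add: bump_nonneg)
    have "?z \<le> 1" using \<eta>[of n] by simp
    then have "?z > 0 \<Longrightarrow> 1 / ?z \<ge> 1" by (simp add: field_simps)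
    then show "bump 0 ?z * exp 1 \<le> 1"
      unfolding bump_def by (auto simp: exp_add[symmetric])
  qed
  have \<phi>: "\<phi> n x = (bump 0 (1 - \<eta> n * (norm (x - b))\<^sup>2) * exp 1) * ?f x" for n x
    unfolding \<phi>_def by simp
  have f0: "?f x \<ge> 0" for x by simp
  have \<phi>le: "\<bar>\<phi> n x\<bar> \<le> ?f x" for n x
  proof -
    have "0 \<le> \<phi> n x" unfolding \<phi> by (intro mult_nonneg_nonneg cut f0)
    moreover have "\<phi> n x \<le> 1 * ?f x" unfolding \<phi> by (intro mult_right_mono cut f0)
    ultimately show ?thesis by simp
  qed
  have ptw: "(\<lambda>n. \<phi> n x) \<longlonglongrightarrow> ?f x" for x
  proof -
    have "isCont (bump 0) 1" using DERIV_isCont[OF bump_has_derivative] .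
    moreover have "(\<lambda>n. 1 - \<eta> n * (norm (x - b))\<^sup>2) \<longlonglongrightarrow> 1 - 0 * (norm (x - b))\<^sup>2" by (intro tendsto_intros \<eta>lim)
    ultimately have "(\<lambda>n. bump 0 (1 - \<eta> n * (norm (x - b))\<^sup>2)) \<longlonglongrightarrow> bump 0 1"
      using isCont_tendsto_compose by fastforce
    then have "(\<lambda>n. \<phi> n x) \<longlonglongrightarrow> (bump 0 1 * exp 1) * ?f x"
      unfolding \<phi> by (intro tendsto_intros)
    then show ?thesis by (simp add: bump_def exp_minus)
  qed
  obtain C m where C: "C \<ge> 0" "\<And>x. (a + (norm (x - b))\<^sup>2) powr r \<le> C * (1 + (norm (x - b))\<^sup>2) ^ m"
    using cutoff_algebra_bound[OF cutoff_algebra.power[of a b r] a] by force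
  have i: "integrable lborel (\<lambda>x. C * ((1 + (norm (x - b))\<^sup>2) ^ m * exp (- \<delta> * (norm (x - b))\<^sup>2)))"
    by (intro integrable_mult_right gaussian_moment d)
  have fle: "?f x \<le> C * ((1 + (norm (x - b))\<^sup>2) ^ m * exp (- \<delta> * (norm (x - b))\<^sup>2))" for x
    using mult_left_mono[OF C(2)[of x], of "exp (- \<delta> * (norm (x - b))\<^sup>2)"] by (simp add: mult_ac)
  have b: "AE x in lborel. norm (?f x) \<le> norm (C * ((1 + (norm (x - b))\<^sup>2) ^ m * exp (- \<delta> * (norm (x - b))\<^sup>2)))"
    unfolding real_norm_def by (intro AE_I2, subst abs_of_nonneg[OF f0], rule order_trans[OF fle abs_ge_self])
  have if1: "integrable lborel ?f" by (rule Bochner_Integration.integrable_bound[OF i _ b]) measurable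
  have ip: "integrable lborel (\<lambda>x. \<bar>?f x\<bar> powr ?p)"
  proof -
    let ?h = "\<lambda>x. C powr ?p * ((1 + (norm (x - b))\<^sup>2) ^ (m * nat \<lceil>?p\<rceil>) * exp (- (\<delta> * ?p) * (norm (x - b))\<^sup>2))"
    have ih: "integrable lborel ?h"
      using d p by (intro integrable_mult_right gaussian_moment) auto
    have hle: "\<bar>?f x\<bar> powr ?p \<le> ?h x" for x
    proof -
      let ?y = "1 + (norm (x - b))\<^sup>2"
      have y: "?y \<ge> 1" by simp
      have "\<bar>?f x\<bar> powr ?p \<le> (C * (?y ^ m * exp (- \<delta> * (norm (x - b))\<^sup>2))) powr ?p"
        using fle[of x] f0[of x] p by (intro powr_mono2) auto
      also have "\<dots> = C powr ?p * ((?y ^ m) powr ?p * exp (- (\<delta> * ?p) * (norm (x - b))\<^sup>2))"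
        using C(1) by (simp add: powr_mult exp_powr_real mult_ac)
      also have "\<dots> \<le> ?h x"
      proof (intro mult_left_mono mult_right_mono)
        have "(?y ^ m) powr ?p \<le> (?y ^ m) powr real (nat \<lceil>?p\<rceil>)"
          using y by (intro powr_mono one_le_power) linarith+
        also have "\<dots> = ?y ^ (m * nat \<lceil>?p\<rceil>)"
          using y by (subst powr_realpow) (auto simp: power_mult intro!: zero_less_power add_pos_nonneg)
        finally show "(?y ^ m) powr ?p \<le> ?y ^ (m * nat \<lceil>?p\<rceil>)" .
      qed auto
      finally show ?thesis .
    qed
    have b: "AE x in lborel. norm (\<bar>?f x\<bar> powr ?p) \<le> norm (?h x)"
      unfolding real_norm_def by (intro AE_I2, subst abs_of_nonneg, simp, rule order_trans[OF hle abs_ge_self])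
    show ?thesis by (rule Bochner_Integration.integrable_bound[OF ih _ b]) measurable
  qed
  obtain K where K: "K \<ge> 0" "\<And>n \<xi>. (1 + (norm \<xi>)\<^sup>2) ^ (2 * ?N) * cmod (fourier (\<lambda>x. of_real (\<phi> n x)) \<xi>) \<le> K"
    using damped_cutoff_fourier_decay[OF g a d, of "2 * ?N"] \<eta> unfolding \<phi>_def by blast
  have flim: "(\<lambda>n. fourier (\<lambda>x. of_real (\<phi> n x)) \<xi>) \<longlonglongrightarrow> fourier (\<lambda>x. of_real (?f x)) \<xi>" for \<xi>
    by (rule fourier_tendsto[OF _ _ if1 \<phi>le ptw]) measurable
  have K': "(1 + (norm \<xi>)\<^sup>2) ^ (2 * ?N) * cmod (fourier (\<lambda>x. of_real (?f x)) \<xi>) \<le> K" for \<xi>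
  proof (rule LIMSEQ_le_const2)
    show "(\<lambda>n. (1 + (norm \<xi>)\<^sup>2) ^ (2 * ?N) * cmod (fourier (\<lambda>x. of_real (\<phi> n x)) \<xi>)) \<longlonglongrightarrow> (1 + (norm \<xi>)\<^sup>2) ^ (2 * ?N) * cmod (fourier (\<lambda>x. of_real (?f x)) \<xi>)"
      by (intro tendsto_intros flim)
  qed (use K in blast)
  have s': "0 \<le> s" "s < real CARD('n)" using s by auto
  have W1: "cmod (weighted_fourier s (\<phi> n) \<xi>) \<le> K / (1 + (norm \<xi>)\<^sup>2) ^ ?N" for n \<xi>
    unfolding weighted_fourier_def by (rule weighted_le_inverse_power[OF K(2) s' K(1)])
  have W2: "cmod (weighted_fourier s ?f \<xi>) \<le> K / (1 + (norm \<xi>)\<^sup>2) ^ ?N" for \<xi>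
    unfolding weighted_fourier_def by (rule weighted_le_inverse_power[OF K' s' K(1)])
  have sq: "square_integrable (weighted_fourier s (\<phi> n))" for n
    using s by (intro weighted_fourier_square_integrable t) auto
  have Wlim: "(\<lambda>n. weighted_fourier s (\<phi> n) \<xi>) \<longlonglongrightarrow> weighted_fourier s ?f \<xi>" for \<xi>
    unfolding weighted_fourier_def by (intro tendsto_intros flim)
  have [measurable]: "weighted_fourier s (\<phi> n) \<in> borel_measurable borel" for n
    using sq by (rule square_integrable_measurable)
  have [measurable]: "weighted_fourier s ?f \<in> borel_measurable borel"
    by (rule borel_measurable_LIMSEQ_metric[OF _ Wlim]) measurable
  have iw: "integrable lborel (\<lambda>\<xi>::real^'n. (2 * K)\<^sup>2 / (1 + (norm \<xi>)\<^sup>2) ^ (2 * ?N))"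
  proof (rule integrable_inverse_nat_power)
    have "CARD('n) div 2 \<le> CARD('n)" "CARD('n) > 0" by simp_all
    then show "DIM(real^'n) div 2 < 2 * CARD('n)" unfolding DIM_cart DIM_real by linarith
  qed
  have bound2: "(cmod z)\<^sup>2 \<le> (2 * K)\<^sup>2 / (1 + (norm \<xi>)\<^sup>2) ^ (2 * ?N)" if "cmod z \<le> 2 * K / (1 + (norm \<xi>)\<^sup>2) ^ ?N" for z and \<xi> :: "real^'n"
  proof -
    have "(cmod z)\<^sup>2 \<le> (2 * K / (1 + (norm \<xi>)\<^sup>2) ^ ?N)\<^sup>2" using that by (intro power_mono) auto
    then show ?thesis by (simp add: power_divide power_mult mult.commute[of 2])
  qed
  have W2': "cmod (weighted_fourier s ?f \<xi>) \<le> 2 * K / (1 + (norm \<xi>)\<^sup>2) ^ ?N" for \<xi>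
    using W2[of \<xi>] divide_right_mono[of K "2 * K" "(1 + (norm \<xi>)\<^sup>2) ^ ?N"] K(1) by (auto intro: order_trans)
  have b2: "AE \<xi> in lborel. norm ((cmod (weighted_fourier s ?f \<xi>))\<^sup>2) \<le> norm ((2 * K)\<^sup>2 / (1 + (norm \<xi>)\<^sup>2) ^ (2 * ?N))"
    unfolding real_norm_def
    by (intro AE_I2, subst abs_of_nonneg, simp, rule order_trans[OF bound2[OF W2'] abs_ge_self])
  have sqf: "square_integrable (weighted_fourier s ?f)"
    unfolding square_integrable_def
  proof
    show "integrable lborel (\<lambda>\<xi>. (cmod (weighted_fourier s ?f \<xi>))\<^sup>2)"
      by (rule Bochner_Integration.integrable_bound[OF iw _ b2]) measurable
  qed measurable
  show ?thesis
  proof (rule Hs_pair_limit[OF s _ ip sqf Hs_pair_test_function[OF s t]])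
    show "?f \<in> borel_measurable borel" by measurable
    have "(\<lambda>n. \<integral>x. \<bar>\<phi> n x - ?f x\<bar> powr ?p \<partial>lborel) \<longlonglongrightarrow> (\<integral>x. (0::real) \<partial>(lborel :: (real^'n) measure))"
    proof (rule integral_dominated_convergence[where w="\<lambda>x. \<bar>?f x\<bar> powr ?p"])
      show "AE x in lborel. (\<lambda>n. \<bar>\<phi> n x - ?f x\<bar> powr ?p) \<longlonglongrightarrow> 0"
      proof (rule AE_I2)
        fix x
        have "(\<lambda>n. \<bar>\<phi> n x - ?f x\<bar>) \<longlonglongrightarrow> \<bar>?f x - ?f x\<bar>" by (intro tendsto_intros ptw)
        then have "(\<lambda>n. \<bar>\<phi> n x - ?f x\<bar>) \<longlonglongrightarrow> 0" by simp
        from tendsto_zero_powrI[OF this tendsto_const] show "(\<lambda>n. \<bar>\<phi> n x - ?f x\<bar> powr ?p) \<longlonglongrightarrow> 0" using p by simp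
      qed
      show "AE x in lborel. norm (\<bar>\<phi> n x - ?f x\<bar> powr ?p) \<le> \<bar>?f x\<bar> powr ?p" for n
      proof (rule AE_I2)
        fix x
        have "0 \<le> \<phi> n x" unfolding \<phi> by (intro mult_nonneg_nonneg cut f0)
        then have "\<bar>\<phi> n x - ?f x\<bar> \<le> \<bar>?f x\<bar>" using \<phi>le[of n x] by linarith
        then show "norm (\<bar>\<phi> n x - ?f x\<bar> powr ?p) \<le> \<bar>?f x\<bar> powr ?p" using p by (auto intro!: powr_mono2)
      qed
    qed (use ip in auto)
    then show "(\<lambda>n. \<integral>x. \<bar>\<phi> n x - ?f x\<bar> powr ?p \<partial>lborel) \<longlonglongrightarrow> 0" by simp
    have "(\<lambda>n. \<integral>\<xi>. (cmod (weighted_fourier s (\<phi> n) \<xi> - weighted_fourier s ?f \<xi>))\<^sup>2 \<partial>lborel) \<longlonglongrightarrow> (\<integral>\<xi>. (0::real) \<partial>(lborel :: (real^'n) measure))"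
    proof (rule integral_dominated_convergence[OF _ _ iw])
      show "AE \<xi> in lborel. (\<lambda>n. (cmod (weighted_fourier s (\<phi> n) \<xi> - weighted_fourier s ?f \<xi>))\<^sup>2) \<longlonglongrightarrow> 0"
      proof (rule AE_I2)
        fix \<xi>
        have "(\<lambda>n. (cmod (weighted_fourier s (\<phi> n) \<xi> - weighted_fourier s ?f \<xi>))\<^sup>2) \<longlonglongrightarrow> (cmod (weighted_fourier s ?f \<xi> - weighted_fourier s ?f \<xi>))\<^sup>2"
          by (intro tendsto_intros Wlim)
        then show "(\<lambda>n. (cmod (weighted_fourier s (\<phi> n) \<xi> - weighted_fourier s ?f \<xi>))\<^sup>2) \<longlonglongrightarrow> 0" by simp
      qed
      show "AE \<xi> in lborel. norm ((cmod (weighted_fourier s (\<phi> n) \<xi> - weighted_fourier s ?f \<xi>))\<^sup>2) \<le> (2 * K)\<^sup>2 / (1 + (norm \<xi>)\<^sup>2) ^ (2 * ?N)" for n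
      proof (rule AE_I2)
        fix \<xi> :: "real^'n"
        have "cmod (weighted_fourier s (\<phi> n) \<xi> - weighted_fourier s ?f \<xi>) \<le> K / (1 + (norm \<xi>)\<^sup>2) ^ ?N + K / (1 + (norm \<xi>)\<^sup>2) ^ ?N"
          using norm_triangle_ineq4 W1[of n \<xi>] W2[of \<xi>] by (rule order_trans[OF _ add_mono])
        also have "\<dots> = 2 * K / (1 + (norm \<xi>)\<^sup>2) ^ ?N" by simp
        finally show "norm ((cmod (weighted_fourier s (\<phi> n) \<xi> - weighted_fourier s ?f \<xi>))\<^sup>2) \<le> (2 * K)\<^sup>2 / (1 + (norm \<xi>)\<^sup>2) ^ (2 * ?N)"
          unfolding real_norm_def abs_power2 by (rule bound2)
      qed
    qed measurable
    from tendsto_real_sqrt[OF this] show "(\<lambda>n. l2norm (\<lambda>\<xi>. weighted_fourier s (\<phi> n) \<xi> - weighted_fourier s ?f \<xi>)) \<longlonglongrightarrow> 0"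
      unfolding l2norm_def by simp
  qed
qed

section \<open>Fourier transforms of bubbles\<close>

text \<open>With d the dimension, the exponent \<open>(d - 2 * s) / 2\<close> gives a bubble,
  \<open>(d + 2 * s) / 2\<close> its power \<open>crit_exp d s - 1\<close>, and \<open>d\<close> its
  critical power.\<close>

definition bubble_power :: "real \<Rightarrow> real \<Rightarrow> real ^ 'n \<Rightarrow> real ^ 'n \<Rightarrow> real" where
  "bubble_power g a b x = (a + (norm (x - b))\<^sup>2) powr - g"

lemma bubble_power_measurable [measurable]: "bubble_power g a b \<in> borel_measurable borel"
  unfolding bubble_power_def by measurable

lemma bubble_power_nonneg [simp]: "bubble_power g a b x \<ge> 0"
  by (simp add: bubble_power_def)

lemma bubble_power_integral:
  fixes b :: "real ^ 'n"
  assumes g: "g > real CARD('n) / 2" and a: "a > 0"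
  shows "has_bochner_integral lborel (bubble_power g a b)
    (pi powr (real CARD('n) / 2) * Gamma (g - real CARD('n) / 2) / Gamma g * a powr (real CARD('n) / 2 - g))"
proof -
  let ?f = "\<lambda>x::real^'n. (a + 1 * (norm x)\<^sup>2) powr - g"
  have f: "has_bochner_integral lborel ?f (pi powr (real CARD('n) / 2) * Gamma (g - real CARD('n) / 2) / Gamma g * a powr (real CARD('n) / 2 - g))"
    using inverse_power_integral[where 'a="real^'n", of g 1 a] g a by simp
  have "integrable lborel (\<lambda>x. ?f (x - b))" "(\<integral>x. ?f (x - b) \<partial>lborel) = (\<integral>x. ?f x \<partial>lborel)"
    using f integrable_lborel_translation(2)[of ?f b] integral_lborel_translation(2)[of ?f b]
    by (simp_all add: has_bochner_integral_iff)
  then show ?thesis using f unfolding bubble_power_def by (simp add: has_bochner_integral_iff)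
qed

lemma bubble_power_powr_integrable:
  fixes b :: "real ^ 'n"
  assumes s: "0 < s" "s < real CARD('n) / 2" and g: "g \<ge> (real CARD('n) - 2 * s) / 2" and a: "a > 0"
  shows "integrable lborel (\<lambda>x. \<bar>bubble_power g a b x\<bar> powr crit_exp (real CARD('n)) s)"
proof -
  let ?p = "crit_exp (real CARD('n)) s"
  have "real CARD('n) = (real CARD('n) - 2 * s) / 2 * ?p" using s by (simp add: crit_exp_def)
  also have "\<dots> \<le> g * ?p" using g crit_exp_gt_2[OF s] by (intro mult_right_mono) auto
  finally have "real CARD('n) \<le> g * ?p" .
  moreover have "real CARD('n) > 0" by simp
  ultimately have "g * ?p > real CARD('n) / 2" by linarith
  from bubble_power_integral[OF this a, of b] show ?thesis
    unfolding bubble_power_def by (simp add: has_bochner_integral_iff powr_powr)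
qed

text \<open>An unnormalised Gamma density: mixing the Gaussians
  \<open>exp (- t * (norm (x - b))\<^sup>2)\<close> with it produces a bubble power
  (\<open>subordinate_bubble\<close>).\<close>

definition subordinate :: "real \<Rightarrow> real \<Rightarrow> real \<Rightarrow> real" where
  "subordinate g a t = indicator {0<..} t * t powr (g - 1) * exp (- t * a)"

lemma subordinate_measurable [measurable]: "subordinate g a \<in> borel_measurable borel"
  unfolding subordinate_def by measurable

lemma subordinate_nonneg [simp]: "subordinate g a t \<ge> 0"
  by (simp add: subordinate_def)

lemma subordinate_integral:
  assumes "g > 0" "a > 0"
  shows "has_bochner_integral lborel (subordinate g a) (Gamma g * a powr - g)"
  unfolding subordinate_def by (rule Gamma_scaled_integral[OF assms])

lemma subordinate_bubble:
  fixes b x :: "real ^ 'n"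
  assumes "g > 0" "a > 0"
  shows "has_bochner_integral lborel (\<lambda>t. subordinate g a t * exp (- t * (norm (x - b))\<^sup>2)) (Gamma g * bubble_power g a b x)"
proof -
  have "subordinate g a t * exp (- t * (norm (x - b))\<^sup>2) = subordinate g (a + (norm (x - b))\<^sup>2) t" for t
    by (simp add: subordinate_def algebra_simps exp_add[symmetric])
  then show ?thesis
    using subordinate_integral[of g "a + (norm (x - b))\<^sup>2"] assms unfolding bubble_power_def by (simp add: add_pos_nonneg)
qed

text \<open>The mixture with each Gaussian replaced by its Fourier transform, as a function of
  \<open>z = (norm \<xi>)\<^sup>2\<close>. The shift \<open>\<delta>\<close> stands for an extra
  Gaussian damping factor of that rate.\<close>

definition subordinate_fourier :: "real \<Rightarrow> real \<Rightarrow> real \<Rightarrow> real \<Rightarrow> real \<Rightarrow> real" where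
  "subordinate_fourier d g a \<delta> z = (\<integral>t. subordinate g a t * ((2 * (t + \<delta>)) powr (- d / 2) * exp (- z / (4 * (t + \<delta>)))) \<partial>lborel) / Gamma g"

lemma subordinate_fourier_measurable [measurable]: "subordinate_fourier d g a \<delta> \<in> borel_measurable borel"
  unfolding subordinate_fourier_def by measurable

lemma shifted_gaussian_fourier:
  fixes b \<xi> :: "real ^ 'n"
  assumes t: "\<tau> > 0"
  shows "has_bochner_integral lborel (\<lambda>x. cis (- (x \<bullet> \<xi>)) * of_real (exp (- \<tau> * (norm (x - b))\<^sup>2)))
     (cis (- (b \<bullet> \<xi>)) * of_real ((pi / \<tau>) powr (real CARD('n) / 2) * exp (- (norm \<xi>)\<^sup>2 / (4 * \<tau>))))"
proof -
  let ?f = "\<lambda>x::real^'n. cis (x \<bullet> (- \<xi>)) * complex_of_real (exp (- \<tau> * (norm x)\<^sup>2))"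
  let ?I = "complex_of_real ((pi / \<tau>) powr (real CARD('n) / 2) * exp (- (norm \<xi>)\<^sup>2 / (4 * \<tau>)))"
  have f: "has_bochner_integral lborel ?f ?I"
    using gaussian_fourier[OF t, of "- \<xi>"] by simp
  have "has_bochner_integral lborel (\<lambda>x. ?f (x - b)) ?I"
    using f integrable_lborel_translation(2)[of ?f b] integral_lborel_translation(2)[of ?f b]
    by (simp add: has_bochner_integral_iff)
  from has_bochner_integral_mult_right[OF this, of "cis (- (b \<bullet> \<xi>))"]
  have "has_bochner_integral lborel (\<lambda>x. cis (- (b \<bullet> \<xi>)) * ?f (x - b)) (cis (- (b \<bullet> \<xi>)) * ?I)" .
  moreover have "cis (- (b \<bullet> \<xi>)) * ?f (x - b) = cis (- (x \<bullet> \<xi>)) * of_real (exp (- \<tau> * (norm (x - b))\<^sup>2))" for x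
    by (simp add: mult.assoc[symmetric] cis_mult inner_diff_left)
  ultimately show ?thesis by (simp only:)
qed

text \<open>Fubini over the mixing parameter. The last hypothesis makes the function integrable: in
  the absence of damping the exponent has to exceed half the dimension.\<close>

lemma fourier_damped_bubble:
  fixes b \<xi> :: "real ^ 'n"
  assumes g: "g > 0" and a: "a > 0" and d: "\<delta> \<ge> 0" "\<delta> > 0 \<or> g > real CARD('n) / 2"
  shows "fourier (\<lambda>x. of_real (exp (- \<delta> * (norm (x - b))\<^sup>2) * bubble_power g a b x)) \<xi>
     = cis (- (b \<bullet> \<xi>)) * of_real (subordinate_fourier (real CARD('n)) g a \<delta> ((norm \<xi>)\<^sup>2))"
proof -
  let ?d = "real CARD('n)"
  let ?f = "\<lambda>t x. of_real (subordinate g a t) * (cis (- (x \<bullet> \<xi>)) * of_real (exp (- (t + \<delta>) * (norm (x - b))\<^sup>2)))"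
  have G: "Gamma g > 0" using g by (simp add: Gamma_real_pos)
  have nf: "norm (?f t x) = subordinate g a t * exp (- (t + \<delta>) * (norm (x - b))\<^sup>2)" for t and x :: "real^'n"
    by (simp add: norm_mult)
  have gi: "has_bochner_integral lborel (\<lambda>x::real^'n. exp (- \<tau> * (norm (x - b))\<^sup>2)) ((pi / \<tau>) powr (?d / 2))" if "\<tau> > 0" for \<tau>
    using has_bochner_integral_Re[OF shifted_gaussian_fourier[OF that, of 0 b]] by simp
  have in1: "integrable lborel (\<lambda>x. subordinate g a t * exp (- (t + \<delta>) * (norm (x - b))\<^sup>2))"
    and in2: "(\<integral>x. subordinate g a t * exp (- (t + \<delta>) * (norm (x - b))\<^sup>2) \<partial>lborel) = subordinate g a t * (pi / (t + \<delta>)) powr (?d / 2)" for t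
  proof -
    have "integrable lborel (\<lambda>x. subordinate g a t * exp (- (t + \<delta>) * (norm (x - b))\<^sup>2)) \<and>
      (\<integral>x. subordinate g a t * exp (- (t + \<delta>) * (norm (x - b))\<^sup>2) \<partial>lborel) = subordinate g a t * (pi / (t + \<delta>)) powr (?d / 2)"
    proof (cases "t > 0")
      case True
      then show ?thesis using gi[of "t + \<delta>"] d by (auto simp: has_bochner_integral_iff simp del: mult_minus_left minus_add_distrib)
    qed (simp add: subordinate_def)
    then show "integrable lborel (\<lambda>x. subordinate g a t * exp (- (t + \<delta>) * (norm (x - b))\<^sup>2))"
      "(\<integral>x. subordinate g a t * exp (- (t + \<delta>) * (norm (x - b))\<^sup>2) \<partial>lborel) = subordinate g a t * (pi / (t + \<delta>)) powr (?d / 2)" by blast+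
  qed
  \<comment> \<open>The total mass of the mixture. Near \<open>t = 0\<close> the Gaussian mass is of
    order \<open>t powr - (?d / 2)\<close>, which is cut off by a positive \<open>\<delta>\<close>
    or else integrable against the density because \<open>g > ?d / 2\<close>.\<close>
  have it: "integrable lborel (\<lambda>t. subordinate g a t * (pi / (t + \<delta>)) powr (?d / 2))"
  proof (cases "\<delta> > 0")
    case True
    have i: "integrable lborel (\<lambda>t. subordinate g a t * (pi / \<delta>) powr (?d / 2))"
      using subordinate_integral[OF g a] by (simp add: has_bochner_integral_iff)
    have b: "AE t in lborel. norm (subordinate g a t * (pi / (t + \<delta>)) powr (?d / 2)) \<le> norm (subordinate g a t * (pi / \<delta>) powr (?d / 2))"
    proof (rule AE_I2)
      fix t :: real
      show "norm (subordinate g a t * (pi / (t + \<delta>)) powr (?d / 2)) \<le> norm (subordinate g a t * (pi / \<delta>) powr (?d / 2))"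
      proof (cases "t > 0")
        case t: True
        then have "(pi / (t + \<delta>)) powr (?d / 2) \<le> (pi / \<delta>) powr (?d / 2)"
          using True by (intro powr_mono2 divide_left_mono) auto
        then show ?thesis by (simp add: abs_mult mult_left_mono)
      qed (simp add: subordinate_def)
    qed
    show ?thesis by (rule Bochner_Integration.integrable_bound[OF i _ b]) measurable
  next
    case False
    then have d0: "\<delta> = 0" "g > ?d / 2" using d by auto
    have "integrable lborel (\<lambda>t. pi powr (?d / 2) * subordinate (g - ?d / 2) a t)"
      using subordinate_integral[of "g - ?d / 2" a] d0 a by (auto simp: has_bochner_integral_iff)
    moreover have "subordinate g a t * (pi / (t + \<delta>)) powr (?d / 2) = pi powr (?d / 2) * subordinate (g - ?d / 2) a t" for t
    proof (cases "t > 0")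
      case True
      have "t powr (g - ?d / 2 - 1) = t powr (g - 1) * t powr - (?d / 2)"
        using True by (simp add: powr_add[symmetric] algebra_simps)
      then show ?thesis using True d0 by (simp add: subordinate_def powr_divide powr_minus_divide)
    qed (simp add: subordinate_def)
    ultimately show ?thesis by simp
  qed
  have prod: "integrable (lborel \<Otimes>\<^sub>M lborel) (\<lambda>(t, x). ?f t x)"
  proof (rule lborel_pair.Fubini_integrable)
    show "(\<lambda>(t, x). ?f t x) \<in> borel_measurable (lborel \<Otimes>\<^sub>M lborel)" by measurable
    show "integrable lborel (\<lambda>t. \<integral>x. norm (case (t, x) of (t, x) \<Rightarrow> ?f t x) \<partial>lborel)"
      using it by (simp only: prod.case nf in2)
    show "AE t in lborel. integrable lborel (\<lambda>x. case (t, x) of (t, x) \<Rightarrow> ?f t x)"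
    proof (intro AE_I2)
      fix t
      have b: "AE x in lborel. norm (?f t x) \<le> norm (subordinate g a t * exp (- (t + \<delta>) * (norm (x - b))\<^sup>2))"
        unfolding nf real_norm_def by (intro AE_I2 abs_ge_self)
      have "integrable lborel (?f t)"
        by (rule Bochner_Integration.integrable_bound[OF in1[of t] _ b]) measurable
      then show "integrable lborel (\<lambda>x. case (t, x) of (t, x) \<Rightarrow> ?f t x)" by simp
    qed
  qed
  have 1: "(\<integral>t. ?f t x \<partial>lborel) = of_real (Gamma g) * (cis (- (x \<bullet> \<xi>)) * of_real (exp (- \<delta> * (norm (x - b))\<^sup>2) * bubble_power g a b x))" for x
  proof -
    have "?f t x = (cis (- (x \<bullet> \<xi>)) * of_real (exp (- \<delta> * (norm (x - b))\<^sup>2))) * of_real (subordinate g a t * exp (- t * (norm (x - b))\<^sup>2))" for t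
    proof -
      have "exp (- (t + \<delta>) * (norm (x - b))\<^sup>2) = exp (- \<delta> * (norm (x - b))\<^sup>2) * exp (- t * (norm (x - b))\<^sup>2)"
        unfolding exp_add[symmetric] by (simp add: algebra_simps)
      then show ?thesis by simp
    qed
    then have "(\<integral>t. ?f t x \<partial>lborel) = (cis (- (x \<bullet> \<xi>)) * of_real (exp (- \<delta> * (norm (x - b))\<^sup>2))) * of_real (\<integral>t. subordinate g a t * exp (- t * (norm (x - b))\<^sup>2) \<partial>lborel)"
      by (simp only: integral_mult_right_zero integral_complex_of_real)
    also have "(\<integral>t. subordinate g a t * exp (- t * (norm (x - b))\<^sup>2) \<partial>lborel) = Gamma g * bubble_power g a b x"
      using subordinate_bubble[OF g a, where x=x and b=b] by (simp only: has_bochner_integral_iff)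
    finally show ?thesis by simp
  qed
  have 2: "(\<integral>x. ?f t x \<partial>lborel) = cis (- (b \<bullet> \<xi>)) * of_real ((2 * pi) powr (?d / 2) * (subordinate g a t * ((2 * (t + \<delta>)) powr (- ?d / 2) * exp (- (norm \<xi>)\<^sup>2 / (4 * (t + \<delta>))))))" for t
  proof (cases "t > 0")
    case True
    then have td: "t + \<delta> > 0" using d by simp
    have "(\<integral>x. ?f t x \<partial>lborel) = of_real (subordinate g a t) * (cis (- (b \<bullet> \<xi>)) * of_real ((pi / (t + \<delta>)) powr (?d / 2) * exp (- (norm \<xi>)\<^sup>2 / (4 * (t + \<delta>)))))"
      using shifted_gaussian_fourier[OF td, of \<xi> b] unfolding integral_mult_right_zero by (simp only: has_bochner_integral_iff)
    moreover have "(pi / (t + \<delta>)) powr (?d / 2) = (2 * pi) powr (?d / 2) * (2 * (t + \<delta>)) powr (- ?d / 2)"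
    proof -
      have "(2 * pi) powr (?d / 2) * (2 * (t + \<delta>)) powr (- ?d / 2) = ((2 * pi) / (2 * (t + \<delta>))) powr (?d / 2)"
        using td by (subst powr_divide) (auto simp: powr_minus_divide)
      moreover have "(2 * pi) / (2 * (t + \<delta>)) = pi / (t + \<delta>)" by (rule mult_divide_mult_cancel_left) simp
      ultimately show ?thesis by (simp only:)
    qed
    ultimately show ?thesis by (simp only: of_real_mult mult_ac)
  qed (simp add: subordinate_def)
  have "of_real (Gamma g) * (\<integral>x. cis (- (x \<bullet> \<xi>)) * of_real (exp (- \<delta> * (norm (x - b))\<^sup>2) * bubble_power g a b x) \<partial>lborel) = (\<integral>x. (\<integral>t. ?f t x \<partial>lborel) \<partial>lborel)"
    by (simp only: 1 integral_mult_right_zero)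
  also have "\<dots> = (\<integral>t. (\<integral>x. ?f t x \<partial>lborel) \<partial>lborel)"
    by (rule lborel_pair.Fubini_integral[OF prod])
  also have "\<dots> = cis (- (b \<bullet> \<xi>)) * of_real ((2 * pi) powr (?d / 2) * (Gamma g * subordinate_fourier ?d g a \<delta> ((norm \<xi>)\<^sup>2)))"
    by (simp only: 2) (simp only: integral_mult_right_zero integral_complex_of_real subordinate_fourier_def, use G in simp)
  finally have "of_real (Gamma g) * (\<integral>x. cis (- (x \<bullet> \<xi>)) * of_real (exp (- \<delta> * (norm (x - b))\<^sup>2) * bubble_power g a b x) \<partial>lborel)
     = of_real (Gamma g) * (of_real ((2 * pi) powr (?d / 2)) * (cis (- (b \<bullet> \<xi>)) * of_real (subordinate_fourier ?d g a \<delta> ((norm \<xi>)\<^sup>2))))"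
    by (simp only: of_real_mult mult_ac)
  then have "(\<integral>x. cis (- (x \<bullet> \<xi>)) * of_real (exp (- \<delta> * (norm (x - b))\<^sup>2) * bubble_power g a b x) \<partial>lborel)
     = of_real ((2 * pi) powr (?d / 2)) * (cis (- (b \<bullet> \<xi>)) * of_real (subordinate_fourier ?d g a \<delta> ((norm \<xi>)\<^sup>2)))"
    using G by (simp only: mult_cancel_left of_real_eq_0_iff) auto
  moreover have "of_real (fourier_const TYPE('n)) * (complex_of_real ((2 * pi) powr (?d / 2)) * z) = z" for z
    by (simp add: mult.assoc[symmetric] powr_add[symmetric] flip: of_real_mult)
  ultimately show ?thesis unfolding fourier_def by (simp only:)
qed

text \<open>By homogeneity only \<open>x = z / (4 * y)\<close> matters, and
  \<open>x powr r * exp (- x)\<close> is bounded.\<close>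

lemma powr_exp_inverse_bound:
  fixes r :: real
  assumes r: "r \<ge> 0"
  shows "\<exists>C\<ge>0. \<forall>y>0. \<forall>z>0. y powr - r * exp (- z / (4 * y)) \<le> C * z powr - r"
proof -
  define m where "m = nat \<lceil>r\<rceil>"
  have m: "r \<le> real m" unfolding m_def by linarith
  have x: "x powr r * exp (- x) \<le> 1 + real m ^ m" if "x > 0" for x :: real
  proof -
    have "x powr r \<le> 1 + x ^ m"
    proof (cases "x \<ge> 1")
      case True
      then have "x powr r \<le> x powr real m" using m by (intro powr_mono) auto
      then show ?thesis using True by (simp add: powr_realpow)
    next
      case False
      then have "x powr r \<le> 1" using that r by (intro powr_le1) auto
      moreover have "0 \<le> x ^ m" using that by simp
      ultimately show ?thesis by linarith
    qed
    also have "\<dots> \<le> exp x + real m ^ m * exp x"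
      using power_le_exp[of x m] that by (intro add_mono) auto
    finally have "x powr r * exp (- x) \<le> (exp x + real m ^ m * exp x) * exp (- x)" by (intro mult_right_mono) auto
    then show ?thesis by (simp add: distrib_right mult.assoc exp_minus)
  qed
  have "y powr - r * exp (- z / (4 * y)) \<le> (4 powr r * (1 + real m ^ m)) * z powr - r" if "y > 0" "z > 0" for y z :: real
  proof -
    have "y powr - r = 4 powr r * (z / (4 * y)) powr r * z powr - r"
      using that by (simp add: powr_divide powr_mult powr_minus_divide)
    then have "y powr - r * exp (- z / (4 * y)) = 4 powr r * ((z / (4 * y)) powr r * exp (- (z / (4 * y)))) * z powr - r" by simp
    also have "\<dots> \<le> 4 powr r * (1 + real m ^ m) * z powr - r"
      using that by (intro mult_right_mono mult_left_mono x) auto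
    finally show ?thesis .
  qed
  then show ?thesis by (intro exI[of _ "4 powr r * (1 + real m ^ m)"]) auto
qed

text \<open>\<open>q\<close> trades decay at high frequency for a milder singularity at 0:
  \<open>q = 0\<close> gives the fastest decay, larger \<open>q\<close> a weaker singularity. Bounds
  uniform in \<open>\<delta>\<close> allow the damping to be removed.\<close>

lemma subordinate_fourier_bound:
  assumes q: "0 \<le> q" "q < g" "q \<le> d / 2" and a: "a > 0"
  shows "\<exists>C\<ge>0. \<forall>\<delta>\<ge>0. \<forall>z>0. (\<forall>t. \<bar>subordinate g a t * ((2 * (t + \<delta>)) powr (- d / 2) * exp (- z / (4 * (t + \<delta>))))\<bar> \<le> (C * z powr - (d / 2 - q)) * subordinate (g - q) a t)
     \<and> \<bar>subordinate_fourier d g a \<delta> z\<bar> \<le> C * z powr - (d / 2 - q)"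
proof -
  let ?r = "d / 2 - q"
  obtain C where C: "C \<ge> 0" "\<And>y z. y > 0 \<Longrightarrow> z > 0 \<Longrightarrow> y powr - ?r * exp (- z / (4 * y)) \<le> C * z powr - ?r"
    using powr_exp_inverse_bound[of ?r] q by auto
  let ?B = "2 powr (- d / 2) * C"
  have B0: "?B \<ge> 0" using C by simp
  have G: "Gamma g > 0" "Gamma (g - q) > 0" using q by (auto intro!: Gamma_real_pos)
  have i: "has_bochner_integral lborel (subordinate (g - q) a) (Gamma (g - q) * a powr - (g - q))"
    using subordinate_integral[of "g - q" a] q a by simp
  define M where "M = max ?B (?B * (Gamma (g - q) * a powr - (g - q)) / Gamma g)"
  have k: "\<bar>subordinate g a t * ((2 * (t + \<delta>)) powr (- d / 2) * exp (- z / (4 * (t + \<delta>))))\<bar> \<le> (?B * z powr - ?r) * subordinate (g - q) a t"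
    if "\<delta> \<ge> 0" "z > 0" for \<delta> z t
  proof (cases "t > 0")
    case True
    let ?y = "t + \<delta>"
    have y: "?y > 0" using True that by simp
    \<comment> \<open>The part with exponent \<open>q\<close> goes into the mixing density, lowering
      its index to \<open>g - q\<close>; the exponential controls the rest.\<close>
    have e: "?y powr (- d / 2) = ?y powr - q * ?y powr - ?r" using y by (simp add: powr_add[symmetric] field_simps)
    have "(2 * ?y) powr (- d / 2) * exp (- z / (4 * ?y)) = 2 powr (- d / 2) * (?y powr - q * (?y powr - ?r * exp (- z / (4 * ?y))))"
      using y by (subst powr_mult) (simp_all only: e mult.assoc)
    also have "\<dots> \<le> 2 powr (- d / 2) * (t powr - q * (C * z powr - ?r))"
      using True that y q C(1) by (intro mult_left_mono mult_mono C(2) powr_mono2') auto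
    finally have "subordinate g a t * ((2 * ?y) powr (- d / 2) * exp (- z / (4 * ?y))) \<le> subordinate g a t * (2 powr (- d / 2) * (t powr - q * (C * z powr - ?r)))"
      by (intro mult_left_mono) auto
    also have "\<dots> = (?B * z powr - ?r) * (subordinate g a t * t powr - q)" by simp
    also have "subordinate g a t * t powr - q = subordinate (g - q) a t"
    proof -
      have "t powr (g - q - 1) = t powr (g - 1) * t powr - q" using True by (simp add: powr_add[symmetric] algebra_simps)
      then show ?thesis using True by (simp add: subordinate_def)
    qed
    finally show ?thesis by (simp add: abs_mult)
  qed (simp add: subordinate_def)
  have "\<bar>subordinate_fourier d g a \<delta> z\<bar> \<le> M * z powr - ?r" if "\<delta> \<ge> 0" "z > 0" for \<delta> z
  proof -
    let ?k = "\<lambda>t. subordinate g a t * ((2 * (t + \<delta>)) powr (- d / 2) * exp (- z / (4 * (t + \<delta>))))"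
    have i2: "integrable lborel (\<lambda>t. (?B * z powr - ?r) * subordinate (g - q) a t)" using i by (simp add: has_bochner_integral_iff)
    have b: "AE t in lborel. norm (?k t) \<le> norm ((?B * z powr - ?r) * subordinate (g - q) a t)"
      unfolding real_norm_def by (intro AE_I2 order_trans[OF k[OF that] abs_ge_self])
    have i1: "integrable lborel ?k"
      by (rule Bochner_Integration.integrable_bound[OF i2 _ b]) measurable
    have "\<bar>\<integral>t. ?k t \<partial>lborel\<bar> \<le> (\<integral>t. (?B * z powr - ?r) * subordinate (g - q) a t \<partial>lborel)"
      using order_trans[OF integral_abs_bound integral_mono[OF integrable_abs[OF i1] i2 k[OF that]]] .
    also have "\<dots> = (?B * z powr - ?r) * (Gamma (g - q) * a powr - (g - q))"
      using i by (simp add: has_bochner_integral_iff)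
    finally have "\<bar>subordinate_fourier d g a \<delta> z\<bar> \<le> (?B * z powr - ?r) * (Gamma (g - q) * a powr - (g - q)) / Gamma g"
      unfolding subordinate_fourier_def abs_divide using G by (simp add: divide_right_mono)
    also have "\<dots> = (?B * (Gamma (g - q) * a powr - (g - q)) / Gamma g) * z powr - ?r" by simp
    also have "\<dots> \<le> M * z powr - ?r" unfolding M_def by (intro mult_right_mono) auto
    finally show ?thesis .
  qed
  moreover have "\<bar>subordinate g a t * ((2 * (t + \<delta>)) powr (- d / 2) * exp (- z / (4 * (t + \<delta>))))\<bar> \<le> (M * z powr - ?r) * subordinate (g - q) a t"
    if "\<delta> \<ge> 0" "z > 0" for \<delta> z t
    by (rule order_trans[OF k[OF that]]) (intro mult_right_mono, auto simp: M_def)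
  moreover have "M \<ge> 0" using B0 unfolding M_def by (rule max.coboundedI1)
  ultimately show ?thesis by (intro exI[of _ M]) blast
qed

lemma subordinate_fourier_tendsto:
  assumes g: "g > 0" and d: "d \<ge> 0" and a: "a > 0" and z: "z > 0"
  shows "(\<lambda>n. subordinate_fourier d g a (1 / real (Suc n)) z) \<longlonglongrightarrow> subordinate_fourier d g a 0 z"
proof -
  obtain C where C: "\<And>\<delta> t. \<delta> \<ge> 0 \<Longrightarrow> \<bar>subordinate g a t * ((2 * (t + \<delta>)) powr (- d / 2) * exp (- z / (4 * (t + \<delta>))))\<bar> \<le> (C * z powr - (d / 2 - 0)) * subordinate (g - 0) a t"
    using subordinate_fourier_bound[of 0 g d a] assms by auto
  have h0: "(\<lambda>n. 1 / real (Suc n)) \<longlonglongrightarrow> 0"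
    using LIMSEQ_inverse_real_of_nat by (simp add: inverse_eq_divide)
  have "(\<lambda>n. \<integral>t. subordinate g a t * ((2 * (t + 1 / real (Suc n))) powr (- d / 2) * exp (- z / (4 * (t + 1 / real (Suc n))))) \<partial>lborel)
    \<longlonglongrightarrow> (\<integral>t. subordinate g a t * ((2 * (t + 0)) powr (- d / 2) * exp (- z / (4 * (t + 0)))) \<partial>lborel)"
  proof (rule integral_dominated_convergence[where w="\<lambda>t. (C * z powr - (d / 2 - 0)) * subordinate (g - 0) a t"])
    show "integrable lborel (\<lambda>t. (C * z powr - (d / 2 - 0)) * subordinate (g - 0) a t)"
      using subordinate_integral[OF g a] by (simp add: has_bochner_integral_iff)
    show "AE t in lborel. norm (subordinate g a t * ((2 * (t + 1 / real (Suc n))) powr (- d / 2) * exp (- z / (4 * (t + 1 / real (Suc n)))))) \<le> (C * z powr - (d / 2 - 0)) * subordinate (g - 0) a t" for n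
      unfolding real_norm_def by (intro AE_I2 C) simp
    show "AE t in lborel. (\<lambda>n. subordinate g a t * ((2 * (t + 1 / real (Suc n))) powr (- d / 2) * exp (- z / (4 * (t + 1 / real (Suc n))))))
       \<longlonglongrightarrow> subordinate g a t * ((2 * (t + 0)) powr (- d / 2) * exp (- z / (4 * (t + 0))))"
    proof (rule AE_I2)
      fix t :: real
      show "(\<lambda>n. subordinate g a t * ((2 * (t + 1 / real (Suc n))) powr (- d / 2) * exp (- z / (4 * (t + 1 / real (Suc n))))))
       \<longlonglongrightarrow> subordinate g a t * ((2 * (t + 0)) powr (- d / 2) * exp (- z / (4 * (t + 0))))"
      proof (cases "t > 0")
        case True
        then show ?thesis by (intro tendsto_intros h0) auto
      qed (simp add: subordinate_def)
    qed
  qed measurable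
  moreover have "Gamma g \<noteq> 0" using Gamma_real_pos[OF g] by simp
  ultimately show ?thesis unfolding subordinate_fourier_def by (intro tendsto_divide tendsto_const)
qed

text \<open>For \<open>g\<close> at most half the dimension, in particular for bubbles themselves,
  \<open>bubble_power\<close> is not integrable and \<open>fourier\<close> returns its default 0.
  This formula is the transform in that range too, as \<open>bubble_fourier_inversion\<close> and
  \<open>Hs_pair_bubble_power\<close> show.\<close>

definition bubble_fourier :: "real \<Rightarrow> real \<Rightarrow> real ^ 'n \<Rightarrow> real ^ 'n \<Rightarrow> complex" where
  "bubble_fourier g a b \<xi> = cis (- (b \<bullet> \<xi>)) * of_real (subordinate_fourier (real CARD('n)) g a 0 ((norm \<xi>)\<^sup>2))"

lemma bubble_fourier_measurable [measurable]: "bubble_fourier g a b \<in> borel_measurable borel"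
  unfolding bubble_fourier_def by measurable

lemma fourier_bubble_power:
  fixes b :: "real ^ 'n"
  assumes "g > real CARD('n) / 2" "a > 0"
  shows "fourier (\<lambda>x. of_real (bubble_power g a b x)) \<xi> = bubble_fourier g a b \<xi>"
proof -
  have "g > 0" using assms(1) by (rule le_less_trans[rotated]) simp
  then show ?thesis using fourier_damped_bubble[of g a 0 b \<xi>] assms unfolding bubble_fourier_def by simp
qed

text \<open>The damping rate tends to 0. Two instances of \<open>subordinate_fourier_bound\<close>,
  one for low and one for high frequencies, combine into an integrable bound \<open>W\<close> for
  the squared transforms.\<close>

lemma Hs_pair_bubble_power:
  fixes b :: "real ^ 'n"
  assumes s: "0 < s" "s < real CARD('n) / 2" and g: "g \<ge> (real CARD('n) - 2 * s) / 2" and a: "a > 0"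
  shows "Hs_pair s (bubble_power g a b) (\<lambda>\<xi>. of_real (norm \<xi> powr s) * bubble_fourier g a b \<xi>)"
proof -
  let ?d = "real CARD('n)" and ?p = "crit_exp (real CARD('n)) s" and ?N = "CARD('n)"
  have p: "?p > 2" using crit_exp_gt_2[OF s] .
  define al where "al = (?d - 2 * s) / 2"
  have al: "al > 0" using s by (simp add: al_def)
  then have g0: "g > 0" using g unfolding al_def by simp
  define e where "e n = 1 / real (Suc n)" for n
  have e: "e n > 0" for n by (simp add: e_def)
  define f where "f n x = exp (- e n * (norm (x - b))\<^sup>2) * bubble_power g a b x" for n x
  have [measurable]: "f n \<in> borel_measurable borel" for n unfolding f_def by measurable
  have Hf: "Hs_pair s (f n) (weighted_fourier s (f n))" for n
    using Hs_pair_damped[OF s a e[of n], of b "- g"] unfolding f_def bubble_power_def .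
  have Wf: "weighted_fourier s (f n) \<xi> = of_real (norm \<xi> powr s) * (cis (- (b \<bullet> \<xi>)) * of_real (subordinate_fourier ?d g a (e n) ((norm \<xi>)\<^sup>2)))" for n \<xi>
    unfolding weighted_fourier_def f_def using fourier_damped_bubble[OF g0 a, of "e n" b \<xi>] e[of n] by simp
  define F where "F \<xi> = of_real (norm \<xi> powr s) * bubble_fourier g a b \<xi>" for \<xi> :: "real^'n"
  have [measurable]: "F \<in> borel_measurable borel" unfolding F_def by measurable
  have [measurable]: "weighted_fourier s (f n) \<in> borel_measurable borel" for n
    using Hf[of n] unfolding Hs_pair_def by (auto intro: square_integrable_measurable)
  obtain C1 where C1: "C1 \<ge> 0" "\<And>\<delta> z. \<delta> \<ge> 0 \<Longrightarrow> z > 0 \<Longrightarrow> \<bar>subordinate_fourier ?d g a \<delta> z\<bar> \<le> C1 * z powr - (?d / 2)"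
    using subordinate_fourier_bound[of 0 g ?d a] g0 a by auto
  \<comment> \<open>Any value strictly between \<open>al / 2\<close> and \<open>al\<close> serves:
    below \<open>al\<close> because \<open>q < g\<close> is required and \<open>g\<close> may equal
    \<open>al\<close>, above \<open>al / 2\<close> so that the singularity
    \<open>norm \<xi> powr (s - ?d + 2 * q)\<close> is square-integrable at 0.\<close>
  define q where "q = 3 * al / 4"
  have q: "0 \<le> q" "q < g" "q \<le> ?d / 2"
    using al g s unfolding q_def al_def by (auto simp: field_simps)
  obtain C2 where C2: "C2 \<ge> 0" "\<And>\<delta> z. \<delta> \<ge> 0 \<Longrightarrow> z > 0 \<Longrightarrow> \<bar>subordinate_fourier ?d g a \<delta> z\<bar> \<le> C2 * z powr - (?d / 2 - q)"
    using subordinate_fourier_bound[OF q a] by auto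
  define q' where "q' = (?d + 2 * s) / 4"
  have q': "0 < q'" "q' < ?d / 2" using s unfolding q'_def by (auto simp: field_simps add_pos_pos)
  define W where "W \<xi> = (C2\<^sup>2 * 2 powr ?d) * (norm \<xi> powr (- 2 * q') * (1 + (norm \<xi>)\<^sup>2) powr - ?d) + (C1\<^sup>2 * 2 powr (?d - s)) * (1 + (norm \<xi>)\<^sup>2) powr - (?d - s)" for \<xi> :: "real^'n"
  have iW: "integrable lborel W"
    unfolding W_def using q' s
    by (intro Bochner_Integration.integrable_add integrable_mult_right integrable_riesz_inverse_power integrable_inverse_power) auto
  have W0: "W \<xi> \<ge> 0" for \<xi> unfolding W_def by simp
  have bound: "(norm \<xi> powr s * \<bar>subordinate_fourier ?d g a \<delta> ((norm \<xi>)\<^sup>2)\<bar>)\<^sup>2 \<le> W \<xi>" if "\<delta> \<ge> 0" "\<xi> \<noteq> 0" for \<delta> and \<xi> :: "real^'n"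
  proof (cases "norm \<xi> \<le> 1")
    case True
    have x: "norm \<xi> > 0" using that by simp
    have "norm \<xi> powr s * \<bar>subordinate_fourier ?d g a \<delta> ((norm \<xi>)\<^sup>2)\<bar> \<le> norm \<xi> powr s * (C2 * ((norm \<xi>)\<^sup>2) powr - (?d / 2 - q))"
      using that by (intro mult_left_mono C2) auto
    also have "((norm \<xi>)\<^sup>2) powr - (?d / 2 - q) = norm \<xi> powr (- ?d + 2 * q)"
      using x by (simp add: powr_powr algebra_simps flip: powr_numeral)
    also have "norm \<xi> powr s * (C2 * norm \<xi> powr (- ?d + 2 * q)) = C2 * norm \<xi> powr (- q')"
    proof -
      have "s + (- ?d + 2 * q) = - q'" unfolding q_def q'_def al_def by (simp add: field_simps)
      then have "norm \<xi> powr s * norm \<xi> powr (- ?d + 2 * q) = norm \<xi> powr (- q')"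
        by (simp only: powr_add[symmetric])
      then show ?thesis by (simp only: mult.left_commute)
    qed
    finally have "(norm \<xi> powr s * \<bar>subordinate_fourier ?d g a \<delta> ((norm \<xi>)\<^sup>2)\<bar>)\<^sup>2 \<le> (C2 * norm \<xi> powr (- q'))\<^sup>2"
      by (intro power_mono) auto
    also have "\<dots> = C2\<^sup>2 * norm \<xi> powr (- 2 * q')"
      unfolding power_mult_distrib by (simp add: power2_eq_square powr_add[symmetric])
    also have "\<dots> \<le> C2\<^sup>2 * (norm \<xi> powr (- 2 * q') * (2 powr ?d * (1 + (norm \<xi>)\<^sup>2) powr - ?d))"
    proof -
      have "(1 + (norm \<xi>)\<^sup>2) powr ?d \<le> 2 powr ?d" using True by (intro powr_mono2) (auto simp: power_le_one)
      moreover have "(1 + (norm \<xi>)\<^sup>2) powr ?d > 0" by (simp add: add_pos_nonneg) (smt (verit) zero_le_power2)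
      moreover have "1 \<le> A * (1 / X)" if "X \<le> A" "X > 0" for A X :: real using that by simp
      ultimately have "1 \<le> 2 powr ?d * (1 + (norm \<xi>)\<^sup>2) powr - ?d" by (simp only: powr_minus_divide)
      then show ?thesis using mult_left_mono[of 1 _ "norm \<xi> powr (- 2 * q')"] by (intro mult_left_mono) auto
    qed
    also have "\<dots> \<le> W \<xi>" unfolding W_def by simp
    finally show ?thesis .
  next
    \<comment> \<open>At high frequency the transform is of order
      \<open>norm \<xi> powr (s - ?d)\<close>, square-integrable at infinity because
      \<open>2 * (?d - s)\<close> exceeds the dimension.\<close>
    case False
    have x: "norm \<xi> > 0" using that by simp
    have "norm \<xi> powr s * \<bar>subordinate_fourier ?d g a \<delta> ((norm \<xi>)\<^sup>2)\<bar> \<le> norm \<xi> powr s * (C1 * ((norm \<xi>)\<^sup>2) powr - (?d / 2))"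
      using that by (intro mult_left_mono C1) auto
    also have "((norm \<xi>)\<^sup>2) powr - (?d / 2) = norm \<xi> powr - ?d"
      using x by (simp add: powr_powr flip: powr_numeral)
    also have "norm \<xi> powr s * (C1 * norm \<xi> powr - ?d) = C1 * norm \<xi> powr - (?d - s)"
      by (simp add: powr_add[symmetric])
    finally have "(norm \<xi> powr s * \<bar>subordinate_fourier ?d g a \<delta> ((norm \<xi>)\<^sup>2)\<bar>)\<^sup>2 \<le> (C1 * norm \<xi> powr - (?d - s))\<^sup>2"
      by (intro power_mono) auto
    also have "\<dots> = C1\<^sup>2 * ((norm \<xi>)\<^sup>2) powr - (?d - s)"
    proof -
      have "(norm \<xi> powr - (?d - s))\<^sup>2 = ((norm \<xi>)\<^sup>2) powr - (?d - s)"
        using x by (simp add: powr_powr power2_eq_square powr_add[symmetric] powr_mult)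
      then show ?thesis by (simp only: power_mult_distrib)
    qed
    also have "\<dots> \<le> C1\<^sup>2 * (2 powr (?d - s) * (1 + (norm \<xi>)\<^sup>2) powr - (?d - s))"
    proof (intro mult_left_mono)
      have "1 \<le> (norm \<xi>)\<^sup>2" using False by (simp add: one_le_power)
      then have "(1 + (norm \<xi>)\<^sup>2) powr (?d - s) \<le> (2 * (norm \<xi>)\<^sup>2) powr (?d - s)" using s by (intro powr_mono2) auto
      also have "\<dots> = 2 powr (?d - s) * ((norm \<xi>)\<^sup>2) powr (?d - s)" by (simp add: powr_mult)
      finally have le: "(1 + (norm \<xi>)\<^sup>2) powr (?d - s) \<le> 2 powr (?d - s) * ((norm \<xi>)\<^sup>2) powr (?d - s)" .
      have pos: "(1 + (norm \<xi>)\<^sup>2) powr (?d - s) > 0" "((norm \<xi>)\<^sup>2) powr (?d - s) > 0"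
        using x by (auto simp: add_pos_nonneg) (smt (verit) zero_le_power2)
      have "1 / Y \<le> c * (1 / X)" if "X \<le> c * Y" "X > 0" "Y > 0" for X Y c :: real
        using that by (simp add: field_simps)
      from this[OF le pos] show "((norm \<xi>)\<^sup>2) powr - (?d - s) \<le> 2 powr (?d - s) * (1 + (norm \<xi>)\<^sup>2) powr - (?d - s)"
        by (simp only: powr_minus_divide)
    qed simp
    also have "\<dots> \<le> W \<xi>" unfolding W_def by simp
    finally show ?thesis .
  qed
  have bF: "(cmod (F \<xi>))\<^sup>2 \<le> W \<xi>" if "\<xi> \<noteq> 0" for \<xi>
    using bound[of 0 \<xi>] that unfolding F_def bubble_fourier_def by (simp add: norm_mult)
  have sqF: "square_integrable F"
    unfolding square_integrable_def
  proof
    have b: "AE \<xi> in lborel. norm ((cmod (F \<xi>))\<^sup>2) \<le> norm (W \<xi>)"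
      by (rule eventually_mono[OF AE_lborel_singleton[of 0]]) (use bF W0 in auto)
    show "integrable lborel (\<lambda>\<xi>. (cmod (F \<xi>))\<^sup>2)"
      by (rule Bochner_Integration.integrable_bound[OF iW _ b]) measurable
  qed measurable
  have ip: "integrable lborel (\<lambda>x. \<bar>bubble_power g a b x\<bar> powr ?p)"
    by (rule bubble_power_powr_integrable[OF s g a])
  have h0: "e \<longlonglongrightarrow> 0" unfolding e_def using LIMSEQ_inverse_real_of_nat by (simp add: inverse_eq_divide)
  show ?thesis unfolding F_def[symmetric]
  proof (rule Hs_pair_limit[OF s _ ip sqF Hf])
    have "(\<lambda>n. \<integral>x. \<bar>f n x - bubble_power g a b x\<bar> powr ?p \<partial>lborel) \<longlonglongrightarrow> (\<integral>x. (0::real) \<partial>(lborel :: (real^'n) measure))"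
    proof (rule integral_dominated_convergence[OF _ _ ip])
      show "AE x in lborel. (\<lambda>n. \<bar>f n x - bubble_power g a b x\<bar> powr ?p) \<longlonglongrightarrow> 0"
      proof (rule AE_I2)
        fix x
        have "(\<lambda>n. \<bar>f n x - bubble_power g a b x\<bar>) \<longlonglongrightarrow> \<bar>exp (- 0 * (norm (x - b))\<^sup>2) * bubble_power g a b x - bubble_power g a b x\<bar>"
          unfolding f_def by (intro tendsto_intros h0)
        then have "(\<lambda>n. \<bar>f n x - bubble_power g a b x\<bar>) \<longlonglongrightarrow> 0" by simp
        from tendsto_zero_powrI[OF this tendsto_const] show "(\<lambda>n. \<bar>f n x - bubble_power g a b x\<bar> powr ?p) \<longlonglongrightarrow> 0"
          using p by simp
      qed
      show "AE x in lborel. norm (\<bar>f n x - bubble_power g a b x\<bar> powr ?p) \<le> \<bar>bubble_power g a b x\<bar> powr ?p" for n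
      proof (rule AE_I2)
        fix x
        have "exp (- e n * (norm (x - b))\<^sup>2) \<le> 1" using e[of n] by simp
        then have "0 \<le> f n x" "f n x \<le> 1 * bubble_power g a b x"
          unfolding f_def by (simp, intro mult_right_mono, simp_all)
        then have "\<bar>f n x - bubble_power g a b x\<bar> \<le> \<bar>bubble_power g a b x\<bar>" by linarith
        then show "norm (\<bar>f n x - bubble_power g a b x\<bar> powr ?p) \<le> \<bar>bubble_power g a b x\<bar> powr ?p"
          using p by (auto intro!: powr_mono2)
      qed
    qed measurable
    then show "(\<lambda>n. \<integral>x. \<bar>f n x - bubble_power g a b x\<bar> powr ?p \<partial>lborel) \<longlonglongrightarrow> 0" by simp
    have "(\<lambda>n. \<integral>\<xi>. (cmod (weighted_fourier s (f n) \<xi> - F \<xi>))\<^sup>2 \<partial>lborel) \<longlonglongrightarrow> (\<integral>\<xi>. (0::real) \<partial>(lborel :: (real^'n) measure))"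
    proof (rule integral_dominated_convergence[where w="\<lambda>\<xi>. 4 * W \<xi>"])
      show "integrable lborel (\<lambda>\<xi>. 4 * W \<xi>)" using iW by simp
      show "AE \<xi> in lborel. (\<lambda>n. (cmod (weighted_fourier s (f n) \<xi> - F \<xi>))\<^sup>2) \<longlonglongrightarrow> 0"
      proof (rule eventually_mono[OF AE_lborel_singleton[of 0]])
        fix \<xi> :: "real^'n" assume "\<xi> \<noteq> 0"
        then have z: "(norm \<xi>)\<^sup>2 > 0" by simp
        have "(\<lambda>n. weighted_fourier s (f n) \<xi>) \<longlonglongrightarrow> F \<xi>"
          unfolding Wf F_def bubble_fourier_def e_def
          by (intro tendsto_intros subordinate_fourier_tendsto g0 a z) simp
        then have "(\<lambda>n. (cmod (weighted_fourier s (f n) \<xi> - F \<xi>))\<^sup>2) \<longlonglongrightarrow> (cmod (F \<xi> - F \<xi>))\<^sup>2"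
          by (intro tendsto_intros)
        then show "(\<lambda>n. (cmod (weighted_fourier s (f n) \<xi> - F \<xi>))\<^sup>2) \<longlonglongrightarrow> 0" by simp
      qed
      show "AE \<xi> in lborel. norm ((cmod (weighted_fourier s (f n) \<xi> - F \<xi>))\<^sup>2) \<le> 4 * W \<xi>" for n
      proof (rule eventually_mono[OF AE_lborel_singleton[of 0]])
        fix \<xi> :: "real^'n" assume x: "\<xi> \<noteq> 0"
        have 1: "(cmod (weighted_fourier s (f n) \<xi>))\<^sup>2 \<le> W \<xi>"
          using bound[of "e n" \<xi>] e[of n] x unfolding Wf by (simp add: norm_mult)
        have "(cmod (weighted_fourier s (f n) \<xi> - F \<xi>))\<^sup>2 \<le> (cmod (weighted_fourier s (f n) \<xi>) + cmod (F \<xi>))\<^sup>2"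
          by (intro power_mono norm_triangle_ineq4) auto
        also have "\<dots> \<le> 2 * (cmod (weighted_fourier s (f n) \<xi>))\<^sup>2 + 2 * (cmod (F \<xi>))\<^sup>2"
          using sum_squares_bound[of "cmod (weighted_fourier s (f n) \<xi>)" "cmod (F \<xi>)"] by (simp add: power2_sum)
        finally show "norm ((cmod (weighted_fourier s (f n) \<xi> - F \<xi>))\<^sup>2) \<le> 4 * W \<xi>"
          using 1 bF[OF x] by simp
      qed
    qed measurable
    from tendsto_real_sqrt[OF this] show "(\<lambda>n. l2norm (\<lambda>\<xi>. weighted_fourier s (f n) \<xi> - F \<xi>)) \<longlonglongrightarrow> 0"
      unfolding l2norm_def by simp
  qed measurable
qed

text \<open>The inverse transform is computed Gaussian by Gaussian. In frequency the normalised
  Gaussians of the mixture all have the same integral, whatever their width, so Fubini applies for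
  every \<open>g > 0\<close>, including bubbles that are not integrable in space.\<close>

lemma
  fixes b :: "real ^ 'n"
  assumes g: "g > 0" and a: "a > 0"
  shows bubble_fourier_integrable: "integrable lborel (bubble_fourier g a b)"
    and bubble_fourier_inversion: "of_real (bubble_power g a b x) = of_real (fourier_const TYPE('n)) * (\<integral>\<xi>. cis (x \<bullet> \<xi>) * bubble_fourier g a b \<xi> \<partial>lborel)"
proof -
  let ?d = "real CARD('n)"
  have G: "Gamma g > 0" using g by (simp add: Gamma_real_pos)
  let ?k = "\<lambda>t \<xi>. complex_of_real (subordinate g a t * ((2 * t) powr (- ?d / 2) * exp (- (norm (\<xi>::real^'n))\<^sup>2 / (4 * t))))"
  have gi: "has_bochner_integral lborel (\<lambda>\<xi>::real^'n. cis (\<xi> \<bullet> y) * of_real (exp (- (norm \<xi>)\<^sup>2 / (4 * t))))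
     (of_real ((4 * pi * t) powr (?d / 2) * exp (- t * (norm y)\<^sup>2)))" if "t > 0" for t y
    using gaussian_fourier[of "1 / (4 * t)" y] that by (simp add: field_simps)
  have k: "has_bochner_integral lborel (\<lambda>\<xi>. cis (\<xi> \<bullet> y) * ?k t \<xi>) (of_real ((2 * pi) powr (?d / 2) * (subordinate g a t * exp (- t * (norm y)\<^sup>2))))" for t y
  proof (cases "t > 0")
    case True
    have "has_bochner_integral lborel (\<lambda>\<xi>::real^'n. of_real (subordinate g a t * (2 * t) powr (- ?d / 2)) * (cis (\<xi> \<bullet> y) * of_real (exp (- (norm \<xi>)\<^sup>2 / (4 * t)))))
      (of_real (subordinate g a t * (2 * t) powr (- ?d / 2)) * of_real ((4 * pi * t) powr (?d / 2) * exp (- t * (norm y)\<^sup>2)))"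
      by (intro has_bochner_integral_mult_right gi True)
    moreover have "(2 * t) powr (- ?d / 2) * (4 * pi * t) powr (?d / 2) = (2 * pi) powr (?d / 2)"
    proof -
      have "(4 * pi * t) powr (?d / 2) = ((2 * pi) * (2 * t)) powr (?d / 2)" by (simp add: mult_ac)
      also have "\<dots> = (2 * pi) powr (?d / 2) * (2 * t) powr (?d / 2)" using True by (subst powr_mult) auto
      finally have "(2 * t) powr (- ?d / 2) * (4 * pi * t) powr (?d / 2) = (2 * pi) powr (?d / 2) * ((2 * t) powr (- ?d / 2) * (2 * t) powr (?d / 2))" by simp
      also have "(2 * t) powr (- ?d / 2) * (2 * t) powr (?d / 2) = 1" using True by (simp add: powr_add[symmetric])
      finally show ?thesis by simp
    qed
    then have "(subordinate g a t * (2 * t) powr (- ?d / 2)) * ((4 * pi * t) powr (?d / 2) * exp (- t * (norm y)\<^sup>2)) = (2 * pi) powr (?d / 2) * (subordinate g a t * exp (- t * (norm y)\<^sup>2))"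
      by (simp add: mult.assoc mult.left_commute)
    moreover have "of_real (subordinate g a t * (2 * t) powr (- ?d / 2)) * (cis (\<xi> \<bullet> y) * of_real (exp (- (norm \<xi>)\<^sup>2 / (4 * t)))) = cis (\<xi> \<bullet> y) * ?k t \<xi>" for \<xi> :: "real^'n"
      by simp
    ultimately show ?thesis by (simp only: of_real_mult[symmetric])
  qed (simp add: subordinate_def has_bochner_integral_iff)
  have prod: "integrable (lborel \<Otimes>\<^sub>M lborel) (\<lambda>(t, \<xi>). ?k t \<xi>)"
  proof (rule lborel_pair.Fubini_integrable)
    show "(\<lambda>(t, \<xi>). ?k t \<xi>) \<in> borel_measurable (lborel \<Otimes>\<^sub>M lborel)" by measurable
    have nk: "norm (?k t \<xi>) = Re (cis (\<xi> \<bullet> 0) * ?k t \<xi>)" for t \<xi>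
      by (simp only: norm_of_real inner_zero_right cis_zero mult_1 Re_complex_of_real) (rule abs_of_nonneg, simp)
    have "(\<integral>\<xi>. norm (?k t \<xi>) \<partial>lborel) = (2 * pi) powr (?d / 2) * subordinate g a t" for t
      unfolding nk using has_bochner_integral_Re[OF k[of 0 t]] by (simp only: has_bochner_integral_iff) simp
    then show "integrable lborel (\<lambda>t. \<integral>\<xi>. norm (case (t, \<xi>) of (t, \<xi>) \<Rightarrow> ?k t \<xi>) \<partial>lborel)"
      using subordinate_integral[OF g a] by (simp only: prod.case has_bochner_integral_iff) simp
    show "AE t in lborel. integrable lborel (\<lambda>\<xi>. case (t, \<xi>) of (t, \<xi>) \<Rightarrow> ?k t \<xi>)"
      using k[of 0] by (intro AE_I2) (simp add: has_bochner_integral_iff)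
  qed
  have bf: "bubble_fourier g a b \<xi> = of_real (1 / Gamma g) * (cis (- (b \<bullet> \<xi>)) * (\<integral>t. ?k t \<xi> \<partial>lborel))" for \<xi>
    unfolding bubble_fourier_def subordinate_fourier_def integral_complex_of_real by simp
  have "integrable lborel (\<lambda>\<xi>. \<integral>t. ?k t \<xi> \<partial>lborel)"
    using lborel_pair.integrable_snd[OF prod] .
  then show i: "integrable lborel (bubble_fourier g a b)"
    unfolding bf by (intro integrable_mult_right integrable_cis_mult) auto
  have b: "AE z in lborel \<Otimes>\<^sub>M lborel. norm (case z of (t, \<xi>) \<Rightarrow> cis (\<xi> \<bullet> (x - b)) * ?k t \<xi>) \<le> norm (case z of (t, \<xi>) \<Rightarrow> ?k t \<xi>)"
    by (intro AE_I2) (simp add: norm_mult split: prod.split)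
  have prod2: "integrable (lborel \<Otimes>\<^sub>M lborel) (\<lambda>(t, \<xi>). cis (\<xi> \<bullet> (x - b)) * ?k t \<xi>)"
    by (rule Bochner_Integration.integrable_bound[OF prod _ b]) measurable
  have "(\<integral>\<xi>. cis (x \<bullet> \<xi>) * bubble_fourier g a b \<xi> \<partial>lborel) = (\<integral>\<xi>. of_real (1 / Gamma g) * (\<integral>t. cis (\<xi> \<bullet> (x - b)) * ?k t \<xi> \<partial>lborel) \<partial>lborel)"
  proof (intro Bochner_Integration.integral_cong refl)
    fix \<xi>
    have "cis (\<xi> \<bullet> (x - b)) = cis (x \<bullet> \<xi>) * cis (- (b \<bullet> \<xi>))"
      by (simp add: cis_mult inner_diff_right inner_commute)
    then show "cis (x \<bullet> \<xi>) * bubble_fourier g a b \<xi> = of_real (1 / Gamma g) * (\<integral>t. cis (\<xi> \<bullet> (x - b)) * ?k t \<xi> \<partial>lborel)"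
      unfolding bf integral_mult_right_zero by (simp only: mult.assoc mult.left_commute)
  qed
  also have "\<dots> = of_real (1 / Gamma g) * (\<integral>\<xi>. (\<integral>t. cis (\<xi> \<bullet> (x - b)) * ?k t \<xi> \<partial>lborel) \<partial>lborel)"
    by (rule integral_mult_right_zero)
  also have "(\<integral>\<xi>. (\<integral>t. cis (\<xi> \<bullet> (x - b)) * ?k t \<xi> \<partial>lborel) \<partial>lborel) = (\<integral>t. (\<integral>\<xi>. cis (\<xi> \<bullet> (x - b)) * ?k t \<xi> \<partial>lborel) \<partial>lborel)"
    by (rule lborel_pair.Fubini_integral[OF prod2])
  also have "\<dots> = (\<integral>t. of_real ((2 * pi) powr (?d / 2) * (subordinate g a t * exp (- t * (norm (x - b))\<^sup>2))) \<partial>lborel)"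
    using k by (simp only: has_bochner_integral_iff)
  also have "\<dots> = of_real ((2 * pi) powr (?d / 2) * (Gamma g * bubble_power g a b x))"
    unfolding integral_complex_of_real integral_mult_right_zero using subordinate_bubble[OF g a, where x=x and b=b]
    by (simp only: has_bochner_integral_iff)
  finally have "of_real (fourier_const TYPE('n)) * (\<integral>\<xi>. cis (x \<bullet> \<xi>) * bubble_fourier g a b \<xi> \<partial>lborel)
    = of_real (fourier_const TYPE('n) * (1 / Gamma g * ((2 * pi) powr (?d / 2) * (Gamma g * bubble_power g a b x))))"
    by (simp only: of_real_mult)
  also have "fourier_const TYPE('n) * (1 / Gamma g * ((2 * pi) powr (?d / 2) * (Gamma g * bubble_power g a b x)))
     = (fourier_const TYPE('n) * (2 * pi) powr (?d / 2)) * bubble_power g a b x" using G by simp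
  also have "fourier_const TYPE('n) * (2 * pi) powr (?d / 2) = 1" by (simp add: powr_add[symmetric])
  finally show "of_real (bubble_power g a b x) = of_real (fourier_const TYPE('n)) * (\<integral>\<xi>. cis (x \<bullet> \<xi>) * bubble_fourier g a b \<xi> \<partial>lborel)"
    by simp
qed

section \<open>Inner products\<close>

text \<open>Beyond \<open>Hs_pair\<close>, \<open>f\<close> has to be the inverse transform of an
  integrable \<open>G\<close> at every point; this is what moves inner products to physical space in
  \<open>Hs_rep_pairing\<close>.\<close>

definition Hs_rep :: "real \<Rightarrow> (real ^ 'n \<Rightarrow> real) \<Rightarrow> (real ^ 'n \<Rightarrow> complex) \<Rightarrow> bool" where
  "Hs_rep s f G \<longleftrightarrow> integrable lborel G \<and>
     (\<forall>x. of_real (f x) = of_real (fourier_const TYPE('n)) * (\<integral>\<xi>. cis (x \<bullet> \<xi>) * G \<xi> \<partial>lborel)) \<and>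
     Hs_pair s f (\<lambda>\<xi>. of_real (norm \<xi> powr s) * G \<xi>)"

lemma Hs_rep_lincomb:
  fixes f g :: "real ^ 'n \<Rightarrow> real"
  assumes s: "0 < s" "s < real CARD('n) / 2" and f: "Hs_rep s f F" and g: "Hs_rep s g G"
  shows "Hs_rep s (\<lambda>x. a * f x + b * g x) (\<lambda>\<xi>. of_real a * F \<xi> + of_real b * G \<xi>)"
  unfolding Hs_rep_def
proof (intro conjI allI)
  let ?c = "complex_of_real (fourier_const TYPE('n))"
  have F: "integrable lborel F" "\<And>x. of_real (f x) = ?c * (\<integral>\<xi>. cis (x \<bullet> \<xi>) * F \<xi> \<partial>lborel)" "Hs_pair s f (\<lambda>\<xi>. of_real (norm \<xi> powr s) * F \<xi>)"
    using f unfolding Hs_rep_def by blast+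
  have G: "integrable lborel G" "\<And>x. of_real (g x) = ?c * (\<integral>\<xi>. cis (x \<bullet> \<xi>) * G \<xi> \<partial>lborel)" "Hs_pair s g (\<lambda>\<xi>. of_real (norm \<xi> powr s) * G \<xi>)"
    using g unfolding Hs_rep_def by blast+
  show "integrable lborel (\<lambda>\<xi>. of_real a * F \<xi> + of_real b * G \<xi>)"
    using F G by (intro Bochner_Integration.integrable_add integrable_mult_right)
  have "(\<lambda>\<xi>. of_real (norm \<xi> powr s) * (of_real a * F \<xi> + of_real b * G \<xi>)) = (\<lambda>\<xi>. of_real a * (of_real (norm \<xi> powr s) * F \<xi>) + of_real b * (of_real (norm \<xi> powr s) * G \<xi>))"
    by (simp only: distrib_left mult.left_commute)
  then show "Hs_pair s (\<lambda>x. a * f x + b * g x) (\<lambda>\<xi>. of_real (norm \<xi> powr s) * (of_real a * F \<xi> + of_real b * G \<xi>))"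
    using Hs_pair_lincomb[OF s F(3) G(3)] by (simp only:)
  fix x
  have i: "integrable lborel (\<lambda>\<xi>. of_real a * (cis (x \<bullet> \<xi>) * F \<xi>))" "integrable lborel (\<lambda>\<xi>. of_real b * (cis (x \<bullet> \<xi>) * G \<xi>))"
    by (intro integrable_mult_right integrable_cis_mult F G, simp)+
  have "(\<integral>\<xi>. cis (x \<bullet> \<xi>) * (of_real a * F \<xi> + of_real b * G \<xi>) \<partial>lborel) = (\<integral>\<xi>. of_real a * (cis (x \<bullet> \<xi>) * F \<xi>) + of_real b * (cis (x \<bullet> \<xi>) * G \<xi>) \<partial>lborel)"
    by (simp only: distrib_left mult.left_commute)
  also have "\<dots> = of_real a * (\<integral>\<xi>. cis (x \<bullet> \<xi>) * F \<xi> \<partial>lborel) + of_real b * (\<integral>\<xi>. cis (x \<bullet> \<xi>) * G \<xi> \<partial>lborel)"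
    by (simp only: Bochner_Integration.integral_add[OF i] integral_mult_right_zero)
  finally show "of_real (a * f x + b * g x) = ?c * (\<integral>\<xi>. cis (x \<bullet> \<xi>) * (of_real a * F \<xi> + of_real b * G \<xi>) \<partial>lborel)"
    unfolding of_real_add of_real_mult F(2) G(2) by (simp only: distrib_left mult.left_commute)
qed

lemma Hs_rep_bubble_power:
  fixes b :: "real ^ 'n"
  assumes s: "0 < s" "s < real CARD('n) / 2" and g: "g \<ge> (real CARD('n) - 2 * s) / 2" and a: "a > 0"
  shows "Hs_rep s (bubble_power g a b) (bubble_fourier g a b)"
proof -
  have "g > 0" using s g by simp
  then show ?thesis
    unfolding Hs_rep_def using bubble_fourier_integrable bubble_fourier_inversion Hs_pair_bubble_power[OF s g a] a by blast
qed

text \<open>Hypothesis \<open>eq\<close> is the equation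
  \<open>(- \<Delta>)\<^sup>s h = l * V\<close> in frequency space, so this is integration by parts:
  both half-powers are collected on \<open>h\<close>, and the multiplication formula moves the
  transform of \<open>V\<close> onto \<open>f\<close>. Frequency 0 is left out as a null
  set.\<close>

lemma Hs_rep_pairing:
  fixes f h V :: "real ^ 'n \<Rightarrow> real"
  assumes f: "Hs_rep s f G" and h: "Hs_rep s h H" and V: "integrable lborel V"
    and eq: "\<And>\<xi>. \<xi> \<noteq> 0 \<Longrightarrow> of_real (norm \<xi> powr (2 * s)) * H \<xi> = of_real l * fourier (\<lambda>x. of_real (V x)) \<xi>"
  shows "(\<integral>\<xi>. (of_real (norm \<xi> powr s) * G \<xi>) * cnj (of_real (norm \<xi> powr s) * H \<xi>) \<partial>lborel) = of_real (l * (\<integral>x. f x * V x \<partial>lborel))"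
proof -
  let ?c = "complex_of_real (fourier_const TYPE('n))"
  have G: "integrable lborel G" "\<And>x. of_real (f x) = ?c * (\<integral>\<xi>. cis (x \<bullet> \<xi>) * G \<xi> \<partial>lborel)"
    using f unfolding Hs_rep_def by blast+
  have H: "integrable lborel H" using h unfolding Hs_rep_def by blast
  have [measurable]: "G \<in> borel_measurable borel" "H \<in> borel_measurable borel" using G H by auto
  have V': "integrable lborel (\<lambda>x. complex_of_real (V x))" using V by simp
  let ?F = "\<lambda>\<xi>. \<integral>x. cis (x \<bullet> \<xi>) * complex_of_real (V x) \<partial>lborel"
  have cF: "cnj (fourier (\<lambda>x. of_real (V x)) \<xi>) = ?c * ?F \<xi>" for \<xi>
    unfolding fourier_def by (simp add: Bochner_Integration.integral_cnj[symmetric] cis_cnj del: Bochner_Integration.integral_cnj)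
  have [measurable]: "?F \<in> borel_measurable borel"
    using continuous_fourier_integral[OF V'] by (rule borel_measurable_continuous_onI)
  have "(\<integral>\<xi>. (of_real (norm \<xi> powr s) * G \<xi>) * cnj (of_real (norm \<xi> powr s) * H \<xi>) \<partial>lborel) = (\<integral>\<xi>. (of_real l * ?c) * (G \<xi> * ?F \<xi>) \<partial>lborel)"
  proof (rule integral_cong_AE)
    show "AE \<xi> in lborel. (of_real (norm \<xi> powr s) * G \<xi>) * cnj (of_real (norm \<xi> powr s) * H \<xi>) = (of_real l * ?c) * (G \<xi> * ?F \<xi>)"
    proof (rule eventually_mono[OF AE_lborel_singleton[of 0]])
      fix \<xi> :: "real^'n" assume x: "\<xi> \<noteq> 0"
      have n: "norm \<xi> powr s * norm \<xi> powr s = norm \<xi> powr (2 * s)" by (simp add: powr_add[symmetric])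
      have "(of_real (norm \<xi> powr s) * G \<xi>) * cnj (of_real (norm \<xi> powr s) * H \<xi>) = G \<xi> * cnj (of_real (norm \<xi> powr s * norm \<xi> powr s) * H \<xi>)"
        by simp
      also have "\<dots> = G \<xi> * cnj (of_real l * fourier (\<lambda>x. of_real (V x)) \<xi>)" unfolding n eq[OF x] ..
      also have "\<dots> = (of_real l * ?c) * (G \<xi> * ?F \<xi>)"
        unfolding complex_cnj_mult complex_cnj_complex_of_real cF by (simp only: mult.assoc mult.left_commute)
      finally show "(of_real (norm \<xi> powr s) * G \<xi>) * cnj (of_real (norm \<xi> powr s) * H \<xi>) = (of_real l * ?c) * (G \<xi> * ?F \<xi>)" .
    qed
  qed measurable
  also have "\<dots> = (of_real l * ?c) * (\<integral>\<xi>. G \<xi> * ?F \<xi> \<partial>lborel)" by (rule integral_mult_right_zero)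
  also have "(\<integral>\<xi>. G \<xi> * ?F \<xi> \<partial>lborel) = (\<integral>x. of_real (V x) * (\<integral>\<xi>. cis (x \<bullet> \<xi>) * G \<xi> \<partial>lborel) \<partial>lborel)"
    by (rule Fubini_bounded_kernel[where C=1]) (use G V' in auto)
  also have "(of_real l * ?c) * \<dots> = of_real l * (\<integral>x. ?c * (of_real (V x) * (\<integral>\<xi>. cis (x \<bullet> \<xi>) * G \<xi> \<partial>lborel)) \<partial>lborel)"
    by (simp only: integral_mult_right_zero mult.assoc)
  also have "(\<integral>x. ?c * (of_real (V x) * (\<integral>\<xi>. cis (x \<bullet> \<xi>) * G \<xi> \<partial>lborel)) \<partial>lborel) = (\<integral>x. of_real (f x * V x) \<partial>lborel)"
    unfolding of_real_mult G(2) by (simp only: mult.assoc mult.left_commute mult.commute)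
  finally show ?thesis by (simp only: integral_complex_of_real) (simp only: of_real_mult)
qed

section \<open>Bessel-type integrals and the Euler-Lagrange equations\<close>

definition bessel_integral :: "real \<Rightarrow> real \<Rightarrow> real \<Rightarrow> real" where
  "bessel_integral \<nu> a z = (\<integral>t. subordinate \<nu> a t * exp (- z / (4 * t)) \<partial>lborel)"

text \<open>For positive \<open>a\<close> and \<open>z\<close>,
  \<open>bessel_integral \<nu> a z\<close> is \<open>2 * (z / (4 * a)) powr (\<nu> / 2)\<close>
  times the Macdonald function of index \<open>\<nu>\<close> at \<open>sqrt (a * z)\<close>. At
  \<open>\<delta> = 0\<close> the factor \<open>t powr (- d / 2)\<close> merely lowers the index of
  the density.\<close>

lemma subordinate_fourier_bessel:
  "subordinate_fourier d g a 0 z = 2 powr (- d / 2) / Gamma g * bessel_integral (g - d / 2) a z"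
proof -
  have "subordinate g a t * ((2 * (t + 0)) powr (- d / 2) * exp (- z / (4 * (t + 0)))) = 2 powr (- d / 2) * (subordinate (g - d / 2) a t * exp (- z / (4 * t)))" for t
  proof (cases "t > 0")
    case True
    have "t powr (g - d / 2 - 1) = t powr (g - 1) * t powr (- d / 2)" using True by (simp add: powr_add[symmetric] algebra_simps)
    then show ?thesis using True by (simp add: subordinate_def powr_mult)
  qed (simp add: subordinate_def)
  then show ?thesis
    unfolding subordinate_fourier_def bessel_integral_def by (simp only: integral_mult_right_zero times_divide_eq_left)
qed

lemma bessel_integrable:
  assumes a: "a > 0" and z: "z > 0"
  shows "integrable lborel (\<lambda>t. subordinate \<nu> a t * exp (- z / (4 * t)))"
proof -
  \<comment> \<open>Raises the index \<open>\<nu> + r\<close> to at least 1; the exponential pays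
    for the negative power of \<open>t\<close> that this leaves behind.\<close>
  define r where "r = max 0 (1 - \<nu>)"
  have r: "r \<ge> 0" "\<nu> + r > 0" by (auto simp: r_def)
  obtain C where C: "\<And>y. y > 0 \<Longrightarrow> y powr - r * exp (- z / (4 * y)) \<le> C * z powr - r"
    using powr_exp_inverse_bound[OF r(1)] z by auto
  have i: "integrable lborel (\<lambda>t. (C * z powr - r) * subordinate (\<nu> + r) a t)"
    using subordinate_integral[OF r(2) a] by (simp add: has_bochner_integral_iff)
  have le: "subordinate \<nu> a t * exp (- z / (4 * t)) \<le> (C * z powr - r) * subordinate (\<nu> + r) a t" for t
  proof (cases "t > 0")
    case True
    have "subordinate \<nu> a t = subordinate (\<nu> + r) a t * t powr - r"
      using True by (simp add: subordinate_def powr_add[symmetric])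
    then have "subordinate \<nu> a t * exp (- z / (4 * t)) = subordinate (\<nu> + r) a t * (t powr - r * exp (- z / (4 * t)))" by simp
    also have "\<dots> \<le> subordinate (\<nu> + r) a t * (C * z powr - r)" by (intro mult_left_mono C True) simp
    finally show ?thesis by (simp add: mult.commute)
  qed (simp add: subordinate_def)
  have b: "AE t in lborel. norm (subordinate \<nu> a t * exp (- z / (4 * t))) \<le> norm ((C * z powr - r) * subordinate (\<nu> + r) a t)"
    unfolding real_norm_def by (intro AE_I2, subst abs_of_nonneg, simp, rule order_trans[OF le abs_ge_self])
  show ?thesis by (rule Bochner_Integration.integrable_bound[OF i _ b]) measurable
qed

text \<open>Substituting \<open>z / (4 * a * t)\<close> for \<open>t\<close> exchanges the two
  exponentials; in Bessel terms, the Macdonald function is even in its index.\<close>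

lemma bessel_integral_reflect:
  assumes a: "a > 0" and z: "z > 0"
  shows "bessel_integral \<nu> a z = (z / (4 * a)) powr \<nu> * bessel_integral (- \<nu>) a z"
proof -
  define F where "F \<nu> t = t powr (\<nu> - 1) * exp (- t * a) * exp (- z / (4 * t))" for \<nu> t
  have si: "set_integrable lborel {0<..} (F \<nu>)" and J: "bessel_integral \<nu> a z = (LINT t:{0<..}|lborel. F \<nu> t)" for \<nu>
    using bessel_integrable[OF a z, of \<nu>]
    unfolding set_integrable_def set_lebesgue_integral_def bessel_integral_def subordinate_def F_def by (simp_all add: mult.assoc)
  have ai: "F \<nu> absolutely_integrable_on {0<..}" for \<nu>
    using si[of \<nu>] unfolding set_integrable_def by (rule integrable_completion[THEN iffD2, rotated]) (auto simp: F_def)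
  have JI: "bessel_integral \<nu> a z = integral {0<..} (F \<nu>)" for \<nu>
    unfolding J using set_borel_integral_eq_integral(2)[OF si] .
  define g where "g t = z / (4 * a * t)" for t
  define g' where "g' t = - z / (4 * a * t\<^sup>2)" for t
  have img: "g ` {0<..} = {0<..}"
  proof
    show "g ` {0<..} \<subseteq> {0<..}" using a z by (auto simp: g_def)
    show "{0<..} \<subseteq> g ` {0<..}"
    proof
      fix t :: real assume "t \<in> {0<..}"
      then have "t = g (g t)" "g t \<in> {0<..}" using a z by (auto simp: g_def)
      then show "t \<in> g ` {0<..}" by blast
    qed
  qed
  have "inj_on g {0<..}" using a z by (auto simp: inj_on_def g_def)
  moreover have "(g has_field_derivative g' t) (at t within {0<..})" if "t \<in> {0<..}" for t
    using that a z unfolding g_def g'_def by (auto intro!: derivative_eq_intros simp: field_simps power2_eq_square)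
  ultimately have "integral {0<..} (\<lambda>t. \<bar>g' t\<bar> * F \<nu> (g t)) = integral {0<..} (F \<nu>)"
    using has_absolute_integral_change_of_variables_1'[of "{0<..}" g g' "F \<nu>" "integral {0<..} (F \<nu>)"] ai[of \<nu>] unfolding img by auto
  moreover have "\<bar>g' t\<bar> * F \<nu> (g t) = (z / (4 * a)) powr \<nu> * F (- \<nu>) t" if "t \<in> {0<..}" for t
  proof -
    have t: "t > 0" using that by simp
    have e1: "g t powr (\<nu> - 1) = (z / (4 * a)) powr (\<nu> - 1) * t powr (1 - \<nu>)"
    proof -
      have "g t = (z / (4 * a)) / t" by (simp add: g_def)
      then have "g t powr (\<nu> - 1) = (z / (4 * a)) powr (\<nu> - 1) / t powr (\<nu> - 1)" using t a z by (simp only:) (subst powr_divide, auto)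
      moreover have "t powr (1 - \<nu>) = 1 / t powr (\<nu> - 1)" using powr_minus_divide[of t "\<nu> - 1"] by simp
      ultimately show ?thesis by simp
    qed
    have e2: "\<bar>g' t\<bar> = (z / (4 * a)) powr 1 * t powr (- 2)"
      using t a z by (simp add: g'_def powr_minus_divide abs_div abs_of_pos)
    have e3: "exp (- g t * a) = exp (- z / (4 * t))" "exp (- z / (4 * g t)) = exp (- t * a)"
      using t a z by (auto simp: g_def)
    have "\<bar>g' t\<bar> * F \<nu> (g t) = ((z / (4 * a)) powr 1 * (z / (4 * a)) powr (\<nu> - 1)) * ((t powr (- 2) * t powr (1 - \<nu>)) * exp (- t * a) * exp (- z / (4 * t)))"
      unfolding F_def e1 e2 e3 by (simp only: ac_simps)
    also have "(z / (4 * a)) powr 1 * (z / (4 * a)) powr (\<nu> - 1) = (z / (4 * a)) powr \<nu>"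
      unfolding powr_add[symmetric] by simp
    also have "t powr (- 2) * t powr (1 - \<nu>) = t powr (- \<nu> - 1)"
    proof -
      have "(- 2) + (1 - \<nu>) = - \<nu> - 1" by simp
      then show ?thesis by (simp only: powr_add[symmetric])
    qed
    finally show ?thesis unfolding F_def by simp
  qed
  ultimately have "integral {0<..} (F \<nu>) = integral {0<..} (\<lambda>t. (z / (4 * a)) powr \<nu> * F (- \<nu>) t)"
    using Henstock_Kurzweil_Integration.integral_cong[of "{0<..}"] by (metis (no_types, lifting))
  then show ?thesis unfolding JI by simp
qed

text \<open>The derivative of \<open>t powr \<nu> * exp (- t) * exp (- z / (4 * t))\<close> is
  integrated over the half-line, where both boundary values vanish. This is the three-term
  recurrence of the Macdonald functions.\<close>

lemma bessel_integral_recurrence: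
  assumes z: "z > 0"
  shows "\<nu> * bessel_integral \<nu> 1 z - bessel_integral (\<nu> + 1) 1 z + z / 4 * bessel_integral (\<nu> - 1) 1 z = 0"
proof -
  define E where "E t = exp (- t) * exp (- z / (4 * t))" for t :: real
  define F where "F t = t powr \<nu> * E t" for t
  define f where "f t = \<nu> * (t powr (\<nu> - 1) * E t) - t powr \<nu> * E t + z / 4 * (t powr (\<nu> - 2) * E t)" for t
  have si: "set_integrable lborel {0<..} (\<lambda>t. t powr (\<mu> - 1) * E t)" and J: "bessel_integral \<mu> 1 z = (LINT t:{0<..}|lborel. t powr (\<mu> - 1) * E t)" for \<mu>
    using bessel_integrable[OF zero_less_one z, of \<mu>]
    unfolding set_integrable_def set_lebesgue_integral_def bessel_integral_def subordinate_def E_def by (simp_all add: mult.assoc)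
  have s1: "set_integrable lborel {0<..} (\<lambda>t. \<nu> * (t powr (\<nu> - 1) * E t))" using si[of \<nu>] by simp
  have s2: "set_integrable lborel {0<..} (\<lambda>t. t powr \<nu> * E t)" using si[of "\<nu> + 1"] by simp
  have s3: "set_integrable lborel {0<..} (\<lambda>t. z / 4 * (t powr (\<nu> - 2) * E t))"
    using si[of "\<nu> - 1"] by (intro set_integrable_mult_right) (simp add: algebra_simps)
  have fi: "set_integrable lborel {0<..} f"
    unfolding f_def by (intro set_integral_add(1) set_integral_diff(1) s1 s2 s3)
  have "(LBINT t=0..\<infinity>. f t) = 0 - 0"
  proof (rule interval_integral_FTC_integrable)
    show "(F has_vector_derivative f t) (at t)" if "0 < ereal t" "ereal t < \<infinity>" for t
    proof -
      have t: "t > 0" using that by simp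
      have "(F has_real_derivative (\<nu> * t powr (\<nu> - 1)) * E t + (exp (- t) * (exp (- z / (4 * t)) * (z / (4 * t\<^sup>2))) - exp (- t) * exp (- z / (4 * t))) * t powr \<nu>) (at t)"
        unfolding F_def E_def using t
        by (auto intro!: derivative_eq_intros simp: field_simps power2_eq_square)
      moreover have "(\<nu> * t powr (\<nu> - 1)) * E t + (exp (- t) * (exp (- z / (4 * t)) * (z / (4 * t\<^sup>2))) - exp (- t) * exp (- z / (4 * t))) * t powr \<nu> = f t"
      proof -
        have p: "t powr (\<nu> - 2) = t powr \<nu> / t\<^sup>2" using t by (simp add: powr_diff)
        show ?thesis unfolding f_def E_def p by (simp add: algebra_simps)
      qed
      ultimately show ?thesis by (simp add: has_real_derivative_iff_has_vector_derivative)
    qed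
    show "isCont f t" if "0 < ereal t" "ereal t < \<infinity>" for t
      unfolding f_def E_def using that by (intro continuous_intros) auto
    show "set_integrable lborel (einterval 0 \<infinity>) f" 
    proof -
      have "einterval 0 \<infinity> = {0<..}" by (auto simp: einterval_def zero_ereal_def)
      then show ?thesis using fi by simp
    qed
    have "((\<lambda>t. t powr \<nu> * (exp (- t) * exp (- z / (4 * t)))) \<longlongrightarrow> 0) (at_right 0)"
      using z by real_asymp
    then show "((F \<circ> real_of_ereal) \<longlongrightarrow> 0) (at_right 0)"
      unfolding zero_ereal_def by (subst ereal_tendsto_simps) (simp add: F_def[abs_def] E_def)
    have "((\<lambda>t. t powr \<nu> * (exp (- t) * exp (- z / (4 * t)))) \<longlongrightarrow> 0) at_top"
      using z by real_asymp
    then show "((F \<circ> real_of_ereal) \<longlongrightarrow> 0) (at_left \<infinity>)"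
      by (subst ereal_tendsto_simps) (simp add: F_def[abs_def] E_def)
  qed simp
  then have "(LINT t:{0<..}|lborel. f t) = 0" by (simp add: interval_lebesgue_integral_0_infty)
  moreover have "(LINT t:{0<..}|lborel. f t) = \<nu> * bessel_integral \<nu> 1 z - bessel_integral (\<nu> + 1) 1 z + z / 4 * bessel_integral (\<nu> - 1) 1 z"
    unfolding f_def J using s1 s2 s3 by (simp add: set_integral_add set_integral_diff algebra_simps)
  ultimately show ?thesis by simp
qed

lemma Gamma_plus1_pos: "x > 0 \<Longrightarrow> Gamma (x + 1) = x * Gamma (x::real)"
  by (rule Gamma_plus1) (auto elim!: nonpos_Ints_cases)

lemma norm_powr_double: "norm x powr (2 * s) = ((norm x)\<^sup>2) powr s" if "x \<noteq> 0"
  using that by (simp add: powr_powr flip: powr_numeral)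

text \<open>The two exponents differ from half the dimension by \<open>- s\<close> and
  \<open>s\<close>, so the Euler-Lagrange equation of a bubble is precisely the reflection formula
  between these two indices.\<close>

lemma bubble_fourier_Euler_Lagrange:
  fixes b \<xi> :: "real ^ 'n"
  assumes s: "0 < s" "s < real CARD('n) / 2" and a: "a > 0" and x: "\<xi> \<noteq> 0"
  defines "al \<equiv> (real CARD('n) - 2 * s) / 2" and "be \<equiv> (real CARD('n) + 2 * s) / 2"
  shows "of_real (norm \<xi> powr (2 * s)) * bubble_fourier al a b \<xi> = of_real ((4 * a) powr s * Gamma be / Gamma al) * bubble_fourier be a b \<xi>"
proof -
  let ?d = "real CARD('n)" and ?z = "(norm \<xi>)\<^sup>2"
  have z: "?z > 0" using x by simp
  have al: "al - ?d / 2 = - s" and be: "be - ?d / 2 = s" by (auto simp: al_def be_def field_simps)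
  have G: "Gamma al > 0" "Gamma be > 0" using s by (auto intro!: Gamma_real_pos simp: al_def be_def)
  have "?z powr s * bessel_integral (- s) a ?z = (4 * a) powr s * bessel_integral s a ?z"
  proof -
    have "?z powr s * (?z / (4 * a)) powr - s = (4 * a) powr s"
      using z a by (simp add: powr_divide powr_minus_divide)
    then show ?thesis using bessel_integral_reflect[OF a z, of "- s"] by simp
  qed
  then have "norm \<xi> powr (2 * s) * subordinate_fourier ?d al a 0 ?z = (4 * a) powr s * Gamma be / Gamma al * subordinate_fourier ?d be a 0 ?z"
    unfolding subordinate_fourier_bessel al be norm_powr_double[OF x] using G by (simp add: field_simps)
  then show ?thesis
    unfolding bubble_fourier_def by (simp only: mult.left_commute[of _ "cis _"] of_real_mult[symmetric])
qed

text \<open>The polynomial \<open>4 w\<^sup>2 - 4 w + d / (d + 1)\<close> in \<open>w = 1 / (1 + |x|\<^sup>2)\<close> is a spherical harmonic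
  of degree 2 in stereographic coordinates; the factor below is the corresponding eigenvalue.\<close>

lemma harmonic_fourier_Euler_Lagrange:
  fixes \<xi> :: "real ^ 'n"
  assumes s: "0 < s" "s < real CARD('n) / 2" and x: "\<xi> \<noteq> 0"
  defines "d \<equiv> real CARD('n)"
  defines "al \<equiv> (d - 2 * s) / 2" and "be \<equiv> (d + 2 * s) / 2"
  shows "of_real (norm \<xi> powr (2 * s)) * (4 * bubble_fourier (al + 2) 1 0 \<xi> - 4 * bubble_fourier (al + 1) 1 0 \<xi> + of_real (d / (d + 1)) * bubble_fourier al 1 0 \<xi>)
    = of_real (4 powr s * Gamma (be + 2) / Gamma (al + 2)) * (4 * bubble_fourier (be + 2) 1 0 \<xi> - 4 * bubble_fourier (be + 1) 1 0 \<xi> + of_real (d / (d + 1)) * bubble_fourier be 1 0 \<xi>)"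
proof -
  let ?z = "(norm \<xi>)\<^sup>2"
  define w where "w = ?z / 4"
  define c where "c = 2 powr (- d / 2)"
  define J where "J k = bessel_integral (s + k) 1 ?z" for k :: real
  have z: "?z > 0" using x by simp
  have w: "w > 0" using z by (simp add: w_def)
  have d: "d \<ge> 1" by (simp add: d_def Suc_leI)
  have al0: "al > 0" and be0: "be > 0" using s by (auto simp: al_def be_def d_def)
  have Ga: "Gamma (al + 1) = al * Gamma al" "Gamma (al + 2) = (al + 1) * (al * Gamma al)"
    using al0 Gamma_plus1_pos[of al] Gamma_plus1_pos[of "al + 1"] by (auto simp: add.assoc)
  have Gb: "Gamma (be + 1) = be * Gamma be" "Gamma (be + 2) = (be + 1) * (be * Gamma be)"
    using be0 Gamma_plus1_pos[of be] Gamma_plus1_pos[of "be + 1"] by (auto simp: add.assoc)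
  have G: "Gamma al > 0" "Gamma be > 0" using al0 be0 by (auto intro!: Gamma_real_pos)
  have refl: "?z powr s * bessel_integral (k - s) 1 ?z = 4 powr s * (w powr k * J (- k))" for k :: real
  proof -
    have "bessel_integral (k - s) 1 ?z = w powr (k - s) * J (- k)"
      using bessel_integral_reflect[OF zero_less_one z, of "k - s"] by (simp add: w_def J_def)
    moreover have "?z powr s * w powr (k - s) = 4 powr s * w powr k"
      using z by (simp add: w_def powr_diff powr_divide)
    ultimately show ?thesis by (simp add: mult.assoc[symmetric])
  qed
  have rec: "(s + k) * J k - J (k + 1) + w * J (k - 1) = 0" for k
    using bessel_integral_recurrence[OF z, of "s + k"] unfolding J_def w_def by (simp add: algebra_simps)
  \<comment> \<open>Reflection has produced \<open>J\<close> at the indices \<open>- 1\<close> and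
    \<open>- 2\<close>; the recurrence brings everything back to \<open>J 0\<close>,
    \<open>J 1\<close> and \<open>J 2\<close>, which make up the right-hand side.\<close>
  have r0: "w * J (- 1) = J 1 - s * J 0" using rec[of 0] by (simp add: algebra_simps)
  have r1: "w * J 0 = J 2 - (s + 1) * J 1" using rec[of 1] by (simp add: algebra_simps)
  have r2: "w * J (- 2) = J 0 - (s - 1) * J (- 1)" using rec[of "- 1"] by (simp add: algebra_simps)
  have r3: "w * (w * J (- 2)) = J 2 - 2 * s * J 1 + s * (s - 1) * J 0"
  proof -
    have "w * (w * J (- 2)) = w * J 0 - (s - 1) * (w * J (- 1))" unfolding r2 by (simp add: algebra_simps)
    then show ?thesis unfolding r0 r1 by (simp add: algebra_simps)
  qed
  have K: "subordinate_fourier d g 1 0 ?z = c / Gamma g * bessel_integral (g - d / 2) 1 ?z" for g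
    unfolding subordinate_fourier_bessel c_def ..
  have ba: "bessel_integral (al - d / 2) 1 ?z = bessel_integral (0 - s) 1 ?z" "bessel_integral (al + 1 - d / 2) 1 ?z = bessel_integral (1 - s) 1 ?z"
    "bessel_integral (al + 2 - d / 2) 1 ?z = bessel_integral (2 - s) 1 ?z"
    by (intro arg_cong[where f="\<lambda>v. bessel_integral v 1 ?z"], simp add: al_def field_simps)+
  have bb: "bessel_integral (be - d / 2) 1 ?z = J 0" "bessel_integral (be + 1 - d / 2) 1 ?z = J 1" "bessel_integral (be + 2 - d / 2) 1 ?z = J 2"
    unfolding J_def by (intro arg_cong[where f="\<lambda>v. bessel_integral v 1 ?z"], simp add: be_def field_simps)+
  have a0: "?z powr s * subordinate_fourier d al 1 0 ?z = 4 powr s * c * (J 0 / Gamma al)"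
    using refl[of 0] w unfolding K ba by (simp add: field_simps)
  have a1: "?z powr s * subordinate_fourier d (al + 1) 1 0 ?z = 4 powr s * c * ((J 1 - s * J 0) / Gamma (al + 1))"
    using refl[of 1] w unfolding K ba r0[symmetric] by (simp add: field_simps)
  have a2: "?z powr s * subordinate_fourier d (al + 2) 1 0 ?z = 4 powr s * c * ((J 2 - 2 * s * J 1 + s * (s - 1) * J 0) / Gamma (al + 2))"
    using refl[of 2] w unfolding K ba r3[symmetric] by (simp add: field_simps power2_eq_square)
  let ?S = "\<lambda>g. subordinate_fourier d g 1 0 ?z"
  have al_d: "al = d / 2 - s" and be_d: "be = d / 2 + s" by (simp_all add: al_def be_def field_simps)
  \<comment> \<open>This forces the coefficient \<open>d / (d + 1)\<close>: the other terms differ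
    by \<open>2 * s * d * J 0\<close>, while
    \<open>(be + 1) * be - (al + 1) * al = 2 * s * (d + 1)\<close>.\<close>
  have key: "4 * (J 2 - 2 * s * J 1 + s * (s - 1) * J 0) - 4 * (al + 1) * (J 1 - s * J 0) + d / (d + 1) * ((al + 1) * al) * J 0
     = 4 * J 2 - 4 * (be + 1) * J 1 + d / (d + 1) * ((be + 1) * be) * J 0"
  proof -
    have "d / (d + 1) * ((be + 1) * be) - d / (d + 1) * ((al + 1) * al) = d / (d + 1) * (2 * s * (d + 1))"
    proof -
      have "(be + 1) * be - (al + 1) * al = 2 * s * (d + 1)" unfolding al_d be_d by (simp add: algebra_simps)
      then show ?thesis by (simp only: right_diff_distrib[symmetric])
    qed
    also have "\<dots> = 2 * s * d" using d by simp
    finally have "d / (d + 1) * ((be + 1) * be) * J 0 = (d / (d + 1) * ((al + 1) * al) + 2 * s * d) * J 0" by (simp add: algebra_simps)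
    then show ?thesis unfolding al_d be_d by (simp add: algebra_simps)
  qed
  have "?z powr s * (4 * ?S (al + 2) - 4 * ?S (al + 1) + d / (d + 1) * ?S al)
     = 4 * (?z powr s * ?S (al + 2)) - 4 * (?z powr s * ?S (al + 1)) + d / (d + 1) * (?z powr s * ?S al)"
    by (simp add: algebra_simps)
  also have "\<dots> = 4 powr s * c / Gamma (al + 2) * (4 * (J 2 - 2 * s * J 1 + s * (s - 1) * J 0) - 4 * (al + 1) * (J 1 - s * J 0) + d / (d + 1) * ((al + 1) * al) * J 0)"
    unfolding a0 a1 a2 Ga using G al0 d by (simp add: divide_simps) (simp add: algebra_simps)
  also have "\<dots> = 4 powr s * Gamma (be + 2) / Gamma (al + 2) * (4 * ?S (be + 2) - 4 * ?S (be + 1) + d / (d + 1) * ?S be)"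
  proof -
    have "C * A / X * (4 * (k / A * p) - 4 * (k / (b * g) * q) + r * (k / g * u)) = C * k / X * (4 * p - 4 * (b + 1) * q + r * ((b + 1) * b) * u)"
      if "b > 0" "g > 0" "A = (b + 1) * (b * g)" for C A X k p q r u b g :: real
    proof -
      define e where "e = k / A"
      have "k / (b * g) = e * (b + 1)" "k / g = e * ((b + 1) * b)" "k = A * e" using that by (auto simp: e_def)
      moreover have "A * (4 * (e * p) - 4 * (e * (b + 1) * q) + r * (e * ((b + 1) * b) * u)) = A * e * (4 * p - 4 * (b + 1) * q + r * ((b + 1) * b) * u)"
        by (simp add: algebra_simps)
      ultimately have "A * (4 * (k / A * p) - 4 * (k / (b * g) * q) + r * (k / g * u)) = k * (4 * p - 4 * (b + 1) * q + r * ((b + 1) * b) * u)"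
        unfolding e_def[symmetric] by (simp only:)
      then show ?thesis by (simp only: times_divide_eq_left mult.assoc)
    qed
    from this[OF be0 G(2) Gb(2)] show ?thesis unfolding key K bb Gb(1) by (simp only:)
  qed
  finally have fin: "?z powr s * (4 * ?S (al + 2) - 4 * ?S (al + 1) + d / (d + 1) * ?S al) = 4 powr s * Gamma (be + 2) / Gamma (al + 2) * (4 * ?S (be + 2) - 4 * ?S (be + 1) + d / (d + 1) * ?S be)" .
  have bf: "bubble_fourier g 1 0 \<xi> = of_real (?S g)" for g
    unfolding bubble_fourier_def d_def by simp
  have "4 * complex_of_real p - 4 * of_real q + of_real r * of_real u = of_real (4 * p - 4 * q + r * u)" for p q r u by simp
  then show ?thesis unfolding bf norm_powr_double[OF x] by (simp only: of_real_mult[symmetric] fin)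
qed

section \<open>Integrals over the conformal sphere\<close>

text \<open>Lagrange remainder on an interval that stays away from \<open>- 1\<close>. The
  coefficients are generalised binomials, kept as products so that they evaluate for concrete
  \<open>n\<close>.\<close>

lemma Taylor_powr_bound:
  fixes r \<delta> :: real
  assumes n: "n > 0" and d: "0 < \<delta>" "\<delta> < 1"
  shows "\<exists>C\<ge>0. \<forall>y. \<bar>y\<bar> \<le> \<delta> \<longrightarrow> \<bar>(1 + y) powr r - (\<Sum>m<n. (\<Prod>j<m. r - real j) / fact m * y ^ m)\<bar> \<le> C * \<bar>y\<bar> ^ n"
proof -
  define D where "D m y = (\<Prod>j<m. r - real j) * (1 + y) powr (r - real m)" for m :: nat and y :: real
  have D: "DERIV (D m) t :> D (Suc m) t" if "- \<delta> \<le> t" for m t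
  proof -
    have t: "1 + t > 0" using that d by linarith
    have "((\<lambda>y. (\<Prod>j<m. r - real j) * (1 + y) powr (r - real m)) has_real_derivative (\<Prod>j<m. r - real j) * ((r - real m) * (1 + t) powr (r - real m - 1))) (at t)"
      using t by (auto intro!: derivative_eq_intros)
    moreover have "r - real m - 1 = r - real (Suc m)" by simp
    ultimately show ?thesis unfolding D_def by (simp only: prod.lessThan_Suc mult.assoc)
  qed
  \<comment> \<open>Adding the values at both endpoints covers either sign of the exponent
    \<open>r - real n\<close>.\<close>
  define B where "B = \<bar>\<Prod>j<n. r - real j\<bar> * ((1 - \<delta>) powr (r - real n) + (1 + \<delta>) powr (r - real n))"
  have B: "\<bar>D n t\<bar> \<le> B" if "\<bar>t\<bar> \<le> \<delta>" for t
  proof -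
    have "(1 + t) powr (r - real n) \<le> (1 - \<delta>) powr (r - real n) + (1 + \<delta>) powr (r - real n)"
    proof (cases "r - real n \<ge> 0")
      case True
      then have "(1 + t) powr (r - real n) \<le> (1 + \<delta>) powr (r - real n)" using that d by (intro powr_mono2) auto
      then show ?thesis by (simp add: add_increasing)
    next
      case False
      then have "(1 + t) powr (r - real n) \<le> (1 - \<delta>) powr (r - real n)" using that d by (intro powr_mono2') auto
      then show ?thesis by (simp add: add_increasing2)
    qed
    then show ?thesis unfolding D_def B_def abs_mult by (simp add: mult_left_mono)
  qed
  have B0: "B \<ge> 0" unfolding B_def by simp
  have "\<bar>(1 + y) powr r - (\<Sum>m<n. (\<Prod>j<m. r - real j) / fact m * y ^ m)\<bar> \<le> B / fact n * \<bar>y\<bar> ^ n" if y: "\<bar>y\<bar> \<le> \<delta>" for y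
  proof (cases "y = 0")
    case True
    have "(\<Sum>m<n. (\<Prod>j<m. r - real j) / fact m * (0::real) ^ m) = (\<Sum>m\<in>{0}. (\<Prod>j<m. r - real j) / fact m * (0::real) ^ m)"
      using n by (intro sum.mono_neutral_right) auto
    then show ?thesis using True n B0 by simp
  next
    case False
    have "\<exists>t. (if y < 0 then y < t \<and> t < 0 else 0 < t \<and> t < y) \<and>
      D 0 y = (\<Sum>m<n. D m 0 / fact m * (y - 0) ^ m) + D n t / fact n * (y - 0) ^ n"
      by (rule Taylor[of n D "D 0" "- \<delta>" \<delta>]) (use n d y False D in auto)
    then obtain t where t: "if y < 0 then y < t \<and> t < 0 else 0 < t \<and> t < y"
      "D 0 y = (\<Sum>m<n. D m 0 / fact m * (y - 0) ^ m) + D n t / fact n * (y - 0) ^ n" by blast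
    have "\<bar>t\<bar> \<le> \<delta>" using t(1) y by (auto split: if_splits)
    from B[OF this] have "\<bar>D n t / fact n * y ^ n\<bar> \<le> B / fact n * \<bar>y\<bar> ^ n"
      by (simp add: abs_mult power_abs divide_right_mono mult_right_mono)
    moreover have "(1 + y) powr r - (\<Sum>m<n. (\<Prod>j<m. r - real j) / fact m * y ^ m) = D n t / fact n * y ^ n"
      using t(2) by (simp add: D_def)
    ultimately show ?thesis by simp
  qed
  then show ?thesis using B0 by (intro exI[of _ "B / fact n"]) auto
qed

text \<open>Euler's integral for the power of \<open>u * A + B\<close>, then Tonelli: the
  \<open>u\<close>-integral leaves \<open>(t * A) powr - g\<close>, the \<open>t\<close>-integral
  \<open>B powr - h\<close>.\<close>

lemma nn_integral_Feynman:
  assumes g: "g > 0" "h > 0" and A: "A > 0" and B: "B > (0::real)"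
  shows "(\<integral>\<^sup>+u. ennreal (indicator {0<..} u * u powr (g - 1) * (u * A + B) powr - (g + h)) \<partial>lborel)
    = ennreal (Gamma g * Gamma h / Gamma (g + h) * A powr - g * B powr - h)"
proof -
  have G: "Gamma g > 0" "Gamma h > 0" "Gamma (g + h) > 0" using g by (auto intro!: Gamma_real_pos)
  let ?f = "\<lambda>u. indicator {0<..} u * u powr (g - 1) * (u * A + B) powr - (g + h)"
  let ?h = "\<lambda>u t. (indicator {0<..} u * u powr (g - 1)) * (indicator {0<..} t * t powr (g + h - 1) * exp (- t * (u * A + B)))"
  have "ennreal (Gamma (g + h)) * (\<integral>\<^sup>+u. ennreal (?f u) \<partial>lborel) = (\<integral>\<^sup>+u. ennreal (Gamma (g + h)) * ennreal (?f u) \<partial>lborel)"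
    by (rule nn_integral_cmult[symmetric]) auto
  also have "\<dots> = (\<integral>\<^sup>+u. (\<integral>\<^sup>+t. ennreal (?h u t) \<partial>lborel) \<partial>lborel)"
  proof (rule nn_integral_cong)
    fix u :: real
    show "ennreal (Gamma (g + h)) * ennreal (?f u) = (\<integral>\<^sup>+t. ennreal (?h u t) \<partial>lborel)"
    proof (cases "u > 0")
      case True
      have "(\<integral>\<^sup>+t. ennreal (?h u t) \<partial>lborel) = (\<integral>\<^sup>+t. ennreal (u powr (g - 1)) * ennreal (indicator {0<..} t * t powr (g + h - 1) * exp (- t * (u * A + B))) \<partial>lborel)"
        using True by (intro nn_integral_cong) (simp add: ennreal_mult)
      also have "\<dots> = ennreal (u powr (g - 1)) * ennreal (Gamma (g + h) * (u * A + B) powr - (g + h))"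
        using True A B g by (subst nn_integral_cmult, measurable) (subst nn_integral_Gamma_scaled, auto simp: add_pos_pos)
      finally show ?thesis using True G by (simp add: ennreal_mult[symmetric] mult_ac)
    qed simp
  qed
  also have "\<dots> = (\<integral>\<^sup>+t. (\<integral>\<^sup>+u. ennreal (?h u t) \<partial>lborel) \<partial>lborel)"
    by (rule lborel_pair.Fubini'[symmetric]) measurable
  also have "\<dots> = (\<integral>\<^sup>+t. ennreal (Gamma g * A powr - g) * ennreal (indicator {0<..} t * t powr (h - 1) * exp (- t * B)) \<partial>lborel)"
  proof (rule nn_integral_cong)
    fix t :: real
    show "(\<integral>\<^sup>+u. ennreal (?h u t) \<partial>lborel) = ennreal (Gamma g * A powr - g) * ennreal (indicator {0<..} t * t powr (h - 1) * exp (- t * B))"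
    proof (cases "t > 0")
      case True
      have "(\<integral>\<^sup>+u. ennreal (?h u t) \<partial>lborel) = (\<integral>\<^sup>+u. ennreal (t powr (g + h - 1) * exp (- t * B)) * ennreal (indicator {0<..} u * u powr (g - 1) * exp (- u * (t * A))) \<partial>lborel)"
        using True by (intro nn_integral_cong, subst ennreal_mult[symmetric]) (auto simp: algebra_simps exp_add[symmetric])
      also have "\<dots> = ennreal (t powr (g + h - 1) * exp (- t * B)) * ennreal (Gamma g * (t * A) powr - g)"
        using True A g by (subst nn_integral_cmult, measurable) (subst nn_integral_Gamma_scaled, auto)
      also have "\<dots> = ennreal ((t powr (g + h - 1) * exp (- t * B)) * (Gamma g * (t * A) powr - g))"
        using G by (simp add: ennreal_mult)
      also have "(t powr (g + h - 1) * exp (- t * B)) * (Gamma g * (t * A) powr - g) = (Gamma g * A powr - g) * (t powr (h - 1) * exp (- t * B))"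
      proof -
        have "t powr (g + h - 1) * t powr - g = t powr (h - 1)" using True by (simp add: powr_add[symmetric])
        then show ?thesis using True A by (simp add: powr_mult)
      qed
      finally show ?thesis using True G by (simp add: ennreal_mult)
    qed simp
  qed
  also have "\<dots> = ennreal (Gamma g * A powr - g) * ennreal (Gamma h * B powr - h)"
    using g B by (subst nn_integral_cmult, measurable) (subst nn_integral_Gamma_scaled, auto)
  also have "\<dots> = ennreal (Gamma g * A powr - g * (Gamma h * B powr - h))" using G by (simp add: ennreal_mult)
  finally have "ennreal (1 / Gamma (g + h)) * (ennreal (Gamma (g + h)) * (\<integral>\<^sup>+u. ennreal (?f u) \<partial>lborel))
     = ennreal (1 / Gamma (g + h)) * ennreal (Gamma g * A powr - g * (Gamma h * B powr - h))" by simp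
  then have "(\<integral>\<^sup>+u. ennreal (?f u) \<partial>lborel) = ennreal (1 / Gamma (g + h) * (Gamma g * A powr - g * (Gamma h * B powr - h)))"
    using G by (simp add: mult.assoc[symmetric] ennreal_mult[symmetric])
  also have "1 / Gamma (g + h) * (Gamma g * A powr - g * (Gamma h * B powr - h)) = Gamma g * Gamma h / Gamma (g + h) * A powr - g * B powr - h"
    by simp
  finally show ?thesis .
qed

text \<open>Constants such as \<open>d\<close> depend on the dimension without showing
  \<open>'n\<close> in their type; the argument \<open>T\<close> fixes it.\<close>

locale bubble_setting =
  fixes s :: real and T :: "'n::finite itself"
  assumes s_pos: "0 < s" and s_less: "s < real CARD('n) / 2" and card_ge_2: "CARD('n) \<ge> 2"
begin

text \<open>\<open>mass\<close> is, up to a constant, the Jacobian of the stereographic projection, and \<open>2 * w - 1\<close> is the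
  height on the sphere.\<close>

definition d :: real where "d = real CARD('n)"
definition al :: real where "al = (d - 2 * s) / 2"
definition be :: real where "be = (d + 2 * s) / 2"

definition mass :: "real ^ 'n \<Rightarrow> real" where "mass = bubble_power d 1 0"
definition w :: "real ^ 'n \<Rightarrow> real" where "w x = 1 / (1 + (norm x)\<^sup>2)"
definition Y :: "real ^ 'n \<Rightarrow> real" where "Y x = 4 * (w x)\<^sup>2 - 4 * w x + d / (d + 1)"
definition om :: real where "om = (\<integral>x. mass x \<partial>lborel)"

lemma d_ge_1: "d \<ge> 1" by (simp add: d_def Suc_leI)
lemma d_ge_2: "d \<ge> 2" using card_ge_2 by (simp add: d_def)
lemma al_pos: "al > 0" using s_less by (simp add: al_def d_def)
lemma be_pos: "be > 0" using s_pos d_ge_1 by (simp add: be_def)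
lemma al_be: "al + be = d" by (simp add: al_def be_def field_simps)
lemma be_gt: "be > d / 2" using s_pos by (simp add: be_def)

lemma w_measurable [measurable]: "w \<in> borel_measurable borel" unfolding w_def by measurable
lemma Y_measurable [measurable]: "Y \<in> borel_measurable borel" unfolding Y_def by measurable
lemma mass_measurable [measurable]: "mass \<in> borel_measurable borel" unfolding mass_def by measurable

lemma w_bounds: "0 < w x" "w x \<le> 1"
  by (auto simp: w_def add_pos_nonneg divide_le_eq_1)

text \<open>The height squared, centred by \<open>1 / (d + 1)\<close>, its mean over the sphere of
  dimension \<open>d\<close>; in this form bounds on \<open>Y\<close> are immediate.\<close>

lemma Y_alt: "Y x = (2 * w x - 1)\<^sup>2 - 1 / (d + 1)"
  using d_ge_1 by (simp add: Y_def power2_eq_square field_simps)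

lemma Y_bound: "\<bar>Y x\<bar> \<le> 1"
proof -
  have "(2 * w x - 1)\<^sup>2 \<le> 1" using w_bounds[of x] by (intro abs_square_le_1[THEN iffD2]) auto
  moreover have "0 \<le> (2 * w x - 1)\<^sup>2" by simp
  moreover have "0 \<le> 1 / (d + 1)" "1 / (d + 1) \<le> 1" using d_ge_1 by auto
  ultimately show ?thesis unfolding Y_alt abs_le_iff by linarith
qed

lemma mass_nonneg [simp]: "mass x \<ge> 0" by (simp add: mass_def)

lemma bubble_power_w: "bubble_power (g + real k) 1 0 x = bubble_power g 1 0 x * (w x) ^ k"
proof -
  have p: "1 + (norm x)\<^sup>2 > 0" by (simp add: add_pos_nonneg)
  have "(1 + (norm x)\<^sup>2) powr - (g + real k) = (1 + (norm x)\<^sup>2) powr - g * (1 + (norm x)\<^sup>2) powr - real k"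
    by (simp add: powr_add[symmetric])
  also have "(1 + (norm x)\<^sup>2) powr - real k = (w x) ^ k"
    using p by (simp add: w_def powr_minus_divide powr_realpow power_one_over)
  finally show ?thesis by (simp add: bubble_power_def)
qed

lemma mass_integral: "has_bochner_integral lborel mass (pi powr (d / 2) * Gamma (d / 2) / Gamma d)"
  unfolding mass_def using bubble_power_integral[of d 1 "0::real^'n"] d_ge_1 by (simp add: d_def)

lemma mass_integrable: "integrable lborel mass" using mass_integral by (simp add: has_bochner_integral_iff)

lemma om_eq: "om = pi powr (d / 2) * Gamma (d / 2) / Gamma d"
  unfolding om_def using mass_integral by (simp add: has_bochner_integral_iff)

lemma om_pos: "om > 0" unfolding om_eq using d_ge_1 by (intro divide_pos_pos mult_pos_pos Gamma_real_pos) auto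

lemma mass_mult_integrable:
  assumes [measurable]: "f \<in> borel_measurable borel" and b: "\<And>x. \<bar>f x\<bar> \<le> C"
  shows "integrable lborel (\<lambda>x. mass x * f x)"
proof -
  have i: "integrable lborel (\<lambda>x. mass x * C)" using mass_integrable by simp
  have C: "C \<ge> 0" using b[of 0] by linarith
  have le: "AE x in lborel. norm (mass x * f x) \<le> norm (mass x * C)"
    using b C by (intro AE_I2) (simp add: abs_mult mult_left_mono)
  show ?thesis by (rule Bochner_Integration.integrable_bound[OF i _ le]) measurable
qed

section \<open>Moments of the height and of the spherical harmonic\<close>

definition mom :: "nat \<Rightarrow> real" where "mom k = (\<integral>x. mass x * (w x) ^ k \<partial>lborel)"

lemma mom_integrable: "integrable lborel (\<lambda>x. mass x * (w x) ^ k)"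
  by (rule mass_mult_integrable[where C=1]) (use w_bounds in \<open>auto simp: power_le_one less_imp_le abs_of_pos\<close>)

text \<open>\<open>mass x * (w x) ^ k\<close> is again a bubble power, of exponent
  \<open>d + real k\<close>, so \<open>mom k\<close> is a quotient of Gamma functions. In other
  words, under the normalised \<open>mass\<close> the function \<open>w\<close> is Beta distributed
  with both parameters \<open>d / 2\<close>.\<close>

lemma mom_Suc: "mom (Suc k) = mom k * (d / 2 + real k) / (d + real k)"
proof -
  have m: "mom k = pi powr (d / 2) * Gamma (d / 2 + real k) / Gamma (d + real k)" for k
  proof -
    have "mom k = (\<integral>x. bubble_power (d + real k) 1 (0::real^'n) x \<partial>lborel)"
      unfolding mom_def mass_def bubble_power_w ..
    also have "\<dots> = pi powr (d / 2) * Gamma (d + real k - d / 2) / Gamma (d + real k)"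
    proof -
      have "d + real k > real CARD('n) / 2" using d_ge_1 unfolding d_def by linarith
      from bubble_power_integral[OF this zero_less_one, of "0::real^'n"] show ?thesis
        unfolding d_def by (simp add: has_bochner_integral_iff)
    qed
    also have "d + real k - d / 2 = d / 2 + real k" by simp
    finally show ?thesis .
  qed
  have "Gamma (d / 2 + real (Suc k)) = (d / 2 + real k) * Gamma (d / 2 + real k)" "Gamma (d + real (Suc k)) = (d + real k) * Gamma (d + real k)"
    using Gamma_plus1_pos[of "d / 2 + real k"] Gamma_plus1_pos[of "d + real k"] d_ge_1 by (simp_all add: add_ac)
  then show ?thesis unfolding m by (simp add: mult.commute mult.left_commute)
qed

lemma mom_0: "mom 0 = om" by (simp add: mom_def om_def)

lemma mom_values:
  "mom 1 = om * (1 / 2)" "mom 2 = om * ((d + 2) / (4 * (d + 1)))" "mom 3 = om * ((d + 4) / (8 * (d + 1)))"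
  "mom 4 = om * ((d + 4) * (d + 6) / (16 * (d + 1) * (d + 3)))" "mom 5 = om * ((d + 6) * (d + 8) / (32 * (d + 1) * (d + 3)))"
  "mom 6 = om * ((d + 6) * (d + 8) * (d + 10) / (64 * (d + 1) * (d + 3) * (d + 5)))"
proof -
  have pos: "d > 0" "d + 1 > 0" "d + 2 > 0" "d + 3 > 0" "d + 4 > 0" "d + 5 > 0" using d_ge_1 by auto
  show 1: "mom 1 = om * (1 / 2)" using mom_Suc[of 0] pos by (simp add: mom_0)
  show 2: "mom 2 = om * ((d + 2) / (4 * (d + 1)))"
  proof -
    have "mom 2 = mom 1 * (d / 2 + 1) / (d + 1)" using mom_Suc[of 1] by (simp add: numeral_2_eq_2)
    then show ?thesis unfolding 1 using pos by (simp add: field_simps)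
  qed
  show 3: "mom 3 = om * ((d + 4) / (8 * (d + 1)))"
    using mom_Suc[of 2] pos 2 by (simp add: numeral_3_eq_3[symmetric] divide_simps) (simp add: algebra_simps)?
  show 4: "mom 4 = om * ((d + 4) * (d + 6) / (16 * (d + 1) * (d + 3)))"
    using mom_Suc[of 3] pos 3 by (simp add: divide_simps) (simp add: algebra_simps)?
  show 5: "mom 5 = om * ((d + 6) * (d + 8) / (32 * (d + 1) * (d + 3)))"
    using mom_Suc[of 4] pos 4 by (simp add: divide_simps) (simp add: algebra_simps)?
  show "mom 6 = om * ((d + 6) * (d + 8) * (d + 10) / (64 * (d + 1) * (d + 3) * (d + 5)))"
    using mom_Suc[of 5] pos 5 by (simp add: divide_simps) (simp add: algebra_simps)?
qed

lemma integral_Y: "(\<integral>x. mass x * Y x \<partial>lborel) = 0"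
proof -
  have "(\<integral>x. mass x * Y x \<partial>lborel) = (\<integral>x. 4 * (mass x * (w x) ^ 2) - 4 * (mass x * (w x) ^ 1) + d / (d + 1) * (mass x * (w x) ^ 0) \<partial>lborel)"
    by (simp add: Y_def algebra_simps)
  also have "\<dots> = 4 * mom 2 - 4 * mom 1 + d / (d + 1) * mom 0"
    using mom_integrable[of 0] mom_integrable[of 1] mom_integrable[of 2]
    unfolding mom_def by (subst Bochner_Integration.integral_add, simp_all)
  also have "\<dots> = 0" unfolding mom_values mom_0 using d_ge_1 by (simp add: divide_simps) (simp add: algebra_simps)
  finally show ?thesis .
qed

text \<open>With \<open>integral_Y\<close> this gives orthogonality to the height
  \<open>2 * w x - 1\<close>, the zonal harmonic of degree 1; the other harmonics of degree 1 are
  treated by parity in \<open>integral_Y_tilt\<close>.\<close>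

lemma integral_Y_w: "(\<integral>x. mass x * (Y x * w x) \<partial>lborel) = 0"
proof -
  have "(\<integral>x. mass x * (Y x * w x) \<partial>lborel) = (\<integral>x. 4 * (mass x * (w x) ^ 3) - 4 * (mass x * (w x) ^ 2) + d / (d + 1) * (mass x * (w x) ^ 1) \<partial>lborel)"
    by (simp add: Y_def algebra_simps power2_eq_square power3_eq_cube)
  also have "\<dots> = 4 * mom 3 - 4 * mom 2 + d / (d + 1) * mom 1"
    using mom_integrable[of 3] mom_integrable[of 1] mom_integrable[of 2]
    unfolding mom_def by (subst Bochner_Integration.integral_add, simp_all)
  also have "\<dots> = 0" unfolding mom_values using d_ge_1 by (simp add: divide_simps) (simp add: algebra_simps)
  finally show ?thesis .
qed

lemma integral_Y_square: "(\<integral>x. mass x * (Y x)\<^sup>2 \<partial>lborel) = om * (2 * d / ((d + 1)\<^sup>2 * (d + 3)))"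
proof -
  let ?c = "d / (d + 1)"
  have "mass x * (Y x)\<^sup>2 = 16 * (mass x * (w x) ^ 4) + (- 32) * (mass x * (w x) ^ 3) + (16 + 8 * ?c) * (mass x * (w x) ^ 2) + (- 8 * ?c) * (mass x * (w x) ^ 1) + ?c\<^sup>2 * (mass x * (w x) ^ 0)" for x
  proof -
    have "m * (4 * v\<^sup>2 - 4 * v + c)\<^sup>2 = 16 * (m * v ^ 4) + (- 32) * (m * v ^ 3) + (16 + 8 * c) * (m * v ^ 2) + (- 8 * c) * (m * v ^ 1) + c\<^sup>2 * (m * v ^ 0)" for m v c :: real
      by (simp add: algebra_simps power2_eq_square power3_eq_cube power4_eq_xxxx)
    then show ?thesis unfolding Y_def .
  qed
  then have "(\<integral>x. mass x * (Y x)\<^sup>2 \<partial>lborel) = 16 * mom 4 + (- 32) * mom 3 + (16 + 8 * ?c) * mom 2 + (- 8 * ?c) * mom 1 + ?c\<^sup>2 * mom 0"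
    unfolding mom_def using mom_integrable
    by (simp only:) (subst Bochner_Integration.integral_add | simp only: integral_mult_right_zero | intro Bochner_Integration.integrable_add integrable_mult_right mom_integrable)+
  also have "\<dots> = om * (16 * ((d + 4) * (d + 6) / (16 * (d + 1) * (d + 3))) - 32 * ((d + 4) / (8 * (d + 1))) + (16 + 8 * ?c) * ((d + 2) / (4 * (d + 1))) - 8 * ?c * (1/2) + ?c\<^sup>2)"
  proof -
    have "16 * (o' * a4) + (- 32) * (o' * a3) + (16 + 8 * c) * (o' * a2) + (- 8 * c) * (o' * a1) + c\<^sup>2 * o' = o' * (16 * a4 - 32 * a3 + (16 + 8 * c) * a2 - 8 * c * a1 + c\<^sup>2)" for o' a4 a3 a2 a1 c :: real
      by (simp add: algebra_simps)
    then show ?thesis unfolding mom_values mom_0 .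
  qed
  also have "16 * ((d + 4) * (d + 6) / (16 * (d + 1) * (d + 3))) - 32 * ((d + 4) / (8 * (d + 1))) + (16 + 8 * ?c) * ((d + 2) / (4 * (d + 1))) - 8 * ?c * (1/2) + ?c\<^sup>2 = 2 * d / ((d + 1)\<^sup>2 * (d + 3))"
    using d_ge_1 by (simp add: divide_simps) (simp add: algebra_simps power2_eq_square)
  finally show ?thesis .
qed

text \<open>The factor \<open>d - 1\<close> is where the dimension enters: on the circle
  \<open>Y\<close> would be half the cosine of twice the angle, whose third moment vanishes.\<close>

lemma integral_Y_cube: "(\<integral>x. mass x * (Y x) ^ 3 \<partial>lborel) = om * (8 * d * (d - 1) / ((d + 1) ^ 3 * (d + 3) * (d + 5)))"
proof -
  let ?c = "d / (d + 1)"
  have "mass x * (Y x) ^ 3 = 64 * (mass x * (w x) ^ 6) + (- 192) * (mass x * (w x) ^ 5) + (192 + 48 * ?c) * (mass x * (w x) ^ 4)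
     + (- 64 - 96 * ?c) * (mass x * (w x) ^ 3) + (48 * ?c + 12 * ?c\<^sup>2) * (mass x * (w x) ^ 2) + (- 12 * ?c\<^sup>2) * (mass x * (w x) ^ 1) + ?c ^ 3 * (mass x * (w x) ^ 0)" for x
  proof -
    have "m * (4 * v\<^sup>2 - 4 * v + c) ^ 3 = 64 * (m * v ^ 6) + (- 192) * (m * v ^ 5) + (192 + 48 * c) * (m * v ^ 4)
     + (- 64 - 96 * c) * (m * v ^ 3) + (48 * c + 12 * c\<^sup>2) * (m * v ^ 2) + (- 12 * c\<^sup>2) * (m * v ^ 1) + c ^ 3 * (m * v ^ 0)" for m v c :: real
      by (simp add: algebra_simps power2_eq_square power3_eq_cube eval_nat_numeral)
    then show ?thesis unfolding Y_def .
  qed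
  then have "(\<integral>x. mass x * (Y x) ^ 3 \<partial>lborel) = 64 * mom 6 + (- 192) * mom 5 + (192 + 48 * ?c) * mom 4
     + (- 64 - 96 * ?c) * mom 3 + (48 * ?c + 12 * ?c\<^sup>2) * mom 2 + (- 12 * ?c\<^sup>2) * mom 1 + ?c ^ 3 * mom 0"
    unfolding mom_def using mom_integrable
    by (simp only:) (subst Bochner_Integration.integral_add | simp only: integral_mult_right_zero | intro Bochner_Integration.integrable_add integrable_mult_right mom_integrable)+
  also have "\<dots> = om * (64 * ((d + 6) * (d + 8) * (d + 10) / (64 * (d + 1) * (d + 3) * (d + 5))) - 192 * ((d + 6) * (d + 8) / (32 * (d + 1) * (d + 3)))
     + (192 + 48 * ?c) * ((d + 4) * (d + 6) / (16 * (d + 1) * (d + 3))) + (- 64 - 96 * ?c) * ((d + 4) / (8 * (d + 1)))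
     + (48 * ?c + 12 * ?c\<^sup>2) * ((d + 2) / (4 * (d + 1))) - 12 * ?c\<^sup>2 * (1/2) + ?c ^ 3)"
  proof -
    have "64 * (o' * a6) + (- 192) * (o' * a5) + (192 + 48 * c) * (o' * a4) + (- 64 - 96 * c) * (o' * a3) + (48 * c + 12 * c\<^sup>2) * (o' * a2) + (- 12 * c\<^sup>2) * (o' * a1) + c ^ 3 * o'
      = o' * (64 * a6 - 192 * a5 + (192 + 48 * c) * a4 + (- 64 - 96 * c) * a3 + (48 * c + 12 * c\<^sup>2) * a2 - 12 * c\<^sup>2 * a1 + c ^ 3)" for o' a6 a5 a4 a3 a2 a1 c :: real
      by (simp add: algebra_simps)
    then show ?thesis unfolding mom_values mom_0 .
  qed
  also have "64 * ((d + 6) * (d + 8) * (d + 10) / (64 * (d + 1) * (d + 3) * (d + 5))) - 192 * ((d + 6) * (d + 8) / (32 * (d + 1) * (d + 3)))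
     + (192 + 48 * ?c) * ((d + 4) * (d + 6) / (16 * (d + 1) * (d + 3))) + (- 64 - 96 * ?c) * ((d + 4) / (8 * (d + 1)))
     + (48 * ?c + 12 * ?c\<^sup>2) * ((d + 2) / (4 * (d + 1))) - 12 * ?c\<^sup>2 * (1/2) + ?c ^ 3 = 8 * d * (d - 1) / ((d + 1) ^ 3 * (d + 3) * (d + 5))"
    using d_ge_1 by (simp add: divide_simps) (simp add: algebra_simps power2_eq_square power3_eq_cube)
  finally show ?thesis .
qed

text \<open>\<open>4 / 3\<close> comes from \<open>powr_ratio_bound\<close>; the fraction is the
  ratio of the Beta functions at \<open>(al + 1, be + 1)\<close> and at
  \<open>(al, be)\<close>.\<close>

definition c0 :: real where "c0 = 4 / 3 * (al * be / (d * (d + 1)))"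

lemma c0_pos: "c0 > 0" using al_pos be_pos d_ge_1 by (simp add: c0_def)

section \<open>Interaction of two bubbles\<close>

lemma interaction_integrable:
  assumes a: "a > 0"
  shows "integrable lborel (\<lambda>x. bubble_power al 1 (0::real^'n) x * bubble_power be a b x)"
proof -
  have i: "integrable lborel (bubble_power be a b)"
    using bubble_power_integral[of be a b] be_gt a by (simp add: d_def has_bochner_integral_iff)
  have "bubble_power al 1 (0::real^'n) x \<le> 1" for x
  proof -
    have "(1 + (norm x)\<^sup>2) powr - al \<le> 1 powr - al" using al_pos by (intro powr_mono2') auto
    then show ?thesis by (simp add: bubble_power_def)
  qed
  then have b: "AE x in lborel. norm (bubble_power al 1 (0::real^'n) x * bubble_power be a b x) \<le> norm (bubble_power be a b x)"
    by (intro AE_I2) (simp add: abs_mult mult_left_le_one_le)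
  show ?thesis by (rule Bochner_Integration.integrable_bound[OF i _ b]) measurable
qed

text \<open>Completing the square in \<open>x\<close> turns the combined quadratic into
  \<open>Q + (1 + u) * (norm (x - c))\<^sup>2\<close>, with minimum value \<open>Q\<close>, so
  \<open>inverse_power_integral\<close> applies with exponent \<open>d\<close>.\<close>

lemma nn_integral_quadratic:
  fixes b :: "real ^ 'n"
  assumes a: "a > 0" and u: "u > 0"
  shows "(\<integral>\<^sup>+x. ennreal ((u * (1 + (norm x)\<^sup>2) + (a + (norm (x - b))\<^sup>2)) powr - d) \<partial>lborel)
     = ennreal (om * ((1 + u) * (u + a) + u * (norm b)\<^sup>2) powr - (d / 2))"
proof -
  define Q where "Q = u + a + u * (norm b)\<^sup>2 / (1 + u)"
  have Q: "Q > 0" using a u unfolding Q_def by (intro add_pos_nonneg add_pos_pos) auto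
  define c where "c = (1 / (1 + u)) *\<^sub>R b"
  have id: "u * (1 + (norm x)\<^sup>2) + (a + (norm (x - b))\<^sup>2) = Q + (1 + u) * (norm (x - c))\<^sup>2" for x
  proof -
    have 1: "(norm (x - b))\<^sup>2 = (norm x)\<^sup>2 - 2 * (x \<bullet> b) + (norm b)\<^sup>2"
      unfolding power2_norm_eq_inner by (simp add: inner_diff_left inner_diff_right inner_commute)
    have 2: "(norm (x - c))\<^sup>2 = (norm x)\<^sup>2 - 2 / (1 + u) * (x \<bullet> b) + (norm b)\<^sup>2 / (1 + u)\<^sup>2"
      unfolding power2_norm_eq_inner c_def using u by (simp add: inner_diff_left inner_diff_right inner_commute power2_eq_square)
    have alg: "(1 + u) * (X - 2 / (1 + u) * t + N / (1 + u)\<^sup>2) = (1 + u) * X - 2 * t + N / (1 + u)" for X t N :: real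
    proof -
      define v where "v = 1 + u"
      have "v \<noteq> 0" using u by (simp add: v_def)
      then show ?thesis unfolding v_def[symmetric] by (simp add: distrib_left right_diff_distrib power2_eq_square)
    qed
    have N: "u * N / (1 + u) + N / (1 + u) = N" for N :: real
    proof -
      have "u * N / (1 + u) + N / (1 + u) = N * (1 + u) / (1 + u)"
        unfolding add_divide_distrib[symmetric] by (simp add: distrib_left mult.commute)
      then show ?thesis using u by simp
    qed
    show ?thesis unfolding 1 2 Q_def alg using N[of "(norm b)\<^sup>2"] by (simp add: algebra_simps)
  qed
  let ?f = "\<lambda>x::real^'n. (Q + (1 + u) * (norm x)\<^sup>2) powr - d"
  have f: "has_bochner_integral lborel ?f (om * ((1 + u) powr - (d / 2) * Q powr (d / 2 - d)))"
    using inverse_power_integral[where 'a="real^'n", of d "1 + u" Q] Q u d_ge_1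
    unfolding om_eq by (simp add: d_def mult.assoc)
  have "(1 + u) powr - (d / 2) * Q powr (d / 2 - d) = ((1 + u) * (u + a) + u * (norm b)\<^sup>2) powr - (d / 2)"
  proof -
    have "(1 + u) * (u + a) + u * (norm b)\<^sup>2 = (1 + u) * Q" unfolding Q_def using u by (simp add: field_simps)
    moreover have "d / 2 - d = - (d / 2)" by simp
    ultimately show ?thesis using u Q by (simp only: powr_mult) 
  qed
  moreover have "(\<integral>\<^sup>+x. ennreal (?f (x - c)) \<partial>lborel) = ennreal (\<integral>x. ?f (x - c) \<partial>lborel)"
    using f integrable_lborel_translation(2)[of ?f c] by (intro nn_integral_eq_integral) (auto simp: has_bochner_integral_iff)
  ultimately show ?thesis
    unfolding id using f integral_lborel_translation(2)[of ?f c] by (simp add: has_bochner_integral_iff)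
qed

text \<open>As \<open>d / 2 \<ge> 1\<close>, the power is at most \<open>1 / (1 + y)\<close>, and
  \<open>1 / (1 + y) \<le> 1 - 2 / 3 * y\<close> for \<open>0 \<le> y \<le> 1 / 2\<close>.
  Truncating \<open>x\<close> at 1 keeps \<open>y = 2 * min x 1 * q\<close> in that range.\<close>

lemma powr_ratio_bound:
  assumes x: "x \<ge> 0" and q: "0 \<le> q" "q \<le> 1 / 4"
  shows "(1 + 2 * x * q) powr - (d / 2) \<le> 1 - 4 / 3 * min x 1 * q"
proof -
  let ?y = "2 * min x 1 * q"
  have y: "0 \<le> ?y" "?y \<le> 1 / 2" "?y \<le> 2 * x * q"
  proof -
    have "min x 1 * q \<le> 1 * (1 / 4)" using x q by (intro mult_mono) auto
    then show "?y \<le> 1 / 2" by simp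
    show "0 \<le> ?y" using x q by simp
    show "?y \<le> 2 * x * q" using x q by (intro mult_right_mono) auto
  qed
  have "(1 + 2 * x * q) powr - (d / 2) \<le> (1 + 2 * x * q) powr - 1"
    using d_ge_2 x q by (intro powr_mono) auto
  also have "\<dots> \<le> (1 + ?y) powr - 1"
  proof (intro powr_mono2')
    show "0 < 1 + ?y" using y(1) by linarith
  qed (use y in auto)
  also have "\<dots> = 1 / (1 + ?y)" using y by (simp add: powr_minus_divide)
  also have "\<dots> \<le> 1 - 2 / 3 * ?y"
  proof -
    have "?y * ?y \<le> 1 / 2 * ?y" using y by (intro mult_right_mono) auto
    then have "1 \<le> (1 - 2 / 3 * ?y) * (1 + ?y)" by (simp add: algebra_simps)
    moreover have "0 < 1 + ?y" using y(1) by linarith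
    ultimately show ?thesis by (subst pos_divide_le_eq) auto
  qed
  finally show ?thesis by simp
qed

text \<open>Up to scalar multiples, bubbles correspond to points \<open>(b, sqrt a)\<close> of the
  hyperbolic upper half-space; this is the hyperbolic cosine of the distance to
  \<open>(0, 1)\<close>, the point of the standard bubble.\<close>

definition cosh_dist :: "real \<Rightarrow> real ^ 'n \<Rightarrow> real" where
  "cosh_dist a b = (1 + a + (norm b)\<^sup>2) / (2 * sqrt a)"

lemma cosh_dist_ge_1: "a > 0 \<Longrightarrow> cosh_dist a b \<ge> 1"
proof -
  assume a: "a > 0"
  have "0 \<le> (sqrt a - 1)\<^sup>2" by simp
  then have "2 * sqrt a \<le> 1 + a" using a by (simp add: power2_diff)
  then have "2 * sqrt a \<le> 1 + a + (norm b)\<^sup>2" by (simp add: add_increasing2)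
  then show ?thesis using a by (simp add: cosh_dist_def)
qed

text \<open>Feynman's parametrization turns the interaction of two bubbles into an integral over one
  parameter, which depends only on their conformally invariant distance.\<close>

lemma interaction_bound:
  assumes a: "a > 0"
  shows "sqrt a powr be * (\<integral>x. bubble_power al 1 (0::real^'n) x * bubble_power be a b x \<partial>lborel) \<le> om * (1 - c0 * min (cosh_dist a b - 1) 1)"
proof -
  define r where "r = sqrt a"
  have r: "r > 0" "r\<^sup>2 = a" using a by (auto simp: r_def)
  define M where "M = cosh_dist a b"
  have M: "M \<ge> 1" using cosh_dist_ge_1[OF a] by (simp add: M_def)
  define \<mu> where "\<mu> = min (M - 1) 1"
  have \<mu>: "0 \<le> \<mu>" using M by (simp add: \<mu>_def)
  let ?P = "\<lambda>x. bubble_power al 1 (0::real^'n) x * bubble_power be a b x"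
  define I where "I = (\<integral>x. ?P x \<partial>lborel)"
  define K where "K = Gamma al * Gamma be / Gamma d"
  define K2 where "K2 = Gamma (al + 1) * Gamma (be + 1) / Gamma (d + 2)"
  have G: "Gamma al > 0" "Gamma be > 0" "Gamma d > 0" using al_pos be_pos d_ge_1 by (auto intro!: Gamma_real_pos)
  have K0: "K > 0" using G by (simp add: K_def)
  have K2: "K2 = K * (al * be / (d * (d + 1)))"
  proof -
    have "Gamma (al + 1) = al * Gamma al" "Gamma (be + 1) = be * Gamma be" using al_pos be_pos by (auto intro: Gamma_plus1_pos)
    moreover have "Gamma (d + 2) = (d + 1) * (d * Gamma d)"
      using Gamma_plus1_pos[of d] Gamma_plus1_pos[of "d + 1"] d_ge_1 by (simp add: add.assoc)
    ultimately show ?thesis unfolding K2_def K_def by (simp add: mult_ac)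
  qed
  let ?g = "\<lambda>u. indicator {0<..} u * u powr (al - 1)"
  define R where "R u = (1 + u) * (u + a) + u * (norm b)\<^sup>2" for u
  let ?q = "\<lambda>u. r * u / (u + r)\<^sup>2"
  have 1: "ennreal K * ennreal I = (\<integral>\<^sup>+u. ennreal (?g u * (om * R u powr - (d / 2))) \<partial>lborel)"
  proof -
    have "ennreal I = (\<integral>\<^sup>+x. ennreal (?P x) \<partial>lborel)"
      unfolding I_def using interaction_integrable[OF a, of b] by (intro nn_integral_eq_integral[symmetric]) auto
    then have "ennreal K * ennreal I = (\<integral>\<^sup>+x. ennreal K * ennreal (?P x) \<partial>lborel)"
      by (simp add: nn_integral_cmult)
    also have "\<dots> = (\<integral>\<^sup>+x. (\<integral>\<^sup>+u. ennreal (?g u * (u * (1 + (norm x)\<^sup>2) + (a + (norm (x - b))\<^sup>2)) powr - d) \<partial>lborel) \<partial>lborel)"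
    proof (rule nn_integral_cong)
      fix x :: "real^'n"
      have "1 + (norm x)\<^sup>2 > 0" "a + (norm (x - b))\<^sup>2 > 0" using a by (auto simp: add_pos_nonneg)
      from nn_integral_Feynman[OF al_pos be_pos this]
      show "ennreal K * ennreal (?P x) = (\<integral>\<^sup>+u. ennreal (?g u * (u * (1 + (norm x)\<^sup>2) + (a + (norm (x - b))\<^sup>2)) powr - d) \<partial>lborel)"
        using K0 unfolding al_be K_def[symmetric] bubble_power_def by (simp add: ennreal_mult[symmetric] mult.assoc)
    qed
    also have "\<dots> = (\<integral>\<^sup>+u. (\<integral>\<^sup>+x. ennreal (?g u * (u * (1 + (norm (x::real^'n))\<^sup>2) + (a + (norm (x - b))\<^sup>2)) powr - d) \<partial>lborel) \<partial>lborel)"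
      by (rule lborel_pair.Fubini'[symmetric]) measurable
    also have "\<dots> = (\<integral>\<^sup>+u. ennreal (?g u * (om * R u powr - (d / 2))) \<partial>lborel)"
    proof (rule nn_integral_cong)
      fix u :: real
      show "(\<integral>\<^sup>+x. ennreal (?g u * (u * (1 + (norm (x::real^'n))\<^sup>2) + (a + (norm (x - b))\<^sup>2)) powr - d) \<partial>lborel) = ennreal (?g u * (om * R u powr - (d / 2)))"
      proof (cases "u > 0")
        case True
        have "(\<integral>\<^sup>+x. ennreal (?g u * (u * (1 + (norm (x::real^'n))\<^sup>2) + (a + (norm (x - b))\<^sup>2)) powr - d) \<partial>lborel)
          = ennreal (?g u) * (\<integral>\<^sup>+x. ennreal ((u * (1 + (norm (x::real^'n))\<^sup>2) + (a + (norm (x - b))\<^sup>2)) powr - d) \<partial>lborel)"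
          by (subst nn_integral_cmult[symmetric]) (auto simp: ennreal_mult)
        also have "\<dots> = ennreal (?g u) * ennreal (om * R u powr - (d / 2))"
          unfolding nn_integral_quadratic[OF a True] R_def ..
        finally show ?thesis using om_pos by (simp add: ennreal_mult)
      qed simp
    qed
    finally show ?thesis .
  qed
  \<comment> \<open>Stated as a sum, so that both sides are nonnegative and can be integrated in the
    extended nonnegative reals.\<close>
  have le: "?g u * (om * R u powr - (d / 2)) + om * (4 / 3 * \<mu>) * (?g u * (?q u * (u + r) powr - d)) \<le> om * (?g u * (u + r) powr - d)" for u
  proof (cases "u > 0")
    case True
    have q: "0 \<le> ?q u" "?q u \<le> 1 / 4"
    proof -
      show "0 \<le> ?q u" using True r by simp
      have "0 \<le> (u - r)\<^sup>2" by simp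
      then have "4 * (r * u) \<le> (u + r)\<^sup>2" by (simp add: power2_sum power2_diff mult.commute)
      then show "?q u \<le> 1 / 4" using True r by (simp add: pos_divide_le_eq)
    qed
    \<comment> \<open>Conformal invariance: apart from the scale \<open>r\<close>, the parameters
      \<open>a\<close> and \<open>b\<close> enter only through \<open>M\<close>.\<close>
    have Rq: "R u = (u + r)\<^sup>2 * (1 + 2 * (M - 1) * ?q u)"
    proof -
      have "1 + a + (norm b)\<^sup>2 = 2 * M * r" unfolding M_def cosh_dist_def r_def using a by simp
      then have nb: "(norm b)\<^sup>2 = 2 * M * r - 1 - r\<^sup>2" using r by simp
      have "R u = (u + r)\<^sup>2 + 2 * (M - 1) * (r * u)"
        unfolding R_def r(2)[symmetric] nb by (simp add: algebra_simps power2_eq_square)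
      also have "\<dots> = (u + r)\<^sup>2 * (1 + 2 * (M - 1) * ?q u)"
        using True r by (simp add: distrib_left)
      finally show ?thesis .
    qed
    have "R u powr - (d / 2) = ((u + r)\<^sup>2) powr - (d / 2) * (1 + 2 * (M - 1) * ?q u) powr - (d / 2)"
      unfolding Rq by (rule powr_mult)
    also have "((u + r)\<^sup>2) powr - (d / 2) = (u + r) powr - d"
      using True r by (simp add: powr_powr flip: powr_numeral)
    also have "(u + r) powr - d * (1 + 2 * (M - 1) * ?q u) powr - (d / 2) \<le> (u + r) powr - d * (1 - 4 / 3 * \<mu> * ?q u)"
      unfolding \<mu>_def using M q by (intro mult_left_mono powr_ratio_bound) auto
    finally have "R u powr - (d / 2) \<le> (u + r) powr - d * (1 - 4 / 3 * \<mu> * ?q u)" .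
    then have "(om * ?g u) * R u powr - (d / 2) \<le> (om * ?g u) * ((u + r) powr - d * (1 - 4 / 3 * \<mu> * ?q u))"
      using om_pos by (intro mult_left_mono) auto
    moreover have "o' * g' * (v * (1 - 4 / 3 * \<mu> * q')) = o' * (g' * v) - o' * (4 / 3 * \<mu>) * (g' * (q' * v))" for o' g' v q'
      by (simp add: algebra_simps)
    ultimately show ?thesis by (simp only: mult.assoc mult.left_commute[of _ om]) (simp add: algebra_simps)
  qed simp
  have 2: "(\<integral>\<^sup>+u. ennreal (om * (?g u * (u + r) powr - d)) \<partial>lborel) = ennreal (om * (K * r powr - be))"
  proof -
    have "(\<integral>\<^sup>+u. ennreal (om * (?g u * (u + r) powr - d)) \<partial>lborel) = ennreal om * (\<integral>\<^sup>+u. ennreal (?g u * (u + r) powr - d) \<partial>lborel)"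
      using om_pos by (subst nn_integral_cmult[symmetric]) (auto simp: ennreal_mult)
    also have "(\<integral>\<^sup>+u. ennreal (?g u * (u + r) powr - d) \<partial>lborel) = ennreal (K * r powr - be)"
      using nn_integral_Feynman[OF al_pos be_pos zero_less_one r(1)] unfolding al_be K_def by simp
    finally show ?thesis using om_pos K0 by (simp add: ennreal_mult)
  qed
  \<comment> \<open>The factor \<open>?q u\<close> raises both Feynman exponents by one, which is
    why the gain carries \<open>K2\<close> in place of \<open>K\<close>.\<close>
  have 3: "(\<integral>\<^sup>+u. ennreal (om * (4 / 3 * \<mu>) * (?g u * (?q u * (u + r) powr - d))) \<partial>lborel) = ennreal (om * (4 / 3 * \<mu>) * (K2 * r powr - be))"
  proof -
    have "(\<integral>\<^sup>+u. ennreal (om * (4 / 3 * \<mu>) * (?g u * (?q u * (u + r) powr - d))) \<partial>lborel)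
      = (\<integral>\<^sup>+u. ennreal (om * (4 / 3 * \<mu>) * r) * ennreal (indicator {0<..} u * u powr ((al + 1) - 1) * (u * 1 + r) powr - ((al + 1) + (be + 1))) \<partial>lborel)"
    proof (rule nn_integral_cong, subst ennreal_mult[symmetric])
      fix u :: real
      have "?g u * (?q u * (u + r) powr - d) = r * (indicator {0<..} u * u powr ((al + 1) - 1) * (u * 1 + r) powr - ((al + 1) + (be + 1)))"
      proof (cases "u > 0")
        case True
        have "u powr ((al + 1) - 1) = u powr (al - 1) * u" using True by (simp add: powr_diff)
        moreover have "(u * 1 + r) powr - ((al + 1) + (be + 1)) = (u + r) powr - d / (u + r)\<^sup>2"
        proof -
          have e: "- ((al + 1) + (be + 1)) = - d + - 2" using al_be by simp
          have p: "(u + r) powr - 2 = 1 / (u + r)\<^sup>2" using True r by (simp add: powr_minus_divide)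
          show ?thesis unfolding e powr_add mult_1_right p by simp
        qed
        ultimately show ?thesis using True by simp
      qed simp
      then show "ennreal (om * (4 / 3 * \<mu>) * (?g u * (?q u * (u + r) powr - d))) = ennreal (om * (4 / 3 * \<mu>) * r * (indicator {0<..} u * u powr ((al + 1) - 1) * (u * 1 + r) powr - ((al + 1) + (be + 1))))"
        by (simp only: mult.assoc)
    qed (use om_pos \<mu> r in auto)
    also have "\<dots> = ennreal (om * (4 / 3 * \<mu>) * r) * ennreal (Gamma (al + 1) * Gamma (be + 1) / Gamma ((al + 1) + (be + 1)) * 1 powr - (al + 1) * r powr - (be + 1))"
      using al_pos be_pos r by (subst nn_integral_cmult, measurable) (subst nn_integral_Feynman, auto)
    also have "Gamma (al + 1) * Gamma (be + 1) / Gamma ((al + 1) + (be + 1)) * 1 powr - (al + 1) * r powr - (be + 1) = K2 * r powr - (be + 1)"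
    proof -
      have "(al + 1) + (be + 1) = d + 2" using al_be by simp
      then show ?thesis unfolding K2_def by (simp only: powr_one_eq_one mult_1_right)
    qed
    also have "ennreal (om * (4 / 3 * \<mu>) * r) * ennreal (K2 * r powr - (be + 1)) = ennreal (om * (4 / 3 * \<mu>) * r * (K2 * r powr - (be + 1)))"
      using om_pos \<mu> r by (intro ennreal_mult'[symmetric]) auto
    also have "om * (4 / 3 * \<mu>) * r * (K2 * r powr - (be + 1)) = om * (4 / 3 * \<mu>) * (K2 * r powr - be)"
    proof -
      have "r powr - (be + 1) = r powr - be / r" using r by (simp add: powr_diff)
      then show ?thesis using r by simp
    qed
    finally show ?thesis .
  qed
  have I0: "I \<ge> 0" unfolding I_def by simp
  have K20: "K2 \<ge> 0" unfolding K2 using K0 al_pos be_pos d_ge_1 by simp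
  have "ennreal (K * I + om * (4 / 3 * \<mu>) * (K2 * r powr - be)) = ennreal K * ennreal I + ennreal (om * (4 / 3 * \<mu>) * (K2 * r powr - be))"
    using K0 I0 K20 om_pos \<mu> by (simp add: ennreal_mult ennreal_plus)
  also have "\<dots> = (\<integral>\<^sup>+u. ennreal (?g u * (om * R u powr - (d / 2))) + ennreal (om * (4 / 3 * \<mu>) * (?g u * (?q u * (u + r) powr - d))) \<partial>lborel)"
    unfolding 1 3[symmetric] R_def by (rule nn_integral_add[symmetric]) measurable
  also have "\<dots> \<le> (\<integral>\<^sup>+u. ennreal (om * (?g u * (u + r) powr - d)) \<partial>lborel)"
  proof (rule nn_integral_mono, subst ennreal_plus[symmetric])
    fix u :: real
    show "0 \<le> ?g u * (om * R u powr - (d / 2))" using om_pos by simp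
    show "0 \<le> om * (4 / 3 * \<mu>) * (?g u * (?q u * (u + r) powr - d))"
      using om_pos \<mu> r by (auto simp: indicator_def intro!: mult_nonneg_nonneg)
    show "ennreal (?g u * (om * R u powr - (d / 2)) + om * (4 / 3 * \<mu>) * (?g u * (?q u * (u + r) powr - d))) \<le> ennreal (om * (?g u * (u + r) powr - d))"
      by (intro ennreal_leI le)
  qed
  also have "\<dots> = ennreal (om * (K * r powr - be))" by (rule 2)
  finally have "K * I + om * (4 / 3 * \<mu>) * (K2 * r powr - be) \<le> om * (K * r powr - be)"
    using om_pos K0 by (subst (asm) ennreal_le_iff) auto
  then have "K * I \<le> K * (om * (1 - c0 * \<mu>) * r powr - be)"
    unfolding K2 c0_def by (simp add: algebra_simps)
  then have "I \<le> om * (1 - c0 * \<mu>) * r powr - be" using K0 by simp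
  then have "r powr be * I \<le> r powr be * (om * (1 - c0 * \<mu>) * r powr - be)" by (intro mult_left_mono) auto
  also have "\<dots> = om * (1 - c0 * \<mu>)" using r by (simp add: powr_minus_divide)
  finally show ?thesis unfolding I_def r_def \<mu>_def M_def .
qed

end

context bubble_setting
begin

text \<open>Relative to \<open>mass\<close>, the product becomes a power of
  \<open>(a + (norm (x - b))\<^sup>2) / (1 + (norm x)\<^sup>2)\<close>, which is an affine function
  on the sphere.\<close>

lemma mass_bubble_product:
  fixes x b :: "real ^ 'n"
  assumes a: "a > 0" 
  shows "sqrt a powr be * (bubble_power al 1 0 x * bubble_power be a b x)
    = mass x * ((a + (norm (x - b))\<^sup>2) / (sqrt a * (1 + (norm x)\<^sup>2))) powr - be"
proof -
  define p q r where "p = 1 + (norm x)\<^sup>2" and "q = a + (norm (x - b))\<^sup>2" and "r = sqrt a"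
  have pos: "p > 0" "q > 0" "r > 0" using a by (auto simp: p_def q_def r_def add_pos_nonneg)
  have "- al = - d + be" using al_be by simp
  then have "p powr - al = p powr - d * p powr be" by (simp only: powr_add)
  moreover have "(q / (r * p)) powr - be = q powr - be * (r powr be * p powr be)"
    using pos by (simp add: powr_divide powr_mult powr_minus_divide)
  ultimately show ?thesis
    by (simp add: bubble_power_def mass_def p_def[symmetric] q_def[symmetric] r_def[symmetric])
qed

text \<open>For \<open>a > 0\<close> and \<open>M = cosh_dist a b\<close>, the base of the power in
  \<open>mass_bubble_product\<close> is \<open>M * (1 - tilt a b x)\<close>. On the sphere
  \<open>tilt\<close> is the restriction of a linear function, hence a harmonic of degree 1, and it
  is small when the bubbles are close.\<close>

definition tilt :: "real \<Rightarrow> real ^ 'n \<Rightarrow> real ^ 'n \<Rightarrow> real" where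
  "tilt a b x = 1 - (a + (norm (x - b))\<^sup>2) / ((1 + a + (norm b)\<^sup>2) / 2 * (1 + (norm x)\<^sup>2))"

lemma tilt_measurable [measurable]: "tilt a b \<in> borel_measurable borel"
  unfolding tilt_def by measurable

lemma tilt_alt:
  assumes a: "a > 0"
  shows "tilt a b x = ((1 - a - (norm b)\<^sup>2) / 2 * (1 - (norm x)\<^sup>2) + 2 * (x \<bullet> b)) / ((1 + a + (norm b)\<^sup>2) / 2 * (1 + (norm x)\<^sup>2))"
proof -
  define X B t where "X = (norm x)\<^sup>2" and "B = (norm b)\<^sup>2" and "t = x \<bullet> b"
  have "(norm (x - b))\<^sup>2 = X - 2 * t + B"
    unfolding X_def B_def t_def power2_norm_eq_inner by (simp add: inner_diff_left inner_diff_right inner_commute)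
  moreover have "(1 + a + B) / 2 * (1 + X) > 0" using a by (simp add: X_def B_def add_pos_nonneg)
  then have "1 - y / ((1 + a + B) / 2 * (1 + X)) = ((1 + a + B) / 2 * (1 + X) - y) / ((1 + a + B) / 2 * (1 + X))" for y
    unfolding diff_divide_distrib by (metis div_self less_irrefl)
  moreover have "(1 + a + B) / 2 * (1 + X) - (a + (X - 2 * t + B)) = (1 - a - B) / 2 * (1 - X) + 2 * t"
    by (simp add: field_simps)
  ultimately show ?thesis
    unfolding tilt_def X_def[symmetric] B_def[symmetric] t_def[symmetric] by (simp only:)
qed

text \<open>Cauchy-Schwarz on the sphere: \<open>tilt\<close> is the inner product of a unit vector
  with a vector whose squared length is the right-hand side.\<close>

lemma tilt_square_le:
  assumes a: "a > 0"
  shows "(tilt a b x)\<^sup>2 \<le> 1 - 1 / (cosh_dist a b)\<^sup>2"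
proof -
  define X B t where "X = (norm x)\<^sup>2" and "B = (norm b)\<^sup>2" and "t = x \<bullet> b"
  define n m where "n = (1 - a - B) / 2" and "m = (1 + a + B) / 2"
  have nn: "X \<ge> 0" "B \<ge> 0" by (auto simp: X_def B_def)
  have m: "m > 0" using a nn by (simp add: m_def)
  have tt: "t\<^sup>2 \<le> X * B" using Cauchy_Schwarz_ineq[of x b] by (simp add: t_def X_def B_def power2_norm_eq_inner)
  \<comment> \<open>Lagrange's identity: this square plus \<open>4 * (X * B - t\<^sup>2)\<close> is
    the defect in Cauchy-Schwarz for the vectors \<open>(n, b)\<close> and
    \<open>(1 - X, 2 x)\<close>.\<close>
  have "0 \<le> (norm ((2 * n) *\<^sub>R x - (1 - X) *\<^sub>R b))\<^sup>2" by simp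
  also have "\<dots> = 4 * n\<^sup>2 * X - 4 * n * (1 - X) * t + (1 - X)\<^sup>2 * B"
    unfolding power2_norm_eq_inner X_def B_def t_def
    by (simp add: inner_diff_left inner_diff_right inner_commute power2_eq_square algebra_simps)
  finally have "(n * (1 - X) + 2 * t)\<^sup>2 \<le> (n\<^sup>2 + B) * (1 + X)\<^sup>2"
    using tt by (simp add: power2_eq_square algebra_simps)
  also have "n\<^sup>2 + B = m\<^sup>2 - a" by (simp add: n_def m_def power2_eq_square field_simps)
  finally have "(n * (1 - X) + 2 * t)\<^sup>2 / (m * (1 + X))\<^sup>2 \<le> ((m\<^sup>2 - a) * (1 + X)\<^sup>2) / (m * (1 + X))\<^sup>2"
    by (intro divide_right_mono) auto
  also have "\<dots> = (m\<^sup>2 - a) / m\<^sup>2" using nn by (simp add: power_mult_distrib)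
  also have "\<dots> = 1 - 1 / (cosh_dist a b)\<^sup>2"
  proof -
    have "cosh_dist a b = m / sqrt a" by (simp add: cosh_dist_def m_def B_def)
    then have "(cosh_dist a b)\<^sup>2 = m\<^sup>2 / a" using a by (simp add: power_divide)
    then show ?thesis using m a by (simp add: diff_divide_distrib)
  qed
  finally show ?thesis
    unfolding tilt_alt[OF a] X_def[symmetric] B_def[symmetric] t_def[symmetric] n_def[symmetric] m_def[symmetric] power_divide .
qed

lemma tilt_bound: "a > 0 \<Longrightarrow> \<bar>tilt a b x\<bar> \<le> 1"
proof -
  assume a: "a > 0"
  have "(tilt a b x)\<^sup>2 \<le> 1" using tilt_square_le[OF a, of b x] by (smt (verit) zero_le_power2 divide_nonneg_nonneg)
  then show ?thesis by (simp add: abs_square_le_1)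
qed

text \<open>Averaging over \<open>x\<close> and \<open>- x\<close> removes the part of
  \<open>tilt\<close> along \<open>b\<close>, since \<open>mass\<close> and \<open>Y\<close> are
  even; what remains is a multiple of the height, covered by \<open>integral_Y\<close> and
  \<open>integral_Y_w\<close>.\<close>

lemma integral_Y_tilt:
  assumes a: "a > 0"
  shows "(\<integral>x. mass x * (Y x * tilt a b x) \<partial>lborel) = 0"
proof -
  let ?f = "\<lambda>x. mass x * (Y x * tilt a b x)"
  have f: "integrable lborel ?f"
  proof (rule mass_mult_integrable[where C = 1])
    fix x show "\<bar>Y x * tilt a b x\<bar> \<le> 1" unfolding abs_mult
      using mult_mono[OF Y_bound[of x] tilt_bound[OF a, of b x]] by simp
  qed measurable
  have f': "integrable lborel (\<lambda>x. ?f (- x))"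
    using integrable_lborel_affine_iff[of "-1" ?f 0] f by simp
  have eq: "(\<integral>x. ?f (- x) \<partial>lborel) = (\<integral>x. ?f x \<partial>lborel)"
    using integral_lborel_affine[of "-1" ?f 0] by simp
  define k where "k = (1 - a - (norm b)\<^sup>2) / ((1 + a + (norm b)\<^sup>2) / 2)"
  have "?f x + ?f (- x) = k * (2 * (mass x * (Y x * w x)) - mass x * Y x)" for x
  proof -
    have e: "mass (- x) = mass x" "Y (- x) = Y x" by (simp_all add: mass_def bubble_power_def Y_def w_def)
    have p: "1 + (norm x)\<^sup>2 \<noteq> 0" by (metis add_pos_nonneg less_irrefl zero_le_power2 zero_less_one)
    have "tilt a b x + tilt a b (- x) = k * ((1 - (norm x)\<^sup>2) / (1 + (norm x)\<^sup>2))"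
      unfolding tilt_alt[OF a] k_def norm_minus_cancel inner_minus_left by (simp add: add_divide_distrib[symmetric])
    also have "(1 - (norm x)\<^sup>2) / (1 + (norm x)\<^sup>2) = 2 * w x - 1" using p by (simp add: w_def field_simps)
    finally have t: "tilt a b x + tilt a b (- x) = k * (2 * w x - 1)" .
    have "?f x + ?f (- x) = mass x * Y x * (tilt a b x + tilt a b (- x))" unfolding e by (simp add: algebra_simps)
    then show ?thesis unfolding t by (simp add: algebra_simps)
  qed
  then have "(\<integral>x. ?f x \<partial>lborel) + (\<integral>x. ?f (- x) \<partial>lborel) = (\<integral>x. k * (2 * (mass x * (Y x * w x)) - mass x * Y x) \<partial>lborel)"
    by (subst Bochner_Integration.integral_add[OF f f', symmetric]) simp
  also have "\<dots> = 0"
  proof -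
    have "integrable lborel (\<lambda>x. mass x * (Y x * w x))"
    proof (rule mass_mult_integrable[where C = 1])
      fix x show "\<bar>Y x * w x\<bar> \<le> 1" unfolding abs_mult
        using mult_mono[OF Y_bound[of x], of "\<bar>w x\<bar>" 1] w_bounds[of x] by simp
    qed measurable
    moreover have "integrable lborel (\<lambda>x. mass x * Y x)" by (rule mass_mult_integrable[where C = 1]) (auto simp: Y_bound)
    ultimately show ?thesis using integral_Y integral_Y_w by simp
  qed
  finally show ?thesis unfolding eq by simp
qed

text \<open>Since \<open>Y\<close> is a second-order spherical harmonic, it is orthogonal to the first-order part of
  the displaced bubble, so perturbing by \<open>Y\<close> changes the interaction only at second order in the
  displacement, where \<open>interaction_bound\<close> leaves room.\<close>

lemma perturbed_interaction_bound:
  "\<exists>\<epsilon>0>0. \<forall>\<epsilon>. 0 \<le> \<epsilon> \<longrightarrow> \<epsilon> \<le> \<epsilon>0 \<longrightarrow> (\<forall>a (b::real^'n). a > 0 \<longrightarrow>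
    \<bar>sqrt a powr be * (\<integral>x. bubble_power al 1 0 x * (1 + \<epsilon> * Y x) * bubble_power be a b x \<partial>lborel)\<bar> \<le> om)"
proof -
  obtain C where C0: "C \<ge> 0" and C': "\<forall>y. \<bar>y\<bar> \<le> 9/10 \<longrightarrow> \<bar>(1 + y) powr - be - (\<Sum>m<2. (\<Prod>j<m. - be - real j) / fact m * y ^ m)\<bar> \<le> C * \<bar>y\<bar> ^ 2"
    using Taylor_powr_bound[of 2 "9/10" "- be"] by auto
  have C: "\<bar>(1 - z) powr - be - (1 + be * z)\<bar> \<le> C * z\<^sup>2" if "\<bar>z\<bar> \<le> 9/10" for z
    using C'[rule_format, of "- z"] that by (simp add: numeral_2_eq_2)
  \<comment> \<open>The bound 1 keeps the interaction nonnegative, \<open>c0\<close> settles bubbles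
    with \<open>M > 2\<close>, and \<open>c0 / (2 * C + 1)\<close> those with
    \<open>M \<le> 2\<close>.\<close>
  define \<epsilon>0 where "\<epsilon>0 = min 1 (min c0 (c0 / (2 * C + 1)))"
  have e0: "\<epsilon>0 > 0" using c0_pos C0 by (simp add: \<epsilon>0_def)
  have e1: "\<epsilon>0 \<le> 1" "\<epsilon>0 \<le> c0" "2 * C * \<epsilon>0 \<le> c0"
  proof -
    have "\<epsilon>0 \<le> c0 / (2 * C + 1)" by (simp add: \<epsilon>0_def)
    then have "\<epsilon>0 * (2 * C + 1) \<le> c0" using C0 by (simp add: pos_le_divide_eq)
    then show "2 * C * \<epsilon>0 \<le> c0" using e0 by (simp add: algebra_simps)
  qed (auto simp: \<epsilon>0_def)
  show ?thesis
  proof (intro exI[of _ \<epsilon>0] conjI e0 allI impI)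
    fix \<epsilon> a :: real and b :: "real^'n"
    assume e: "0 \<le> \<epsilon>" "\<epsilon> \<le> \<epsilon>0" and a: "a > 0"
    define M where "M = cosh_dist a b"
    have M: "M \<ge> 1" using cosh_dist_ge_1[OF a] by (simp add: M_def)
    define G where "G x = sqrt a powr be * (bubble_power al 1 0 x * bubble_power be a b x)" for x
    have G0: "G x \<ge> 0" for x by (simp add: G_def)
    have Gi: "integrable lborel G" unfolding G_def using interaction_integrable[OF a, of b] by simp
    have GYi: "integrable lborel (\<lambda>x. G x * Y x)"
    proof -
      have le: "AE x in lborel. norm (G x * Y x) \<le> norm (G x)"
        using Y_bound by (intro AE_I2) (simp add: abs_mult mult_right_le_one_le)
      have "G \<in> borel_measurable lborel" using Gi by auto
      then have "(\<lambda>x. G x * Y x) \<in> borel_measurable lborel" by measurable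
      then show ?thesis by (rule Bochner_Integration.integrable_bound[OF Gi _ le])
    qed
    \<comment> \<open>The interaction is affine in \<open>\<epsilon>\<close>: \<open>A\<close> is
      its unperturbed value and \<open>B\<close> its slope.\<close>
    define A B where "A = (\<integral>x. G x \<partial>lborel)" and "B = (\<integral>x. G x * Y x \<partial>lborel)"
    have eq: "sqrt a powr be * (\<integral>x. bubble_power al 1 0 x * (1 + \<epsilon> * Y x) * bubble_power be a b x \<partial>lborel) = A + \<epsilon> * B"
    proof -
      have "sqrt a powr be * (\<integral>x. bubble_power al 1 0 x * (1 + \<epsilon> * Y x) * bubble_power be a b x \<partial>lborel)
        = (\<integral>x. G x + \<epsilon> * (G x * Y x) \<partial>lborel)"
        unfolding integral_mult_right_zero[symmetric] by (intro Bochner_Integration.integral_cong) (auto simp: G_def algebra_simps)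
      also have "\<dots> = A + \<epsilon> * B" unfolding A_def B_def using Gi GYi by (subst Bochner_Integration.integral_add) auto
      finally show ?thesis .
    qed
    have A: "A \<le> om * (1 - c0 * min (M - 1) 1)"
      using interaction_bound[OF a, of b] unfolding A_def G_def M_def by simp
    have BA: "\<bar>B\<bar> \<le> A"
    proof -
      have "\<bar>B\<bar> \<le> (\<integral>x. \<bar>G x * Y x\<bar> \<partial>lborel)" unfolding B_def by (rule integral_abs_bound)
      also have "\<dots> \<le> A" unfolding A_def
        using Gi integrable_abs[OF GYi] G0 Y_bound by (intro integral_mono) (simp_all add: abs_mult mult_right_le_one_le)
      finally show ?thesis .
    qed
    have A0: "A \<ge> 0" using BA by linarith
    have eB: "\<bar>\<epsilon> * B\<bar> \<le> \<epsilon> * A" using BA e by (simp add: abs_mult mult_left_mono)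
    have "\<epsilon> * A \<le> 1 * A" using A0 e e1 by (intro mult_right_mono) auto
    then have lower: "0 \<le> A + \<epsilon> * B" using eB by linarith
    have upper: "A + \<epsilon> * B \<le> om"
    \<comment> \<open>Far from the standard bubble the loss in \<open>interaction_bound\<close> is
      the fixed fraction \<open>c0\<close>, and the crude bound \<open>\<bar>B\<bar> \<le> A\<close>
      is enough. Nearby the loss is only proportional to \<open>M - 1\<close>, so \<open>B\<close>
      must be shown to be of that order.\<close>
    proof (cases "M \<le> 2")
      case False
      then have "A \<le> om * (1 - c0)" using A by simp
      then have "A * (1 + \<epsilon>) \<le> om * (1 - c0) * (1 + \<epsilon>)" using e by (intro mult_right_mono) auto
      also have "om * (1 - c0) * (1 + \<epsilon>) \<le> om * 1"
      proof -
        have "(1 - c0) * (1 + \<epsilon>) = 1 - (c0 - \<epsilon>) - c0 * \<epsilon>" by (simp add: algebra_simps)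
        moreover have "0 \<le> c0 * \<epsilon>" using c0_pos e by simp
        ultimately have "(1 - c0) * (1 + \<epsilon>) \<le> 1" using e e1 by linarith
        then show ?thesis using om_pos unfolding mult.assoc by (intro mult_left_mono) auto
      qed
      finally show ?thesis using eB by (simp add: algebra_simps)
    next
      case True
      define \<eta> where "\<eta> = 1 - 1 / M\<^sup>2"
      have z2: "(tilt a b x)\<^sup>2 \<le> \<eta>" for x using tilt_square_le[OF a] by (simp add: \<eta>_def M_def)
      have \<eta>0: "\<eta> \<ge> 0" using z2[of 0] zero_le_power2 order_trans by blast
      have "M\<^sup>2 \<le> 2\<^sup>2" using M True by (intro power_mono) auto
      \<comment> \<open>\<open>3 / 4\<close> lies below the square of \<open>9 / 10\<close>, the
        radius for which the Taylor bound was taken.\<close>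
      then have \<eta>1: "\<eta> \<le> 3 / 4" using M by (simp add: \<eta>_def field_simps)
      have \<eta>2: "\<eta> \<le> 2 * (M - 1)"
      proof -
        have "M * 1 \<le> M * M" using M by (intro mult_left_mono) auto
        then have "M + 1 \<le> 2 * (M * M)" using M by linarith
        then have "(M - 1) * (M + 1) \<le> (M - 1) * (2 * (M * M))" using M by (intro mult_left_mono) auto
        then show ?thesis using M by (simp add: \<eta>_def field_simps power2_eq_square)
      qed
      have z9: "\<bar>tilt a b x\<bar> \<le> 9/10" for x
      proof -
        have "(tilt a b x)\<^sup>2 \<le> (9/10)\<^sup>2" using z2[of x] \<eta>1 by (simp add: power2_eq_square)
        then show ?thesis using abs_le_square_iff[of "tilt a b x" "9/10"] by simp
      qed
      define R where "R x = (1 - tilt a b x) powr - be - (1 + be * tilt a b x)" for x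
      have R_meas [measurable]: "R \<in> borel_measurable borel" unfolding R_def by measurable
      have R: "\<bar>R x\<bar> \<le> C * \<eta>" for x
      proof -
        have "\<bar>R x\<bar> \<le> C * (tilt a b x)\<^sup>2" unfolding R_def by (rule C[OF z9])
        also have "\<dots> \<le> C * \<eta>" using z2 C0 by (intro mult_left_mono) auto
        finally show ?thesis .
      qed
      have YR: "\<bar>Y x * R x\<bar> \<le> C * \<eta>" for x
        unfolding abs_mult using mult_mono[OF Y_bound[of x] R[of x]] by simp
      have i1: "integrable lborel (\<lambda>x. mass x * (Y x * R x))" by (rule mass_mult_integrable[OF _ YR]) measurable
      have i2: "integrable lborel (\<lambda>x. mass x * Y x)" by (rule mass_mult_integrable[where C = 1]) (auto simp: Y_bound)
      have i3: "integrable lborel (\<lambda>x. mass x * (Y x * tilt a b x))"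
      proof (rule mass_mult_integrable[where C = 1])
        fix x show "\<bar>Y x * tilt a b x\<bar> \<le> 1" unfolding abs_mult
          using mult_mono[OF Y_bound[of x] tilt_bound[OF a, of b x]] by simp
      qed measurable
      \<comment> \<open>Taylor expansion in \<open>tilt\<close>: the constant and the linear term
        are orthogonal to \<open>Y\<close>, so only the remainder \<open>R\<close>, of size
        \<open>\<eta>\<close>, contributes to \<open>B\<close>.\<close>
      have GM: "G x * Y x = M powr - be * (mass x * (Y x * R x) + (mass x * Y x + be * (mass x * (Y x * tilt a b x))))" for x
      proof -
        define m where "m = (1 + a + (norm b)\<^sup>2) / 2"
        have m: "m > 0" using a by (simp add: m_def add_pos_nonneg)
        have "M * (1 - tilt a b x) = (a + (norm (x - b))\<^sup>2) / (sqrt a * (1 + (norm x)\<^sup>2))"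
        proof -
          have "M = m / sqrt a" by (simp add: M_def cosh_dist_def m_def)
          moreover have "1 - tilt a b x = (a + (norm (x - b))\<^sup>2) / (m * (1 + (norm x)\<^sup>2))" by (simp add: tilt_def m_def)
          ultimately show ?thesis using m by simp
        qed
        then have "G x = mass x * (M powr - be * (1 - tilt a b x) powr - be)"
          unfolding G_def mass_bubble_product[OF a] by (metis powr_mult)
        moreover have "(1 - tilt a b x) powr - be = R x + (1 + be * tilt a b x)" by (simp add: R_def)
        ultimately show ?thesis by (simp add: algebra_simps)
      qed
      have "B = M powr - be * (\<integral>x. mass x * (Y x * R x) \<partial>lborel)"
      proof -
        have "B = M powr - be * (\<integral>x. mass x * (Y x * R x) + (mass x * Y x + be * (mass x * (Y x * tilt a b x))) \<partial>lborel)"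
          unfolding B_def GM by (rule integral_mult_right_zero)
        also have "(\<integral>x. mass x * (Y x * R x) + (mass x * Y x + be * (mass x * (Y x * tilt a b x))) \<partial>lborel) = (\<integral>x. mass x * (Y x * R x) \<partial>lborel)"
          using i1 i2 i3 integral_Y integral_Y_tilt[OF a] by simp
        finally show ?thesis .
      qed
      moreover have "\<bar>\<integral>x. mass x * (Y x * R x) \<partial>lborel\<bar> \<le> om * (C * \<eta>)"
      proof -
        have "\<bar>\<integral>x. mass x * (Y x * R x) \<partial>lborel\<bar> \<le> (\<integral>x. \<bar>mass x * (Y x * R x)\<bar> \<partial>lborel)" by (rule integral_abs_bound)
        also have "\<dots> \<le> (\<integral>x. mass x * (C * \<eta>) \<partial>lborel)"
          using integrable_abs[OF i1] mass_integrable YR by (intro integral_mono) (simp_all add: abs_mult mult_left_mono)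
        also have "\<dots> = om * (C * \<eta>)" by (simp add: om_def)
        finally show ?thesis .
      qed
      moreover have "M powr - be \<le> 1" using powr_mono2'[of "- be" 1 M] be_pos M by simp
      ultimately have "\<bar>B\<bar> \<le> 1 * (om * (C * \<eta>))"
        using mult_mono[of "M powr - be" 1 "\<bar>\<integral>x. mass x * (Y x * R x) \<partial>lborel\<bar>" "om * (C * \<eta>)"] by (simp only: abs_mult) simp
      also have "\<dots> \<le> om * (C * (2 * (M - 1)))" using \<eta>2 C0 om_pos by (simp add: mult_left_mono)
      finally have B: "B \<le> om * (C * (2 * (M - 1)))" by linarith
      have "\<epsilon> * B \<le> \<epsilon> * (om * (C * (2 * (M - 1))))" using B e by (intro mult_left_mono) auto
      also have "\<dots> = (2 * C * \<epsilon>) * (om * (M - 1))" by simp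
      also have "\<dots> \<le> c0 * (om * (M - 1))"
      proof (intro mult_right_mono)
        have "2 * C * \<epsilon> \<le> 2 * C * \<epsilon>0" using e C0 by (intro mult_left_mono) auto
        then show "2 * C * \<epsilon> \<le> c0" using e1 by linarith
      qed (use om_pos M in auto)
      finally have "\<epsilon> * B \<le> c0 * (om * (M - 1))" .
      moreover have "A \<le> om * (1 - c0 * (M - 1))" using A True by simp
      ultimately show ?thesis by (simp add: algebra_simps)
    qed
    show "\<bar>sqrt a powr be * (\<integral>x. bubble_power al 1 0 x * (1 + \<epsilon> * Y x) * bubble_power be a b x \<partial>lborel)\<bar> \<le> om"
      unfolding eq using lower upper by simp
  qed
qed

end

section \<open>The second-order perturbation of a bubble\<close>

lemma l2norm_add_squared:
  fixes F H :: "'a::euclidean_space \<Rightarrow> complex" and c :: real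
  assumes F: "square_integrable F" and H: "square_integrable H"
  shows "(l2norm (\<lambda>x. F x + of_real c * H x))\<^sup>2 = (l2norm F)\<^sup>2 + 2 * c * Re (\<integral>x. F x * cnj (H x) \<partial>lborel) + c\<^sup>2 * (l2norm H)\<^sup>2"
proof -
  have pt: "(cmod (F x + of_real c * H x))\<^sup>2 = (cmod (F x))\<^sup>2 + 2 * c * Re (F x * cnj (H x)) + c\<^sup>2 * (cmod (H x))\<^sup>2" for x
    by (simp add: cmod_power2) (simp add: power2_eq_square algebra_simps)
  have i: "integrable lborel (\<lambda>x. (cmod (F x))\<^sup>2)" "integrable lborel (\<lambda>x. (cmod (H x))\<^sup>2)" "integrable lborel (\<lambda>x. F x * cnj (H x))"
    using F H square_integrable_product[OF F H] by (auto simp: square_integrable_def)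
  have iR: "integrable lborel (\<lambda>x. Re (F x * cnj (H x)))" using i(3) by (rule integrable_Re)
  have "(\<integral>x. (cmod (F x + of_real c * H x))\<^sup>2 \<partial>lborel)
    = (\<integral>x. (cmod (F x))\<^sup>2 \<partial>lborel) + 2 * c * (\<integral>x. Re (F x * cnj (H x)) \<partial>lborel) + c\<^sup>2 * (\<integral>x. (cmod (H x))\<^sup>2 \<partial>lborel)"
    unfolding pt
    using Bochner_Integration.integral_add[OF Bochner_Integration.integrable_add[OF i(1) integrable_mult_right[OF iR, of "2 * c"]] integrable_mult_right[OF i(2), of "c\<^sup>2"]]
      Bochner_Integration.integral_add[OF i(1) integrable_mult_right[OF iR, of "2 * c"]]
    by (simp only: integral_mult_right_zero)
  then show ?thesis unfolding l2norm_squared integral_Re[OF i(3)] .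
qed

lemma fourier_lincomb:
  fixes V W :: "real ^ 'n \<Rightarrow> real"
  assumes V: "integrable lborel V" and W: "integrable lborel W"
  shows "fourier (\<lambda>x. of_real (a * V x + b * W x)) \<xi> = of_real a * fourier (\<lambda>x. of_real (V x)) \<xi> + of_real b * fourier (\<lambda>x. of_real (W x)) \<xi>"
proof -
  let ?v = "\<lambda>x. cis (- (x \<bullet> \<xi>)) * complex_of_real (V x)" and ?w = "\<lambda>x. cis (- (x \<bullet> \<xi>)) * complex_of_real (W x)"
  have "integrable lborel (\<lambda>x. complex_of_real (V x))" "integrable lborel (\<lambda>x. complex_of_real (W x))"
    using V W by simp_all
  then have v: "integrable lborel ?v" and w: "integrable lborel ?w" by (auto intro!: integrable_cis_mult)
  have "(\<integral>x. cis (- (x \<bullet> \<xi>)) * complex_of_real (a * V x + b * W x) \<partial>lborel) = (\<integral>x. of_real a * ?v x + of_real b * ?w x \<partial>lborel)"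
    by (intro Bochner_Integration.integral_cong) (auto simp: algebra_simps)
  also have "\<dots> = of_real a * (\<integral>x. ?v x \<partial>lborel) + of_real b * (\<integral>x. ?w x \<partial>lborel)"
    using Bochner_Integration.integral_add[OF integrable_mult_right[OF v] integrable_mult_right[OF w]] by (simp only: integral_mult_right_zero)
  finally show ?thesis unfolding fourier_def by (simp add: algebra_simps)
qed

text \<open>Admissibility is read almost everywhere, so a function that vanishes almost everywhere
  must be given norm 0.\<close>

lemma Hs_pair_cong_AE:
  assumes f: "Hs_pair s f F" and [measurable]: "g \<in> borel_measurable borel" and eq: "AE x in lborel. f x = g x"
  shows "Hs_pair s g F"
proof -
  let ?p = "crit_exp (real CARD('a)) s"
  note F = f[unfolded Hs_pair_def]
  have [measurable]: "f \<in> borel_measurable borel" using F by auto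
  have "integrable lborel (\<lambda>x. \<bar>g x\<bar> powr ?p) \<longleftrightarrow> integrable lborel (\<lambda>x. \<bar>f x\<bar> powr ?p)"
    using eq by (intro integrable_cong_AE) (auto elim: eventually_mono)
  moreover have "(\<integral>x. \<bar>\<phi> x - g x\<bar> powr ?p \<partial>lborel) = (\<integral>x. \<bar>\<phi> x - f x\<bar> powr ?p \<partial>lborel)" if "\<phi> \<in> test_functions" for \<phi> :: "real^'a \<Rightarrow> real"
  proof -
    note [measurable] = test_function_measurable[OF that]
    show ?thesis using eq by (intro integral_cong_AE) (auto elim: eventually_mono)
  qed
  ultimately show ?thesis using F assms(2) unfolding Hs_pair_def by auto
qed

context bubble_setting
begin

definition perturbed :: "real \<Rightarrow> real ^ 'n \<Rightarrow> real" where
  "perturbed \<epsilon> x = bubble_power al 1 0 x * (1 + \<epsilon> * Y x)"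

text \<open>Second moment of \<open>Y\<close> under the normalised \<open>mass\<close>;
  \<open>E3\<close> is the third.\<close>

definition E2 :: real where "E2 = 2 * d / ((d + 1)\<^sup>2 * (d + 3))"
definition E3 :: real where "E3 = 8 * d * (d - 1) / ((d + 1) ^ 3 * (d + 3) * (d + 5))"
text \<open>The constant in the equation
  \<open>(- \<Delta>)\<^sup>s U = energy * U powr (p - 1)\<close> of the standard bubble; hence
  \<open>energy * om\<close> is its squared norm.\<close>

definition energy :: real where "energy = 4 powr s * Gamma be / Gamma al"
text \<open>The conformal operator on the sphere has an eigenvalue proportional to
  \<open>Gamma (be + l) / Gamma (al + l)\<close> on harmonics of degree l. This is the ratio of
  degree 2 to degree 0; for degree 1 it would be \<open>be / al = p - 1\<close>.\<close>

definition \<kappa> :: real where "\<kappa> = be * (be + 1) / (al * (al + 1))"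
definition p :: real where "p = d / al"

lemma E2_pos: "E2 > 0" using d_ge_1 by (simp add: E2_def)
lemma E3_pos: "E3 > 0" using d_ge_2 by (simp add: E3_def)
lemma energy_pos: "energy > 0" using al_pos be_pos by (auto simp: energy_def intro!: Gamma_real_pos)
lemma \<kappa>_pos: "\<kappa> > 0" using al_pos be_pos by (simp add: \<kappa>_def)
lemma p_crit: "crit_exp (real CARD('n)) s = p" by (simp add: crit_exp_def p_def al_def d_def)
lemma p_gt_2: "p > 2" using crit_exp_gt_2[OF s_pos s_less] by (simp only: p_crit)
lemma al_p: "al * p = d" using al_pos by (simp add: p_def)

lemma bubble_power_Y: "bubble_power g 1 0 x * Y x = 4 * bubble_power (g + 2) 1 0 x + (- 4) * bubble_power (g + 1) 1 0 x + d / (d + 1) * bubble_power g 1 0 x"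
  using bubble_power_w[of g 1 x] bubble_power_w[of g 2 x] by (simp add: Y_def algebra_simps)

text \<open>The transform of \<open>bubble_power g 1 0 x * Y x\<close>, term by term as in
  \<open>bubble_power_Y\<close>.\<close>

definition harmonic_fourier :: "real \<Rightarrow> real ^ 'n \<Rightarrow> complex" where
  "harmonic_fourier g \<xi> = 4 * bubble_fourier (g + 2) 1 0 \<xi> - 4 * bubble_fourier (g + 1) 1 0 \<xi> + of_real (d / (d + 1)) * bubble_fourier g 1 0 \<xi>"

lemma Hs_rep_bubble:
  assumes "g \<ge> al" "a > 0"
  shows "Hs_rep s (bubble_power g a b) (bubble_fourier g a (b::real^'n))"
  using Hs_rep_bubble_power[OF s_pos s_less, of g a b] assms by (simp add: al_def d_def)

lemma Hs_rep_perturbed: "Hs_rep s (perturbed \<epsilon>) (\<lambda>\<xi>. bubble_fourier al 1 0 \<xi> + of_real \<epsilon> * harmonic_fourier al \<xi>)"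
proof -
  have b: "Hs_rep s (bubble_power al 1 (0::real^'n)) (bubble_fourier al 1 0)" "Hs_rep s (bubble_power (al + 1) 1 (0::real^'n)) (bubble_fourier (al + 1) 1 0)"
    "Hs_rep s (bubble_power (al + 2) 1 (0::real^'n)) (bubble_fourier (al + 2) 1 0)" by (auto intro!: Hs_rep_bubble)
  note l = Hs_rep_lincomb[OF s_pos s_less]
  have "perturbed \<epsilon> = (\<lambda>x. 1 * bubble_power al 1 0 x + \<epsilon> * (1 * (4 * bubble_power (al + 2) 1 0 x + (- 4) * bubble_power (al + 1) 1 0 x) + d / (d + 1) * bubble_power al 1 0 x))"
    unfolding mult_1 bubble_power_Y[symmetric] by (rule ext) (simp add: perturbed_def algebra_simps)
  moreover have "(\<lambda>\<xi>. bubble_fourier al 1 (0::real^'n) \<xi> + of_real \<epsilon> * harmonic_fourier al \<xi>)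
    = (\<lambda>\<xi>. of_real 1 * bubble_fourier al 1 0 \<xi> + of_real \<epsilon> * (of_real 1 * (of_real 4 * bubble_fourier (al + 2) 1 0 \<xi> + of_real (- 4) * bubble_fourier (al + 1) 1 0 \<xi>) + of_real (d / (d + 1)) * bubble_fourier al 1 0 \<xi>))"
    unfolding harmonic_fourier_def by (rule ext) simp
  ultimately show ?thesis by (simp only: l[OF b(1) l[OF l[OF b(3) b(2)] b(1)]])
qed

lemma perturbed_measurable [measurable]: "perturbed \<epsilon> \<in> borel_measurable borel"
  unfolding perturbed_def by measurable

lemma bubble_integrable: "g \<ge> be \<Longrightarrow> a > 0 \<Longrightarrow> integrable lborel (bubble_power g a (b::real^'n))"
  using bubble_power_integral[of g a b] be_gt by (simp add: has_bochner_integral_iff d_def)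

lemma fourier_bubble: "g \<ge> be \<Longrightarrow> a > 0 \<Longrightarrow> fourier (\<lambda>x. of_real (bubble_power g a b x)) \<xi> = bubble_fourier g a (b::real^'n) \<xi>"
  using fourier_bubble_power[of g a b \<xi>] be_gt by (simp add: d_def)

lemma Euler_Lagrange_bubble:
  assumes "a > 0" "\<xi> \<noteq> 0"
  shows "of_real (norm \<xi> powr (2 * s)) * bubble_fourier al a b \<xi> = of_real (a powr s * energy) * fourier (\<lambda>x. of_real (bubble_power be a (b::real^'n) x)) \<xi>"
proof -
  have e: "(4 * a) powr s * Gamma be / Gamma al = a powr s * energy" by (simp add: energy_def powr_mult)
  show ?thesis
    using bubble_fourier_Euler_Lagrange[OF s_pos s_less assms, of b] fourier_bubble[of be a b \<xi>] assms(1)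
    unfolding d_def[symmetric] al_def[symmetric] be_def[symmetric] e by simp
qed

text \<open>Linearity: the bubble keeps the factor \<open>energy\<close>, while its harmonic part
  picks up the eigenvalue ratio \<open>\<kappa>\<close> in addition.\<close>

lemma Euler_Lagrange_perturbed:
  assumes x: "\<xi> \<noteq> (0::real^'n)"
  shows "of_real (norm \<xi> powr (2 * s)) * (bubble_fourier al 1 0 \<xi> + of_real \<epsilon> * harmonic_fourier al \<xi>)
    = of_real energy * fourier (\<lambda>x::real^'n. of_real (bubble_power be 1 0 x * (1 + \<epsilon> * \<kappa> * Y x))) \<xi>"
proof -
  let ?b = "\<lambda>g. bubble_power g 1 (0::real^'n)"
  have i: "integrable lborel (?b be)" "integrable lborel (?b (be + 1))" "integrable lborel (?b (be + 2))" by (auto intro!: bubble_integrable)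
  have i1: "integrable lborel (\<lambda>x. 4 * ?b (be + 2) x + (- 4) * ?b (be + 1) x)" using i by simp
  have i2: "integrable lborel (\<lambda>x. 1 * (4 * ?b (be + 2) x + (- 4) * ?b (be + 1) x) + d / (d + 1) * ?b be x)" using i by simp
  have V: "?b be x * (1 + \<epsilon> * \<kappa> * Y x) = 1 * ?b be x + \<epsilon> * \<kappa> * (1 * (4 * ?b (be + 2) x + (- 4) * ?b (be + 1) x) + d / (d + 1) * ?b be x)" for x
    unfolding mult_1 bubble_power_Y[symmetric] by (simp add: algebra_simps)
  have F: "fourier (\<lambda>x. of_real (?b be x * (1 + \<epsilon> * \<kappa> * Y x))) \<xi> = bubble_fourier be 1 0 \<xi> + of_real (\<epsilon> * \<kappa>) * harmonic_fourier be \<xi>"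
    unfolding V fourier_lincomb[OF i(1) i2] fourier_lincomb[OF i1 i(1)] fourier_lincomb[OF i(3) i(2)]
    by (simp add: fourier_bubble harmonic_fourier_def)
  have "4 powr s * Gamma (be + 2) / Gamma (al + 2) = energy * \<kappa>"
  proof -
    have "Gamma (al + 2) = (al + 1) * (al * Gamma al)" "Gamma (be + 2) = (be + 1) * (be * Gamma be)"
      using Gamma_plus1_pos[of al] Gamma_plus1_pos[of be] Gamma_plus1_pos[of "al + 1"] Gamma_plus1_pos[of "be + 1"] al_pos be_pos
      by (simp_all add: add.assoc)
    then show ?thesis unfolding energy_def \<kappa>_def by (simp only: times_divide_times_eq mult_ac)
  qed
  then have "of_real (norm \<xi> powr (2 * s)) * harmonic_fourier al \<xi> = of_real (energy * \<kappa>) * harmonic_fourier be \<xi>"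
    using harmonic_fourier_Euler_Lagrange[OF s_pos s_less x]
    unfolding d_def[symmetric] al_def[symmetric] be_def[symmetric] harmonic_fourier_def[symmetric] by simp
  moreover have "of_real (norm \<xi> powr (2 * s)) * bubble_fourier al 1 0 \<xi> = of_real energy * bubble_fourier be 1 0 \<xi>"
    using Euler_Lagrange_bubble[of 1 \<xi> 0] x by (simp add: fourier_bubble)
  ultimately show ?thesis unfolding F by (simp add: distrib_left mult.left_commute[of _ "of_real \<epsilon>"])
qed

definition perturbed_energy :: "real \<Rightarrow> real" where
  "perturbed_energy \<epsilon> = energy * (om * (1 + \<epsilon>\<^sup>2 * \<kappa> * E2))"

lemma mass_Y_integrable: "integrable lborel (\<lambda>x. mass x * (Y x) ^ k)"
  by (rule mass_mult_integrable[where C = 1]) (auto simp: power_abs power_le_one Y_bound)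

lemma mass_split: "bubble_power al 1 0 x * bubble_power be 1 0 x = mass x"
proof -
  have "- d = - al + - be" using al_be by simp
  then show ?thesis unfolding mass_def bubble_power_def by (simp only: powr_add)
qed

text \<open>The perturbed bubble is paired with itself through its Euler-Lagrange equation; the term
  linear in \<open>\<epsilon>\<close> drops out because \<open>Y\<close> has mean 0.\<close>

lemma l2norm_perturbed:
  "(l2norm (\<lambda>\<xi>::real^'n. of_real (norm \<xi> powr s) * (bubble_fourier al 1 0 \<xi> + of_real \<epsilon> * harmonic_fourier al \<xi>)))\<^sup>2 = perturbed_energy \<epsilon>"
proof -
  let ?F = "\<lambda>\<xi>::real^'n. of_real (norm \<xi> powr s) * (bubble_fourier al 1 0 \<xi> + of_real \<epsilon> * harmonic_fourier al \<xi>)"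
  let ?V = "\<lambda>x::real^'n. bubble_power be 1 0 x * (1 + \<epsilon> * \<kappa> * Y x)"
  have V: "integrable lborel ?V"
  proof -
    have "integrable lborel (\<lambda>x::real^'n. bubble_power be 1 0 x + \<epsilon> * \<kappa> * (4 * bubble_power (be + 2) 1 0 x + (- 4) * bubble_power (be + 1) 1 0 x + d / (d + 1) * bubble_power be 1 0 x))"
      by (intro Bochner_Integration.integrable_add integrable_mult_right bubble_integrable) auto
    then show ?thesis unfolding bubble_power_Y[symmetric] by (simp add: algebra_simps)
  qed
  have "complex_of_real ((l2norm ?F)\<^sup>2) = (\<integral>\<xi>. ?F \<xi> * cnj (?F \<xi>) \<partial>lborel)"
    unfolding l2norm_squared complex_norm_square[symmetric] by (rule integral_complex_of_real[symmetric])
  also have "\<dots> = of_real (energy * (\<integral>x. perturbed \<epsilon> x * ?V x \<partial>lborel))"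
    by (rule Hs_rep_pairing[OF Hs_rep_perturbed Hs_rep_perturbed V Euler_Lagrange_perturbed])
  also have "(\<integral>x. perturbed \<epsilon> x * ?V x \<partial>lborel) = (\<integral>x. mass x * (Y x) ^ 0 + ((\<epsilon> + \<epsilon> * \<kappa>) * (mass x * (Y x) ^ 1) + \<epsilon>\<^sup>2 * \<kappa> * (mass x * (Y x)\<^sup>2)) \<partial>lborel)"
    by (intro Bochner_Integration.integral_cong refl)
      (simp add: perturbed_def mass_split[symmetric], simp add: algebra_simps power2_eq_square)
  also have "\<dots> = om * (1 + \<epsilon>\<^sup>2 * \<kappa> * E2)"
    using mass_Y_integrable[of 0] mass_Y_integrable[of 1] mass_Y_integrable[of 2] integral_Y integral_Y_square
    by (simp add: om_def[symmetric] E2_def[symmetric]) (simp add: algebra_simps)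
  finally show ?thesis unfolding perturbed_energy_def of_real_eq_iff .
qed

lemma Hs_norm_perturbed: "(Hs_norm s (perturbed \<epsilon>))\<^sup>2 = perturbed_energy \<epsilon>"
  using Hs_pair_norm[OF s_pos s_less] Hs_rep_perturbed[of \<epsilon>] l2norm_perturbed[of \<epsilon>] unfolding Hs_rep_def by metis

text \<open>As a quadratic polynomial in \<open>c\<close> the squared norm is smallest at the
  projection, with value \<open>perturbed_energy \<epsilon> - (l * J)\<^sup>2 / N\<close>.
  Hypothesis \<open>bound\<close> says exactly that the subtracted term is at most
  \<open>energy * om\<close>.\<close>

lemma Hs_norm_perturbed_diff:
  fixes b :: "real ^ 'n"
  assumes a: "a > 0" and bound: "\<bar>sqrt a powr be * (\<integral>x. bubble_power al 1 0 x * (1 + \<epsilon> * Y x) * bubble_power be a b x \<partial>lborel)\<bar> \<le> om"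
  shows "\<exists>F. Hs_pair s (\<lambda>x. perturbed \<epsilon> x - c * bubble_power al a b x) F"
    and "energy * om * (\<epsilon>\<^sup>2 * \<kappa> * E2) \<le> (Hs_norm s (\<lambda>x. perturbed \<epsilon> x - c * bubble_power al a b x))\<^sup>2"
proof -
  let ?F = "\<lambda>\<xi>::real^'n. of_real (norm \<xi> powr s) * (bubble_fourier al 1 0 \<xi> + of_real \<epsilon> * harmonic_fourier al \<xi>)"
  let ?H = "\<lambda>\<xi>::real^'n. of_real (norm \<xi> powr s) * bubble_fourier al a b \<xi>"
  have F: "Hs_pair s (perturbed \<epsilon>) ?F" and H: "Hs_pair s (bubble_power al a b) ?H"
    using Hs_rep_perturbed Hs_rep_bubble[of al a b] a by (auto simp: Hs_rep_def)
  have sq: "square_integrable ?F" "square_integrable ?H" using F H by (auto simp: Hs_pair_def)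
  have D: "Hs_pair s (\<lambda>x. perturbed \<epsilon> x - c * bubble_power al a b x) (\<lambda>\<xi>. ?F \<xi> + of_real (- c) * ?H \<xi>)"
    using Hs_pair_lincomb[OF s_pos s_less F H, of 1 "- c"] by simp
  then show "\<exists>F. Hs_pair s (\<lambda>x. perturbed \<epsilon> x - c * bubble_power al a b x) F" by blast
  define l where "l = a powr s * energy"
  have l: "l > 0" using a energy_pos by (simp add: l_def)
  define J where "J = (\<integral>x. perturbed \<epsilon> x * bubble_power be a b x \<partial>lborel)"
  have V: "integrable lborel (bubble_power be a b)" using a by (intro bubble_integrable) auto
  note EL = Euler_Lagrange_bubble[OF a, folded l_def]
  have FH: "(\<integral>\<xi>. ?F \<xi> * cnj (?H \<xi>) \<partial>lborel) = of_real (l * J)"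
    unfolding J_def by (rule Hs_rep_pairing[OF Hs_rep_perturbed Hs_rep_bubble[OF order_refl a] V EL])
  have HH: "(l2norm ?H)\<^sup>2 = l * (om * a powr - (d / 2))"
  proof -
    have "complex_of_real ((l2norm ?H)\<^sup>2) = (\<integral>\<xi>. ?H \<xi> * cnj (?H \<xi>) \<partial>lborel)"
      unfolding l2norm_squared complex_norm_square[symmetric] by (rule integral_complex_of_real[symmetric])
    also have "\<dots> = of_real (l * (\<integral>x. bubble_power al a b x * bubble_power be a b x \<partial>lborel))"
      by (rule Hs_rep_pairing[OF Hs_rep_bubble[OF order_refl a] Hs_rep_bubble[OF order_refl a] V EL])
    also have "(\<integral>x. bubble_power al a b x * bubble_power be a b x \<partial>lborel) = (\<integral>x. bubble_power d a b x \<partial>lborel)"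
    proof -
      have "- d = - al + - be" using al_be by simp
      then show ?thesis unfolding bubble_power_def by (simp only: powr_add)
    qed
    also have "\<dots> = om * a powr - (d / 2)"
      using bubble_power_integral[of d a b] a d_ge_1 unfolding om_eq by (simp add: d_def has_bochner_integral_iff)
    finally show ?thesis unfolding of_real_eq_iff .
  qed
  define N where "N = (l2norm ?H)\<^sup>2"
  have N: "N > 0" unfolding N_def HH using l om_pos a by simp
  have "(Hs_norm s (\<lambda>x. perturbed \<epsilon> x - c * bubble_power al a b x))\<^sup>2 = perturbed_energy \<epsilon> + 2 * (- c) * (l * J) + c\<^sup>2 * N"
    unfolding Hs_pair_norm[OF s_pos s_less D] l2norm_add_squared[OF sq] l2norm_perturbed FH N_def by simp
  moreover have "perturbed_energy \<epsilon> - (l * J)\<^sup>2 / N \<le> perturbed_energy \<epsilon> + 2 * (- c) * (l * J) + c\<^sup>2 * N"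
  proof -
    have "0 \<le> (c * N - l * J)\<^sup>2 / N" using N by simp
    also have "\<dots> = 2 * (- c) * (l * J) + c\<^sup>2 * N + (l * J)\<^sup>2 / N" using N by (simp add: power2_eq_square field_simps)
    finally show ?thesis by simp
  qed
  moreover have "(l * J)\<^sup>2 / N \<le> energy * om"
  proof -
    have "\<bar>sqrt a powr be * J\<bar> \<le> om" using bound unfolding J_def perturbed_def .
    then have "(sqrt a powr be * J)\<^sup>2 \<le> om\<^sup>2" using abs_le_square_iff[of "sqrt a powr be * J" om] om_pos by simp
    moreover have "(sqrt a powr be * J)\<^sup>2 = a powr be * J\<^sup>2"
    proof -
      have "(sqrt a powr be)\<^sup>2 = (a powr (1 / 2)) powr be * (a powr (1 / 2)) powr be" using a by (simp add: powr_half_sqrt power2_eq_square)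
      also have "\<dots> = a powr be" by (simp add: powr_powr powr_add[symmetric])
      finally show ?thesis by (simp add: power_mult_distrib)
    qed
    ultimately have J2: "a powr be * J\<^sup>2 \<le> om\<^sup>2" by simp
    \<comment> \<open>\<open>be = s + d / 2\<close> lets the powers of \<open>a\<close> from the
      Euler-Lagrange constant and from the norm of the bubble combine into the
      \<open>a powr be\<close> of \<open>bound\<close>.\<close>
    have "(l * J)\<^sup>2 / N = energy * (a powr be * J\<^sup>2) / om"
    proof -
      have "be = s + d / 2" by (simp add: be_def field_simps)
      then have ab: "a powr be = a powr s * a powr (d / 2)" by (simp only: powr_add)
      have "(l * J)\<^sup>2 / N = l * J\<^sup>2 * a powr (d / 2) / om"
        unfolding N_def HH using l a by (simp add: power2_eq_square powr_minus_divide)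
      then show ?thesis unfolding ab l_def by simp
    qed
    also have "\<dots> \<le> energy * om\<^sup>2 / om" using J2 energy_pos om_pos by (intro divide_right_mono mult_left_mono) auto
    also have "\<dots> = energy * om" using om_pos by (simp add: power2_eq_square)
    finally show ?thesis .
  qed
  ultimately show "energy * om * (\<epsilon>\<^sup>2 * \<kappa> * E2) \<le> (Hs_norm s (\<lambda>x. perturbed \<epsilon> x - c * bubble_power al a b x))\<^sup>2"
    unfolding perturbed_energy_def by (simp add: algebra_simps)
qed

section \<open>Expansion of the Bianchi-Egnell quotient\<close>

lemma Lp_norm_perturbed:
  assumes e: "0 \<le> \<epsilon>" "\<epsilon> < 1"
  shows "Lp_norm p (perturbed \<epsilon>) = (\<integral>x. mass x * (1 + \<epsilon> * Y x) powr p \<partial>lborel) powr (1 / p)"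
proof -
  have "norm (perturbed \<epsilon> x) powr p = mass x * (1 + \<epsilon> * Y x) powr p" for x
  proof -
    have "\<bar>\<epsilon> * Y x\<bar> \<le> \<epsilon> * 1" unfolding abs_mult using e Y_bound[of x] by (intro mult_mono) auto
    then have "1 + \<epsilon> * Y x > 0" using e by linarith
    then have "norm (perturbed \<epsilon> x) = bubble_power al 1 0 x * (1 + \<epsilon> * Y x)" by (simp add: perturbed_def)
    then show ?thesis by (simp add: powr_mult bubble_power_def mass_def powr_powr al_p)
  qed
  then show ?thesis unfolding Lp_norm_def by simp
qed

text \<open>The cubic term is what pushes the quotient strictly below its second-order limit: it is positive
  because the third moment of \<open>Y\<close> is, which needs \<open>d \<ge> 2\<close>.\<close>

lemma Lp_norm_expansion:
  "\<exists>\<epsilon>1>0. \<forall>\<epsilon>. 0 < \<epsilon> \<longrightarrow> \<epsilon> \<le> \<epsilon>1 \<longrightarrow>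
     om * (1 + \<epsilon>\<^sup>2 * ((p - 1) * E2)) powr (p / 2) < (\<integral>x. mass x * (1 + \<epsilon> * Y x) powr p \<partial>lborel)"
proof -
  obtain C where C0: "C \<ge> 0" and C': "\<forall>y. \<bar>y\<bar> \<le> 1/2 \<longrightarrow> \<bar>(1 + y) powr p - (\<Sum>m<4. (\<Prod>j<m. p - real j) / fact m * y ^ m)\<bar> \<le> C * \<bar>y\<bar> ^ 4"
    using Taylor_powr_bound[of 4 "1/2" p] by auto
  define k2 k3 where "k2 = p * (p - 1) / 2" and "k3 = p * (p - 1) * (p - 2) / 6"
  have k3: "k3 > 0" using p_gt_2 by (simp add: k3_def)
  have C: "1 + p * y + k2 * y ^ 2 + k3 * y ^ 3 - C * y ^ 4 \<le> (1 + y) powr p" if "\<bar>y\<bar> \<le> 1/2" for y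
  proof -
    have "(\<Sum>m<4. (\<Prod>j<m. p - real j) / fact m * y ^ m) = 1 + p * y + k2 * y ^ 2 + k3 * y ^ 3"
      by (simp add: k2_def k3_def eval_nat_numeral)
    then show ?thesis using C'[rule_format, OF that] by (simp add: abs_le_iff)
  qed
  obtain D where D0: "D \<ge> 0" and D': "\<forall>y. \<bar>y\<bar> \<le> 1/2 \<longrightarrow> \<bar>(1 + y) powr (p / 2) - (\<Sum>m<2. (\<Prod>j<m. p / 2 - real j) / fact m * y ^ m)\<bar> \<le> D * \<bar>y\<bar> ^ 2"
    using Taylor_powr_bound[of 2 "1/2" "p / 2"] by auto
  have D: "(1 + y) powr (p / 2) \<le> 1 + p / 2 * y + D * y ^ 2" if "\<bar>y\<bar> \<le> 1/2" for y
    using D'[rule_format, OF that] by (simp add: numeral_2_eq_2 abs_le_iff)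
  define q where "q = (p - 1) * E2"
  have q: "q > 0" using p_gt_2 E2_pos by (simp add: q_def)
  define A where "A = C + D * q\<^sup>2 + 1"
  have A: "A > 0" using C0 D0 by (simp add: A_def add_nonneg_pos)
  \<comment> \<open>\<open>1 / 2\<close> and \<open>1 / (2 * q)\<close> keep both Taylor arguments
    within \<open>1 / 2\<close>; the last bound lets the cubic gain \<open>k3 * E3\<close> outweigh
    the quartic errors collected in \<open>A\<close>.\<close>
  define \<epsilon>1 where "\<epsilon>1 = min (1/2) (min (1 / (2 * q)) (k3 * E3 / A))"
  have e1: "\<epsilon>1 > 0" using q k3 E3_pos A by (simp add: \<epsilon>1_def)
  show ?thesis
  proof (intro exI[of _ \<epsilon>1] conjI e1 allI impI)
    fix \<epsilon> assume e: "0 < \<epsilon>" "\<epsilon> \<le> \<epsilon>1"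
    have e2: "\<epsilon> \<le> 1/2" "\<epsilon> * (2 * q) \<le> 1" "\<epsilon> * A \<le> k3 * E3"
      using e q A by (auto simp: \<epsilon>1_def pos_le_divide_eq)
    have "\<epsilon> * (\<epsilon> * q) \<le> 1 * (\<epsilon> * q)" using e e2 q by (intro mult_right_mono) auto
    then have "\<epsilon>\<^sup>2 * q \<le> \<epsilon> * q" by (simp add: power2_eq_square mult.assoc)
    moreover have "2 * (\<epsilon> * q) \<le> 1" using e2(2) by (simp only: mult.left_commute)
    moreover have "0 \<le> \<epsilon>\<^sup>2 * q" using q by simp
    ultimately have small: "\<bar>\<epsilon>\<^sup>2 * q\<bar> \<le> 1/2" by linarith
    let ?P = "\<lambda>x. 1 + p * (\<epsilon> * Y x) + k2 * (\<epsilon> * Y x) ^ 2 + k3 * (\<epsilon> * Y x) ^ 3 - C * \<epsilon> ^ 4"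
    have Yb: "\<bar>\<epsilon> * Y x\<bar> \<le> \<epsilon>" for x
      unfolding abs_mult using e Y_bound[of x] by (simp add: mult_left_le)
    have le: "mass x * ?P x \<le> mass x * (1 + \<epsilon> * Y x) powr p" for x
    proof (intro mult_left_mono)
      have "(\<epsilon> * Y x) ^ 4 \<le> \<epsilon> ^ 4"
        using power_mono[OF Yb[of x], of 4] by simp
      then have "C * (\<epsilon> * Y x) ^ 4 \<le> C * \<epsilon> ^ 4" using C0 by (intro mult_left_mono) auto
      then show "?P x \<le> (1 + \<epsilon> * Y x) powr p" using C[of "\<epsilon> * Y x"] Yb[of x] e2 by linarith
    qed simp
    have P: "mass x * ?P x = (1 - C * \<epsilon> ^ 4) * (mass x * Y x ^ 0) + (p * \<epsilon> * (mass x * Y x ^ 1) + (k2 * \<epsilon>\<^sup>2 * (mass x * (Y x)\<^sup>2) + k3 * \<epsilon> ^ 3 * (mass x * Y x ^ 3)))" for x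
      by (simp add: algebra_simps power_mult_distrib)
    have iP: "integrable lborel (\<lambda>x. mass x * ?P x)"
      unfolding P by (intro Bochner_Integration.integrable_add integrable_mult_right mass_Y_integrable)
    have "(\<integral>x. mass x * ?P x \<partial>lborel) = om * (1 - C * \<epsilon> ^ 4 + k2 * \<epsilon>\<^sup>2 * E2 + k3 * \<epsilon> ^ 3 * E3)"
      unfolding P using mass_Y_integrable[of 0] mass_Y_integrable[of 1] mass_Y_integrable[of 2] mass_Y_integrable[of 3] integral_Y integral_Y_square integral_Y_cube
      by (simp add: om_def[symmetric] E2_def[symmetric] E3_def[symmetric]) (simp add: algebra_simps)
    moreover have "(\<integral>x. mass x * ?P x \<partial>lborel) \<le> (\<integral>x. mass x * (1 + \<epsilon> * Y x) powr p \<partial>lborel)"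
    proof (rule integral_mono[OF iP _ le])
      show "integrable lborel (\<lambda>x. mass x * (1 + \<epsilon> * Y x) powr p)"
      proof (rule mass_mult_integrable[where C = "2 powr p"])
        fix x
        have "0 \<le> 1 + \<epsilon> * Y x" "1 + \<epsilon> * Y x \<le> 2" using Yb[of x] e2 by linarith+
        then show "\<bar>(1 + \<epsilon> * Y x) powr p\<bar> \<le> 2 powr p" using p_gt_2 by (simp add: powr_mono2)
      qed measurable
    qed
    ultimately have lower: "om * (1 - C * \<epsilon> ^ 4 + k2 * \<epsilon>\<^sup>2 * E2 + k3 * \<epsilon> ^ 3 * E3) \<le> (\<integral>x. mass x * (1 + \<epsilon> * Y x) powr p \<partial>lborel)"
      by linarith
    have "(1 + \<epsilon>\<^sup>2 * q) powr (p / 2) \<le> 1 + p / 2 * (\<epsilon>\<^sup>2 * q) + D * (\<epsilon>\<^sup>2 * q) ^ 2" by (rule D[OF small])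
    \<comment> \<open>The quadratic terms of the two sides agree,
      \<open>p / 2 * q = k2 * E2\<close>, so the comparison is decided at third order.\<close>
    also have "\<dots> = 1 + k2 * \<epsilon>\<^sup>2 * E2 + \<epsilon> ^ 3 * (\<epsilon> * (D * q\<^sup>2))"
      unfolding k2_def q_def by (simp add: power_mult_distrib) (simp add: eval_nat_numeral)
    also have "\<dots> < 1 - C * \<epsilon> ^ 4 + k2 * \<epsilon>\<^sup>2 * E2 + k3 * \<epsilon> ^ 3 * E3"
    proof -
      have "\<epsilon> ^ 3 * (\<epsilon> * (C + D * q\<^sup>2)) < \<epsilon> ^ 3 * (k3 * E3)"
      proof (rule mult_strict_left_mono)
        have "\<epsilon> * (C + D * q\<^sup>2) < \<epsilon> * A" using e by (simp add: A_def)
        then show "\<epsilon> * (C + D * q\<^sup>2) < k3 * E3" using e2 by linarith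
      qed (use e in simp)
      moreover have "\<epsilon> ^ 4 = \<epsilon> ^ 3 * \<epsilon>" by (simp add: eval_nat_numeral)
      ultimately show ?thesis by (simp only:) (simp add: algebra_simps)
    qed
    finally have "om * (1 + \<epsilon>\<^sup>2 * q) powr (p / 2) < om * (1 - C * \<epsilon> ^ 4 + k2 * \<epsilon>\<^sup>2 * E2 + k3 * \<epsilon> ^ 3 * E3)"
      using om_pos by simp
    then show "om * (1 + \<epsilon>\<^sup>2 * ((p - 1) * E2)) powr (p / 2) < (\<integral>x. mass x * (1 + \<epsilon> * Y x) powr p \<partial>lborel)"
      using lower unfolding q_def by linarith
  qed
qed

text \<open>Since \<open>2 * s / d + 2 / p = 1\<close>, this says that the standard bubble, with
  squared norm \<open>energy * om\<close> and critical integral \<open>om\<close>, gives equality in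
  the Sobolev inequality.\<close>

lemma Sobolev_const_eq: "Sobolev_const (real CARD('n)) s = energy * om powr (2 * s / d)"
proof -
  have pos: "Gamma (d / 2) / Gamma d > 0" using d_ge_1 by (intro divide_pos_pos Gamma_real_pos) auto
  have "om powr (2 * s / d) = (pi powr (d / 2)) powr (2 * s / d) * (Gamma (d / 2) / Gamma d) powr (2 * s / d)"
    unfolding om_eq times_divide_eq_right[symmetric] by (rule powr_mult)
  also have "(pi powr (d / 2)) powr (2 * s / d) = pi powr s" using d_ge_1 by (simp add: powr_powr)
  finally have om: "om powr (2 * s / d) = pi powr s * (Gamma (d / 2) / Gamma d) powr (2 * s / d)" .
  have "2 powr (2 * s) = (4::real) powr s"
    using powr_powr[of 2 2 s] by simp
  then show ?thesis
    unfolding Sobolev_const_def d_def[symmetric] al_def[symmetric] be_def[symmetric] energy_def om by simp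
qed

text \<open>The terms of order 0 cancel. The numerator is below
  \<open>energy * om * \<epsilon>\<^sup>2 * (\<kappa> - (p - 1)) * E2\<close>, and division by the
  distance bound leaves \<open>1 - (p - 1) / \<kappa>\<close>, which is the right-hand side.
  Strictness comes from \<open>Lp\<close>.\<close>

lemma quotient_bound:
  assumes e: "0 < \<epsilon>" "\<epsilon> < 1"
    and dist: "energy * om * (\<epsilon>\<^sup>2 * \<kappa> * E2) \<le> (dist_bubbles s (perturbed \<epsilon>))\<^sup>2"
    and Lp: "om * (1 + \<epsilon>\<^sup>2 * ((p - 1) * E2)) powr (p / 2) < (\<integral>x. mass x * (1 + \<epsilon> * Y x) powr p \<partial>lborel)"
  shows "BE_quotient s (perturbed \<epsilon>) < 2 * s / (be + 1)"
proof -
  define I where "I = (\<integral>x. mass x * (1 + \<epsilon> * Y x) powr p \<partial>lborel)"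
  define q where "q = (p - 1) * E2"
  have q: "q > 0" using p_gt_2 E2_pos by (simp add: q_def)
  define \<Delta> where "\<Delta> = energy * om * (\<epsilon>\<^sup>2 * \<kappa> * E2)"
  have \<Delta>: "\<Delta> > 0" using energy_pos om_pos e \<kappa>_pos E2_pos by (simp add: \<Delta>_def)
  have pp: "p > 0" using p_gt_2 by simp
  have base: "1 + \<epsilon>\<^sup>2 * q > 0" using q by (simp add: add_pos_nonneg)
  have "om powr (2 / p) * (1 + \<epsilon>\<^sup>2 * q) = (om * (1 + \<epsilon>\<^sup>2 * q) powr (p / 2)) powr (2 / p)"
    using base pp by (simp add: powr_mult powr_powr)
  also have "\<dots> < I powr (2 / p)"
    using Lp pp om_pos unfolding I_def q_def by (intro powr_less_mono2) auto
  also have "I powr (2 / p) = (Lp_norm p (perturbed \<epsilon>))\<^sup>2"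
    using Lp_norm_perturbed[of \<epsilon>] e unfolding I_def by (simp add: power2_eq_square powr_add[symmetric])
  finally have less: "om powr (2 / p) * (1 + \<epsilon>\<^sup>2 * q) < (Lp_norm p (perturbed \<epsilon>))\<^sup>2" .
  have exps: "2 * s / d + 2 / p = 1"
  proof -
    have "2 * s / d + 2 / p = (2 * s + 2 * al) / d" using al_pos by (simp add: p_def add_divide_distrib)
    also have "2 * s + 2 * al = d" by (simp add: al_def field_simps)
    finally show ?thesis using d_ge_1 by simp
  qed
  have "energy * om * (1 + \<epsilon>\<^sup>2 * q) = energy * om powr (2 * s / d) * (om powr (2 / p) * (1 + \<epsilon>\<^sup>2 * q))"
    using om_pos powr_add[of om "2 * s / d" "2 / p"] unfolding exps by simp
  also have "\<dots> < energy * om powr (2 * s / d) * (Lp_norm p (perturbed \<epsilon>))\<^sup>2"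
    using less energy_pos om_pos by (intro mult_strict_left_mono) auto
  finally have num: "(Hs_norm s (perturbed \<epsilon>))\<^sup>2 - Sobolev_const (real CARD('n)) s * (Lp_norm p (perturbed \<epsilon>))\<^sup>2
     < energy * om * (1 + \<epsilon>\<^sup>2 * \<kappa> * E2) - energy * om * (1 + \<epsilon>\<^sup>2 * q)" (is "?N < _")
    unfolding Sobolev_const_eq Hs_norm_perturbed perturbed_energy_def by (simp add: mult.assoc)
  also have "\<dots> = 2 * s / (be + 1) * \<Delta>"
  proof -
    have "p - 1 = be / al" using al_pos al_be by (simp add: p_def field_simps)
    moreover have "\<kappa> * (1 - 2 * s / (be + 1)) = be / al"
    proof -
      have "1 - 2 * s / (be + 1) = (al + 1) / (be + 1)"
        using be_pos by (simp add: field_simps) (simp add: al_def be_def field_simps)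
      then show ?thesis unfolding \<kappa>_def using al_pos be_pos by simp
    qed
    ultimately have q: "q = \<kappa> * (1 - 2 * s / (be + 1)) * E2" by (simp add: q_def)
    have "energy * om * (1 + t * \<kappa> * E2) - energy * om * (1 + t * (\<kappa> * (1 - r) * E2)) = r * (energy * om * (t * \<kappa> * E2))" for r t
      by (simp add: algebra_simps)
    then show ?thesis unfolding q \<Delta>_def .
  qed
  finally have N: "?N < 2 * s / (be + 1) * \<Delta>" .
  have dist': "\<Delta> \<le> (dist_bubbles s (perturbed \<epsilon>))\<^sup>2" using dist by (simp add: \<Delta>_def)
  then have "2 * s / (be + 1) * \<Delta> \<le> 2 * s / (be + 1) * (dist_bubbles s (perturbed \<epsilon>))\<^sup>2"
    using s_pos be_pos by (intro mult_left_mono) auto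
  then have "?N < 2 * s / (be + 1) * (dist_bubbles s (perturbed \<epsilon>))\<^sup>2" using N by linarith
  then show ?thesis unfolding BE_quotient_def p_crit using \<Delta> dist' by (subst pos_divide_less_eq) auto
qed

text \<open>A positive lower bound on the norm of the difference to every bubble does both jobs: it
  bounds the distance, and it shows that the function is not a bubble almost everywhere.\<close>

lemma perturbed_admissible:
  assumes e: "0 < \<epsilon>" and bound: "\<And>a (b::real^'n). a > 0 \<Longrightarrow>
    \<bar>sqrt a powr be * (\<integral>x. bubble_power al 1 0 x * (1 + \<epsilon> * Y x) * bubble_power be a b x \<partial>lborel)\<bar> \<le> om"
  shows "perturbed \<epsilon> \<in> BE_admissible s" and "energy * om * (\<epsilon>\<^sup>2 * \<kappa> * E2) \<le> (dist_bubbles s (perturbed \<epsilon>))\<^sup>2"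
proof -
  define \<Delta> where "\<Delta> = energy * om * (\<epsilon>\<^sup>2 * \<kappa> * E2)"
  have \<Delta>: "\<Delta> > 0" using energy_pos om_pos e \<kappa>_pos E2_pos by (simp add: \<Delta>_def)
  obtain F where F: "Hs_pair s (perturbed \<epsilon>) F" using Hs_rep_perturbed unfolding Hs_rep_def by blast
  have bub: "\<exists>F. Hs_pair s (\<lambda>x. perturbed \<epsilon> x - g x) F" "\<Delta> \<le> (Hs_norm s (\<lambda>x. perturbed \<epsilon> x - g x))\<^sup>2" if gb: "g \<in> bubbles s" for g
  proof -
    obtain a b c where "a > 0" and g: "g = (\<lambda>x. c * (a + (norm (x - b))\<^sup>2) powr (- (real CARD('n) - 2 * s) / 2))"
      using gb unfolding bubbles_def by blast
    have "g = (\<lambda>x. c * bubble_power al a b x)"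
      unfolding g bubble_power_def al_def d_def minus_divide_left ..
    then show "\<exists>F. Hs_pair s (\<lambda>x. perturbed \<epsilon> x - g x) F" "\<Delta> \<le> (Hs_norm s (\<lambda>x. perturbed \<epsilon> x - g x))\<^sup>2"
      using Hs_norm_perturbed_diff[OF \<open>a > 0\<close> bound[OF \<open>a > 0\<close>], of c] unfolding \<Delta>_def by simp_all
  qed
  have pair0: "Hs_pair s (\<lambda>x::real^'n. 0) (\<lambda>_. 0)"
    using Hs_pair_lincomb[OF s_pos s_less F F, of 0 0] by simp
  have zero: "Hs_norm s u = 0" if "Hs_pair s u G" "AE x in lborel. u x = 0" for u :: "real^'n \<Rightarrow> real" and G
  proof -
    have "u \<in> borel_measurable borel" using that(1) by (simp add: Hs_pair_def)
    then have "Hs_pair s u (\<lambda>_. 0)" using that(2) by (intro Hs_pair_cong_AE[OF pair0]) (auto elim: eventually_mono)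
    from Hs_pair_norm[OF s_pos s_less this] show ?thesis by (simp add: l2norm_def)
  qed
  show "perturbed \<epsilon> \<in> BE_admissible s"
    unfolding BE_admissible_def
  proof (intro CollectI conjI notI)
    show "perturbed \<epsilon> \<in> Hs s" by (rule Hs_pair_Hs[OF s_pos s_less F])
    assume "\<exists>g\<in>bubbles s \<union> {\<lambda>x. 0}. AE x in lborel. perturbed \<epsilon> x = g x"
    then obtain g where g: "g \<in> bubbles s \<union> {\<lambda>x. 0}" and eq: "AE x in lborel. perturbed \<epsilon> x = g x" by blast
    show False
    proof (cases "g \<in> bubbles s")
      case True
      obtain G where G: "Hs_pair s (\<lambda>x. perturbed \<epsilon> x - g x) G" using bub(1)[OF True] by blast
      have "Hs_norm s (\<lambda>x. perturbed \<epsilon> x - g x) = 0" using eq by (intro zero[OF G]) (auto elim: eventually_mono)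
      then show False using bub(2)[OF True] \<Delta> by simp
    next
      case False
      then have "Hs_norm s (perturbed \<epsilon>) = 0" using g eq by (intro zero[OF F]) auto
      moreover have "perturbed_energy \<epsilon> > 0"
        unfolding perturbed_energy_def using energy_pos om_pos e \<kappa>_pos E2_pos by (intro mult_pos_pos) (auto simp: add_pos_pos)
      ultimately show False using Hs_norm_perturbed[of \<epsilon>] by simp
    qed
  qed
  \<comment> \<open>The infimum is taken over the reals, so \<open>cINF_greatest\<close> needs to
    know that there are bubbles at all.\<close>
  have "(\<lambda>x. 1 * (1 + (norm (x - 0))\<^sup>2) powr (- (real CARD('n) - 2 * s) / 2)) \<in> (bubbles s :: (real^'n \<Rightarrow> real) set)"
    unfolding bubbles_def by (intro CollectI exI[of _ "1::real"] exI[of _ "0::real^'n"] conjI refl) auto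
  then have "sqrt \<Delta> \<le> dist_bubbles s (perturbed \<epsilon>)"
    unfolding dist_bubbles_def
  proof (intro cINF_greatest)
    fix g :: "real^'n \<Rightarrow> real" assume g: "g \<in> bubbles s"
    obtain G where G: "Hs_pair s (\<lambda>x. perturbed \<epsilon> x - g x) G" using bub(1)[OF g] by blast
    have "0 \<le> Hs_norm s (\<lambda>x. perturbed \<epsilon> x - g x)" unfolding Hs_pair_norm[OF s_pos s_less G] by simp
    then show "sqrt \<Delta> \<le> Hs_norm s (\<lambda>x. perturbed \<epsilon> x - g x)" using bub(2)[OF g] \<Delta> by (intro real_le_lsqrt) auto
  qed auto
  then have "(sqrt \<Delta>)\<^sup>2 \<le> (dist_bubbles s (perturbed \<epsilon>))\<^sup>2" using \<Delta> by (intro power_mono) auto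
  then show "energy * om * (\<epsilon>\<^sup>2 * \<kappa> * E2) \<le> (dist_bubbles s (perturbed \<epsilon>))\<^sup>2" using \<Delta> by (simp add: \<Delta>_def)
qed

text \<open>An infimum in \<open>ereal\<close> is at most the quotient of any one admissible
  function; \<open>\<epsilon>\<close> has to satisfy both smallness conditions.\<close>

lemma c_BE_less: "c_BE TYPE('n) s < ereal (2 * s / (be + 1))"
proof -
  obtain \<epsilon>0 where e0: "\<epsilon>0 > 0" and b0: "\<And>\<epsilon> a b. 0 \<le> \<epsilon> \<Longrightarrow> \<epsilon> \<le> \<epsilon>0 \<Longrightarrow> a > 0 \<Longrightarrow>
    \<bar>sqrt a powr be * (\<integral>x. bubble_power al 1 0 x * (1 + \<epsilon> * Y x) * bubble_power be a (b::real^'n) x \<partial>lborel)\<bar> \<le> om"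
    using perturbed_interaction_bound by blast
  obtain \<epsilon>1 where e1: "\<epsilon>1 > 0" and b1: "\<And>\<epsilon>. 0 < \<epsilon> \<Longrightarrow> \<epsilon> \<le> \<epsilon>1 \<Longrightarrow>
     om * (1 + \<epsilon>\<^sup>2 * ((p - 1) * E2)) powr (p / 2) < (\<integral>x. mass x * (1 + \<epsilon> * Y x) powr p \<partial>lborel)"
    using Lp_norm_expansion by blast
  define \<epsilon> where "\<epsilon> = min (1 / 2) (min \<epsilon>0 \<epsilon>1)"
  have e: "0 < \<epsilon>" "\<epsilon> < 1" "\<epsilon> \<le> \<epsilon>0" "\<epsilon> \<le> \<epsilon>1" using e0 e1 by (auto simp: \<epsilon>_def)
  have adm: "perturbed \<epsilon> \<in> BE_admissible s" "energy * om * (\<epsilon>\<^sup>2 * \<kappa> * E2) \<le> (dist_bubbles s (perturbed \<epsilon>))\<^sup>2"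
    using perturbed_admissible[OF e(1) b0[of \<epsilon>]] e by simp_all
  have "c_BE TYPE('n) s \<le> ereal (BE_quotient s (perturbed \<epsilon>))" unfolding c_BE_def by (rule INF_lower[OF adm(1)])
  also have "\<dots> < ereal (2 * s / (be + 1))" using quotient_bound[OF e(1,2) adm(2) b1[OF e(1,4)]] by simp
  finally show ?thesis .
qed

end

theorem theorem1:
  fixes s :: real
  assumes "CARD('n::finite) \<ge> 2"
    and "0 < s" and "s < real CARD('n) / 2"
  shows "c_BE TYPE('n) s < ereal (4 * s / (real CARD('n) + 2 * s + 2))"
proof -
  interpret bubble_setting s "TYPE('n)" using assms by unfold_locales
  have "2 * s / (be + 1) = 4 * s / (real CARD('n) + 2 * s + 2)"
    using assms by (simp add: be_def d_def field_simps)
  then show ?thesis using c_BE_less by simp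
qed

end
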